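(* Let $m\ge2$ and $n\ge m-1$ be integers, and let $E\subset\mathbb{R}^m$ be any centrally symmetric convex body. Let $G\sim N(0,I_m)$ be a standard Gaussian random vector in $\mathbb{R}^m$, and set $$l(E)=\mathbb{E}\|G\|_E,\qquad M_m=\mathbb{E}\big[\max_{1\le i\le m}G_i\big],\qquad C(E)=\frac{1}{\max_{1\le i\le m}\|e_i\|_E^*}.$$ Let $\tau_n(E)$ be the extinction time of $E$ under the flow by the sum of the largest $\min(n,m-1)=m-1$ principal curvatures (mean curvature flow). Then $$\frac{1}{l(E)^2}\ \le\ 2\tau_n(E)\ \le\ \frac{2}{C(E)^2M_m^2}.$$ Equivalently, with $$\mathcal{K}_{n,T}(E):=\max_{A_1}\min_{\bar\varepsilon_1}\cdots\max_{A_T}\min_{\bar\varepsilon_T}\|A_1\bar\varepsilon_1+\cdots+A_T\bar\varepsilon_T\|_E,$$ where each $A_t$ ranges over all real $m\times n$ matrices whose columns have Euclidean length at most $1$ and each $\bar\varepsilon_t$ over $\{-1,1\}^n$, $$\frac{1}{\sqrt2}\,C(E)\,M_m\ \le\ \lim_{T\to\infty}\frac{\mathcal{K}_{n,T}(E)}{\sqrt T}\ \le\ l(E).$$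
   Context: A centrally symmetric convex body is a compact convex set $E$ with nonempty interior and $E=-E$; $\|\cdot\|_E$ is the norm on $\mathbb{R}^m$ with closed unit ball $E$, and $\|z\|_E^*=\sup_{\|y\|_E\le1}(z,y)$ is its dual norm; $e_1,\dots,e_m$ is the canonical basis. The max/min are nested: $A_t$ may depend on all earlier matrices and signs, and $\bar\varepsilon_t$ may depend on $A_1,\dots,A_t$ and the earlier signs. Extinction time. The mean curvature flow starting from $E$ is the family $(E_t)_{t\ge 0}$ with $E_0=E$ whose boundary moves with inner normal velocity equal to the sum of the principal curvatures; the $E_t$ are centrally symmetric convex bodies shrinking to $\{0\}$ at a finite time. $\tau_n(E)$ is the supremum of the $t>0$ such that the flow from $E$ exists and is non-vanishing on $(0,t)$. For general (possibly non-smooth) $E$ the flow is understood in the level set sense: for symmetric $M$ and $p\neq0$ put $F(M,p)=\mathrm{tr}(M)-|p|^{-2}(Mp,p)$, with envelopes $F^*(M,p)=\limsup_{(M',p')\to(M,p),\,p'\neq0}F(M',p')$ and $F_*(M,p)=\liminf_{(M',p')\to(M,p),\,p'\neq0}F(M',p')$. Let $u:\mathbb{R}^m\times(-\infty,0]\to\mathbb{R}$ be the unique viscosity solution, of at most linear growth in $x$ uniformly on each $[-S,0]$, of $\partial_tu+F(D^2u,\nabla u)=0$ in $\mathbb{R}^m\times(-\infty,0)$, $u(x,0)=\|x\|_E$. Then $E_t=\{x:u(x,-t)\le1\}$ and $\tau_n(E)=\sup\{t>0:E_t\text{ has nonempty interior}\}$. Viscosity solution: an upper semicontinuous $u$ is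 a subsolution if, whenever $\phi$ is a test function (with $\partial_t\phi,\nabla\phi,D^2\phi$ continuous) and $u-\phi$ has a local maximum at $(x_0,t_0)$, $t_0<0$, one has $\partial_t\phi+F^*(D^2\phi,\nabla\phi)\ge0$ at $(x_0,t_0)$. A lower semicontinuous $u$ is a supersolution if, whenever $u-\phi$ has a local minimum at $(x_0,t_0)$, $t_0<0$, one has $\partial_t\phi+F_*(D^2\phi,\nabla\phi)\le0$ at $(x_0,t_0)$. A solution is both. *)

theory Defs
  imports "HOL-Probability.Probability"
begin

section \<open>Centrally symmetric convex bodies and their norms\<close>

definition symmetric_convex_body :: "(real ^ 'm) set \<Rightarrow> bool" where
  "symmetric_convex_body E \<longleftrightarrow>
     compact E \<and> convex E \<and> interior E \<noteq> {} \<and> E = uminus ` E"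

definition body_norm :: "(real ^ 'm) set \<Rightarrow> real ^ 'm \<Rightarrow> real" where
  "body_norm E x = Inf {r. 0 \<le> r \<and> x \<in> (*\<^sub>R) r ` E}"

definition body_dual_norm :: "(real ^ 'm) set \<Rightarrow> real ^ 'm \<Rightarrow> real" where
  "body_dual_norm E z = (SUP y\<in>{y. body_norm E y \<le> 1}. z \<bullet> y)"

definition body_C :: "(real ^ 'm) set \<Rightarrow> real" where
  "body_C E = 1 / Max (range (\<lambda>i. body_dual_norm E (axis i 1)))"


section \<open>Standard Gaussian vectors\<close>

definition std_gaussian_vector :: "'a measure \<Rightarrow> ('a \<Rightarrow> real ^ 'm) \<Rightarrow> bool" where
  "std_gaussian_vector M G \<longleftrightarrow>
     prob_space M \<and>
     distributed M lborel G (\<lambda>x. ennreal (\<Prod>i\<in>UNIV. std_normal_density (x $ i)))"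

definition gaussian_ell :: "'a measure \<Rightarrow> ('a \<Rightarrow> real ^ 'm) \<Rightarrow> (real ^ 'm) set \<Rightarrow> real" where
  "gaussian_ell M G E = (\<integral>\<omega>. body_norm E (G \<omega>) \<partial>M)"

definition gaussian_max :: "'a measure \<Rightarrow> ('a \<Rightarrow> real ^ 'm) \<Rightarrow> real" where
  "gaussian_max M G = (\<integral>\<omega>. Max (range (\<lambda>i. G \<omega> $ i)) \<partial>M)"


section \<open>The level set mean curvature flow\<close>

definition mcf_F :: "real ^ 'm ^ 'm \<Rightarrow> real ^ 'm \<Rightarrow> real" where
  "mcf_F A p = trace A - ((A *v p) \<bullet> p) / (norm p)\<^sup>2"

text \<open>The filter of pairs \<open>(A', p') \<rightarrow> (A, p)\<close> with \<open>A'\<close> symmetric and \<open>p' \<noteq> 0\<close>.\<close>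

definition mcf_approach ::
  "real ^ 'm ^ 'm \<Rightarrow> real ^ 'm \<Rightarrow> ((real ^ 'm ^ 'm) \<times> (real ^ 'm)) filter" where
  "mcf_approach A p =
     inf (nhds (A, p)) (principal {(A', p'). transpose A' = A' \<and> p' \<noteq> 0})"

definition mcf_F_upper :: "real ^ 'm ^ 'm \<Rightarrow> real ^ 'm \<Rightarrow> ereal" where
  "mcf_F_upper A p = Limsup (mcf_approach A p) (\<lambda>(A', p'). ereal (mcf_F A' p'))"

definition mcf_F_lower :: "real ^ 'm ^ 'm \<Rightarrow> real ^ 'm \<Rightarrow> ereal" where
  "mcf_F_lower A p = Liminf (mcf_approach A p) (\<lambda>(A', p'). ereal (mcf_F A' p'))"

definition usc_on :: "'a::topological_space set \<Rightarrow> ('a \<Rightarrow> real) \<Rightarrow> bool" where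
  "usc_on S f \<longleftrightarrow> (\<forall>x\<in>S. \<forall>c>f x. \<forall>\<^sub>F y in at x within S. f y < c)"

definition lsc_on :: "'a::topological_space set \<Rightarrow> ('a \<Rightarrow> real) \<Rightarrow> bool" where
  "lsc_on S f \<longleftrightarrow> (\<forall>x\<in>S. \<forall>c<f x. \<forall>\<^sub>F y in at x within S. c < f y)"

text \<open>\<open>\<phi>\<close> is a test function on the set \<open>N\<close> (used for open \<open>N\<close>) with continuous time
  derivative \<open>\<phi>t\<close>, spatial gradient \<open>g\<close> and spatial Hessian \<open>H\<close>. Space-time points are pairs
  \<open>(x, t)\<close>.\<close>

definition is_test_function ::
  "((real ^ 'm) \<times> real) set \<Rightarrow> ((real ^ 'm) \<times> real \<Rightarrow> real) \<Rightarrow> ((real ^ 'm) \<times> real \<Rightarrow> real)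
     \<Rightarrow> ((real ^ 'm) \<times> real \<Rightarrow> real ^ 'm) \<Rightarrow> ((real ^ 'm) \<times> real \<Rightarrow> real ^ 'm ^ 'm) \<Rightarrow> bool" where
  "is_test_function N \<phi> \<phi>t g H \<longleftrightarrow>
     (\<forall>(x, t)\<in>N.
        ((\<lambda>s. \<phi> (x, s)) has_real_derivative \<phi>t (x, t)) (at t) \<and>
        ((\<lambda>y. \<phi> (y, t)) has_derivative (\<lambda>h. g (x, t) \<bullet> h)) (at x) \<and>
        ((\<lambda>y. g (y, t)) has_derivative (\<lambda>h. H (x, t) *v h)) (at x)) \<and>
     continuous_on N \<phi>t \<and> continuous_on N g \<and> continuous_on N H"

definition mcf_subsolution :: "((real ^ 'm) \<times> real \<Rightarrow> real) \<Rightarrow> bool" where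
  "mcf_subsolution u \<longleftrightarrow>
     usc_on (UNIV \<times> {..0}) u \<and>
     (\<forall>N \<phi> \<phi>t g H x0 t0.
        open N \<and> (x0, t0) \<in> N \<and> t0 < 0 \<and> is_test_function N \<phi> \<phi>t g H \<and>
        (\<forall>\<^sub>F z in nhds (x0, t0). u z - \<phi> z \<le> u (x0, t0) - \<phi> (x0, t0))
        \<longrightarrow> 0 \<le> ereal (\<phi>t (x0, t0)) + mcf_F_upper (H (x0, t0)) (g (x0, t0)))"

definition mcf_supersolution :: "((real ^ 'm) \<times> real \<Rightarrow> real) \<Rightarrow> bool" where
  "mcf_supersolution u \<longleftrightarrow>
     lsc_on (UNIV \<times> {..0}) u \<and>
     (\<forall>N \<phi> \<phi>t g H x0 t0.
        open N \<and> (x0, t0) \<in> N \<and> t0 < 0 \<and> is_test_function N \<phi> \<phi>t g H \<and>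
        (\<forall>\<^sub>F z in nhds (x0, t0). u (x0, t0) - \<phi> (x0, t0) \<le> u z - \<phi> z)
        \<longrightarrow> ereal (\<phi>t (x0, t0)) + mcf_F_lower (H (x0, t0)) (g (x0, t0)) \<le> 0)"

definition mcf_level_set_solution ::
  "(real ^ 'm) set \<Rightarrow> ((real ^ 'm) \<times> real \<Rightarrow> real) \<Rightarrow> bool" where
  "mcf_level_set_solution E u \<longleftrightarrow>
     mcf_subsolution u \<and> mcf_supersolution u \<and>
     (\<forall>x. u (x, 0) = body_norm E x) \<and>
     (\<forall>S. \<exists>c. \<forall>x. \<forall>t\<in>{-S..0}. \<bar>u (x, t)\<bar> \<le> c * (1 + norm x))"

text \<open>The solution is unique on \<open>UNIV \<times> {..0}\<close>; its values at positive times are unconstrained and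
  never used, which is why it is selected by \<open>SOME\<close> and not by \<open>THE\<close>.\<close>

definition mcf_level_set_function :: "(real ^ 'm) set \<Rightarrow> (real ^ 'm) \<times> real \<Rightarrow> real" where
  "mcf_level_set_function E = (SOME u. mcf_level_set_solution E u)"

definition mcf_flow :: "(real ^ 'm) set \<Rightarrow> real \<Rightarrow> (real ^ 'm) set" where
  "mcf_flow E t = {x. mcf_level_set_function E (x, - t) \<le> 1}"

text \<open>The extinction time \<open>\<tau>\<^sub>n(E)\<close>. For \<open>n \<ge> m - 1\<close> all \<open>m - 1\<close> principal curvatures are
  summed, so that it does not depend on \<open>n\<close>.\<close>

definition extinction_time :: "(real ^ 'm) set \<Rightarrow> real" where
  "extinction_time E = Sup {t. 0 < t \<and> interior (mcf_flow E t) \<noteq> {}}"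


section \<open>The vector balancing game\<close>

definition short_column_matrices :: "(real ^ 'n ^ 'm) set" where
  "short_column_matrices = {A. \<forall>j. norm (column j A) \<le> 1}"

definition sign_vectors :: "(real ^ 'n) set" where
  "sign_vectors = {e. \<forall>j. e $ j \<in> {-1, 1}}"

text \<open>\<open>game_value TYPE('n) E T x\<close> is the nested expression
  \<open>max\<^sub>A\<^sub>1 min\<^sub>e\<^sub>1 \<dots> max\<^sub>A\<^sub>T min\<^sub>e\<^sub>T \<parallel>x + A\<^sub>1 e\<^sub>1 + \<dots> + A\<^sub>T e\<^sub>T\<parallel>\<^sub>E\<close>, unfolded from the
  outside. The suprema are maxima: the value is continuous in \<open>x\<close> and the matrices range over a
  compact set.\<close>

primrec game_value ::
  "'n::finite itself \<Rightarrow> (real ^ 'm) set \<Rightarrow> nat \<Rightarrow> real ^ 'm \<Rightarrow> real" where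
  "game_value n E 0 x = body_norm E x"
| "game_value n E (Suc T) x =
     (SUP A\<in>(short_column_matrices :: (real ^ 'n ^ 'm) set).
        Min ((\<lambda>e. game_value n E T (x + A *v e)) ` sign_vectors))"

definition game_K :: "'n::finite itself \<Rightarrow> nat \<Rightarrow> (real ^ 'm) set \<Rightarrow> real" where
  "game_K n T E = game_value n E T 0"

end

theory Submission
 imports Defs
begin

text \<open>The rescaled values of the game form an approximation scheme: a Taylor expansion of one round shows that
 their upper and lower half-relaxed limits are a viscosity sub- and supersolution of a geometric equation.
 The two limits agree by comparison: after a sup-convolution, the contact set with test functions has
 positive measure, and a form of Alexandrov's theorem gives second order expansions almost everywhere on it;
 the singularity at gradient zero is harmless because the penalty is quartic. If the matrices are instead
 restricted to \<open>A A\<^sup>T = 2 (I - \<nu> \<nu>\<^sup>T)\<close> for unit vectors \<open>\<nu>\<close>, the same scheme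
 converges to a level set solution of the mean curvature flow.

 All limits are then compared with self-similar solutions of the heat equation, the Gaussian averages of a
 convex function that is homogeneous of degree one. For the upper bound average the norm: its Hessian is
 positive semidefinite, and a Gram-Schmidt walk finds signs for which the quadratic form is at most
 the trace. For the lower bound average the largest coordinate, of which the norm dominates a multiple: here
 the Hessian has nonpositive off-diagonal entries and vanishing row sums, and the gradient has nonnegative
 entries, so in the direction of the gradient the quadratic form is at most half of the trace.\<close>

section \<open>Differentiation almost everywhere\<close>

text \<open>Time runs backwards from the payoff at \<open>t = 0\<close>. In one round lasting
  \<open>h\<close>, displacements have size \<open>sqrt h\<close>, so the first order term dominates
  and only matrices tangent to the gradient count. What survives is a second order term that depends
  on the direction of the gradient and jumps where the gradient vanishes. The Gaussian barriers are
  chosen so that this jump is never met. A convex barrier has a semidefinite Hessian, and then the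
  trace bounds the curvature term for every direction. The averages of the largest coordinate have
  components of the gradient adding up to \<open>1\<close> or \<open>- 1\<close>, so their gradient
  is never zero. The two halves of the theorem differ by a clock: the game with unit columns sees
  half of the quadratic form and diffuses at rate \<open>1 / 2\<close>, the flow at rate
  \<open>1\<close>. Upper barriers diffuse at the full rate, lower barriers at half of it, because
  their curvature term is only known to be at least half of the trace. This is the origin of the
  factor \<open>1 / sqrt 2\<close> in the lower bound for the game.\<close>

lemma negligible_lipschitz_image:
 fixes f :: "'a::euclidean_space => 'b::euclidean_space"
 assumes "negligible S" "DIM('a) \<le> DIM('b)" "!!x y. norm (f y - f x) \<le> B * norm (y - x)"
 shows "negligible (f ` S)"
 by (rule negligible_locally_Lipschitz_image[OF assms(2,1)]) (use assms(3) in blast)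

text \<open>An increasing bi-Lipschitz \<open>F\<close> is a homeomorphism of the line, and the
  push-forward of Lebesgue measure under its inverse is the Stieltjes measure of \<open>F\<close>.
  Lipschitz maps preserve null sets, so this measure is absolutely continuous; its Radon-Nikodym
  density is \<open>g\<close>.\<close>

lemma lipschitz_slope_ae_aux:
 fixes F :: "real => real"
 assumes L: "0 < L" and lo: "!!a b. a \<le> b ==> L * (b - a) \<le> F b - F a"
  and hi: "!!a b. a \<le> b ==> F b - F a \<le> 3 * L * (b - a)"
 obtains g :: "real => real" where "!!a b. a \<le> b ==> (g has_integral (F b - F a)) {a..b}"
proof -
 have mono: "F a < F b" if "a < b" for a b
  using lo[of a b] L that by (smt (verit) mult_pos_pos)
 have cont: "continuous_on UNIV F"
 proof (rule lipschitz_on_continuous_on)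
  show "(3 * L)-lipschitz_on UNIV F"
  proof (rule lipschitz_onI)
   show "dist (F x) (F y) \<le> 3 * L * dist x y" for x y
    using lo[of x y] lo[of y x] hi[of x y] hi[of y x] L
    by (cases "x \<le> y") (auto simp: dist_real_def abs_if mult_less_0_iff algebra_simps)
  qed (use L in simp)
 qed
 have inj: "inj F"
  by (rule injI) (metis mono linorder_neqE_linordered_idom less_irrefl)
 have surj: "\<exists>x. F x = y" for y
 proof -
  define d where "d = \<bar>y - F 0\<bar> / L"
  have d: "d \<ge> 0" "L * d = \<bar>y - F 0\<bar>" using L by (auto simp: d_def)
  have "F (-d) \<le> y" "y \<le> F d" using lo[of "-d" 0] lo[of 0 d] d by auto
  thus ?thesis using IVT'[of F "-d" y d] d continuous_on_subset[OF cont] by auto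
 qed
 define H where "H = inv F"
 have HF: "H (F x) = x" for x using inj by (simp add: H_def)
 have FH: "F (H y) = y" for y using surj by (metis H_def f_inv_into_f UNIV_I image_eqI)
 have Hmono: "H y \<le> H z" if "y \<le> z" for y z
  using mono[of "H z" "H y"] that by (metis FH leI not_less)
 have Hmeas[measurable]: "H \<in> borel_measurable borel"
  by (rule borel_measurable_mono) (simp add: Hmono mono_def)
 have pre: "H -` A = F ` A" for A
  by (auto simp: HF) (metis FH image_eqI)
 define N where "N = distr lborel borel H"
 have setsN[simp]: "sets N = sets borel" by (simp add: N_def)
 have emN: "emeasure N A = emeasure lborel (F ` A)" if "A \<in> sets borel" for A
  using that by (simp add: N_def emeasure_distr pre)
 have img: "F ` {a..b} = {F a..F b}" if "a \<le> b" for a b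
 proof -
  have le: "F x \<le> F y" if "x \<le> y" for x y
   using mono[of x y] that by (cases "x = y") auto
  show ?thesis
  proof (intro equalityI subsetI)
   fix y assume y: "y \<in> {F a..F b}"
   hence "H y \<in> {a..b}" using Hmono[of "F a" y] Hmono[of y "F b"] by (simp add: HF)
   thus "y \<in> F ` {a..b}" using FH[of y] by (metis image_eqI)
  qed (auto simp: le)
 qed
 have emI: "emeasure N {a..b} = ennreal (F b - F a)" if "a \<le> b" for a b
  using that mono[of a b] by (cases "a = b") (auto simp: emN img)
 have ac: "absolutely_continuous lborel N"
  unfolding absolutely_continuous_def
 proof
  fix A :: "real set" assume A: "A \<in> null_sets lborel"
  hence "negligible A"
   using negligible_iff_null_sets null_sets_completionI by blast
  have "negligible (F ` A)"
  proof (rule negligible_lipschitz_image)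
   show "norm (F y - F x) \<le> (3*L) * norm (y - x)" for x y
     using lo[of x y] lo[of y x] hi[of x y] hi[of y x] L
     by (cases "x \<le> y") (auto simp: abs_if mult_less_0_iff algebra_simps)
  qed (use \<open>negligible A\<close> in auto)
  moreover have "F ` A \<in> sets lborel"
  proof -
   have "H -` A \<inter> space borel \<in> sets borel"
    using A by (intro measurable_sets[OF Hmeas]) auto
   thus ?thesis by (simp add: pre)
  qed
  ultimately have "emeasure lborel (F ` A) = 0"
   using negligible_iff_null_sets null_sets_completion_iff null_setsD1 by blast
  thus "A \<in> null_sets N" using A by (auto simp: null_sets_def emN)
 qed
 have sfN: "sigma_finite_measure N"
 proof
  show "\<exists>A. countable A \<and> A \<subseteq> sets N \<and> \<Union> A = space N \<and> (\<forall>a\<in>A. emeasure N a \<noteq> \<infinity>)"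
  proof (intro exI conjI ballI)
   have "\<exists>n::nat. x \<in> {- real n..real n}" for x
    using real_arch_simple[of "\<bar>x\<bar>"] by (auto simp: abs_le_iff minus_le_iff)
   thus "\<Union> (range (\<lambda>n::nat. {- real n..real n})) = space N" by (auto simp: N_def)
  qed (auto simp: emI)
 qed
 define R where "R = RN_deriv lborel N"
 have Rm[measurable]: "R \<in> borel_measurable lborel" by (simp add: R_def)
 have dens: "density lborel R = N"
  unfolding R_def by (rule sigma_finite_measure.density_RN_deriv) (auto simp: ac sigma_finite_lborel)
 have fin: "AE x in lborel. R x \<noteq> \<infinity>"
  unfolding R_def by (rule sigma_finite_measure.RN_deriv_finite) (auto simp: ac sfN sigma_finite_lborel)
 define g where "g x = enn2real (R x)" for x
 have gm[measurable]: "g \<in> borel_measurable lborel" unfolding g_def by measurable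
 show thesis
 proof
  fix a b :: real assume ab: "a \<le> b"
  have "(\<integral>\<^sup>+ x. ennreal (g x * indicator {a..b} x) \<partial>lborel) = (\<integral>\<^sup>+ x. R x * indicator {a..b} x \<partial>lborel)"
   by (rule nn_integral_cong_AE) (use fin in \<open>auto elim!: eventually_mono simp: g_def ennreal_enn2real less_top indicator_def\<close>)
  also have "\<dots> = emeasure (density lborel R) {a..b}"
   by (simp add: emeasure_density)
  also have "\<dots> = ennreal (F b - F a)" by (simp add: dens emI ab)
  finally have "((\<lambda>x. g x * indicator {a..b} x) has_integral (F b - F a)) UNIV"
   using mono[of a b] ab by (intro nn_integral_has_integral) (auto simp: g_def less_eq_real_def[of a b])
  hence "((\<lambda>x. if x \<in> {a..b} then g x else 0) has_integral (F b - F a)) UNIV"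
   by (rule has_integral_eq[rotated]) (auto simp: indicator_def)
  thus "(g has_integral (F b - F a)) {a..b}"
   by (simp only: has_integral_restrict_UNIV)
 qed
qed

text \<open>The boxes of the differentiation theorem have \<open>x\<close> as their lower corner, so
  in dimension one they see only the right side of \<open>x\<close>. The left side will come from
  reflecting the line.\<close>

lemma lebesgue_right_differentiation:
 fixes h :: "real => real"
 assumes "!!a b. h integrable_on cbox a b"
 obtains N where "negligible N"
  "!!x e. x \<notin> N ==> 0 < e ==> \<exists>d>0. \<forall>s. 0 < s \<and> s < d --> \<bar>integral {x..x + s} h / s - h x\<bar> < e"
proof -
 obtain N where N: "negligible N"
   "!!x e. [|x \<notin> N; 0 < e|] ==>
       \<exists>d>0. \<forall>s. 0 < s \<and> s < d -->
            norm(integral (cbox x (x + s *\<^sub>R One)) h /\<^sub>R s ^ DIM(real) - h x) < e"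
  using integrable_ccontinuous_explicit[OF assms] by blast
 show thesis
  by (rule that[OF N(1)]) (use N(2) in \<open>simp add: divide_inverse mult.commute\<close>)
qed

text \<open>Rademacher's theorem on the line. Adding \<open>2 * K * x\<close> makes \<open>F\<close>
  increasing with slopes between \<open>K\<close> and \<open>3 * K\<close>. The density
  \<open>h\<close> left after removing this term is differentiated at its Lebesgue points, from the
  right directly and from the left through \<open>h (- x)\<close>.\<close>

lemma lipschitz_slope_ae:
 fixes F :: "real => real"
 assumes lip: "!!x y. \<bar>F x - F y\<bar> \<le> L * \<bar>x - y\<bar>"
 obtains N where "negligible N"
  "!!x e. x \<notin> N ==> 0 < e ==> \<exists>c. \<exists>d>0. \<forall>s. \<bar>s\<bar> < d --> \<bar>F (x + s) - F x - c * s\<bar> \<le> e * \<bar>s\<bar>"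
proof -
 define K where "K = \<bar>L\<bar> + 1"
 have K: "K > 0" "\<bar>F x - F y\<bar> \<le> K * \<bar>x - y\<bar>" for x y
 proof -
  show "K > 0" by (simp add: K_def)
  have "L * \<bar>x - y\<bar> \<le> K * \<bar>x - y\<bar>" by (rule mult_right_mono) (auto simp: K_def)
  thus "\<bar>F x - F y\<bar> \<le> K * \<bar>x - y\<bar>" using lip[of x y] by linarith
 qed
 have a1: "K * (b - a) \<le> (F b + 2 * K * b) - (F a + 2 * K * a)" if "a \<le> b" for a b
  using K(2)[of b a] that by (auto simp: algebra_simps abs_if split: if_splits)
 have a2: "(F b + 2 * K * b) - (F a + 2 * K * a) \<le> 3 * K * (b - a)" if "a \<le> b" for a b
  using K(2)[of b a] that by (auto simp: algebra_simps abs_if split: if_splits)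
 obtain g where "!!a b. a \<le> b ==> (g has_integral ((F b + 2 * K * b) - (F a + 2 * K * a))) {a..b}"
  using lipschitz_slope_ae_aux[of K "\<lambda>x. F x + 2 * K * x", OF K(1) a1 a2] by metis
 define h where "h x = g x - 2 * K" for x
 have h: "(h has_integral (F b - F a)) {a..b}" if "a \<le> b" for a b
 proof -
  have "((\<lambda>x. g x - 2 * K) has_integral (((F b + 2 * K * b) - (F a + 2 * K * a)) - (b - a) *\<^sub>R (2 * K))) {a..b}"
   using has_integral_const_real[of "2*K" a b] that \<open>!!a b. a \<le> b ==> (g has_integral _ a b) {a..b}\<close>
   by (intro has_integral_diff) auto
  thus ?thesis unfolding h_def by (simp add: algebra_simps)
 qed
 have h': "((\<lambda>x. h (- x)) has_integral (F (-a) - F (-b))) {a..b}" if "a \<le> b" for a b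
  using h[of "-b" "-a"] has_integral_reflect_real[of h _ "-a" "-b"] that by simp
 have int1: "h integrable_on cbox a b" for a b
  using h by (cases "a \<le> b") auto
 have int2: "(\<lambda>x. h (- x)) integrable_on cbox a b" for a b
  using h' by (cases "a \<le> b") auto
 obtain N1 where N1: "negligible N1"
  "!!x e. x \<notin> N1 ==> 0 < e ==> \<exists>d>0. \<forall>s. 0 < s \<and> s < d --> \<bar>integral {x..x + s} h / s - h x\<bar> < e"
  using lebesgue_right_differentiation[OF int1] by blast
 obtain N2 where N2: "negligible N2"
  "!!x e. x \<notin> N2 ==> 0 < e ==> \<exists>d>0. \<forall>s. 0 < s \<and> s < d --> \<bar>integral {x..x + s} (\<lambda>x. h (-x)) / s - h (-x)\<bar> < e"
  using lebesgue_right_differentiation[OF int2] by blast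
 show thesis
 proof
  have "negligible (uminus ` N2)"
 by (rule negligible_lipschitz_image[where B = 1, OF N2(1)]) (auto simp: abs_minus_commute)

  thus "negligible (N1 \<union> uminus ` N2)" using N1 by auto
  fix x e :: real assume x: "x \<notin> N1 \<union> uminus ` N2" and e: "0 < e"
  hence x2: "- x \<notin> N2" by force
  obtain d1 where d1: "d1 > 0" "!!s. 0 < s ==> s < d1 ==> \<bar>integral {x..x + s} h / s - h x\<bar> < e"
   using N1(2)[of x e] x e by auto
  obtain d2 where d2: "d2 > 0" "!!s. 0 < s ==> s < d2 ==> \<bar>integral {-x..-x + s} (\<lambda>x. h (-x)) / s - h x\<bar> < e"
   using N2(2)[of "-x" e] x2 e by auto
  show "\<exists>c. \<exists>d>0. \<forall>s. \<bar>s\<bar> < d --> \<bar>F (x + s) - F x - c * s\<bar> \<le> e * \<bar>s\<bar>"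
  proof (intro exI conjI allI impI)
   show "min d1 d2 > 0" using d1 d2 by auto
   fix s :: real assume s: "\<bar>s\<bar> < min d1 d2"
   consider "s = 0" | "s > 0" | "s < 0" by linarith
   thus "\<bar>F (x + s) - F x - h x * s\<bar> \<le> e * \<bar>s\<bar>"
   proof cases
    case 2
    have "integral {x..x+s} h = F (x + s) - F x" using h[of x "x+s"] 2 by (simp add: integral_unique)
    hence "\<bar>(F (x + s) - F x) / s - h x\<bar> < e" using d1(2)[of s] s 2 by auto
    moreover have "(F (x + s) - F x) / s - h x = (F (x + s) - F x - h x * s) / s"
     using 2 by (simp add: field_simps)
    ultimately show ?thesis using 2 by (simp add: abs_divide pos_divide_less_eq)
   next
    case 3
    have "integral {-x..-x+(-s)} (\<lambda>x. h (-x)) = F x - F (x + s)"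
     using h'[of "-x" "-x + (-s)"] 3 by (simp add: integral_unique add.commute)
    hence "\<bar>(F x - F (x + s)) / (-s) - h x\<bar> < e" using d2(2)[of "-s"] s 3 by auto
    moreover have "(F x - F (x + s)) / (-s) - h x = (F (x + s) - F x - h x * s) / s"
     using 3 by (simp add: field_simps)
    ultimately have "\<bar>(F (x + s) - F x - h x * s) / s\<bar> < e" by simp
    hence "\<bar>F (x + s) - F x - h x * s\<bar> / (- s) < e" using 3 by (simp add: abs_divide)
    thus ?thesis using 3 pos_divide_less_eq[of "-s"] by simp
   qed auto
  qed
 qed
qed

text \<open>Fubini along an arbitrary direction: by translation invariance the measure of
  \<open>S\<close> is the average over \<open>t\<close> in \<open>{0..1}\<close> of the measures of
  its translates by \<open>t *\<^sub>R v\<close>, and exchanging the integrals measures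
  \<open>S\<close> along the lines.\<close>

lemma negligible_by_lines:
 fixes S :: "'a::euclidean_space set" and v :: 'a
 assumes S[measurable]: "S \<in> sets borel" and lines: "!!x. negligible {t::real. x + t *\<^sub>R v \<in> S}"
 shows "negligible S"
proof -
 let ?f = "\<lambda>(x, t). indicator S (x + t *\<^sub>R v) * indicator {0..1::real} t :: ennreal"
 have m: "?f \<in> borel_measurable (lborel \<Otimes>\<^sub>M lborel)" by measurable
 have "emeasure lborel S = (\<integral>\<^sup>+ t. emeasure lborel S * indicator {0..1::real} t \<partial>lborel)"
  by (simp add: nn_integral_cmult)
 also have "\<dots> = (\<integral>\<^sup>+ t. (\<integral>\<^sup>+ x. ?f (x, t) \<partial>lborel) \<partial>lborel)"
 proof (rule nn_integral_cong)
  fix t :: real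
  have "emeasure lborel S = (\<integral>\<^sup>+ x. indicator S x \<partial>distr lborel borel ((+) (t *\<^sub>R v)))"
   by (simp add: lborel_distr_plus)
  also have "\<dots> = (\<integral>\<^sup>+ x. indicator S (t *\<^sub>R v + x) \<partial>lborel)"
   by (subst nn_integral_distr) auto
  finally have "emeasure lborel S = (\<integral>\<^sup>+ x. indicator S (x + t *\<^sub>R v) \<partial>lborel)"
   by (simp add: add.commute)
  thus "emeasure lborel S * indicator {0..1} t = (\<integral>\<^sup>+ x. ?f (x, t) \<partial>lborel)"
   by (simp add: nn_integral_multc)
 qed
 also have "\<dots> = (\<integral>\<^sup>+ x. (\<integral>\<^sup>+ t. ?f (x, t) \<partial>lborel) \<partial>lborel)"
  using lborel_pair.Fubini[OF m] by simp
 also have "\<dots> = (\<integral>\<^sup>+ x. 0 \<partial>(lborel :: 'a measure))"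
 proof (rule nn_integral_cong)
  fix x :: 'a
  have "{t. x + t *\<^sub>R v \<in> S} \<in> sets borel" by measurable
  hence "{t. x + t *\<^sub>R v \<in> S} \<in> null_sets lborel"
   using lines[of x] by (simp add: negligible_iff_null_sets null_sets_completion_iff)
  hence "AE t in lborel. x + t *\<^sub>R v \<notin> S"
   by (rule AE_I') auto
  hence "AE t in lborel. ?f (x, t) = 0" by eventually_elim auto
  thus "(\<integral>\<^sup>+ t. ?f (x, t) \<partial>lborel) = 0"
   by (subst nn_integral_0_iff_AE) auto
 qed
 finally have "emeasure lborel S = 0" by simp
 thus ?thesis
  by (simp add: negligible_iff_null_sets null_setsI null_sets_completionI)
qed

text \<open>At a density point \<open>x\<close> of \<open>A\<close>, the small cube with lower
  corner \<open>x + y\<close> must meet \<open>A\<close>: otherwise a fixed proportion of the box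
  with lower corner \<open>x\<close> would miss \<open>A\<close>. Boxes with corner \<open>x\<close>
  reach only the nonnegative directions.\<close>

lemma orthant_nonporous_ae:
 fixes A :: "'a::euclidean_space set"
 assumes A: "closed A" and eps: "0 < eps"
 obtains N where "negligible N"
  "!!x. x \<in> A - N ==> \<exists>rh>0. \<forall>y::'a. (\<forall>b\<in>Basis. 0 \<le> y \<bullet> b) \<and> y \<noteq> 0 \<and> norm y < rh --> (\<exists>s\<in>A. norm (x + y - s) \<le> eps * norm y)"
proof -
 define f :: "'a => real" where "f = indicator A"
 have Al: "A \<in> sets lebesgue" using A by (simp add: borel_closed)
 have int: "f integrable_on cbox a b" for a b
  using A unfolding f_def integrable_on_indicator
  by (auto intro!: lmeasurable_compact closed_Int_compact)
 obtain N where N: "negligible N"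
   "!!x e. [|x \<notin> N; 0 < e|] ==>
       \<exists>d>0. \<forall>h. 0 < h \<and> h < d -->
            norm(integral (cbox x (x + h *\<^sub>R One)) f /\<^sub>R h ^ DIM('a) - f x) < e"
  using integrable_ccontinuous_explicit[OF int] by blast
 \<comment> \<open>The norm is at most the sum of the coordinates, so every point of a cube of side
   \<open>c * norm y\<close> is within \<open>eps * norm y\<close> of its corner. The number
   \<open>e\<close> is the proportion of the large box that this cube occupies.\<close>
 define c where "c = eps / DIM('a)"
 define e where "e = (c / (1 + c)) ^ DIM('a)"
 have c: "c > 0" using eps by (simp add: c_def)
 hence e: "e > 0" by (simp add: e_def)
 show thesis
 proof (rule that[OF N(1)])
  fix x assume x: "x \<in> A - N"
  obtain d where d: "d > 0" "!!h. 0 < h ==> h < d ==> \<bar>integral (cbox x (x + h *\<^sub>R One)) f / h ^ DIM('a) - 1\<bar> < e"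
   using N(2)[of x e] x e by (auto simp: f_def divide_inverse mult.commute)
  show "\<exists>rh>0. \<forall>y::'a. (\<forall>b\<in>Basis. 0 \<le> y \<bullet> b) \<and> y \<noteq> 0 \<and> norm y < rh --> (\<exists>s\<in>A. norm (x + y - s) \<le> eps * norm y)"
  proof (intro exI conjI allI impI)
   show "d / (1 + c) > 0" using d c by simp
   fix y :: 'a assume "(\<forall>b\<in>Basis. 0 \<le> y \<bullet> b) \<and> y \<noteq> 0 \<and> norm y < d / (1 + c)"
   hence y: "!!b. b \<in> Basis ==> 0 \<le> y \<bullet> b" "norm y > 0" "norm y * (1 + c) < d"
    using c by (auto simp: pos_less_divide_eq)
   define h where "h = norm y * (1 + c)"
   have h: "0 < h" "h < d" using y c by (auto simp: h_def)
   define Q where "Q = cbox (x + y) (x + y + (c * norm y) *\<^sub>R One)"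
   have Qsub: "Q \<subseteq> cbox x (x + h *\<^sub>R One)"
   proof -
    have "y \<bullet> b \<le> norm y" if "b \<in> Basis" for b
     using Basis_le_norm[OF that, of y] by simp
    moreover have "h = norm y + c * norm y" by (simp add: h_def algebra_simps)
    ultimately have "x \<bullet> b \<le> z \<bullet> b \<and> z \<bullet> b \<le> x \<bullet> b + h"
     if "b \<in> Basis" "x \<bullet> b + y \<bullet> b \<le> z \<bullet> b" "z \<bullet> b \<le> x \<bullet> b + y \<bullet> b + c * norm y" for b z
     using that y(1)[of b] by fastforce
    thus ?thesis
     by (auto simp: Q_def mem_box inner_add_left)
   qed
   have Q0: "cbox (x + y) (x + y + (c * norm y) *\<^sub>R One) \<noteq> {}"
    using c y by (simp add: box_ne_empty inner_add_left)
   have "\<exists>s\<in>A. s \<in> Q"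
   proof (rule ccontr)
    assume "\<not> (\<exists>s\<in>A. s \<in> Q)"
    hence dis: "A \<inter> Q = {}" by auto
    have i1: "(indicator Q :: 'a => real) integrable_on cbox x (x + h *\<^sub>R One)"
     unfolding integrable_on_indicator Q_def by (simp add: Int_interval)
    have "integral (cbox x (x + h *\<^sub>R One)) f + integral (cbox x (x + h *\<^sub>R One)) (indicator Q)
      = integral (cbox x (x + h *\<^sub>R One)) (\<lambda>z. f z + indicator Q z)"
     using int i1 by (simp add: integral_add)
    also have "\<dots> \<le> integral (cbox x (x + h *\<^sub>R One)) (\<lambda>z. 1)"
    proof (rule integral_le)
     show "(\<lambda>z. f z + indicator Q z) integrable_on cbox x (x + h *\<^sub>R One)"
      using int i1 by (rule integrable_add)
    qed (use dis in \<open>auto simp: f_def indicator_def\<close>)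
    also have "\<dots> = h ^ DIM('a)"
     using h by (simp add: content_cbox_if box_eq_empty inner_add_left)
    also have "integral (cbox x (x + h *\<^sub>R One)) (indicator Q) = (c * norm y) ^ DIM('a)"
    proof -
     have "integral (cbox x (x + h *\<^sub>R One)) (indicator Q) = measure lebesgue (Q \<inter> cbox x (x + h *\<^sub>R One))"
      by (rule integral_indicator) (simp add: Q_def Int_interval)
     also have "Q \<inter> cbox x (x + h *\<^sub>R One) = Q" using Qsub by auto
     also have "measure lebesgue Q = (c * norm y) ^ DIM('a)"
      using Q0 c y unfolding Q_def by (simp add: content_cbox_if inner_add_left)
     finally show ?thesis .
    qed
    finally have "integral (cbox x (x + h *\<^sub>R One)) f / h ^ DIM('a) \<le> (h ^ DIM('a) - (c * norm y) ^ DIM('a)) / h ^ DIM('a)"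
     using h by (intro divide_right_mono) auto
    also have "\<dots> = 1 - (c * norm y / h) ^ DIM('a)" using h by (simp add: diff_divide_distrib power_divide)
    also have "c * norm y / h = c / (1 + c)" using y c by (simp add: h_def mult.commute[of c])
    finally show False using d(2)[OF h] e by (simp add: e_def)
   qed
   then obtain s where s: "s \<in> A" "s \<in> Q" by auto
   have "norm (x + y - s) \<le> (\<Sum>b\<in>Basis. \<bar>(x + y - s) \<bullet> b\<bar>)" by (rule norm_le_l1)
   also have "\<dots> \<le> (\<Sum>b\<in>(Basis::'a set). c * norm y)"
    using s(2) by (intro sum_mono) (fastforce simp: Q_def mem_box inner_add_left inner_diff_left)
   also have "\<dots> = eps * norm y" by (simp add: c_def)
   finally show "\<exists>s\<in>A. norm (x + y - s) \<le> eps * norm y" using s by blast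
  qed
 qed
qed

text \<open>The isometric involution \<open>T B\<close> reverses the coordinates in \<open>B\<close>
  and carries the previous statement to the other orthants, at the price of finitely many
  exceptional sets.\<close>

lemma nonporous_ae:
 fixes A :: "'a::euclidean_space set"
 assumes A: "closed A" and eps: "0 < eps"
 obtains N where "negligible N"
  "!!x. x \<in> A - N ==> \<exists>rh>0. \<forall>y::'a. y \<noteq> 0 \<and> norm y < rh --> (\<exists>s\<in>A. norm (x + y - s) \<le> eps * norm y)"
proof -
 define T :: "'a set => 'a => 'a" where "T B y = (\<Sum>b\<in>Basis. ((if b \<in> B then -1 else 1) * (y \<bullet> b)) *\<^sub>R b)" for B y
 have Tb: "T B y \<bullet> b = (if b \<in> B then -1 else 1) * (y \<bullet> b)" if "b \<in> Basis" for B y b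
  using that by (simp add: T_def inner_sum_left inner_Basis if_distrib cong: if_cong)
 have TT: "T B (T B y) = y" for B y
  by (rule euclidean_eqI) (simp add: Tb)
 have Tadd: "T B (x + y) = T B x + T B y" "T B (x - y) = T B x - T B y" for B x y
  by (rule euclidean_eqI; simp add: Tb inner_add_left inner_diff_left algebra_simps)+
 have Tn: "norm (T B y) = norm y" for B y
  unfolding norm_eq_sqrt_inner by (subst (1 2) euclidean_inner) (auto simp: Tb intro!: arg_cong[of _ _ sqrt] sum.cong)
 have Tlip: "norm (T B y - T B x) \<le> 1 * norm (y - x)" for B x y
  by (simp add: Tadd(2)[symmetric] Tn)
 have clT: "closed (T B ` A)" for B
 proof -
  have "T B ` A = T B -` A" by (auto simp: TT) (metis TT image_eqI)
  moreover have "continuous_on UNIV (T B)" unfolding T_def by (intro continuous_intros)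
  ultimately show ?thesis using A by (metis closed_vimage)
 qed
 have "\<exists>N. negligible N \<and> (\<forall>x. x \<in> T B ` A - N --> (\<exists>rh>0. \<forall>y::'a. (\<forall>b\<in>Basis. 0 \<le> y \<bullet> b) \<and> y \<noteq> 0 \<and> norm y < rh --> (\<exists>s\<in>T B ` A. norm (x + y - s) \<le> eps * norm y)))" for B
  using orthant_nonporous_ae[OF clT eps] by metis
 then obtain N where N: "!!B. negligible (N B)"
  "!!B x. x \<in> T B ` A - N B ==> \<exists>rh>0. \<forall>y::'a. (\<forall>b\<in>Basis. 0 \<le> y \<bullet> b) \<and> y \<noteq> 0 \<and> norm y < rh --> (\<exists>s\<in>T B ` A. norm (x + y - s) \<le> eps * norm y)"
  by metis
 show thesis
 proof
  show "negligible (\<Union>B\<in>Pow Basis. T B ` N B)"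
   by (rule negligible_Union) (auto intro!: negligible_lipschitz_image[OF N(1) _ Tlip])
  fix x assume x: "x \<in> A - (\<Union>B\<in>Pow Basis. T B ` N B)"
  have "\<exists>rh>0. \<forall>y::'a. (\<forall>b\<in>Basis. 0 \<le> y \<bullet> b) \<and> y \<noteq> 0 \<and> norm y < rh --> (\<exists>s\<in>T B ` A. norm (T B x + y - s) \<le> eps * norm y)"
   if "B \<in> Pow Basis" for B
  proof (rule N(2))
   have "T B x \<notin> N B"
   proof
    assume "T B x \<in> N B"
    hence "T B (T B x) \<in> (\<Union>B\<in>Pow Basis. T B ` N B)" using that by blast
    thus False using x by (simp add: TT)
   qed
   thus "T B x \<in> T B ` A - N B" using x by blast
  qed
  then obtain rh where rh: "!!B. B \<in> Pow Basis ==> rh B > 0"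
   "!!B y. B \<in> Pow Basis ==> (\<forall>b\<in>Basis. 0 \<le> y \<bullet> b) ==> y \<noteq> 0 ==> norm y < rh B ==> (\<exists>s\<in>T B ` A. norm (T B x + y - s) \<le> eps * norm y)"
   by metis
  show "\<exists>rh>0. \<forall>y::'a. y \<noteq> 0 \<and> norm y < rh --> (\<exists>s\<in>A. norm (x + y - s) \<le> eps * norm y)"
  proof (intro exI[of _ "Min (rh ` Pow Basis)"] conjI allI impI)
   show "Min (rh ` Pow Basis) > 0" using rh(1) by (subst Min_gr_iff) auto
   fix y :: 'a assume y: "y \<noteq> 0 \<and> norm y < Min (rh ` Pow Basis)"
   define B where "B = {b\<in>Basis. y \<bullet> b < 0}"
   have B: "B \<in> Pow Basis" by (auto simp: B_def)
   have "Min (rh ` Pow Basis) \<le> rh B" using B by (intro Min_le) auto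
   hence "norm y < rh B" using y by linarith
   moreover have "\<forall>b\<in>Basis. 0 \<le> T B y \<bullet> b" by (auto simp: Tb B_def)
   ultimately obtain s where s: "s \<in> T B ` A" "norm (T B x + T B y - s) \<le> eps * norm y"
    using rh(2)[OF B, of "T B y"] y by (metis Tn norm_eq_zero)
   then obtain s' where "s' \<in> A" "s = T B s'" by auto
   hence "norm (x + y - s') \<le> eps * norm y" using s(2) by (simp add: Tadd[symmetric] Tn)
   with \<open>s' \<in> A\<close> show "\<exists>s\<in>A. norm (x + y - s) \<le> eps * norm y" by blast
  qed
 qed
qed

text \<open>Rademacher's theorem at a fixed accuracy \<open>e\<close>. The closed set
  \<open>S b q n\<close> collects the points whose slope in direction \<open>b\<close> is
  \<open>q\<close> up to \<open>et\<close>, on a scale fixed by \<open>n\<close>; by the result on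
  lines, almost every point lies in some \<open>Z c n\<close> with rational slopes. Almost
  everywhere in \<open>Z c n\<close> this set is so dense that, on the way from \<open>x\<close> to
  \<open>x + y\<close> one coordinate at a time, each corner can be replaced by a point of
  \<open>Z c n\<close>.\<close>

lemma lipschitz_affine_ae:
 fixes f :: "'a::euclidean_space => real"
 assumes lip: "!!x y. \<bar>f x - f y\<bar> \<le> L * norm (x - y)" and e: "0 < e"
 obtains N where "negligible N"
  "!!x. x \<notin> N ==> \<exists>c. \<exists>r>0. \<forall>y. norm y < r --> \<bar>f (x + y) - f x - c \<bullet> y\<bar> \<le> e * norm y"
proof -
 have L0: "L \<ge> 0"
 proof -
  obtain b :: 'a where "b \<in> Basis" using nonempty_Basis by blast
  thus ?thesis using lip[of b 0] by (simp add: norm_Basis)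
 qed
 have contf: "continuous_on UNIV f"
  by (rule lipschitz_on_continuous_on[of L]) (auto intro!: lipschitz_onI simp: dist_norm dist_real_def lip L0)
 \<comment> \<open>Each coordinate is allowed twice \<open>et * norm y\<close>: once for the error
   of the slope, once for moving both ends of the segment into \<open>Z c n\<close>, which costs
   \<open>2 * L * eps * norm y\<close>.\<close>
 define et where "et = e / (2 * DIM('a))"
 define eps where "eps = et / (2 * L + 1)"
 have et: "et > 0" using e by (simp add: et_def)
 hence eps: "eps > 0" using L0 by (simp add: eps_def)
 have eps2: "2 * L * eps \<le> et"
 proof -
  have "(2 * L + 1) * eps = et" using L0 by (simp add: eps_def)
  thus ?thesis using eps by (simp add: algebra_simps)
 qed
 define S where "S b q n = {x. \<forall>t. \<bar>t\<bar> \<le> inverse (real (Suc n)) --> \<bar>f (x + t *\<^sub>R b) - f x - q * t\<bar> \<le> et * \<bar>t\<bar>}" for b :: 'a and q :: real and n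
 have clS: "closed (S b q n)" for b q n
 proof -
  have "S b q n = (\<Inter>t\<in>{t. \<bar>t\<bar> \<le> inverse (real (Suc n))}. {x. \<bar>f (x + t *\<^sub>R b) - f x - q * t\<bar> \<le> et * \<bar>t\<bar>})"
   by (auto simp: S_def)
  also have "closed \<dots>"
   by (intro closed_INT ballI closed_Collect_le continuous_intros continuous_on_compose2[OF contf]) auto
  finally show ?thesis .
 qed
 have bad: "negligible (- (\<Union>q\<in>\<rat>. \<Union>n. S b q n))" if b: "b \<in> Basis" for b
 proof (rule negligible_by_lines[where v = b])
  have "(\<Union>q\<in>\<rat>. \<Union>n. S b q n) \<in> sets borel"
  proof -
   have "(\<Union>n. S b q n) \<in> sets borel" for q
    by (intro sets.countable_UN) (auto intro: borel_closed clS)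
   thus ?thesis by (intro sets.countable_UN' countable_rat) auto
  qed
  thus "- (\<Union>q\<in>\<rat>. \<Union>n. S b q n) \<in> sets borel" by (metis borel_comp)
 next
  fix x
  have lF: "\<bar>f (x + s *\<^sub>R b) - f (x + t *\<^sub>R b)\<bar> \<le> L * \<bar>s - t\<bar>" for s t
   using lip[of "x + s *\<^sub>R b" "x + t *\<^sub>R b"] b by (simp add: scaleR_left_diff_distrib[symmetric] norm_Basis)
  obtain N where N: "negligible N" "!!t e. t \<notin> N ==> 0 < e ==> \<exists>c. \<exists>d>0. \<forall>s. \<bar>s\<bar> < d --> \<bar>f (x + (t + s) *\<^sub>R b) - f (x + t *\<^sub>R b) - c * s\<bar> \<le> e * \<bar>s\<bar>"
   using lipschitz_slope_ae[of "\<lambda>t. f (x + t *\<^sub>R b)", OF lF] by metis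
  have "t \<in> N" if t: "x + t *\<^sub>R b \<in> - (\<Union>q\<in>\<rat>. \<Union>n. S b q n)" for t
  proof (rule ccontr)
   assume "t \<notin> N"
   then obtain c d where cd: "d > 0" "!!s. \<bar>s\<bar> < d ==> \<bar>f (x + (t + s) *\<^sub>R b) - f (x + t *\<^sub>R b) - c * s\<bar> \<le> (et/2) * \<bar>s\<bar>"
    using N(2)[of t "et/2"] et by auto
   obtain q where q: "q \<in> \<rat>" "c - et/2 < q" "q < c + et/2"
    using Rats_dense_in_real[of "c - et/2" "c + et/2"] et by auto
   obtain n where n: "inverse (real (Suc n)) < d" using reals_Archimedean cd(1) by blast
   have "x + t *\<^sub>R b \<in> S b q n"
    unfolding S_def
   proof (intro CollectI allI impI)
    fix s :: real assume "\<bar>s\<bar> \<le> inverse (real (Suc n))"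
    hence "\<bar>f (x + (t + s) *\<^sub>R b) - f (x + t *\<^sub>R b) - c * s\<bar> \<le> (et/2) * \<bar>s\<bar>"
     using n by (intro cd(2)) auto
    moreover have "\<bar>c * s - q * s\<bar> \<le> (et/2) * \<bar>s\<bar>"
    proof -
     have "\<bar>c - q\<bar> \<le> et / 2" using q by linarith
     thus ?thesis unfolding left_diff_distrib[symmetric] abs_mult by (rule mult_right_mono) auto
    qed
    moreover have eq: "x + (t + s) *\<^sub>R b = x + t *\<^sub>R b + s *\<^sub>R b" by (simp add: scaleR_left_distrib)
    ultimately show "\<bar>f (x + t *\<^sub>R b + s *\<^sub>R b) - f (x + t *\<^sub>R b) - q * s\<bar> \<le> et * \<bar>s\<bar>"
     unfolding eq by (smt (verit) field_sum_of_halves distrib_right)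
   qed
   thus False using t q by auto
  qed
  thus "negligible {t. x + t *\<^sub>R b \<in> - (\<Union>q\<in>\<rat>. \<Union>n. S b q n)}"
   by (intro negligible_subset[OF N(1)]) blast
 qed
 define Z where "Z c n = (\<Inter>b\<in>Basis. S b (c b) n)" for c :: "'a => real" and n
 have clZ: "closed (Z c n)" for c n unfolding Z_def by (intro closed_INT ballI clS)
 have "\<exists>N. negligible N \<and> (\<forall>x\<in>Z c n - N. \<exists>rh>0. \<forall>y. y \<noteq> 0 \<and> norm y < rh --> (\<exists>s\<in>Z c n. norm (x + y - s) \<le> eps * norm y))" for c n
  using nonporous_ae[OF clZ eps, of c n] by metis
 then obtain P where P: "!!c n. negligible (P c n)"
  "!!c n x. x \<in> Z c n - P c n ==> \<exists>rh>0. \<forall>y. y \<noteq> 0 \<and> norm y < rh --> (\<exists>s\<in>Z c n. norm (x + y - s) \<le> eps * norm y)"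
  by metis
 define C where "C = (Basis :: 'a set) \<rightarrow>\<^sub>E (\<rat> :: real set)"
 have cC: "countable C" unfolding C_def by (intro countable_PiE finite_Basis countable_rat)
 show thesis
 proof
  have "negligible (\<Union>((\<lambda>(c, n). P c n) ` (C \<times> (UNIV :: nat set))))"
   by (rule negligible_countable_Union) (use cC P in auto)
  moreover have "negligible (\<Union>b\<in>Basis. - (\<Union>q\<in>\<rat>. \<Union>n. S b q n))"
   by (rule negligible_Union) (use bad in auto)
  ultimately show "negligible (\<Union>((\<lambda>(c, n). P c n) ` (C \<times> (UNIV :: nat set))) \<union> (\<Union>b\<in>Basis. - (\<Union>q\<in>\<rat>. \<Union>n. S b q n)))"
   by auto
  fix x assume x: "x \<notin> \<Union>((\<lambda>(c, n). P c n) ` (C \<times> (UNIV :: nat set))) \<union> (\<Union>b\<in>Basis. - (\<Union>q\<in>\<rat>. \<Union>n. S b q n))"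
  hence "\<forall>b\<in>Basis. \<exists>q\<in>\<rat>. \<exists>n. x \<in> S b q n" by auto
  then obtain q m where qm: "!!b. b \<in> Basis ==> q b \<in> \<rat>" "!!b. b \<in> Basis ==> x \<in> S b (q b) (m b)"
   by metis
  define c where "c = restrict q Basis"
  define n where "n = Max (m ` Basis)"
  have c: "c \<in> C" using qm(1) by (auto simp: C_def c_def)
  have "x \<in> Z c n"
   unfolding Z_def
  proof
   fix b :: 'a assume b: "b \<in> Basis"
   have "inverse (real (Suc n)) \<le> inverse (real (Suc (m b)))"
    using b by (intro le_imp_inverse_le) (auto simp: n_def)
   hence "\<bar>t\<bar> \<le> inverse (real (Suc (m b)))" if "\<bar>t\<bar> \<le> inverse (real (Suc n))" for t
    using that by linarith
   thus "x \<in> S b (c b) n" using qm(2)[OF b] b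
    unfolding S_def c_def mem_Collect_eq by (simp del: of_nat_Suc)
  qed
  moreover have "x \<notin> P c n" using x c by auto
  ultimately obtain rh where rh: "rh > 0" "!!y. y \<noteq> 0 ==> norm y < rh ==> (\<exists>s\<in>Z c n. norm (x + y - s) \<le> eps * norm y)"
   using P(2)[of x c n] by auto
  define c' where "c' = (\<Sum>b\<in>Basis. c b *\<^sub>R b)"
  show "\<exists>c. \<exists>r>0. \<forall>y. norm y < r --> \<bar>f (x + y) - f x - c \<bullet> y\<bar> \<le> e * norm y"
  proof (intro exI conjI allI impI)
   show "min rh (inverse (real (Suc n))) > 0" using rh by simp
   fix y :: 'a assume y: "norm y < min rh (inverse (real (Suc n)))"
   have claim: "\<bar>f (x + (\<Sum>b\<in>J. (y \<bullet> b) *\<^sub>R b)) - f x - (\<Sum>b\<in>J. c b * (y \<bullet> b))\<bar> \<le> card J * (2 * et * norm y)"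
    if "J \<subseteq> Basis" for J
   proof -
    have "finite J" using that finite_Basis finite_subset by blast
    thus ?thesis using that
    proof (induction J)
     case (insert b J)
     define w where "w = (\<Sum>b\<in>J. (y \<bullet> b) *\<^sub>R b)"
     have b: "b \<in> Basis" using insert by auto
     have wn: "norm w \<le> norm y"
     proof -
      have "w \<bullet> b = (if b \<in> J then y \<bullet> b else 0)" if "b \<in> Basis" for b
       using insert that \<open>finite J\<close> unfolding w_def inner_sum_left
       by (subst sum.cong[OF refl, of _ _ "\<lambda>i. if i = b then y \<bullet> b else 0"]) (auto simp: inner_Basis)
      thus ?thesis
       by (intro norm_le_componentwise) auto
     qed
     obtain s where s: "s \<in> Z c n" "norm (x + w - s) \<le> eps * norm y"
     proof (cases "w = 0")
      case True
      thus ?thesis using that[of x] \<open>x \<in> Z c n\<close> eps by simp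
     next
      case False
      then obtain s where "s \<in> Z c n" "norm (x + w - s) \<le> eps * norm w"
       using rh(2)[of w] wn y by auto
      moreover have "eps * norm w \<le> eps * norm y" using wn eps by simp
      ultimately show ?thesis using that[of s] by linarith
     qed
     have yb: "\<bar>y \<bullet> b\<bar> \<le> norm y" using Basis_le_norm[OF b] .
     have "\<bar>f (s + (y \<bullet> b) *\<^sub>R b) - f s - c b * (y \<bullet> b)\<bar> \<le> et * \<bar>y \<bullet> b\<bar>"
      using s(1) b y yb by (auto simp: Z_def S_def)
     moreover have "et * \<bar>y \<bullet> b\<bar> \<le> et * norm y" using yb et by simp
     moreover have "\<bar>f (x + w + (y \<bullet> b) *\<^sub>R b) - f (s + (y \<bullet> b) *\<^sub>R b)\<bar> \<le> L * (eps * norm y)"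
      using lip[of "x + w + (y \<bullet> b) *\<^sub>R b" "s + (y \<bullet> b) *\<^sub>R b"] mult_left_mono[OF s(2) L0] by simp
     moreover have "\<bar>f (x + w) - f s\<bar> \<le> L * (eps * norm y)"
      using lip[of "x + w" s] mult_left_mono[OF s(2) L0] by simp
     moreover have "2 * (L * (eps * norm y)) \<le> et * norm y"
      using mult_right_mono[OF eps2, of "norm y"] by (simp add: mult.assoc)
     ultimately have "\<bar>f (x + w + (y \<bullet> b) *\<^sub>R b) - f (x + w) - c b * (y \<bullet> b)\<bar> \<le> 2 * et * norm y"
      by linarith
     moreover have "\<bar>f (x + w) - f x - (\<Sum>b\<in>J. c b * (y \<bullet> b))\<bar> \<le> card J * (2 * et * norm y)"
      using insert by (simp add: w_def)
     moreover have e1: "x + (\<Sum>b\<in>insert b J. (y \<bullet> b) *\<^sub>R b) = x + w + (y \<bullet> b) *\<^sub>R b"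
      using insert by (simp add: w_def algebra_simps)
     moreover have e2: "card (insert b J) * (2 * et * norm y) = 2 * et * norm y + card J * (2 * et * norm y)"
      using insert by (simp add: algebra_simps)
     moreover have e3: "(\<Sum>b\<in>insert b J. c b * (y \<bullet> b)) = c b * (y \<bullet> b) + (\<Sum>b\<in>J. c b * (y \<bullet> b))"
      using insert by simp
     ultimately show ?case unfolding e1 e2 e3 by linarith
    qed simp
   qed
   have "c' \<bullet> y = (\<Sum>b\<in>Basis. c b * (y \<bullet> b))"
    by (subst inner_commute) (simp add: c'_def inner_sum_right)
   moreover have "card (Basis :: 'a set) * (2 * et * norm y) = e * norm y"
    by (simp add: et_def)
   ultimately show "\<bar>f (x + y) - f x - c' \<bullet> y\<bar> \<le> e * norm y"
    using claim[of Basis] by (simp only: euclidean_representation)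
  qed
 qed
qed

section \<open>Semiconvex functions and their contact sets\<close>

lemma increment_le_of_quadratic_error:
 fixes h :: "real => real"
 assumes h: "!!a b. 0 \<le> a ==> a \<le> b ==> b \<le> 1 ==> \<bar>h b - h a\<bar> \<le> E * (b - a) + B * (b - a)^2"
 shows "\<bar>h 1 - h 0\<bar> \<le> E"
proof -
 \<comment> \<open>Cutting the interval into \<open>Suc n\<close> equal pieces preserves the total
   linear error and divides the total quadratic error by \<open>Suc n\<close>.\<close>
 have *: "\<bar>h 1 - h 0\<bar> \<le> E + B / real (Suc n)" for n
 proof -
  define N where "N = Suc n"
  have N: "N > 0" by (simp add: N_def)
  have "\<bar>h (k / N) - h 0\<bar> \<le> k * (E / N + B / N^2)" if "k \<le> N" for k
   using that
  proof (induction k)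
   case (Suc k)
   have "\<bar>h (Suc k / N) - h (k / N)\<bar> \<le> E * (Suc k / N - k / N) + B * (Suc k / N - k / N)^2"
    using Suc.prems N by (intro h) (auto simp: divide_simps)
   also have "Suc k / N - k / N = 1 / N" by (simp add: diff_divide_distrib[symmetric])
   finally have "\<bar>h (Suc k / N) - h (k / N)\<bar> \<le> E / N + B / N^2" by (simp add: power_divide)
   moreover have "\<bar>h (k / N) - h 0\<bar> \<le> k * (E / N + B / N^2)" using Suc by simp
   moreover have "Suc k * (E / N + B / N^2) = (E / N + B / N^2) + k * (E / N + B / N^2)"
    by (simp only: of_nat_Suc distrib_right mult_1_left add.commute)
   ultimately show ?case by linarith
  qed simp
  from this[of N] have "\<bar>h 1 - h 0\<bar> \<le> N * (E / N + B / N^2)" using N by simp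
  also have "\<dots> = E + B / N" using N by (simp add: field_simps power2_eq_square)
  finally show ?thesis by (simp add: N_def)
 qed
 have "(\<lambda>n. E + B / real (Suc n)) \<longlonglongrightarrow> E + 0"
  by (intro tendsto_intros LIMSEQ_Suc lim_const_over_n)
 thus ?thesis using * by (intro LIMSEQ_le_const[of _ "E"]) auto
qed

text \<open>The lower paraboloid at \<open>z2\<close> must stay below the upper one at
  \<open>z1\<close>. This is tested with a step \<open>y\<close> of length
  \<open>norm (z2 - z1)\<close> parallel to the difference of the slopes. The constant is
  \<open>1 + 1 + 4\<close>, the \<open>4\<close> because \<open>z2 - z1 + y\<close> can be twice as
  long. The upper paraboloid is needed at one of the two points only, which later allows
  \<open>z2\<close> to leave the contact set.\<close>

lemma semiconvex_gradient_lipschitz: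
 fixes W :: "'a::euclidean_space => real"
 assumes lower: "!!z y. norm y \<le> rh ==> W z + l z \<bullet> y - c * (norm y)^2 \<le> W (z + y)"
  and upper: "!!y. norm y \<le> rh ==> W (z1 + y) \<le> W z1 + l z1 \<bullet> y + c * (norm y)^2"
  and d: "norm (z2 - z1) \<le> rh / 2" and c0: "0 \<le> c"
 shows "norm (l z2 - l z1) \<le> 6 * c * norm (z2 - z1)"
proof (cases "z2 = z1 \<or> l z2 = l z1")
 case True
 thus ?thesis using c0 by auto
next
 case False
 define d' where "d' = norm (z2 - z1)"
 have d': "d' > 0" "2 * d' \<le> rh" using False d by (auto simp: d'_def)
 define y where "y = (d' / norm (l z2 - l z1)) *\<^sub>R (l z2 - l z1)"
 have ny: "norm y = d'" using False d' by (simp add: y_def)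
 have iy: "(l z2 - l z1) \<bullet> y = d' * norm (l z2 - l z1)"
  using False by (simp add: y_def power2_norm_eq_inner[symmetric] power2_eq_square)
 have 1: "W z2 + l z2 \<bullet> y - c * d'^2 \<le> W (z2 + y)" using lower[of y z2] ny d' by simp
 have n2: "norm (z2 - z1 + y) \<le> 2 * d'" using norm_triangle_ineq[of "z2 - z1" y] ny by (simp add: d'_def)
 have 3: "W z1 + l z1 \<bullet> (z2 - z1) - c * d'^2 \<le> W z2" using lower[of "z2 - z1" z1] d' norm_ge_zero[of "z2 - z1"] unfolding d'_def by (simp del: norm_ge_zero)

 have 2: "W (z2 + y) \<le> W z1 + l z1 \<bullet> (z2 - z1 + y) + c * (2 * d')^2"
 proof -
  have "c * (norm (z2 - z1 + y))^2 \<le> c * (2 * d')^2" using n2 c0 by (intro mult_left_mono power_mono) auto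
  thus ?thesis using upper[of "z2 - z1 + y"] n2 d' by (simp add: add.assoc)
 qed
 have "(l z2 - l z1) \<bullet> y \<le> 6 * c * d'^2"
  using 1 2 3 by (simp add: inner_add_right inner_diff_left power2_eq_square)
 hence "d' * norm (l z2 - l z1) \<le> d' * (6 * c * d')" by (simp add: iy power2_eq_square mult_ac)
 thus ?thesis using d' by (simp add: d'_def)
qed

text \<open>The lower paraboloids at both ends of a short step pin the increment of \<open>W\<close>
  between the values of \<open>l\<close>, up to a quadratic error that disappears under subdivision.
  Hence an expansion of \<open>l\<close> along the segment integrates to one of
  \<open>W\<close>.\<close>

lemma semiconvex_taylor:
 fixes W :: "'a::euclidean_space => real"
 assumes lower: "!!z y. norm y \<le> rh ==> W z + l z \<bullet> y - c * (norm y)^2 \<le> W (z + y)"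
  and y: "norm y \<le> rh"
  and err: "!!s. 0 \<le> s ==> s \<le> 1 ==> \<bar>l (z + s *\<^sub>R y) \<bullet> y - l z \<bullet> y - s * q\<bar> \<le> E"
 shows "\<bar>W (z + y) - W z - l z \<bullet> y - q / 2\<bar> \<le> E"
proof -
 define h where "h s = W (z + s *\<^sub>R y) - s * (l z \<bullet> y) - s^2 * q / 2" for s
 have "\<bar>h b - h a\<bar> \<le> E * (b - a) + (\<bar>c\<bar> * (norm y)^2 + \<bar>q\<bar>) * (b - a)^2"
  if ab: "0 \<le> a" "a \<le> b" "b \<le> 1" for a b
 proof -
  have nb: "norm ((b - a) *\<^sub>R y) \<le> rh" "norm ((a - b) *\<^sub>R y) \<le> rh"
   using ab y mult_left_le_one_le[of "norm y" "b - a"] by auto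
  have z: "z + a *\<^sub>R y + (b - a) *\<^sub>R y = z + b *\<^sub>R y" "z + b *\<^sub>R y + (a - b) *\<^sub>R y = z + a *\<^sub>R y"
   by (auto simp: algebra_simps)
  have c: "c * (norm y)^2 \<le> \<bar>c\<bar> * (norm y)^2" by (simp add: mult_right_mono)
  define D where "D = (b - a)^2"
  have D: "D \<ge> 0" by (simp add: D_def)
  have cD: "c * (norm y)^2 * D \<le> \<bar>c\<bar> * (norm y)^2 * D" using mult_right_mono[OF c D] .
  have "W (z + a *\<^sub>R y) + (b - a) * (l (z + a *\<^sub>R y) \<bullet> y) - c * (norm y)^2 * D \<le> W (z + b *\<^sub>R y)"
   using lower[OF nb(1), of "z + a *\<^sub>R y"] by (simp add: z D_def power_mult_distrib mult_ac)
  moreover have "(b - a) * (l (z + a *\<^sub>R y) \<bullet> y - l z \<bullet> y - a * q) \<ge> - (b - a) * E"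
   using err[of a] ab by (smt (verit, best) mult_left_mono mult_minus_right minus_mult_commute)
  ultimately have lo: "W (z + b *\<^sub>R y) - W (z + a *\<^sub>R y) \<ge> (b - a) * (l z \<bullet> y) + (b - a) * (a * q) - (b - a) * E - \<bar>c\<bar> * (norm y)^2 * D"
   using cD by (simp add: algebra_simps)
  have "W (z + b *\<^sub>R y) + (a - b) * (l (z + b *\<^sub>R y) \<bullet> y) - c * (norm y)^2 * D \<le> W (z + a *\<^sub>R y)"
   using lower[OF nb(2), of "z + b *\<^sub>R y"] by (simp add: z D_def power_mult_distrib mult_ac power2_commute)
  moreover have "(b - a) * (l (z + b *\<^sub>R y) \<bullet> y - l z \<bullet> y - b * q) \<le> (b - a) * E"
   using err[of b] ab by (intro mult_left_mono) auto
  ultimately have up: "W (z + b *\<^sub>R y) - W (z + a *\<^sub>R y) \<le> (b - a) * (l z \<bullet> y) + (b - a) * (b * q) + (b - a) * E + \<bar>c\<bar> * (norm y)^2 * D"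
   using cD by (simp add: algebra_simps)
  have q: "\<bar>q * D\<bar> \<le> \<bar>q\<bar> * D" "D = (b - a)^2" using D by (auto simp: abs_mult D_def)
  have "h b - h a = W (z + b *\<^sub>R y) - W (z + a *\<^sub>R y) - (b - a) * (l z \<bullet> y) - (b^2 - a^2) * q / 2"
   by (simp add: h_def algebra_simps diff_divide_distrib)
  moreover have "(b^2 - a^2) * q / 2 = (b - a) * (a * q) + q * D / 2" "(b^2 - a^2) * q / 2 = (b - a) * (b * q) - q * D / 2"
   by (auto simp: D_def power2_eq_square field_simps)
  ultimately have "\<bar>h b - h a\<bar> \<le> (b - a) * E + \<bar>c\<bar> * (norm y)^2 * D + \<bar>q * D\<bar>" using lo up by linarith
  also have "\<dots> \<le> (b - a) * E + \<bar>c\<bar> * (norm y)^2 * D + \<bar>q\<bar> * D" using q by linarith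
  finally show ?thesis by (simp add: D_def algebra_simps)
 qed
 hence "\<bar>h 1 - h 0\<bar> \<le> E" by (rule increment_le_of_quadratic_error)
 thus ?thesis by (simp add: h_def)
qed

text \<open>McShane's extension: the lower envelope of the cones of slope \<open>L\<close> standing
  on the graph over \<open>K\<close>.\<close>

lemma lipschitz_extension_real:
 fixes f :: "'a::euclidean_space => real"
 assumes lip: "!!x y. x \<in> K ==> y \<in> K ==> \<bar>f x - f y\<bar> \<le> L * norm (x - y)" and L: "0 \<le> L"
 obtains g where "!!x. x \<in> K ==> g x = f x" "!!x y. \<bar>g x - g y\<bar> \<le> L * norm (x - y)"
proof (cases "K = {}")
 case True
 thus ?thesis using that[of "\<lambda>_. 0"] L by auto
next
 case False
 then obtain k0 where k0: "k0 \<in> K" by auto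
 define g where "g x = (INF k\<in>K. f k + L * norm (x - k))" for x
 have bd: "bdd_below ((\<lambda>k. f k + L * norm (x - k)) ` K)" for x
 proof (rule bdd_belowI2)
  fix k assume k: "k \<in> K"
  have "L * norm (k0 - k) \<le> L * norm (x - k0) + L * norm (x - k)"
   using L norm_triangle_ineq[of "k0 - x" "x - k"] by (simp add: norm_minus_commute distrib_left[symmetric] mult_left_mono)
  thus "f k0 - L * norm (x - k0) \<le> f k + L * norm (x - k)"
   using lip[OF k0 k] by linarith
 qed
 have le: "g x \<le> f k + L * norm (x - k)" if "k \<in> K" for x k
  unfolding g_def using bd that by (rule cINF_lower)
 have half: "g x \<le> g y + L * norm (x - y)" for x y
 proof -
  have "g x - L * norm (x - y) \<le> g y"
   unfolding g_def[of y]
  proof (rule cINF_greatest[OF False])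
   fix k assume k: "k \<in> K"
   have "L * norm (x - k) \<le> L * norm (x - y) + L * norm (y - k)"
    using L norm_triangle_ineq[of "x - y" "y - k"] by (simp add: distrib_left[symmetric] mult_left_mono)
   thus "g x - L * norm (x - y) \<le> f k + L * norm (y - k)"
    using le[OF k, of x] by linarith
  qed
  thus ?thesis by linarith
 qed
 show thesis
 proof
  fix x assume x: "x \<in> K"
  show "g x = f x"
  proof (rule antisym)
   show "g x \<le> f x" using le[OF x, of x] by simp
   show "f x \<le> g x" unfolding g_def
    by (rule cINF_greatest[OF False]) (use lip[OF x] in \<open>smt (verit)\<close>)
  qed
 next
  show "\<bar>g x - g y\<bar> \<le> L * norm (x - y)" for x y
   using half[of x y] half[of y x] by (simp add: norm_minus_commute)
 qed
qed

text \<open>A form of Alexandrov's theorem on the set \<open>K\<close> of points where the semiconvex function \<open>W\<close> is also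
 touched from above by a paraboloid: there its gradient \<open>l\<close> is Lipschitz.\<close>

lemma semiconvex_second_order_on_contact_set:
 fixes W :: "'a::euclidean_space \<times> real => real"
 assumes lower: "!!z y. norm y \<le> rh ==> W z + l z \<bullet> y - c * (norm y)^2 \<le> W (z + y)"
  and upper: "!!z y. z \<in> K ==> norm y \<le> rh ==> W (z + y) \<le> W z + l z \<bullet> y + c * (norm y)^2"
  and rh: "0 < rh" and c: "0 < c" and K: "\<not> negligible K" and et: "0 < et"
 obtains z C r where "z \<in> K" "linear C" "!!y. norm (C y) \<le> (real DIM('a) * (6 * c + et)) * norm y" "r > 0"
  "!!y. norm y < r ==> \<bar>W (z + (y, 0)) - W z - fst (l z) \<bullet> y - (C y \<bullet> y) / 2\<bar> \<le> et * (norm y)^2"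
proof -
 obtain D :: "('a \<times> real) set" where D: "countable D" "UNIV \<subseteq> closure D"
  by (rule separable[of "UNIV :: ('a \<times> real) set"])
 \<comment> \<open>The Lipschitz bound for \<open>l\<close> holds for points at distance at most
   \<open>rh / 2\<close>, so \<open>K\<close> is first cut down to one of countably many small
   pieces that is not negligible.\<close>
 have "\<exists>a\<in>D. \<not> negligible (K \<inter> ball a (rh/4))"
 proof (rule ccontr)
  assume "\<not> ?thesis"
  hence "negligible (\<Union>a\<in>D. K \<inter> ball a (rh/4))"
   using D(1) by (intro negligible_countable_Union) auto
  moreover have "K \<subseteq> (\<Union>a\<in>D. K \<inter> ball a (rh/4))"
  proof
   fix x assume "x \<in> K"
   have "\<forall>e>0. \<exists>a\<in>D. dist a x < e" using D(2) closure_approachable[of x D] by blast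
   then obtain a where "a \<in> D" "dist a x < rh/4" using rh by (meson divide_pos_pos zero_less_numeral)
   thus "x \<in> (\<Union>a\<in>D. K \<inter> ball a (rh/4))" using \<open>x \<in> K\<close> by auto
  qed
  ultimately show False using K negligible_subset by blast
 qed
 then obtain a where a: "\<not> negligible (K \<inter> ball a (rh/4))" by auto
 define K' where "K' = K \<inter> ball a (rh/4)"
 have K'close: "norm (x - y) \<le> rh/2" if "x \<in> K'" "y \<in> K'" for x y
  using that dist_triangle2[of x y a] unfolding K'_def by (auto simp: dist_norm norm_minus_commute)
 have lip: "norm (l z2 - l z1) \<le> 6 * c * norm (z2 - z1)" if "z1 \<in> K" "norm (z2 - z1) \<le> rh/2" for z1 z2
  by (rule semiconvex_gradient_lipschitz[OF lower upper[OF that(1)] that(2)]) (use c in auto)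
 define e where "e = et / (6 * DIM('a))"
 define eps where "eps = min (1/2) (et / (48 * c * DIM('a)))"
 have dpos: "real DIM('a) > 0" by simp
 have e: "e > 0" using et by (simp add: e_def)
 have eps: "eps > 0" "eps \<le> 1/2" using et c by (auto simp: eps_def)
 have epsc: "24 * c * eps \<le> et / (2 * DIM('a))"
 proof -
  have "24 * c * eps \<le> 24 * c * (et / (48 * c * DIM('a)))" using c by (intro mult_left_mono) (auto simp: eps_def)
  also have "\<dots> = et / (2 * DIM('a))" using c by (simp add: field_simps)
  finally show ?thesis .
 qed
 \<comment> \<open>The slopes are Lipschitz only relative to \<open>K'\<close>; extended to the
   whole space, their components become accessible to \<open>lipschitz_affine_ae\<close>.\<close>
 have "\<exists>f. (\<forall>x\<in>K'. f x = fst (l x) \<bullet> b) \<and> (\<forall>x y. \<bar>f x - f y\<bar> \<le> (6 * c) * norm (x - y))" if b: "b \<in> Basis" for b :: 'a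
 proof -
  have "\<bar>fst (l x) \<bullet> b - fst (l y) \<bullet> b\<bar> \<le> (6 * c) * norm (x - y)" if "x \<in> K'" "y \<in> K'" for x y
  proof -
   have "\<bar>fst (l x) \<bullet> b - fst (l y) \<bullet> b\<bar> = \<bar>fst (l x - l y) \<bullet> b\<bar>" by (simp add: inner_diff_left)
   also have "\<dots> \<le> norm (fst (l x - l y))" by (rule Basis_le_norm[OF b])
   also have "\<dots> \<le> norm (l x - l y)" by (metis norm_fst_le prod.collapse)
   also have "\<dots> \<le> 6 * c * norm (x - y)" using lip[of y x] that K'close[of x y] by (auto simp: K'_def)
   finally show ?thesis .
  qed
  from lipschitz_extension_real[of K' "\<lambda>x. fst (l x) \<bullet> b", OF this] c show ?thesis by (metis less_imp_le mult_pos_pos zero_less_numeral)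
 qed
 then obtain f where f: "!!b x. b \<in> Basis ==> x \<in> K' ==> f b x = fst (l x) \<bullet> b"
  "!!b x y. b \<in> Basis ==> \<bar>f b x - f b y\<bar> \<le> (6 * c) * norm (x - y)" by metis
 have "\<exists>N. negligible N \<and> (\<forall>x. x \<notin> N --> (\<exists>v. \<exists>r>0. \<forall>y. norm y < r --> \<bar>f b (x + y) - f b x - v \<bullet> y\<bar> \<le> e * norm y))"
  if "b \<in> Basis" for b
  using lipschitz_affine_ae[of "f b", OF f(2)[OF that] e] by metis
 then obtain N where N: "!!b. b \<in> Basis ==> negligible (N b)"
  "!!b x. b \<in> Basis ==> x \<notin> N b ==> (\<exists>v. \<exists>r>0. \<forall>y. norm y < r --> \<bar>f b (x + y) - f b x - v \<bullet> y\<bar> \<le> e * norm y)"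
  by metis
 obtain N0 where N0: "negligible N0"
  "!!x. x \<in> closure K' - N0 ==> \<exists>r>0. \<forall>y. y \<noteq> 0 \<and> norm y < r --> (\<exists>s\<in>closure K'. norm (x + y - s) \<le> eps * norm y)"
  using nonporous_ae[of "closure K'" eps] eps by auto
 have "negligible (N0 \<union> (\<Union>b\<in>Basis. N b))"
  using N0(1) N(1) by (auto intro!: negligible_Union)
 hence "\<not> K' \<subseteq> N0 \<union> (\<Union>b\<in>Basis. N b)" using a negligible_subset unfolding K'_def by blast
 then obtain z where z: "z \<in> K'" "z \<notin> N0" "!!b. b \<in> Basis ==> z \<notin> N b" by auto
 obtain r0 where r0: "r0 > 0" "!!y. y \<noteq> 0 ==> norm y < r0 ==> (\<exists>s\<in>closure K'. norm (z + y - s) \<le> eps * norm y)"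
  using N0(2)[of z] z closure_subset by blast
 have "\<forall>b\<in>Basis. \<exists>v. \<exists>r>0. \<forall>y. norm y < r --> \<bar>f b (z + y) - f b z - v \<bullet> y\<bar> \<le> e * norm y"
  using N(2) z(3) by auto
 then obtain v r1 where v: "!!b. b \<in> Basis ==> r1 b > 0"
  "!!b y. b \<in> Basis ==> norm y < r1 b ==> \<bar>f b (z + y) - f b z - v b \<bullet> y\<bar> \<le> e * norm y"
  by metis
 have vb: "\<bar>v b \<bullet> y\<bar> \<le> (6 * c + e) * norm y" if b: "b \<in> Basis" for b y
 proof (cases "y = 0")
  case False
  define t where "t = r1 b / (2 * norm y)"
  have t: "t > 0" "norm (t *\<^sub>R y) < r1 b" using False v(1)[OF b] by (auto simp: t_def)
  have "\<bar>v b \<bullet> (t *\<^sub>R y)\<bar> \<le> (6 * c + e) * norm (t *\<^sub>R y)"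
   using v(2)[OF b t(2)] f(2)[OF b, of "z + t *\<^sub>R y" z] by (simp add: algebra_simps)
  hence "t * \<bar>v b \<bullet> y\<bar> \<le> t * ((6 * c + e) * norm y)" using t by (simp add: abs_mult mult_ac)
  thus ?thesis using t by simp
 qed simp
 \<comment> \<open>Only the spatial second derivatives enter the equation, so the linear
   approximations of the slope are restricted to increments \<open>(y, 0)\<close>. Symmetry of
   \<open>C\<close> is not known here and is restored later by
   \<open>symmetrized_matrix\<close>.\<close>
 define C where "C y = (\<Sum>b\<in>Basis. (v b \<bullet> (y, 0)) *\<^sub>R b)" for y :: 'a
 have Cb: "C y \<bullet> b = v b \<bullet> (y, 0)" if "b \<in> Basis" for y b
  using that by (simp add: C_def inner_sum_left inner_Basis if_distrib cong: if_cong)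
 define R where "R = insert (r0 / 2) (insert (rh/2) ((\<lambda>b. r1 b / 3) ` Basis))"
 define r where "r = Min R"
 have Rle: "x \<in> R ==> r \<le> x" for x unfolding r_def by (rule Min_le) (auto simp: R_def)
 have r: "r > 0" "r \<le> r0/2" "r \<le> rh/2" "!!b. b \<in> Basis ==> r \<le> r1 b/3"
 proof -
  have "finite R" "R \<noteq> {}" "\<forall>x\<in>R. x > 0" using r0(1) rh v(1) by (auto simp: R_def)
  thus "r > 0" by (simp add: r_def)
  show "r \<le> r0/2" "r \<le> rh/2" "!!b. b \<in> Basis ==> r \<le> r1 b/3"
   by (rule Rle, simp add: R_def)+
 qed
 have grad: "\<bar>(fst (l (z + (y, 0))) - fst (l z) - C y) \<bullet> b\<bar> \<le> (et / DIM('a)) * norm y" if y: "norm y < r" "y \<noteq> 0" and b: "b \<in> Basis" for y b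
 proof -
  define Y where "Y = (y, 0 :: real)"
  have Yn: "norm Y = norm y" "Y \<noteq> 0" using y by (auto simp: Y_def norm_Pair zero_prod_def)
  have yp: "norm y > 0" using y by simp
  \<comment> \<open>The point \<open>z + Y\<close> may lie outside \<open>K'\<close>, where the
    extension says nothing about \<open>l\<close>. It is compared with a point \<open>k\<close> of
    \<open>K'\<close> at distance at most \<open>2 * eps * norm y\<close>, using the Lipschitz bound
    with \<open>k\<close> as the touched point.\<close>
  obtain s where s: "s \<in> closure K'" "norm (z + Y - s) \<le> eps * norm y"
   using r0(2)[of Y] Yn y r r0 by auto
  obtain k where k: "k \<in> K'" "dist k s < eps * norm y"
   using s(1) yp eps closure_approachable[of s K'] by (metis mult_pos_pos)
  have zk: "norm (z + Y - k) \<le> 2 * eps * norm y"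
  proof -
   have "norm (z + Y - k) \<le> norm (z + Y - s) + norm (s - k)" using norm_triangle_ineq[of "z + Y - s" "s - k"] by simp
   thus ?thesis using s(2) k(2) by (simp add: dist_norm norm_minus_commute algebra_simps)
  qed
  also have "\<dots> \<le> norm y" using eps yp by simp
  finally have zk2: "norm (z + Y - k) \<le> norm y" .
  have kz: "norm (k - z) \<le> 2 * norm y"
   using norm_triangle_ineq4[of "Y" "z + Y - k"] zk2 Yn by simp
  have 1: "\<bar>(fst (l (z + Y)) - fst (l k)) \<bullet> b\<bar> \<le> 12 * c * eps * norm y"
  proof -
   have "\<bar>(fst (l (z + Y)) - fst (l k)) \<bullet> b\<bar> \<le> norm (fst (l (z + Y) - l k))" using Basis_le_norm[OF b] by simp
   also have "\<dots> \<le> norm (l (z + Y) - l k)" by (metis norm_fst_le prod.collapse)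
   also have "\<dots> \<le> 6 * c * norm (z + Y - k)" using k zk2 y r by (intro lip) (auto simp: K'_def)
   also have "\<dots> \<le> 6 * c * (2 * eps * norm y)" using zk c by (intro mult_left_mono) auto
   finally show ?thesis by simp
  qed
  have 2: "\<bar>fst (l k) \<bullet> b - fst (l z) \<bullet> b - v b \<bullet> (k - z)\<bar> \<le> 2 * e * norm y"
  proof -
   have "\<bar>f b (z + (k - z)) - f b z - v b \<bullet> (k - z)\<bar> \<le> e * norm (k - z)"
    using kz y r(4)[OF b] v(1)[OF b] by (intro v(2)[OF b]) linarith
   also have "\<dots> \<le> e * (2 * norm y)" using kz e by (intro mult_left_mono) auto
   finally show ?thesis using f(1)[OF b] k(1) z(1) by simp
  qed
  have 3: "\<bar>v b \<bullet> (z + Y - k)\<bar> \<le> 12 * c * eps * norm y + e * norm y"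
  proof -
   have "\<bar>v b \<bullet> (z + Y - k)\<bar> \<le> 6 * c * norm (z + Y - k) + e * norm (z + Y - k)" using vb[OF b, of "z + Y - k"] by (simp add: algebra_simps)
   also have "\<dots> \<le> 6 * c * (2 * eps * norm y) + e * norm y" using zk zk2 c e by (intro add_mono mult_left_mono) auto
   finally show ?thesis by simp
  qed
  have "(fst (l (z + Y)) - fst (l z) - C y) \<bullet> b = (fst (l (z + Y)) - fst (l k)) \<bullet> b
   + (fst (l k) \<bullet> b - fst (l z) \<bullet> b - v b \<bullet> (k - z)) - v b \<bullet> (z + Y - k)"
   by (simp add: inner_diff_left Cb[OF b] Y_def[symmetric] inner_diff_right inner_add_right)
  hence "\<bar>(fst (l (z + Y)) - fst (l z) - C y) \<bullet> b\<bar> \<le> (24 * c * eps + 3 * e) * norm y"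
   using 1 2 3 by (simp add: algebra_simps)
  also have "\<dots> \<le> (et / (2 * DIM('a)) + 3 * e) * norm y" using epsc by (intro mult_right_mono) auto
  also have "et / (2 * DIM('a)) + 3 * e = et / DIM('a)" by (simp add: e_def field_simps)
  finally show ?thesis by (simp add: Y_def)
 qed
 show thesis
 proof
  show "z \<in> K" using z by (simp add: K'_def)
  show "linear C"
  proof (rule linearI)
   fix x y :: 'a and s :: real
   have "(x + y, 0 :: real) = (x, 0) + (y, 0)" "(s *\<^sub>R x, 0 :: real) = s *\<^sub>R (x, 0)" by auto
   thus "C (x + y) = C x + C y" "C (s *\<^sub>R x) = s *\<^sub>R C x"
    unfolding C_def by (auto simp only: inner_add_right inner_scaleR_right scaleR_left_distrib sum.distrib scaleR_sum_right scaleR_scaleR)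
  qed
  show "norm (C y) \<le> (real DIM('a) * (6 * c + et)) * norm y" for y
  proof -
   have "norm (C y) \<le> (\<Sum>b\<in>Basis. \<bar>C y \<bullet> b\<bar>)" by (rule norm_le_l1)
   also have "\<dots> \<le> (\<Sum>b\<in>(Basis::'a set). (6 * c + et) * norm y)"
   proof (rule sum_mono)
    fix b :: 'a assume b: "b \<in> Basis"
    have "1 \<le> real DIM('a)" by (metis DIM_positive One_nat_def Suc_leI of_nat_1 of_nat_le_iff)
    hence "1 \<le> real (6 * DIM('a))" by linarith
    from frac_le[of et et 1, OF _ order_refl _ this] have "e \<le> et" using et by (simp add: e_def)
    hence "(6 * c + e) * norm y \<le> (6 * c + et) * norm y" by (intro mult_right_mono) auto
    thus "\<bar>C y \<bullet> b\<bar> \<le> (6 * c + et) * norm y" using vb[OF b, of "(y, 0)"] by (simp add: Cb[OF b] norm_Pair)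
   qed
   finally show ?thesis by simp
  qed
  show "r > 0" by (rule r)
  fix y :: 'a assume y: "norm y < r"
  show "\<bar>W (z + (y, 0)) - W z - fst (l z) \<bullet> y - (C y \<bullet> y) / 2\<bar> \<le> et * (norm y)^2"
  proof -
   have Cs: "C (s *\<^sub>R y) = s *\<^sub>R C y" for s
   proof -
    have "(s *\<^sub>R y, 0 :: real) = s *\<^sub>R (y, 0)" by auto
    thus ?thesis unfolding C_def by (simp only: inner_scaleR_right scaleR_sum_right scaleR_scaleR)
   qed
   have "\<bar>W (z + (y, 0)) - W z - l z \<bullet> (y, 0) - (C y \<bullet> y) / 2\<bar> \<le> et * (norm y)^2"
   proof (rule semiconvex_taylor[OF lower])
    show "norm (y, 0 :: real) \<le> rh" using y r by (simp add: norm_Pair)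
    fix s :: real assume s: "0 \<le> s" "s \<le> 1"
    show "\<bar>l (z + s *\<^sub>R (y, 0)) \<bullet> (y, 0) - l z \<bullet> (y, 0) - s * (C y \<bullet> y)\<bar> \<le> et * (norm y)^2"
    proof (cases "s *\<^sub>R y = 0")
     case True
     thus ?thesis using et by (auto simp: zero_prod_def[symmetric])
    next
     case False
     have sy: "norm (s *\<^sub>R y) \<le> norm y" using s by (simp add: mult_left_le_one_le)
     define G where "G = fst (l (z + (s *\<^sub>R y, 0))) - fst (l z) - C (s *\<^sub>R y)"
     have "norm G \<le> (\<Sum>b\<in>Basis. \<bar>G \<bullet> b\<bar>)" by (rule norm_le_l1)
     also have "\<dots> \<le> (\<Sum>b\<in>(Basis::'a set). (et / DIM('a)) * norm (s *\<^sub>R y))"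
      unfolding G_def by (intro sum_mono grad) (use sy y False in linarith)+
     also have "\<dots> = et * norm (s *\<^sub>R y)" by simp
     also have "\<dots> \<le> et * norm y" using sy et by (intro mult_left_mono) auto
     finally have "norm G \<le> et * norm y" .
     hence "\<bar>G \<bullet> y\<bar> \<le> et * norm y * norm y"
      using Cauchy_Schwarz_ineq2[of G y] by (meson mult_right_mono norm_ge_zero order_trans)
     moreover have "l (z + s *\<^sub>R (y, 0)) \<bullet> (y, 0) - l z \<bullet> (y, 0) - s * (C y \<bullet> y) = G \<bullet> y"
      by (simp add: G_def Cs inner_diff_left inner_prod_def)
     ultimately show ?thesis by (simp add: power2_eq_square mult.assoc)
    qed
   qed
   thus ?thesis by (simp add: inner_prod_def)
  qed
 qed
qed

text \<open>The measure argument of Jensen's lemma: if every small slope occurs at a contact point,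
  a locally Lipschitz map sends the contact set onto a ball, and the image of a null set would be
  null.\<close>

lemma contact_set_not_negligible:
 fixes D :: "'a::euclidean_space => 'a"
 assumes onto: "ball 0 dl \<subseteq> D ` K" and dl: "0 < dl" and rh: "0 < rh"
  and lip: "!!z1 z2. z1 \<in> K ==> z2 \<in> K ==> norm (z2 - z1) \<le> rh ==> norm (D z2 - D z1) \<le> B * norm (z2 - z1)"
 shows "\<not> negligible K"
proof
 assume K: "negligible K"
 have "negligible (D ` K)"
 proof (rule negligible_locally_Lipschitz_image[OF _ K])
  fix x assume x: "x \<in> K"
  show "\<exists>T B. open T \<and> x \<in> T \<and> (\<forall>y\<in>K \<inter> T. norm (D y - D x) \<le> B * norm (y - x))"
  proof (intro exI conjI ballI)
   show "open (ball x rh)" "x \<in> ball x rh" using rh by auto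
   show "norm (D y - D x) \<le> B * norm (y - x)" if "y \<in> K \<inter> ball x rh" for y
    using that by (intro lip x) (auto simp: dist_norm norm_minus_commute)
  qed
 qed auto
 hence "negligible (ball (0::'a) dl)" using onto negligible_subset by blast
 thus False using dl open_not_negligible[of "ball (0::'a) dl"] by auto
qed

section \<open>Quadratic forms and test functions\<close>

definition quad :: "real ^ 'm ^ 'm => real ^ 'm => real" where
 "quad H a = (H *v a) \<bullet> a"

lemma bounded_bilinear_matrix_vector_mult: "bounded_bilinear ((*v) :: real^'n^'m => real^'n => real^'m)"
 unfolding bilinear_conv_bounded_bilinear[symmetric] bilinear_def
 by (auto intro!: linearI simp: matrix_vector_mult_add_rdistrib matrix_vector_right_distrib
   scaleR_matrix_vector_assoc matrix_vector_mult_scaleR)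

lemmas tendsto_matrix_vector_mult[tendsto_intros] = bounded_bilinear.tendsto[OF bounded_bilinear_matrix_vector_mult]
lemmas continuous_on_matrix_vector_mult[continuous_intros] = bounded_bilinear.continuous_on[OF bounded_bilinear_matrix_vector_mult]

lemma bounded_bilinear_matrix_mult: "bounded_bilinear ((**) :: real^'n^'m => real^'k^'n => real^'k^'m)"
 unfolding bilinear_conv_bounded_bilinear[symmetric] bilinear_def
 by (auto intro!: linearI simp: vec_eq_iff matrix_matrix_mult_def algebra_simps sum.distrib sum_distrib_left)

lemmas tendsto_matrix_mult[tendsto_intros] = bounded_bilinear.tendsto[OF bounded_bilinear_matrix_mult]
lemmas continuous_on_matrix_mult[continuous_intros] = bounded_bilinear.continuous_on[OF bounded_bilinear_matrix_mult]

lemma transpose_vec_inner: "(transpose A *v d) \<bullet> e = d \<bullet> (A *v (e :: real^'n))" for A :: "real^'n^'m"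
 by (metis dot_lmul_matrix transpose_matrix_vector inner_commute)

lemma quad_scale: "quad H (c *\<^sub>R a) = c^2 * quad H a"
 by (simp add: quad_def matrix_vector_mult_scaleR power2_eq_square)

lemma quad_minus: "quad H (- a) = quad H a"
 using quad_scale[of H "-1" a] by simp

lemma quad_add: "quad (A + B) a = quad A a + quad B a"
 by (simp add: quad_def matrix_vector_mult_add_rdistrib inner_add_left)

lemma quad_scaleR: "quad (c *\<^sub>R A) a = c * quad A a"
 by (simp add: quad_def scaleR_matrix_vector_assoc[symmetric])

lemma quad_mat_1: "quad (mat c) a = c * (norm a)^2"
proof -
 have "mat c *v a = c *\<^sub>R a" by (simp add: vec_eq_iff matrix_vector_mult_def mat_def if_distrib if_distribR sum.delta cong: if_cong)
 thus ?thesis by (simp add: quad_def power2_norm_eq_inner)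
qed

lemma quad_tendsto [tendsto_intros]:
 "(H \<longlongrightarrow> H0) F ==> (a \<longlongrightarrow> a0) F ==> ((\<lambda>i. quad (H i) (a i)) \<longlongrightarrow> quad H0 a0) F"
 unfolding quad_def by (intro tendsto_intros)

lemma test_function_subset: "is_test_function N ph pht g H ==> N' \<subseteq> N ==> is_test_function N' ph pht g H"
 unfolding is_test_function_def by (auto intro: continuous_on_subset)

lemma test_function_add:
 assumes "is_test_function N ph pht g H" "is_test_function N ps pst k J"
 shows "is_test_function N (\<lambda>z. ph z + ps z) (\<lambda>z. pht z + pst z) (\<lambda>z. g z + k z) (\<lambda>z. H z + J z)"
 using assms unfolding is_test_function_def
 by (fastforce intro!: continuous_intros derivative_eq_intros simp: inner_add_left matrix_vector_mult_add_rdistrib)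

lemma test_function_scale:
 assumes "is_test_function N ph pht g H"
 shows "is_test_function N (\<lambda>z. c * ph z) (\<lambda>z. c * pht z) (\<lambda>z. c *\<^sub>R g z) (\<lambda>z. c *\<^sub>R H z)"
 using assms unfolding is_test_function_def
 by (fastforce intro!: continuous_intros derivative_eq_intros simp: scaleR_matrix_vector_assoc[symmetric])

lemma test_function_time:
 assumes "!!t. t \<in> snd ` N ==> (h has_real_derivative h' t) (at t)" "continuous_on (snd ` N) h'"
 shows "is_test_function N (\<lambda>(x, t). h t) (\<lambda>(x, t). h' t) (\<lambda>_. 0) (\<lambda>_. 0)"
 using assms unfolding is_test_function_def case_prod_unfold
 by (auto intro!: continuous_intros derivative_eq_intros continuous_on_compose2[OF assms(2)] simp: image_iff)

lemma outer_vec: "(\<chi> i j. a $ i * b $ j) *v c = (b \<bullet> c) *\<^sub>R (a :: real^'m)"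
 by (simp add: vec_eq_iff matrix_vector_mult_def inner_vec_def sum_distrib_right mult_ac sum_distrib_left)

lemma mat_vec: "mat c *v a = c *\<^sub>R (a :: real^'m)"
 by (simp add: vec_eq_iff matrix_vector_mult_def mat_def if_distrib if_distribR sum.delta cong: if_cong)

lemma test_function_norm4:
 "is_test_function N (\<lambda>(x, t). ((x - x0) \<bullet> (x - x0))^2) (\<lambda>_. 0) (\<lambda>(x, t). (4 * ((x - x0) \<bullet> (x - x0))) *\<^sub>R (x - x0))
  (\<lambda>(x, t). (4 * ((x - x0) \<bullet> (x - x0))) *\<^sub>R mat 1 + 8 *\<^sub>R (\<chi> i j. (x - x0) $ i * (x - x0) $ j))"
proof -
 have 1: "((\<lambda>y. ((y - x0) \<bullet> (y - x0))^2) has_derivative (\<lambda>h. ((4 * ((x - x0) \<bullet> (x - x0))) *\<^sub>R (x - x0)) \<bullet> h)) (at x)" for x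
  by (auto intro!: derivative_eq_intros simp: fun_eq_iff inner_commute)
 have 2: "((\<lambda>y. (4 * ((y - x0) \<bullet> (y - x0))) *\<^sub>R (y - x0)) has_derivative
   (\<lambda>h. ((4 * ((x - x0) \<bullet> (x - x0))) *\<^sub>R mat 1 + 8 *\<^sub>R (\<chi> i j. (x - x0) $ i * (x - x0) $ j)) *v h)) (at x)" for x
  by (auto intro!: derivative_eq_intros simp: fun_eq_iff inner_commute matrix_vector_mult_add_rdistrib
    scaleR_matrix_vector_assoc[symmetric] outer_vec[of "x - x0" "x - x0", simplified] mat_vec)
 show ?thesis
  unfolding is_test_function_def case_prod_unfold
  apply (intro conjI ballI)
  subgoal by (auto intro!: derivative_eq_intros)
  subgoal using 1 by (simp only: fst_conv snd_conv)
  subgoal using 2 by (simp only: fst_conv snd_conv)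
  by (auto intro!: continuous_intros)
qed

lemma test_function_quadratic:
 assumes "transpose C = C"
 shows "is_test_function N (\<lambda>(x, t). p \<bullet> (x - x0) + quad C (x - x0) / 2) (\<lambda>_. 0) (\<lambda>(x, t). p + C *v (x - x0)) (\<lambda>_. C)"
proof -
 have s: "(C *v a) \<bullet> b = (C *v b) \<bullet> a" for a b
  using transpose_vec_inner[of C a b] assms by (simp add: inner_commute)
 show ?thesis
  unfolding is_test_function_def case_prod_unfold quad_def
  apply (intro conjI ballI)
  subgoal by (auto intro!: derivative_eq_intros)
  subgoal for z
   apply (rule has_derivative_eq_rhs)
   apply (rule derivative_intros bounded_bilinear.FDERIV[OF bounded_bilinear_matrix_vector_mult] | simp)+
   apply (auto simp: fun_eq_iff inner_add_left s[of "fst z - x0"])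
   done
  subgoal for z
   apply (rule has_derivative_eq_rhs)
   apply (rule derivative_intros bounded_bilinear.FDERIV[OF bounded_bilinear_matrix_vector_mult] | simp)+
   done
  by (auto intro!: continuous_intros)
qed

lemma test_function_line:
 assumes "is_test_function N ph pht g H" "(x + s *\<^sub>R a, t) \<in> N"
 shows "((\<lambda>s. ph (x + s *\<^sub>R a, t)) has_real_derivative g (x + s *\<^sub>R a, t) \<bullet> a) (at s)"
  "((\<lambda>s. g (x + s *\<^sub>R a, t) \<bullet> b) has_real_derivative (H (x + s *\<^sub>R a, t) *v a) \<bullet> b) (at s)"
proof -
 have d: "((\<lambda>y. ph (y, t)) has_derivative (\<lambda>h. g (x + s *\<^sub>R a, t) \<bullet> h)) (at (x + s *\<^sub>R a))"
  "((\<lambda>y. g (y, t)) has_derivative (\<lambda>h. H (x + s *\<^sub>R a, t) *v h)) (at (x + s *\<^sub>R a))"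
  using assms unfolding is_test_function_def by auto
 have l: "((\<lambda>s. x + s *\<^sub>R a) has_derivative (\<lambda>r. r *\<^sub>R a)) (at s)"
  by (auto intro!: derivative_eq_intros)
 show "((\<lambda>s. ph (x + s *\<^sub>R a, t)) has_real_derivative g (x + s *\<^sub>R a, t) \<bullet> a) (at s)"
  using has_derivative_compose[OF l d(1)] by (simp add: has_field_derivative_def mult.commute[of _ "g _ \<bullet> a"])
 have "((\<lambda>s. g (x + s *\<^sub>R a, t) \<bullet> b) has_derivative (\<lambda>r. (H (x + s *\<^sub>R a, t) *v (r *\<^sub>R a)) \<bullet> b)) (at s)"
  by (intro derivative_intros has_derivative_compose[OF l d(2)])
 thus "((\<lambda>s. g (x + s *\<^sub>R a, t) \<bullet> b) has_real_derivative (H (x + s *\<^sub>R a, t) *v a) \<bullet> b) (at s)"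
  by (simp add: has_field_derivative_def matrix_vector_mult_scaleR mult.commute[of _ "(_ *v a) \<bullet> b"])
qed

text \<open>Schwarz's theorem. The second difference of \<open>ph\<close> over a small parallelogram
  is \<open>s * s\<close> times a mixed second derivative at one of its points, in either order of
  the sides, and \<open>H\<close> is continuous. Symmetry matters because the envelopes of
  \<open>mcf_F\<close> approach through symmetric matrices only.\<close>

lemma test_function_hessian_symmetric:
 fixes ph :: "(real^'m) \<times> real => real"
 assumes T: "is_test_function N ph pht g H" and N: "open N" "(x, t) \<in> N"
 shows "transpose (H (x, t)) = H (x, t)"
proof -
 have cont: "continuous (at (x, t)) H"
  using T N unfolding is_test_function_def by (simp add: continuous_on_eq_continuous_at)
 have sym: "(H (x, t) *v a) \<bullet> b = (H (x, t) *v b) \<bullet> a" for a b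
 proof (rule ccontr)
  assume ne: "(H (x, t) *v a) \<bullet> b \<noteq> (H (x, t) *v b) \<bullet> a"
  define e where "e = \<bar>(H (x, t) *v a) \<bullet> b - (H (x, t) *v b) \<bullet> a\<bar> / 2"
  have e: "e > 0" using ne by (simp add: e_def)
  have "(H \<longlongrightarrow> H (x, t)) (nhds (x, t))"
   using cont unfolding isCont_def tendsto_at_iff_tendsto_nhds .
  hence c: "((\<lambda>z. (H z *v a) \<bullet> b) \<longlongrightarrow> (H (x, t) *v a) \<bullet> b) (nhds (x, t))" "((\<lambda>z. (H z *v b) \<bullet> a) \<longlongrightarrow> (H (x, t) *v b) \<bullet> a) (nhds (x, t))"
   by (auto intro!: tendsto_intros)
  have "\<forall>\<^sub>F z in nhds (x, t). \<bar>(H z *v a) \<bullet> b - (H (x, t) *v a) \<bullet> b\<bar> < e" "\<forall>\<^sub>F z in nhds (x, t). \<bar>(H z *v b) \<bullet> a - (H (x, t) *v b) \<bullet> a\<bar> < e"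
   using c e unfolding tendsto_iff dist_real_def by blast+
  moreover have "\<forall>\<^sub>F z in nhds (x, t). z \<in> N" using N by (simp add: eventually_nhds_in_open)
  ultimately have "\<forall>\<^sub>F z in nhds (x, t). z \<in> N \<and> \<bar>(H z *v a) \<bullet> b - (H (x, t) *v a) \<bullet> b\<bar> < e \<and> \<bar>(H z *v b) \<bullet> a - (H (x, t) *v b) \<bullet> a\<bar> < e"
   by eventually_elim auto
  then obtain d where d: "d > 0" "!!z. dist z (x, t) < d ==> z \<in> N \<and> \<bar>(H z *v a) \<bullet> b - (H (x, t) *v a) \<bullet> b\<bar> < e \<and> \<bar>(H z *v b) \<bullet> a - (H (x, t) *v b) \<bullet> a\<bar> < e"
   unfolding eventually_nhds_metric by auto
  have k0: "norm a + norm b + 1 > 0" by (simp add: add_nonneg_pos)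
  define s where "s = d / (2 * (norm a + norm b + 1))"
  have s: "s > 0" using d by (simp add: s_def add_nonneg_pos)
  have near: "dist (x + p *\<^sub>R a + q *\<^sub>R b, t) (x, t) < d" if "0 \<le> p" "p \<le> s" "0 \<le> q" "q \<le> s" for p q
  proof -
   have "norm (p *\<^sub>R a + q *\<^sub>R b) \<le> s * norm a + s * norm b"
    using that by (intro norm_triangle_le add_mono) (auto intro: mult_right_mono)
   also have "\<dots> \<le> s * (norm a + norm b + 1)" using s by (simp add: algebra_simps)
   also have "\<dots> = d / 2" using k0 unfolding s_def
    by (metis (no_types, opaque_lifting) divide_divide_eq_left less_irrefl nonzero_eq_divide_eq)
   finally show ?thesis using d by (simp add: dist_Pair_Pair dist_norm add.assoc)
  qed
  have key: "\<exists>p q. 0 \<le> p \<and> p \<le> s \<and> 0 \<le> q \<and> q \<le> s \<and>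
    ph (x + s *\<^sub>R u + s *\<^sub>R v, t) - ph (x + s *\<^sub>R u, t) - ph (x + s *\<^sub>R v, t) + ph (x, t) = s * (s * ((H (x + p *\<^sub>R u + q *\<^sub>R v, t) *v v) \<bullet> u))"
   if near': "!!p q. 0 \<le> p ==> p \<le> s ==> 0 \<le> q ==> q \<le> s ==> (x + p *\<^sub>R u + q *\<^sub>R v, t) \<in> N" for u v
  proof -
   define F where "F p = ph (x + s *\<^sub>R v + p *\<^sub>R u, t) - ph (x + p *\<^sub>R u, t)" for p
   have "\<exists>p>0. p < s \<and> F s - F 0 = (s - 0) * (g (x + s *\<^sub>R v + p *\<^sub>R u, t) \<bullet> u - g (x + p *\<^sub>R u, t) \<bullet> u)"
   proof (rule MVT2[OF s])
    fix p assume p: "0 \<le> p" "p \<le> s"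
    show "(F has_real_derivative g (x + s *\<^sub>R v + p *\<^sub>R u, t) \<bullet> u - g (x + p *\<^sub>R u, t) \<bullet> u) (at p)"
     unfolding F_def using near'[OF p, of s] near'[OF p, of 0] s
     by (intro DERIV_diff test_function_line(1)[OF T]) (auto simp: algebra_simps)
   qed
   then obtain p where p: "0 < p" "p < s" "F s - F 0 = s * (g (x + s *\<^sub>R v + p *\<^sub>R u, t) \<bullet> u - g (x + p *\<^sub>R u, t) \<bullet> u)" by auto
   have "\<exists>q>0. q < s \<and> g (x + p *\<^sub>R u + s *\<^sub>R v, t) \<bullet> u - g (x + p *\<^sub>R u + 0 *\<^sub>R v, t) \<bullet> u = (s - 0) * ((H (x + p *\<^sub>R u + q *\<^sub>R v, t) *v v) \<bullet> u)"
    by (rule MVT2[OF s, of "\<lambda>q. g (x + p *\<^sub>R u + q *\<^sub>R v, t) \<bullet> u"]) (use near' p in \<open>auto intro!: test_function_line(2)[OF T]\<close>)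
   then obtain q where "0 < q" "q < s" "g (x + p *\<^sub>R u + s *\<^sub>R v, t) \<bullet> u - g (x + p *\<^sub>R u, t) \<bullet> u = s * ((H (x + p *\<^sub>R u + q *\<^sub>R v, t) *v v) \<bullet> u)" by auto
   thus ?thesis using p by (intro exI[of _ p] exI[of _ q]) (auto simp: F_def algebra_simps)
  qed
  obtain p q where pq: "0 \<le> p" "p \<le> s" "0 \<le> q" "q \<le> s" "ph (x + s *\<^sub>R a + s *\<^sub>R b, t) - ph (x + s *\<^sub>R a, t) - ph (x + s *\<^sub>R b, t) + ph (x, t) = s * (s * ((H (x + p *\<^sub>R a + q *\<^sub>R b, t) *v b) \<bullet> a))"
   using key[of a b] near d(2) by meson
  have near2: "dist (x + p *\<^sub>R b + q *\<^sub>R a, t) (x, t) < d" if "0 \<le> p" "p \<le> s" "0 \<le> q" "q \<le> s" for p q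
   using near[of q p] that by (simp add: add_ac)
  obtain p' q' where pq': "0 \<le> p'" "p' \<le> s" "0 \<le> q'" "q' \<le> s" "ph (x + s *\<^sub>R b + s *\<^sub>R a, t) - ph (x + s *\<^sub>R b, t) - ph (x + s *\<^sub>R a, t) + ph (x, t) = s * (s * ((H (x + p' *\<^sub>R b + q' *\<^sub>R a, t) *v a) \<bullet> b))"
   using key[of b a] near2 d(2) by meson
  have "s * (s * ((H (x + p *\<^sub>R a + q *\<^sub>R b, t) *v b) \<bullet> a)) = s * (s * ((H (x + p' *\<^sub>R b + q' *\<^sub>R a, t) *v a) \<bullet> b))"
   unfolding pq(5)[symmetric] pq'(5)[symmetric] by (simp add: algebra_simps)
  hence "(H (x + p *\<^sub>R a + q *\<^sub>R b, t) *v b) \<bullet> a = (H (x + p' *\<^sub>R b + q' *\<^sub>R a, t) *v a) \<bullet> b" using s by simp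
  moreover have "\<bar>(H (x + p *\<^sub>R a + q *\<^sub>R b, t) *v b) \<bullet> a - (H (x, t) *v b) \<bullet> a\<bar> < e"
   using d(2)[OF near[OF pq(1-4)]] by simp
  moreover have "\<bar>(H (x + p' *\<^sub>R b + q' *\<^sub>R a, t) *v a) \<bullet> b - (H (x, t) *v a) \<bullet> b\<bar> < e"
   using d(2)[OF near2[OF pq'(1-4)]] by simp
  ultimately have "\<bar>(H (x, t) *v a) \<bullet> b - (H (x, t) *v b) \<bullet> a\<bar> < 2 * e" by linarith
  thus False unfolding e_def by simp
 qed
 have "transpose (H (x, t)) *v a = H (x, t) *v a" for a
 proof -
  have "(transpose (H (x, t)) *v a) \<bullet> z = (H (x, t) *v a) \<bullet> z" for z
   unfolding transpose_vec_inner using sym[of a z] by (metis inner_commute)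
  thus ?thesis by (metis vector_eq_rdot)
 qed
 thus ?thesis by (simp add: matrix_eq)
qed

text \<open>Parabolic scaling: time \<open>h\<close>, displacement \<open>sqrt h\<close>. The
  gradient is taken at the moving point \<open>(x, t)\<close> because freezing it at
  \<open>z0\<close> would cost \<open>sqrt h\<close> times a small number, which is not small
  compared with \<open>h\<close>; the other coefficients may be frozen.\<close>

lemma test_function_taylor:
 fixes ph :: "(real^'m) \<times> real => real"
 assumes T: "is_test_function N ph pht g H" and N: "open N" "z0 \<in> N" and eps: "0 < eps" and R: "0 < R"
 obtains dl where "0 < dl" "!!x t a h. dist (x :: real^'m, t) z0 < dl ==> norm a \<le> R ==> 0 < h ==> h < dl ==>
  \<bar>ph (x + sqrt h *\<^sub>R a, t + h) - ph (x, t) - sqrt h * (g (x, t) \<bullet> a) - h * (pht z0 + quad (H z0) a / 2)\<bar> \<le> eps * h"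
proof -
 have e0: "1 + R^2 > 0" by (simp add: add_pos_nonneg)
 define eps' where "eps' = eps / (2 * (1 + R^2))"
 have e1: "eps' > 0" using eps by (simp add: eps'_def add_pos_nonneg)
 have e2: "eps' + eps' * R^2 \<le> eps"
 proof -
  have "eps' + eps' * R^2 = eps' * (1 + R^2)" by (simp add: algebra_simps)
  also have "\<dots> = eps / 2" using e0 unfolding eps'_def by (metis (no_types, opaque_lifting) divide_divide_eq_left less_irrefl nonzero_eq_divide_eq)
  finally show ?thesis using eps by simp
 qed
 have cont: "continuous (at z0) pht" "continuous (at z0) H"
  using T N unfolding is_test_function_def by (auto simp: continuous_on_eq_continuous_at)
 obtain B where B: "B > 0" "!!A x. norm ((A :: real^'m^'m) *v x) \<le> norm A * norm x * B"
  using bounded_bilinear.pos_bounded[OF bounded_bilinear_matrix_vector_mult] by blast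
 have qb: "\<bar>quad A a - quad A' a\<bar> \<le> norm (A - A') * B * (norm a)^2" for A A' :: "real^'m^'m" and a
 proof -
  have "quad A a - quad A' a = ((A - A') *v a) \<bullet> a" by (simp add: quad_def matrix_vector_mult_diff_rdistrib inner_diff_left)
  also have "\<bar>\<dots>\<bar> \<le> norm ((A - A') *v a) * norm a" by (rule Cauchy_Schwarz_ineq2)
  also have "\<dots> \<le> (norm (A - A') * norm a * B) * norm a" by (intro mult_right_mono B) auto
  finally show ?thesis by (simp add: power2_eq_square mult_ac)
 qed
 have "\<forall>\<^sub>F z in nhds z0. \<bar>pht z - pht z0\<bar> < eps'" "\<forall>\<^sub>F z in nhds z0. norm (H z - H z0) < eps' / B"
 proof -
  have "(pht \<longlongrightarrow> pht z0) (nhds z0)" "(H \<longlongrightarrow> H z0) (nhds z0)"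
   using cont unfolding isCont_def tendsto_at_iff_tendsto_nhds .
  thus "\<forall>\<^sub>F z in nhds z0. \<bar>pht z - pht z0\<bar> < eps'" "\<forall>\<^sub>F z in nhds z0. norm (H z - H z0) < eps' / B"
   using e1 B(1) unfolding tendsto_iff dist_norm real_norm_def by simp_all
 qed
 moreover have "\<forall>\<^sub>F z in nhds z0. z \<in> N" using N by (simp add: eventually_nhds_in_open)
 ultimately have "\<forall>\<^sub>F z in nhds z0. z \<in> N \<and> \<bar>pht z - pht z0\<bar> < eps' \<and> norm (H z - H z0) < eps' / B"
  by eventually_elim auto
 then obtain d where d: "d > 0" "!!z. dist z z0 < d ==> z \<in> N \<and> \<bar>pht z - pht z0\<bar> < eps' \<and> norm (H z - H z0) < eps' / B"
  unfolding eventually_nhds_metric by auto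
 define dl where "dl = min (d/4) ((d / (4 * R))^2)"
 show thesis
 proof (rule that[of dl])
  show "dl > 0" using d R by (simp add: dl_def)
  fix x a :: "real^'m" and t h assume xt: "dist (x, t) z0 < dl" and a: "norm a \<le> R" and h: "0 < h" "h < dl"
  have sh: "sqrt h > 0" "sqrt h * R < d / 4"
  proof -
   have "sqrt h < sqrt ((d / (4 * R))^2)" using h by (subst real_sqrt_less_iff) (simp add: dl_def)
   also have "\<dots> = d / (4 * R)" using d R by (intro real_sqrt_abs[THEN trans]) simp
   finally have "sqrt h < d / (4 * R)" .
   thus "sqrt h * R < d / 4" using R by (simp add: field_simps)
  qed (use h in simp)
  have near: "dist (x + (s * sqrt h) *\<^sub>R a, t + r) z0 < d" if "0 \<le> s" "s \<le> 1" "0 \<le> r" "r \<le> h" for s r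
  proof -
   have "dist (x + (s * sqrt h) *\<^sub>R a, t + r) (x, t) \<le> norm ((s * sqrt h) *\<^sub>R a) + norm r"
    using norm_Pair_le[of "(s * sqrt h) *\<^sub>R a" r] by (simp add: dist_norm)
   also have "norm ((s * sqrt h) *\<^sub>R a) \<le> sqrt h * R"
   proof -
    have "s * norm a \<le> R" using that a mult_left_le_one_le[of "norm a" s] norm_ge_zero[of a] by linarith
    hence "sqrt h * (s * norm a) \<le> sqrt h * R" using sh by (intro mult_left_mono) auto
    thus ?thesis using that sh by (simp add: mult_ac)
   qed
   finally have "dist (x + (s * sqrt h) *\<^sub>R a, t + r) (x, t) < d / 4 + d / 4"
    using sh that h by (simp add: dl_def)
   thus ?thesis using xt d(1) dist_triangle[of "(x + (s * sqrt h) *\<^sub>R a, t + r)" z0 "(x, t)"] by (simp add: dl_def)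
  qed
  define b where "b = sqrt h *\<^sub>R a"
  have qh: "quad A b = h * quad A a" for A using h by (simp add: b_def quad_scale)
  have near1: "dist (x + s *\<^sub>R b, t + r) z0 < d" if "0 \<le> s" "s \<le> 1" "0 \<le> r" "r \<le> h" for s r
   using near[OF that] by (simp add: b_def)
  \<comment> \<open>time increment at the shifted point, then a second order expansion in space\<close>
  have "\<exists>r>t. r < t + h \<and> ph (x + b, t + h) - ph (x + b, t) = (t + h - t) * pht (x + b, r)"
  proof (rule MVT2)
   fix r assume r: "t \<le> r" "r \<le> t + h"
   have "(x + b, r) \<in> N" using d(2)[OF near1[of 1 "r - t"]] r by simp
   thus "((\<lambda>s. ph (x + b, s)) has_real_derivative pht (x + b, r)) (at r)"
    using T unfolding is_test_function_def by auto
  qed (use h in simp)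
  then obtain r where r: "t < r" "r < t + h" "ph (x + b, t + h) - ph (x + b, t) = h * pht (x + b, r)" by auto
  have 1: "\<bar>ph (x + b, t + h) - ph (x + b, t) - h * pht z0\<bar> \<le> h * eps'"
  proof -
   have "\<bar>pht (x + b, r) - pht z0\<bar> < eps'" using d(2)[OF near1[of 1 "r - t"]] r by simp
   hence "h * \<bar>pht (x + b, r) - pht z0\<bar> \<le> h * eps'" using h by simp
   thus ?thesis using h unfolding r(3) by (simp add: abs_mult[symmetric] right_diff_distrib[symmetric] abs_mult)
  qed
  define D where "D m s = (if m = 0 then ph (x + s *\<^sub>R b, t) else if m = 1 then g (x + s *\<^sub>R b, t) \<bullet> b else quad (H (x + s *\<^sub>R b, t)) b)" for m :: nat and s
  have "\<exists>s>0. s < 1 \<and> ph (x + 1 *\<^sub>R b, t) = (\<Sum>m<2. D m 0 / fact m * 1 ^ m) + D 2 s / fact 2 * 1 ^ 2"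
  proof (rule Maclaurin)
   show "\<forall>m s. m < 2 \<and> 0 \<le> s \<and> s \<le> 1 --> (D m has_real_derivative D (Suc m) s) (at s)"
   proof (intro allI impI)
    fix m :: nat and s :: real assume ms: "m < 2 \<and> 0 \<le> s \<and> s \<le> 1"
    have inN: "(x + s *\<^sub>R b, t) \<in> N" using d(2)[OF near1[of s 0]] ms h by simp
    show "(D m has_real_derivative D (Suc m) s) (at s)"
     using ms test_function_line[OF T inN] by (cases m) (auto simp: D_def[abs_def] quad_def less_Suc_eq numeral_2_eq_2)
   qed
  qed (auto simp: D_def)
  then obtain s where s: "0 < s" "s < 1" "ph (x + b, t) = ph (x, t) + g (x, t) \<bullet> b + quad (H (x + s *\<^sub>R b, t)) b / 2"
   by (auto simp: D_def numeral_2_eq_2)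
  have 2: "\<bar>ph (x + b, t) - ph (x, t) - g (x, t) \<bullet> b - quad (H z0) b / 2\<bar> \<le> h * (eps' * R^2)"
  proof -
   have "norm (H (x + s *\<^sub>R b, t) - H z0) < eps' / B" using d(2)[OF near1[of s 0]] s h by simp
   hence "norm (H (x + s *\<^sub>R b, t) - H z0) * B \<le> eps'" using B by (simp add: pos_less_divide_eq)
   have "\<bar>quad (H (x + s *\<^sub>R b, t)) b - quad (H z0) b\<bar> = h * \<bar>quad (H (x + s *\<^sub>R b, t)) a - quad (H z0) a\<bar>"
    using h by (simp add: qh right_diff_distrib[symmetric] abs_mult)
   also have "\<dots> \<le> h * (norm (H (x + s *\<^sub>R b, t) - H z0) * B * (norm a)^2)" using h by (intro mult_left_mono qb) auto
   also have "\<dots> \<le> h * (eps' * R^2)"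
    using h a e1 \<open>_ * B \<le> eps'\<close> B by (intro mult_left_mono mult_mono power_mono) auto
   finally show ?thesis unfolding s(3) using e1 h by (auto simp: abs_if split: if_splits)
  qed
  have "g (x, t) \<bullet> b = sqrt h * (g (x, t) \<bullet> a)" by (simp add: b_def)
  hence "\<bar>ph (x + sqrt h *\<^sub>R a, t + h) - ph (x, t) - sqrt h * (g (x, t) \<bullet> a) - h * (pht z0 + quad (H z0) a / 2)\<bar>
    \<le> h * eps' + h * (eps' * R^2)"
   using 1 2 unfolding b_def[symmetric] by (simp add: qh algebra_simps)
  also have "\<dots> = h * (eps' + eps' * R^2)" by (simp add: algebra_simps)
  also have "\<dots> \<le> eps * h" using e2 h by (simp add: mult.commute)
  finally show "\<bar>ph (x + sqrt h *\<^sub>R a, t + h) - ph (x, t) - sqrt h * (g (x, t) \<bullet> a) - h * (pht z0 + quad (H z0) a / 2)\<bar> \<le> eps * h" .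
 qed
qed

section \<open>The game scheme and its half-relaxed limits\<close>

lemma finite_sign_vectors: "finite (sign_vectors :: (real^'n) set)"
proof -
 have "sign_vectors \<subseteq> (\<lambda>f. \<chi> j. f j) ` (PiE (UNIV :: 'n set) (\<lambda>_. {-1, 1 :: real}))"
 proof
  fix e :: "real^'n" assume "e \<in> sign_vectors"
  hence "(\<lambda>j. e $ j) \<in> PiE UNIV (\<lambda>_. {-1, 1})" "e = (\<chi> j. e $ j)"
   by (auto simp: sign_vectors_def)
  thus "e \<in> (\<lambda>f. \<chi> j. f j) ` (PiE UNIV (\<lambda>_. {-1, 1}))" by (intro image_eqI[of e _ "\<lambda>j. e $ j"])
 qed
 thus ?thesis by (rule finite_subset) (intro finite_imageI finite_PiE; simp)
qed

lemma one_sign_vector: "(\<chi> j. 1) \<in> sign_vectors"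
 by (simp add: sign_vectors_def)

lemma sign_vectors_nonempty: "sign_vectors \<noteq> {}"
 using one_sign_vector by blast

lemma minus_sign_vector: "e \<in> sign_vectors ==> - e \<in> sign_vectors"
 unfolding sign_vectors_def by (auto simp: minus_equation_iff) (metis minus_equation_iff)+

lemma sign_vectors_orthogonal:
 assumes "!!e. e \<in> sign_vectors ==> v \<bullet> e = 0"
 shows "v = (0 :: real^'n)"
proof (rule vec_eq_iff[THEN iffD2], rule allI)
 fix j
 define e :: "real^'n" where "e = (\<chi> i. 1)"
 define e' where "e' = e - axis j 2"
 have "e' \<in> sign_vectors" by (auto simp: sign_vectors_def e'_def e_def axis_def)
 hence "v \<bullet> (e - e') = 0" using assms[of e] assms[of e'] one_sign_vector by (simp add: inner_diff_right e_def)
 thus "v $ j = 0 $ j" by (simp add: e'_def inner_axis)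
qed

definition game_step :: "(real^'n^'m) set => (real^'m => real) => real^'m => real" where
 "game_step AA g x = (SUP A\<in>AA. Min ((\<lambda>e. g (x + A *v e)) ` sign_vectors))"

text \<open>The later limit and comparison arguments turn matrices tangent to one direction into
  matrices tangent to a nearby one; the displacement must therefore be linear in
  \<open>norm (d - d')\<close>. Distance at most 1 keeps \<open>1 + c\<close> above
  \<open>3 / 2\<close>, and the constant is \<open>6 / (3 / 2)\<close>.\<close>

lemma rotation_between_unit_vectors:
 fixes d d' :: "'a::euclidean_space"
 assumes d: "norm d = 1" "norm d' = 1" "norm (d - d') \<le> 1"
 obtains Q where "orthogonal_transformation Q" "Q d = d'" "!!x. norm (Q x - x) \<le> 4 * norm (d - d') * norm x"
proof -
 have dd: "d \<bullet> d = 1" "d' \<bullet> d' = 1" using d by (simp_all add: norm_eq_1)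
 define c where "c = d \<bullet> d'"
 have c: "(norm (d - d'))^2 = 2 - 2 * c"
  by (simp add: power2_norm_eq_inner inner_diff_left inner_diff_right dd c_def inner_commute)
 have "(norm (d - d'))^2 \<le> 1" using d(3) by (simp add: power_le_one)
 hence c1: "c \<ge> 1/2" using c by simp
 define s where "s = d + d'"
 have s: "s \<bullet> d = 1 + c" "s \<bullet> d' = 1 + c" "s \<bullet> s = 2 * (1 + c)"
  by (auto simp: s_def c_def inner_add_left inner_add_right dd inner_commute)
 \<comment> \<open>Composition of two reflections: first in the hyperplane orthogonal to
   \<open>d\<close>, then in the one orthogonal to \<open>s\<close>.\<close>
 define Q where "Q x = x - ((s \<bullet> x) / (1 + c)) *\<^sub>R s + (2 * (d \<bullet> x)) *\<^sub>R d'" for x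
 have lin: "linear Q"
  by (rule linearI) (auto simp: Q_def inner_add_right algebra_simps add_divide_distrib)
 have "Q x \<bullet> Q x = x \<bullet> x" for x
 proof -
  define a where "a = (s \<bullet> x) / (1 + c)"
  have sx: "s \<bullet> x = a * (1 + c)" using c1 by (simp add: a_def)
  have d'x: "d' \<bullet> x = s \<bullet> x - d \<bullet> x" by (simp add: s_def inner_add_left)
  have "Q x \<bullet> Q x = x \<bullet> x + a^2 * (s \<bullet> s) + 4 * (d \<bullet> x)^2 - 2 * a * (s \<bullet> x) + 4 * (d \<bullet> x) * (d' \<bullet> x) - 4 * a * (d \<bullet> x) * (s \<bullet> d')"
   unfolding Q_def a_def[symmetric]
   by (simp add: inner_add_left inner_add_right inner_diff_left inner_diff_right dd inner_commute power2_eq_square algebra_simps)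
  also have "\<dots> = x \<bullet> x" unfolding s(2,3) d'x sx by (simp add: power2_eq_square algebra_simps)
  finally show ?thesis .
 qed
 hence "orthogonal_transformation Q"
  using lin by (simp add: orthogonal_transformation norm_eq_sqrt_inner)
 moreover have "Q d = d'"
  using c1 by (simp add: Q_def s dd) (simp add: s_def algebra_simps scaleR_2)
 moreover have "norm (Q x - x) \<le> 4 * norm (d - d') * norm x" for x
 proof -
  define dl where "dl = d - d'"
  have dl1: "norm dl \<le> 1" using d by (simp add: dl_def)
  have n2: "(norm dl)^2 = 2 - 2 * c" using c by (simp add: dl_def)
  have "(1 + c) *\<^sub>R (Q x - x) = (- ((norm dl)^2 * (d \<bullet> x)) + 2 * (dl \<bullet> x)) *\<^sub>R d' + (dl \<bullet> x - 2 * (d \<bullet> x)) *\<^sub>R dl"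
  proof -
   have sx: "s \<bullet> x = 2 * (d \<bullet> x) - dl \<bullet> x" by (simp add: s_def dl_def inner_add_left inner_diff_left)
   have s': "s = 2 *\<^sub>R d' + dl" by (simp add: s_def dl_def scaleR_2)
   have "(1 + c) *\<^sub>R (Q x - x) = - (s \<bullet> x) *\<^sub>R s + (2 * (1 + c) * (d \<bullet> x)) *\<^sub>R d'"
   proof -
    have "Q x - x = (2 * (d \<bullet> x)) *\<^sub>R d' - ((s \<bullet> x) / (1 + c)) *\<^sub>R s" by (simp add: Q_def)
    moreover have "(1 + c) * ((s \<bullet> x) / (1 + c)) = s \<bullet> x" using c1 by simp
    ultimately show ?thesis by (simp only: scaleR_right_diff_distrib scaleR_scaleR) (simp add: mult_ac)
   qed
   also have "2 * (1 + c) = 4 - (norm dl)^2" using n2 by simp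
   finally show ?thesis unfolding sx unfolding s' by (simp add: algebra_simps)
  qed
  hence "(1 + c) * norm (Q x - x) = norm ((- ((norm dl)^2 * (d \<bullet> x)) + 2 * (dl \<bullet> x)) *\<^sub>R d' + (dl \<bullet> x - 2 * (d \<bullet> x)) *\<^sub>R dl)"
   using c1 by (metis abs_of_nonneg add_nonneg_nonneg norm_scaleR order_trans zero_le_divide_1_iff zero_le_numeral zero_le_one)
  also have "\<dots> \<le> \<bar>- ((norm dl)^2 * (d \<bullet> x)) + 2 * (dl \<bullet> x)\<bar> + \<bar>dl \<bullet> x - 2 * (d \<bullet> x)\<bar> * norm dl"
   using norm_triangle_ineq d by (metis norm_scaleR mult.right_neutral)
  also have "\<dots> \<le> (norm dl * norm x + 2 * (norm dl * norm x)) + (norm x + 2 * norm x) * norm dl"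
  proof (intro add_mono mult_right_mono order_trans[OF abs_triangle_ineq] order_trans[OF abs_triangle_ineq4])
   have dx: "\<bar>d \<bullet> x\<bar> \<le> norm x" "\<bar>dl \<bullet> x\<bar> \<le> norm dl * norm x" using Cauchy_Schwarz_ineq2[of d x] Cauchy_Schwarz_ineq2[of dl x] d by auto
   have "(norm dl)^2 \<le> norm dl" using dl1 by (simp add: power2_eq_square mult_left_le)
   hence "(norm dl)^2 * \<bar>d \<bullet> x\<bar> \<le> norm dl * norm x" using dx by (intro mult_mono) auto
   thus "\<bar>- ((norm dl)^2 * (d \<bullet> x))\<bar> \<le> norm dl * norm x" by (simp add: abs_mult)
   show "\<bar>2 * (dl \<bullet> x)\<bar> \<le> 2 * (norm dl * norm x)" using dx by (simp add: abs_mult)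
   show "\<bar>dl \<bullet> x\<bar> \<le> norm x" using dx(2) dl1 mult_right_mono[OF dl1, of "norm x"] by simp
   show "\<bar>2 * (d \<bullet> x)\<bar> \<le> 2 * norm x" using dx by (simp add: abs_mult)
  qed simp
  also have "\<dots> = 6 * norm dl * norm x" by simp
  finally have "(1 + c) * norm (Q x - x) \<le> 6 * norm dl * norm x" .
  moreover have "(3/2) * norm (Q x - x) \<le> (1 + c) * norm (Q x - x)" using c1 by (intro mult_right_mono) auto
  ultimately show ?thesis by (simp add: dl_def)
 qed
 ultimately show thesis using that by blast
qed

text \<open>The two games differ only in the set \<open>AA\<close> of admissible matrices.
  \<open>AA_tangent\<close> lets the maximizing player move orthogonally to any given direction,
  \<open>AA_rot\<close> lets a move tangent to one direction be turned into a move tangent to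
  another, and \<open>f_hom\<close> makes the payoff invariant under the parabolic
  rescaling.\<close>

locale game_scheme =
 fixes AA :: "(real^'n^'m) set" and f :: "real^'m => real" and La R :: real
 assumes AA_compact: "compact AA"
  and AA_tangent: "!!d. \<exists>A\<in>AA. transpose A *v d = 0"
  and AA_rot: "!!Q A. orthogonal_transformation Q ==> A \<in> AA ==> matrix Q ** A \<in> AA"
  and AA_bound: "!!A e. A \<in> AA ==> e \<in> sign_vectors ==> norm (A *v e) \<le> R" and R_pos: "0 < R"
  and f_lip: "!!x y. \<bar>f x - f y\<bar> \<le> La * norm (x - y)" and La_pos: "0 < La"
  and f_hom: "!!c x. 0 \<le> c ==> f (c *\<^sub>R x) = c * f x"
begin

abbreviation "lip g \<equiv> (\<forall>x y. \<bar>g x - g y\<bar> \<le> La * norm (x - y))"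

lemma AA_nonempty: "AA \<noteq> {}" using AA_tangent[of 0] by auto

lemma Min_le_sign:
 "e \<in> sign_vectors ==> Min ((\<lambda>e. g (x + A *v e)) ` sign_vectors) \<le> g (x + A *v e)"
 by (intro Min_le finite_imageI finite_sign_vectors) auto

lemma step_bdd:
 assumes "lip g"
 shows "bdd_above ((\<lambda>A. Min ((\<lambda>e. g (x + A *v e)) ` sign_vectors)) ` AA)"
proof (rule bdd_aboveI2)
 fix A assume A: "A \<in> AA"
 have "\<bar>g (x + A *v (\<chi> j. 1)) - g x\<bar> \<le> La * norm (A *v (\<chi> j. 1))" using assms[rule_format, of "x + A *v (\<chi> j. 1)" x] by simp
 also have "\<dots> \<le> La * R" using AA_bound[OF A one_sign_vector] La_pos by simp
 finally show "Min ((\<lambda>e. g (x + A *v e)) ` sign_vectors) \<le> g x + La * R"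
  using Min_le_sign[OF one_sign_vector, of g x A] by linarith
qed

lemma step_ge:
 assumes "lip g" "A \<in> AA"
 shows "\<exists>e\<in>sign_vectors. g (x + A *v e) \<le> game_step AA g x"
proof -
 have "Min ((\<lambda>e. g (x + A *v e)) ` sign_vectors) \<in> (\<lambda>e. g (x + A *v e)) ` sign_vectors"
  by (intro Min_in finite_imageI finite_sign_vectors) (simp add: sign_vectors_nonempty)
 then obtain e where "e \<in> sign_vectors" "Min ((\<lambda>e. g (x + A *v e)) ` sign_vectors) = g (x + A *v e)" by auto
 moreover have "Min ((\<lambda>e. g (x + A *v e)) ` sign_vectors) \<le> game_step AA g x"
  unfolding game_step_def by (rule cSUP_upper[OF assms(2) step_bdd[OF assms(1)]])
 ultimately show ?thesis by auto
qed

lemma step_le: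
 assumes "lip g" "0 < eps"
 shows "\<exists>A\<in>AA. \<forall>e\<in>sign_vectors. game_step AA g x - eps \<le> g (x + A *v e)"
proof -
 have "game_step AA g x - eps < (SUP A\<in>AA. Min ((\<lambda>e. g (x + A *v e)) ` sign_vectors))"
  using assms by (simp add: game_step_def)
 then obtain A where A: "A \<in> AA" "game_step AA g x - eps < Min ((\<lambda>e. g (x + A *v e)) ` sign_vectors)"
  using less_cSUP_iff[OF AA_nonempty step_bdd[OF assms(1)]] by metis
 show ?thesis
 proof (intro bexI[OF _ A(1)] ballI)
  fix e :: "real^'n" assume "e \<in> sign_vectors"
  thus "game_step AA g x - eps \<le> g (x + A *v e)" using A(2) Min_le_sign[of e g x A] by linarith
 qed
qed

lemma step_lip:
 assumes "lip g" shows "lip (game_step AA g)"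
proof -
 have "game_step AA g x \<le> game_step AA g y + La * norm (x - y)" for x y
 proof (rule field_le_epsilon)
  fix eps :: real assume "0 < eps"
  then obtain A where A: "A \<in> AA" "!!e. e \<in> sign_vectors ==> game_step AA g x - eps \<le> g (x + A *v e)"
   using step_le[OF assms, of eps x] by auto
  obtain e where e: "e \<in> sign_vectors" "g (y + A *v e) \<le> game_step AA g y" using step_ge[OF assms A(1)] by blast
  have "\<bar>g (x + A *v e) - g (y + A *v e)\<bar> \<le> La * norm (x - y)"
   using assms[rule_format, of "x + A *v e" "y + A *v e"] by simp
  thus "game_step AA g x \<le> game_step AA g y + La * norm (x - y) + eps"
   using A(2)[OF e(1)] e(2) by linarith
 qed
 from this this[of y x for x y] show ?thesis by (smt (verit) norm_minus_commute)
qed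

lemma steps_lip: "lip g ==> lip ((game_step AA ^^ k) g)"
 by (induction k) (use step_lip in auto)

text \<open>The minimizing player can choose between \<open>e\<close> and \<open>- e\<close>, one of
  which has nonpositive inner product with \<open>x - y\<close>; the squared distance to
  \<open>y\<close> then grows by at most \<open>R^2\<close> in a round.\<close>

lemma steps_upper_barrier:
 assumes g: "lip g"
 shows "(game_step AA ^^ k) g x \<le> g y + La * sqrt ((norm (x - y))^2 + R^2 * k)"
proof (induction k arbitrary: x)
 case 0
 show ?case using g[rule_format, of x y] by simp
next
 case (Suc k)
 show ?case
 proof (rule field_le_epsilon)
  fix eps :: real assume "0 < eps"
  then obtain A where A: "A \<in> AA" "!!e. e \<in> sign_vectors ==> (game_step AA ^^ Suc k) g x - eps \<le> (game_step AA ^^ k) g (x + A *v e)"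
   using step_le[OF steps_lip[OF g], of eps k x] by auto
  obtain e where e: "e \<in> sign_vectors" "(x - y) \<bullet> (A *v e) \<le> 0"
  proof (cases "(x - y) \<bullet> (A *v (\<chi> j. 1)) \<le> 0")
   case False
   have "A *v (- v) = - (A *v v)" for v using matrix_vector_mult_scaleR[of A "-1" v] by simp
   thus ?thesis using False that[OF minus_sign_vector[OF one_sign_vector]] by simp
  qed (use that one_sign_vector in blast)
  have "(norm (x + A *v e - y))^2 = (norm (x - y))^2 + 2 * ((x - y) \<bullet> (A *v e)) + (norm (A *v e))^2"
   by (simp add: power2_norm_eq_inner inner_add_left inner_add_right inner_diff_left inner_diff_right inner_commute)
  also have "\<dots> \<le> (norm (x - y))^2 + R^2"
   using e(2) power_mono[OF AA_bound[OF A(1) e(1)], of 2] by simp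
  finally have "La * sqrt ((norm (x + A *v e - y))^2 + R^2 * k) \<le> La * sqrt ((norm (x - y))^2 + R^2 * Suc k)"
   using La_pos by (simp add: algebra_simps)
  thus "(game_step AA ^^ Suc k) g x \<le> g y + La * sqrt ((norm (x - y))^2 + R^2 * Suc k) + eps"
   using A(2)[OF e(1)] Suc.IH[of "x + A *v e"] by linarith
 qed
qed

text \<open>Here the maximizing player keeps the position near \<open>y\<close>: with a matrix
  tangent to \<open>x - y\<close>, every reply is orthogonal to \<open>x - y\<close> and the squared
  distance again grows by at most \<open>R^2\<close>.\<close>

lemma steps_lower_barrier:
 assumes g: "lip g"
 shows "g y - La * sqrt ((norm (x - y))^2 + R^2 * k) \<le> (game_step AA ^^ k) g x"
proof (induction k arbitrary: x)
 case 0
 show ?case using g[rule_format, of x y] by simp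
next
 case (Suc k)
 obtain A where A: "A \<in> AA" "transpose A *v (x - y) = 0" using AA_tangent by blast
 obtain e where e: "e \<in> sign_vectors" "(game_step AA ^^ k) g (x + A *v e) \<le> (game_step AA ^^ Suc k) g x"
  using step_ge[OF steps_lip[OF g] A(1), of k x] by auto
 have "(x - y) \<bullet> (A *v e) = 0" using A(2) transpose_vec_inner[of A "x - y" e] by (simp del: transpose_matrix_vector)
 hence "(norm (x + A *v e - y))^2 = (norm (x - y))^2 + (norm (A *v e))^2"
  by (simp add: power2_norm_eq_inner inner_add_left inner_add_right inner_diff_left inner_diff_right inner_commute)
 also have "\<dots> \<le> (norm (x - y))^2 + R^2"
  using power_mono[OF AA_bound[OF A(1) e(1)], of 2] by simp
 finally have "La * sqrt ((norm (x + A *v e - y))^2 + R^2 * k) \<le> La * sqrt ((norm (x - y))^2 + R^2 * Suc k)"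
  using La_pos by (simp add: algebra_simps)
 thus ?case using e(2) Suc.IH[of "x + A *v e"] by linarith
qed

lemma steps_close:
 assumes g: "lip g"
 shows "\<bar>(game_step AA ^^ k) g x - g x\<bar> \<le> La * R * sqrt k"
 using steps_upper_barrier[OF g, of k x x] steps_lower_barrier[OF g, of x x k] R_pos
 by (simp add: real_sqrt_mult abs_le_iff mult.assoc)

text \<open>The rescaled value with \<open>n + 1\<close> rounds per unit of time; since \<open>nat\<close> truncates, it equals the
 terminal value \<open>f x\<close> at nonnegative times.\<close>

definition V :: "nat => (real^'m) \<times> real => real" where
 "V n = (\<lambda>(x, t). (game_step AA ^^ nat \<lfloor>- t * real (Suc n)\<rfloor>) f (sqrt (real (Suc n)) *\<^sub>R x) / sqrt (real (Suc n)))"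

lemma lip_f: "lip f" using f_lip by blast

lemma V_nonneg_time: "0 \<le> t ==> V n (x, t) = f x"
proof -
 assume "0 \<le> t"
 hence "0 \<le> t * real (Suc n)" by (rule mult_nonneg_nonneg) simp
 hence "\<lfloor>- t * real (Suc n)\<rfloor> \<le> 0" by linarith
 hence "nat \<lfloor>- t * real (Suc n)\<rfloor> = 0" by simp
 thus ?thesis unfolding V_def prod.case by (simp add: f_hom del: of_nat_Suc)
qed

lemma V_lip: "\<bar>V n (x, t) - V n (y, t)\<bar> \<le> La * norm (x - y)"
proof -
 define N where "N = sqrt (real (Suc n))"
 have N: "N > 0" by (simp add: N_def del: of_nat_Suc)
 define g where "g = (game_step AA ^^ nat \<lfloor>- t * real (Suc n)\<rfloor>) f"
 have "\<bar>g (N *\<^sub>R x) - g (N *\<^sub>R y)\<bar> \<le> La * norm (N *\<^sub>R x - N *\<^sub>R y)"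
  using steps_lip[OF lip_f] unfolding g_def by blast
 also have "\<dots> = N * (La * norm (x - y))" using N by (simp add: scaleR_right_diff_distrib[symmetric])
 finally have "\<bar>g (N *\<^sub>R x) - g (N *\<^sub>R y)\<bar> / N \<le> La * norm (x - y)" using N by (simp add: pos_divide_le_eq mult.commute)
 thus ?thesis using N unfolding V_def prod.case g_def[symmetric] N_def[symmetric] diff_divide_distrib[symmetric] by simp
qed

text \<open>The square root is the diffusive displacement over the elapsed rounds. The summand
  \<open>1 / real (Suc n)\<close> pays for rounding both times to whole rounds.\<close>

lemma V_time: "\<bar>V n (x, t) - V n (x, s)\<bar> \<le> La * R * sqrt (\<bar>t - s\<bar> + 1 / real (Suc n))"
proof -
 have *: "\<bar>V n (x, t) - V n (x, s)\<bar> \<le> La * R * sqrt (\<bar>t - s\<bar> + 1 / real (Suc n))" if "s \<le> t" for s t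
 proof -
  define N where "N = real (Suc n)"
  have N: "N > 0" by (simp add: N_def del: of_nat_Suc)
  define k where "k = nat \<lfloor>- t * N\<rfloor>"
  define j where "j = nat \<lfloor>- s * N\<rfloor> - k"
  have "- t * N \<le> - s * N" using that N by simp
  hence le: "k \<le> nat \<lfloor>- s * N\<rfloor>" unfolding k_def by (intro nat_mono floor_mono)
  hence jk: "nat \<lfloor>- s * N\<rfloor> = j + k" by (simp add: j_def)
  have jb: "real j \<le> (t - s) * N + 1"
  proof (cases "- t * N \<ge> 0")
   case True
   hence "real j = real_of_int \<lfloor>- s * N\<rfloor> - real_of_int \<lfloor>- t * N\<rfloor>"
    using le \<open>- t * N \<le> - s * N\<close> unfolding j_def k_def by (simp add: of_nat_diff)
   moreover have "real_of_int \<lfloor>- s * N\<rfloor> \<le> - s * N" "- t * N < real_of_int \<lfloor>- t * N\<rfloor> + 1" by linarith+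
   moreover have "(t - s) * N = - s * N - (- t * N)" by (simp add: algebra_simps)
   ultimately show ?thesis by linarith
  next
   case False
   hence "k = 0" by (simp add: k_def floor_le_zero)
   have "real j \<le> max 0 (- s * N)" unfolding j_def \<open>k = 0\<close> by (simp add: max_def)
   moreover have "0 \<le> (t - s) * N" using that N by simp
   moreover have "- s * N \<le> (t - s) * N" using False N by (simp add: algebra_simps zero_le_mult_iff mult_le_0_iff not_le)
   ultimately show ?thesis by linarith
  qed
  define g where "g = (game_step AA ^^ k) f"
  have "\<bar>(game_step AA ^^ j) g (sqrt N *\<^sub>R x) - g (sqrt N *\<^sub>R x)\<bar> \<le> La * R * sqrt j"
   unfolding g_def by (rule steps_close[OF steps_lip[OF lip_f]])
  also have "\<dots> \<le> La * R * sqrt ((t - s) * N + 1)" using jb La_pos R_pos by simp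
  finally have "\<bar>(game_step AA ^^ j) g (sqrt N *\<^sub>R x) - g (sqrt N *\<^sub>R x)\<bar> / sqrt N \<le> La * R * sqrt ((t - s) * N + 1) / sqrt N"
   using N by (intro divide_right_mono) auto
  also have "\<dots> = La * R * sqrt (\<bar>t - s\<bar> + 1 / N)"
  proof -
   have "((t - s) * N + 1) / N = \<bar>t - s\<bar> + 1 / N" using N that by (simp add: add_divide_distrib)
   thus ?thesis by (metis real_sqrt_divide times_divide_eq_right)
  qed
  also have "\<bar>(game_step AA ^^ j) g (sqrt N *\<^sub>R x) - g (sqrt N *\<^sub>R x)\<bar> / sqrt N = \<bar>V n (x, t) - V n (x, s)\<bar>"
   using N unfolding V_def prod.case N_def[symmetric] jk k_def[symmetric] g_def funpow_add o_apply diff_divide_distrib[symmetric]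
   by (simp add: abs_minus_commute)
  finally show ?thesis by (simp add: N_def)
 qed
 show ?thesis using *[of s t] *[of t s] by (cases "s \<le> t") (simp_all add: abs_minus_commute)
qed

lemma V_bound: "\<bar>V n (x, t)\<bar> \<le> \<bar>f x\<bar> + La * R * sqrt (\<bar>t\<bar> + 1)"
proof -
 have "sqrt (\<bar>t - 0\<bar> + 1 / real (Suc n)) \<le> sqrt (\<bar>t\<bar> + 1)" by (simp add: divide_le_eq)
 hence "La * R * sqrt (\<bar>t - 0\<bar> + 1 / real (Suc n)) \<le> La * R * sqrt (\<bar>t\<bar> + 1)" using La_pos R_pos by (intro mult_left_mono) auto
 thus ?thesis using V_time[of n x t 0] V_nonneg_time[of 0 n x] by linarith
qed

text \<open>Dynamic programming in the scaling of \<open>V\<close>; the bound on \<open>t\<close>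
  guarantees that at least one round is left to play.\<close>

lemma V_step:
 assumes "t \<le> - 1 / real (Suc n)"
 shows "\<exists>g. lip g \<and> V n (x, t) = game_step AA g (sqrt (real (Suc n)) *\<^sub>R x) / sqrt (real (Suc n)) \<and>
  (\<forall>a. g (sqrt (real (Suc n)) *\<^sub>R x + a) / sqrt (real (Suc n)) = V n (x + sqrt (1 / real (Suc n)) *\<^sub>R a, t + 1 / real (Suc n)))"
proof -
 define N where "N = real (Suc n)"
 have N: "N > 0" by (simp add: N_def del: of_nat_Suc)
 define k where "k = nat \<lfloor>- (t + 1 / N) * N\<rfloor>"
 have tN: "- t * N \<ge> 1" using assms N by (simp add: N_def[symmetric] field_simps del: of_nat_Suc)
 have "- (t + 1 / N) * N = - t * N - 1" using N by (simp add: field_simps)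
 hence k: "nat \<lfloor>- t * N\<rfloor> = Suc k" using tN by (simp add: k_def nat_eq_iff)
 define g where "g = (game_step AA ^^ k) f"
 have "lip g" unfolding g_def by (rule steps_lip[OF lip_f])
 moreover have "V n (x, t) = game_step AA g (sqrt N *\<^sub>R x) / sqrt N"
  unfolding V_def prod.case N_def[symmetric] k g_def by simp
 moreover have "g (sqrt N *\<^sub>R x + a) / sqrt N = V n (x + sqrt (1 / N) *\<^sub>R a, t + 1 / N)" for a
 proof -
  have "sqrt N *\<^sub>R (x + sqrt (1 / N) *\<^sub>R a) = sqrt N *\<^sub>R x + a"
   using N by (simp add: scaleR_right_distrib real_sqrt_divide)
  thus ?thesis unfolding V_def prod.case N_def[symmetric] k_def[symmetric] g_def by simp
 qed
 ultimately show ?thesis unfolding N_def by blast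
qed

lemma V_le:
 assumes "t \<le> - 1 / real (Suc n)" "0 < eps"
 shows "\<exists>A\<in>AA. \<forall>e\<in>sign_vectors. V n (x, t) - eps \<le> V n (x + sqrt (1 / real (Suc n)) *\<^sub>R (A *v e), t + 1 / real (Suc n))"
proof -
 define N where "N = sqrt (real (Suc n))"
 have N: "N > 0" by (simp add: N_def del: of_nat_Suc)
 obtain g where g: "lip g" "V n (x, t) = game_step AA g (N *\<^sub>R x) / N"
  "!!a. g (N *\<^sub>R x + a) / N = V n (x + sqrt (1 / real (Suc n)) *\<^sub>R a, t + 1 / real (Suc n))"
  using V_step[OF assms(1), of x] unfolding N_def by auto
 obtain A where A: "A \<in> AA" "!!e. e \<in> sign_vectors ==> game_step AA g (N *\<^sub>R x) - N * eps \<le> g (N *\<^sub>R x + A *v e)"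
  using step_le[OF g(1), of "N * eps" "N *\<^sub>R x"] N assms by auto
 have "V n (x, t) - eps \<le> g (N *\<^sub>R x + A *v e) / N" if "e \<in> sign_vectors" for e
  using A(2)[OF that] N g(2) by (simp add: field_simps)
 thus ?thesis using A(1) g(3) by auto
qed

lemma V_ge:
 assumes "t \<le> - 1 / real (Suc n)" "A \<in> AA"
 shows "\<exists>e\<in>sign_vectors. V n (x + sqrt (1 / real (Suc n)) *\<^sub>R (A *v e), t + 1 / real (Suc n)) \<le> V n (x, t)"
proof -
 define N where "N = sqrt (real (Suc n))"
 have N: "N > 0" by (simp add: N_def del: of_nat_Suc)
 obtain g where g: "lip g" "V n (x, t) = game_step AA g (N *\<^sub>R x) / N"
  "!!a. g (N *\<^sub>R x + a) / N = V n (x + sqrt (1 / real (Suc n)) *\<^sub>R a, t + 1 / real (Suc n))"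
  using V_step[OF assms(1), of x] unfolding N_def by auto
 obtain e where e: "e \<in> sign_vectors" "g (N *\<^sub>R x + A *v e) \<le> game_step AA g (N *\<^sub>R x)"
  using step_ge[OF g(1) assms(2)] by blast
 hence "g (N *\<^sub>R x + A *v e) / N \<le> V n (x, t)" using N g(2) by (simp add: divide_right_mono)
 thus ?thesis using e(1) g(3) by auto
qed

end

text \<open>A test function is differentiable in time and in space separately. Joint continuity
  follows from the local bound on the time derivative together with continuity in space at the
  single time \<open>t0\<close>.\<close>

lemma test_function_continuous:
 fixes ph :: "(real^'m) \<times> real => real"
 assumes T: "is_test_function N ph pht g H" and N: "open N"
 shows "continuous_on N ph"
 unfolding continuous_on_eq_continuous_at[OF N]
proof
 fix z0 assume z0: "z0 \<in> N"
 obtain x0 t0 where z0': "z0 = (x0, t0)" by (cases z0)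
 have "continuous (at z0) pht" using T N z0 unfolding is_test_function_def by (simp add: continuous_on_eq_continuous_at)
 hence "(pht \<longlongrightarrow> pht z0) (nhds z0)" unfolding isCont_def tendsto_at_iff_tendsto_nhds .
 hence "\<forall>\<^sub>F z in nhds z0. dist (pht z) (pht z0) < 1" by (simp add: tendsto_iff)
 moreover have "\<forall>\<^sub>F z in nhds z0. z \<in> N" using N z0 by (simp add: eventually_nhds_in_open)
 ultimately have "\<forall>\<^sub>F z in nhds z0. z \<in> N \<and> dist (pht z) (pht z0) < 1" by eventually_elim auto
 then obtain d where d: "d > 0" "!!z. dist z z0 < d ==> z \<in> N \<and> \<bar>pht z - pht z0\<bar> < 1"
  unfolding eventually_nhds_metric dist_real_def by auto
 define B where "B = \<bar>pht z0\<bar> + 1"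
 have time: "\<bar>ph (x, t) - ph (x, t0)\<bar> \<le> B * \<bar>t - t0\<bar>" if "dist (x, t) z0 < d" for x t
 proof -
  have seg: "dist (x, s) z0 < d" if "\<bar>s - t0\<bar> \<le> \<bar>t - t0\<bar>" for s
  proof -
   have "dist (x, s) z0 \<le> dist (x, t) z0"
    using that unfolding z0' dist_Pair_Pair dist_real_def
    by (intro real_sqrt_le_mono add_left_mono) (metis power2_abs power_mono abs_ge_zero)
   thus ?thesis using \<open>dist (x, t) z0 < d\<close> by linarith
  qed
  have der: "((\<lambda>s. ph (x, s)) has_real_derivative pht (x, s)) (at s)" "\<bar>pht (x, s)\<bar> \<le> B" if "\<bar>s - t0\<bar> \<le> \<bar>t - t0\<bar>" for s
   using d(2)[OF seg[OF that]] T unfolding is_test_function_def B_def by auto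
  consider "t = t0" | "t0 < t" | "t < t0" by linarith
  thus ?thesis
  proof cases
   case 2
   have "\<exists>s>t0. s < t \<and> ph (x, t) - ph (x, t0) = (t - t0) * pht (x, s)"
    by (rule MVT2[OF 2]) (auto intro!: der)
   thus ?thesis using der(2) 2 by (auto simp: abs_mult mult.commute)
  next
   case 3
   have "\<exists>s>t. s < t0 \<and> ph (x, t0) - ph (x, t) = (t0 - t) * pht (x, s)"
    by (rule MVT2[OF 3]) (use 3 in \<open>auto intro!: der\<close>)
   then obtain s where s: "t < s" "s < t0" "ph (x, t0) - ph (x, t) = (t0 - t) * pht (x, s)" by auto
   have "\<bar>pht (x, s)\<bar> \<le> B" using s 3 by (intro der(2)) auto
   hence "(t0 - t) * \<bar>pht (x, s)\<bar> \<le> (t0 - t) * B" using 3 by (intro mult_left_mono) auto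
   thus ?thesis using 3 s(3) by (simp add: abs_minus_commute[of "ph (x, t)"] abs_mult mult.commute abs_minus_commute[of t])
  qed simp
 qed
 have "isCont (\<lambda>x. ph (x, t0)) x0"
  using T z0 unfolding is_test_function_def z0' by (blast intro: has_derivative_continuous)
 hence cx: "((\<lambda>z. ph (fst z, t0)) \<longlongrightarrow> ph (x0, t0)) (nhds z0)"
  unfolding isCont_def tendsto_at_iff_tendsto_nhds[of "\<lambda>x. ph (x, t0)"] z0' nhds_prod
  by (rule filterlim_compose[OF _ filterlim_fst])
 have "((\<lambda>z. ph z - ph (fst z, t0)) \<longlongrightarrow> 0) (nhds z0)"
 proof (rule Lim_null_comparison)
  have "\<forall>\<^sub>F z in nhds z0. dist z z0 < d" using d(1) by (metis eventually_nhds_metric)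
  thus "\<forall>\<^sub>F z in nhds z0. norm (ph z - ph (fst z, t0)) \<le> B * \<bar>snd z - t0\<bar>"
   by eventually_elim (use time in force)
  have "((\<lambda>z. B * \<bar>snd z - t0\<bar>) \<longlongrightarrow> B * \<bar>snd z0 - t0\<bar>) (nhds z0)"
   by (intro tendsto_intros filterlim_ident)
  thus "((\<lambda>z. B * \<bar>snd z - t0\<bar>) \<longlongrightarrow> 0) (nhds z0)" by (simp add: z0')
 qed
 from tendsto_add[OF this cx] show "continuous (at z0) ph"
  unfolding isCont_def tendsto_at_iff_tendsto_nhds z0' by simp
qed

section \<open>Upper limits and the convergence of maximum points\<close>

lemma bounded_limsup_exists:
 fixes a :: "nat => real"
 assumes "!!n. \<bar>a n\<bar> \<le> B"
 shows "\<exists>L. (\<forall>eps>0. \<forall>\<^sub>F n in sequentially. a n < L + eps) \<and> (\<exists>r. strict_mono r \<and> (\<lambda>n. a (r n)) \<longlonglongrightarrow> L)"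
proof -
 define L where "L = limsup (\<lambda>n. ereal (a n))"
 have "L \<le> ereal B" unfolding L_def
  by (rule Limsup_bounded) (use assms in \<open>auto simp: abs_le_iff\<close>)
 moreover have "ereal (- B) \<le> L" unfolding L_def
  by (rule le_Limsup) (use assms in \<open>auto simp: abs_le_iff minus_le_iff\<close>)
 ultimately obtain l where l: "L = ereal l" by (cases L) auto
 obtain r where r: "strict_mono r" "((\<lambda>n. ereal (a n)) \<circ> r) \<longlonglongrightarrow> L"
  using limsup_subseq_lim[of "\<lambda>n. ereal (a n)"] unfolding L_def by auto
 have "(\<lambda>n. a (r n)) \<longlonglongrightarrow> l" using r(2) unfolding l o_def by simp
 moreover have "\<forall>\<^sub>F n in sequentially. a n < l + eps" if "eps > 0" for eps
 proof -
  have "limsup (\<lambda>n. ereal (a n)) < ereal (l + eps)" using l that unfolding L_def by simp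
  from Limsup_lessD[OF this] show ?thesis by simp
 qed
 ultimately show ?thesis using r(1) by blast
qed

text \<open>The rescaled values jump in time, so a maximum is sought only on the grid
  \<open>t0 + k / real (Suc n)\<close>, finite near \<open>t0\<close> and preserved by one round of
  the game. The limit superior is pointwise; the two moduli make it behave like a half-relaxed limit
  when the maximum points move.\<close>

lemma maximum_points_concentrate:
 fixes F :: "nat => (real^'m) \<times> real => real"
 assumes lipx: "!!n x y t. \<bar>F n (x, t) - F n (y, t)\<bar> \<le> L * norm (x - y)"
  and lipt: "!!n x t s. \<bar>F n (x, t) - F n (x, s)\<bar> \<le> L' * sqrt (\<bar>t - s\<bar> + 1 / real (Suc n))"
  and up: "!!z eps. 0 < eps ==> \<forall>\<^sub>F n in sequentially. F n z < U z + eps"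
  and r: "strict_mono r" "(\<lambda>n. F (r n) (x0, t0)) \<longlonglongrightarrow> U (x0, t0)"
  and rh: "0 < rh"
  and cont: "continuous_on (cball x0 rh \<times> cball t0 rh) ph"
  and strict: "!!x t. x \<in> cball x0 rh ==> t \<in> cball t0 rh ==> (x, t) \<noteq> (x0, t0) ==> U (x, t) - ph (x, t) < U (x0, t0) - ph (x0, t0)"
 obtains q X S where "strict_mono q" "X \<longlonglongrightarrow> x0" "S \<longlonglongrightarrow> t0"
  "!!n. \<exists>k::int. S n = t0 + k / real (Suc (q n))"
  "!!n x t. x \<in> cball x0 rh ==> t \<in> cball t0 rh ==> (\<exists>k::int. t = t0 + k / real (Suc (q n))) ==>
   F (q n) (x, t) - ph (x, t) \<le> F (q n) (X n, S n) - ph (X n, S n)"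
proof -
 define Tn where "Tn n = cball t0 rh \<inter> range (\<lambda>k::int. t0 + k / real (Suc n))" for n
 have finT: "finite (Tn n)" for n
 proof -
  have "Tn n \<subseteq> (\<lambda>k::int. t0 + k / real (Suc n)) ` {\<lfloor>- rh * real (Suc n)\<rfloor>..\<lceil>rh * real (Suc n)\<rceil>}"
  proof
   fix t assume "t \<in> Tn n"
   then obtain k :: int where k: "t = t0 + k / real (Suc n)" "\<bar>k / real (Suc n)\<bar> \<le> rh"
    by (auto simp: Tn_def dist_real_def simp del: of_nat_Suc)
   hence "\<bar>real_of_int k\<bar> \<le> rh * real (Suc n)" by (simp add: abs_divide pos_divide_le_eq del: of_nat_Suc)
   hence "k \<in> {\<lfloor>- rh * real (Suc n)\<rfloor>..\<lceil>rh * real (Suc n)\<rceil>}"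
    by (simp add: floor_le_iff le_ceiling_iff abs_le_iff del: of_nat_Suc)
   thus "t \<in> (\<lambda>k::int. t0 + k / real (Suc n)) ` {\<lfloor>- rh * real (Suc n)\<rfloor>..\<lceil>rh * real (Suc n)\<rceil>}" using k(1) by blast
  qed
  thus ?thesis by (rule finite_subset) simp
 qed
 have t0T: "t0 \<in> Tn n" for n using rh by (auto simp: Tn_def intro!: image_eqI[of _ _ 0])
 have "\<exists>x s. x \<in> cball x0 rh \<and> s \<in> Tn n \<and> (\<forall>y\<in>cball x0 rh. \<forall>t\<in>Tn n. F n (y, t) - ph (y, t) \<le> F n (x, s) - ph (x, s))" for n
 proof -
  have "\<exists>x\<in>cball x0 rh. \<forall>y\<in>cball x0 rh. F n (y, t) - ph (y, t) \<le> F n (x, t) - ph (x, t)" if t: "t \<in> Tn n" for t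
  proof (rule continuous_attains_sup)
   have "continuous_on (cball x0 rh) (\<lambda>y. F n (y, t))"
   proof (rule lipschitz_on_continuous_on[of "\<bar>L\<bar>"], rule lipschitz_onI)
    fix x y show "dist (F n (x, t)) (F n (y, t)) \<le> \<bar>L\<bar> * dist x y"
     using order_trans[OF lipx[of n x t y] mult_right_mono[OF abs_ge_self norm_ge_zero]] by (simp add: dist_real_def dist_norm)
   qed simp
   moreover have "continuous_on (cball x0 rh) (\<lambda>y. ph (y, t))"
    using t by (intro continuous_on_compose2[OF cont] continuous_intros) (auto simp: Tn_def)
   ultimately show "continuous_on (cball x0 rh) (\<lambda>y. F n (y, t) - ph (y, t))" by (intro continuous_intros)
  qed (use rh in auto)
  then obtain xm where xm: "!!t. t \<in> Tn n ==> xm t \<in> cball x0 rh"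
   "!!t y. t \<in> Tn n ==> y \<in> cball x0 rh ==> F n (y, t) - ph (y, t) \<le> F n (xm t, t) - ph (xm t, t)" by metis
  have "Tn n \<noteq> {}" using t0T by auto
  then obtain s where s: "s \<in> Tn n" "!!t. t \<in> Tn n ==> F n (xm t, t) - ph (xm t, t) \<le> F n (xm s, s) - ph (xm s, s)"
   using finT obtains_MAX[of "Tn n" "\<lambda>t. F n (xm t, t) - ph (xm t, t)"] Max_ge
   by (metis (no_types, lifting) finite_imageI image_eqI)
  show ?thesis
   by (intro exI[of _ "xm s"] exI[of _ s]) (use s xm in \<open>meson order_trans\<close>)
 qed
 then obtain Y P where YP: "!!n. Y n \<in> cball x0 rh" "!!n. P n \<in> Tn n"
  "!!n y t. y \<in> cball x0 rh ==> t \<in> Tn n ==> F n (y, t) - ph (y, t) \<le> F n (Y n, P n) - ph (Y n, P n)"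
  by metis
 have "compact (cball x0 rh \<times> cball t0 rh)" by (intro compact_Times compact_cball)
 moreover have "\<forall>n. (Y (r n), P (r n)) \<in> cball x0 rh \<times> cball t0 rh" using YP by (auto simp: Tn_def)
 ultimately obtain z s where z: "z \<in> cball x0 rh \<times> cball t0 rh" and s: "strict_mono s" "((\<lambda>n. (Y (r n), P (r n))) \<circ> s) \<longlonglongrightarrow> z"
  by (meson compact_def)
 define q where "q = r \<circ> s"
 have q: "strict_mono q" unfolding q_def using r(1) s(1) by (rule strict_mono_o)
 obtain x1 t1 where zz: "z = (x1, t1)" by (cases z)
 have lim: "(\<lambda>n. (Y (q n), P (q n))) \<longlonglongrightarrow> (x1, t1)" using s(2) by (simp add: q_def o_def zz)
 have Yl: "(\<lambda>n. Y (q n)) \<longlonglongrightarrow> x1" and Pl: "(\<lambda>n. P (q n)) \<longlonglongrightarrow> t1"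
  using tendsto_fst[OF lim] tendsto_snd[OF lim] by auto
 have F0: "(\<lambda>n. F (q n) (x0, t0)) \<longlonglongrightarrow> U (x0, t0)"
  using LIMSEQ_subseq_LIMSEQ[OF r(2) s(1)] by (simp add: q_def o_def)
 have phl: "(\<lambda>n. ph (Y (q n), P (q n))) \<longlonglongrightarrow> ph (x1, t1)"
  using cont lim z unfolding continuous_on_sequentially zz
  by (elim ballE[of _ _ "(x1, t1)"] allE[of _ "\<lambda>n. (Y (q n), P (q n))"]) (use YP in \<open>auto simp: Tn_def o_def\<close>)
 have inv0: "(\<lambda>n. 1 / real (Suc (q n))) \<longlonglongrightarrow> 0"
  using LIMSEQ_subseq_LIMSEQ[OF LIMSEQ_inverse_real_of_nat q] by (simp add: o_def inverse_eq_divide)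
 have "U (x0, t0) - ph (x0, t0) \<le> U (x1, t1) - ph (x1, t1)"
 proof (rule field_le_epsilon)
  fix eps :: real assume "eps > 0"
  have ev: "\<forall>\<^sub>F n in sequentially. F (q n) (x1, t1) < U (x1, t1) + eps"
   using eventually_subseq[OF q up[OF \<open>eps > 0\<close>]] by simp
  have "(\<lambda>n. L * norm (Y (q n) - x1) + L' * sqrt (\<bar>P (q n) - t1\<bar> + 1 / real (Suc (q n)))) \<longlonglongrightarrow> L * norm (x1 - x1) + L' * sqrt (\<bar>t1 - t1\<bar> + 0)"
   by (intro tendsto_intros Yl Pl inv0)
  hence m: "(\<lambda>n. U (x1, t1) + eps + (L * norm (Y (q n) - x1) + L' * sqrt (\<bar>P (q n) - t1\<bar> + 1 / real (Suc (q n)))) - ph (Y (q n), P (q n))) \<longlonglongrightarrow> U (x1, t1) + eps + 0 - ph (x1, t1)"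
   by (intro tendsto_intros phl) simp
  have l: "(\<lambda>n. F (q n) (x0, t0) - ph (x0, t0)) \<longlonglongrightarrow> U (x0, t0) - ph (x0, t0)" by (intro tendsto_intros F0)
  have "\<forall>\<^sub>F n in sequentially. F (q n) (x0, t0) - ph (x0, t0) \<le> U (x1, t1) + eps + (L * norm (Y (q n) - x1) + L' * sqrt (\<bar>P (q n) - t1\<bar> + 1 / real (Suc (q n)))) - ph (Y (q n), P (q n))"
   using ev
  proof eventually_elim
   case (elim n)
   have "F (q n) (x0, t0) - ph (x0, t0) \<le> F (q n) (Y (q n), P (q n)) - ph (Y (q n), P (q n))"
    using rh t0T by (intro YP) auto
   moreover have "F (q n) (Y (q n), P (q n)) \<le> F (q n) (x1, P (q n)) + L * norm (Y (q n) - x1)"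
    using lipx[of "q n" "Y (q n)" "P (q n)" x1] by linarith
   moreover have "F (q n) (x1, P (q n)) \<le> F (q n) (x1, t1) + L' * sqrt (\<bar>P (q n) - t1\<bar> + 1 / real (Suc (q n)))"
    using lipt[of "q n" x1 "P (q n)" t1] by linarith
   ultimately show ?case using elim by linarith
  qed
  from tendsto_le[OF sequentially_bot m l this] show "U (x0, t0) - ph (x0, t0) \<le> U (x1, t1) - ph (x1, t1) + eps" by simp
 qed
 hence eq: "x1 = x0" "t1 = t0" using strict[of x1 t1] z by (auto simp: zz)
 show thesis
 proof (rule that[OF q])
  show "(\<lambda>n. Y (q n)) \<longlonglongrightarrow> x0" "(\<lambda>n. P (q n)) \<longlonglongrightarrow> t0" using Yl Pl eq by auto
  show "\<exists>k::int. P (q n) = t0 + k / real (Suc (q n))" for n using YP(2)[of "q n"] by (auto simp: Tn_def)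
  show "F (q n) (x, t) - ph (x, t) \<le> F (q n) (Y (q n), P (q n)) - ph (Y (q n), P (q n))"
   if "x \<in> cball x0 rh" "t \<in> cball t0 rh" "\<exists>k::int. t = t0 + k / real (Suc (q n))" for n x t
   using that by (intro YP) (auto simp: Tn_def)
 qed
qed

text \<open>Viscosity supersolutions are described by applying \<open>touched_above\<close> to their negatives.\<close>

definition touched_above :: "(real => real^'m => real^'m^'m => bool) => ((real^'m) \<times> real => real) => bool" where
 "touched_above P u \<longleftrightarrow> (\<forall>N ph pht g H x0 t0.
  open N \<and> (x0, t0) \<in> N \<and> t0 < 0 \<and> is_test_function N ph pht g H \<and>
  (\<forall>\<^sub>F z in nhds (x0, t0). u z - ph z \<le> u (x0, t0) - ph (x0, t0)) -->
  P (pht (x0, t0)) (g (x0, t0)) (H (x0, t0)))"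

text \<open>What an optimal matrix of the maximizing player satisfies in the limit. A matrix that is
  not tangent to \<open>p\<close> would be answered by a sign vector with negative first order term,
  and that term outweighs the second order one.\<close>

definition sub_condition :: "(real^'n^'m) set => real => real^'m => real^'m^'m => bool" where
 "sub_condition AA a p X \<longleftrightarrow>
  (\<exists>A\<in>AA. transpose A *v p = 0 \<and> (\<forall>e\<in>sign_vectors. 0 \<le> a + quad X (A *v e) / 2))"

text \<open>The vector \<open>d\<close> is a limit of gradient directions at approximating points:
  it is determined by \<open>p\<close> unless \<open>p = 0\<close>, and then any unit vector can
  occur. The condition is written for the negative of a supersolution, hence the exchange of
  quantifiers compared with \<open>sub_condition\<close>.\<close>

definition super_condition :: "(real^'n^'m) set => real => real^'m => real^'m^'m => bool" where
 "super_condition AA a p X \<longleftrightarrow> (\<exists>d. norm d = 1 \<and> p = norm p *\<^sub>R d \<and>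
  (\<forall>A\<in>AA. transpose A *v d = 0 --> (\<exists>e\<in>sign_vectors. 0 \<le> a + quad X (A *v e) / 2)))"

lemma touched_aboveD:
 assumes "touched_above P u" "open N" "(x0, t0) \<in> N" "t0 < 0" "is_test_function N ph pht g H"
  "\<forall>\<^sub>F z in nhds (x0, t0). u z - ph z \<le> u (x0, t0) - ph (x0, t0)"
 shows "P (pht (x0, t0)) (g (x0, t0)) (H (x0, t0))"
 using assms(1)[unfolded touched_above_def, rule_format, OF conjI[OF assms(2) conjI[OF assms(3) conjI[OF assms(4) conjI[OF assms(5,6)]]]]] .

lemma touched_above_mono:
 assumes "touched_above P u" "!!a p X. transpose X = X ==> P a p X ==> Q a p X"
 shows "touched_above Q u"
 unfolding touched_above_def
proof (intro allI impI, elim conjE)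
 fix N ph pht g H x0 t0
 assume a: "open N" "(x0, t0) \<in> N" "t0 < 0" "is_test_function N ph pht g H"
  "\<forall>\<^sub>F z in nhds (x0, t0). u z - ph z \<le> u (x0, t0) - ph (x0, t0)"
 show "Q (pht (x0, t0)) (g (x0, t0)) (H (x0, t0))"
  by (rule assms(2)[OF test_function_hessian_symmetric[OF a(4,1,2)] touched_aboveD[OF assms(1) a]])
qed

lemma modulus_continuous:
 assumes "!!x t y s. \<bar>u (x :: real^'m, t) - u (y, s)\<bar> \<le> a * norm (x - y) + b * sqrt \<bar>t - s\<bar>"
 shows "continuous_on S u"
proof -
 have "(u \<longlongrightarrow> u z) (at z within S)" for z
 proof (rule LIM_zero_cancel, rule Lim_null_comparison)
  let ?b = "\<lambda>w. a * norm (fst w - fst z) + b * sqrt \<bar>snd w - snd z\<bar>"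
  show "\<forall>\<^sub>F w in at z within S. norm (u w - u z) \<le> ?b w"
   using assms[of "fst w" "snd w" "fst z" "snd z" for w] by (auto intro!: always_eventually)
  have "(?b \<longlongrightarrow> ?b z) (at z within S)" by (intro tendsto_intros)
  thus "(?b \<longlongrightarrow> 0) (at z within S)" by simp
 qed
 thus ?thesis by (simp add: continuous_on_def)
qed

text \<open>Quartic in space and quadratic in time, the added term makes a maximum strict without
  changing the derivatives at \<open>(x0, t0)\<close> that enter the equation. With
  \<open>ph = 0\<close> and \<open>c = 1 / eps\<close> it is also the penalty of the
  sup-convolution.\<close>

lemma test_function_penalized:
 assumes "is_test_function N ph pht g H"
 shows "is_test_function N (\<lambda>z. ph z + c * (((fst z - x0) \<bullet> (fst z - x0))^2 + (snd z - t0)^2))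
  (\<lambda>z. pht z + c * (2 * (snd z - t0))) (\<lambda>z. g z + c *\<^sub>R ((4 * ((fst z - x0) \<bullet> (fst z - x0))) *\<^sub>R (fst z - x0)))
  (\<lambda>z. H z + c *\<^sub>R ((4 * ((fst z - x0) \<bullet> (fst z - x0))) *\<^sub>R mat 1 + 8 *\<^sub>R (\<chi> i j. (fst z - x0) $ i * (fst z - x0) $ j)))"
proof -
 have "is_test_function N (\<lambda>(x, t). (t - t0)^2) (\<lambda>(x, t). 2 * (t - t0)) (\<lambda>_. 0) (\<lambda>_. 0)"
  by (rule test_function_time) (auto intro!: derivative_eq_intros continuous_intros)
 from test_function_add[OF assms test_function_scale[OF test_function_add[OF test_function_norm4[of N x0] this]], of c]
 show ?thesis by (simp add: case_prod_unfold)
qed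

lemma matrix_vector_mult_minus_right: "A *v (- v) = - (A *v (v :: real^'n))"
 using matrix_vector_mult_scaleR[of A "-1" v] by simp

lemma box_in_nhds:
 fixes x0 :: "'a::euclidean_space"
 assumes ev: "\<forall>\<^sub>F z in nhds (x0, t0 :: real). P z" and a: "0 < a"
 obtains rh where "0 < rh" "rh < a" "!!x t. x \<in> cball x0 rh ==> t \<in> cball t0 rh ==> P (x, t)"
proof -
 obtain d where d: "d > 0" "!!z. dist z (x0, t0) < d ==> P z"
  using ev unfolding eventually_nhds_metric by auto
 show thesis
 proof (rule that[of "min (d/3) (a/2)"])
  fix x t assume "x \<in> cball x0 (min (d/3) (a/2))" "t \<in> cball t0 (min (d/3) (a/2))"
  hence "dist x x0 \<le> d/3" "\<bar>t - t0\<bar> \<le> d/3" by (auto simp: dist_commute dist_real_def abs_minus_commute)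
  moreover have "dist (x, t) (x0, t0) \<le> dist x x0 + \<bar>t - t0\<bar>"
   using norm_Pair_le[of "x - x0" "t - t0"] by (simp add: dist_norm)
  ultimately show "P (x, t)" using d(1) by (intro d(2)) linarith
 qed (use d a in auto)
qed

text \<open>With \<open>sg = - 1\<close> the following notions describe the negatives of lower limits.\<close>

definition (in game_scheme) limit_above :: "real => ((real^'m) \<times> real => real) => bool" where
 "limit_above sg U \<longleftrightarrow> (\<forall>z. (\<forall>eps>0. \<forall>\<^sub>F n in sequentially. sg * V n z < U z + eps) \<and>
  (\<exists>r. strict_mono r \<and> (\<lambda>n. sg * V (r n) z) \<longlonglongrightarrow> U z))"

locale signed_scheme = game_scheme AA f La R
 for AA :: "(real^'n^'m) set" and f :: "real^'m => real" and La R :: real +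
 fixes sg :: real
 assumes sign: "\<bar>sg\<bar> = 1"
begin

lemma sign_mult: "\<bar>sg * x - sg * y\<bar> = \<bar>x - y\<bar>" for x y
 using sign by (simp add: abs_mult flip: right_diff_distrib)

lemma limit_exists: "\<exists>U. limit_above sg U"
proof -
 have "\<exists>L. (\<forall>eps>0. \<forall>\<^sub>F n in sequentially. sg * V n z < L + eps) \<and> (\<exists>r. strict_mono r \<and> (\<lambda>n. sg * V (r n) z) \<longlonglongrightarrow> L)" for z
 proof -
  obtain B where "\<bar>sg * V n z\<bar> \<le> B" for n using V_bound sign by (cases z) (metis abs_mult mult_1)
  from bounded_limsup_exists[of "\<lambda>n. sg * V n z", OF this] show ?thesis .
 qed
 thus ?thesis unfolding limit_above_def by metis
qed

lemma limit_modulus: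
 assumes U: "limit_above sg U"
 shows "\<bar>U (x, t) - U (y, s)\<bar> \<le> La * norm (x - y) + La * R * sqrt \<bar>t - s\<bar>"
proof -
 have half: "U (x, t) \<le> U (y, s) + (La * norm (x - y) + La * R * sqrt \<bar>t - s\<bar>)" for x t y s
 proof (rule field_le_epsilon)
  fix eps :: real assume eps: "eps > 0"
  obtain r where r: "strict_mono r" "(\<lambda>n. sg * V (r n) (x, t)) \<longlonglongrightarrow> U (x, t)" using U unfolding limit_above_def by blast
  have "(\<lambda>n. 1 / real (Suc (r n))) \<longlonglongrightarrow> 0"
   using LIMSEQ_subseq_LIMSEQ[OF LIMSEQ_inverse_real_of_nat r(1)] by (simp add: o_def inverse_eq_divide)
  hence l: "(\<lambda>n. U (y, s) + eps + (La * norm (x - y) + La * R * sqrt (\<bar>t - s\<bar> + 1 / real (Suc (r n)))))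
    \<longlonglongrightarrow> U (y, s) + eps + (La * norm (x - y) + La * R * sqrt (\<bar>t - s\<bar> + 0))"
   by (intro tendsto_intros)
  have "\<forall>\<^sub>F n in sequentially. sg * V (r n) (y, s) < U (y, s) + eps"
   using U eps eventually_subseq[OF r(1), of "\<lambda>n. sg * V n (y, s) < U (y, s) + eps"] unfolding limit_above_def by blast
  hence "\<forall>\<^sub>F n in sequentially. sg * V (r n) (x, t) \<le> U (y, s) + eps + (La * norm (x - y) + La * R * sqrt (\<bar>t - s\<bar> + 1 / real (Suc (r n))))"
  proof eventually_elim
   case (elim n)
   thus ?case using V_lip[of "r n" x t y] V_time[of "r n" y t s] sign_mult[of "V (r n) (x, t)" "V (r n) (y, s)"] by linarith
  qed
  from tendsto_le[OF sequentially_bot l r(2) this]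
  show "U (x, t) \<le> U (y, s) + (La * norm (x - y) + La * R * sqrt \<bar>t - s\<bar>) + eps" by simp
 qed
 show ?thesis using half[of x t y s] half[of y s x t] by (simp add: norm_minus_commute abs_minus_commute abs_le_iff)
qed

lemma limit_nonneg_time:
 assumes "limit_above sg U" "0 \<le> t"
 shows "U (x, t) = sg * f x"
proof -
 obtain r where r: "(\<lambda>n. sg * V (r n) (x, t)) \<longlonglongrightarrow> U (x, t)"
  using assms(1) unfolding limit_above_def by metis
 thus ?thesis using V_nonneg_time[OF assms(2)] by (simp add: LIMSEQ_const_iff)
qed

text \<open>The maximum points of \<open>sg V - ph\<close> on the grid converge to the touching point; near them one step of
 the game changes \<open>V\<close> at most as much as \<open>ph\<close>.\<close>

lemma touching_points:
 assumes U: "limit_above sg U" and N: "open N" "(x0, t0) \<in> N" and t0: "t0 < 0"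
  and T: "is_test_function N ph pht g H"
  and mx: "\<forall>\<^sub>F z in nhds (x0, t0). U z - ph z \<le> U (x0, t0) - ph (x0, t0)"
 obtains q k S X where "strict_mono q" "k \<longlonglongrightarrow> g (x0, t0)"
  "!!eps. 0 < eps ==> \<forall>\<^sub>F n in sequentially. S n \<le> - 1 / real (Suc (q n)) \<and> (\<forall>a. norm a \<le> R -->
   sg * (V (q n) (X n + sqrt (1 / real (Suc (q n))) *\<^sub>R a, S n + 1 / real (Suc (q n))) - V (q n) (X n, S n))
    \<le> sqrt (1 / real (Suc (q n))) * (k n \<bullet> a) + (pht (x0, t0) + quad (H (x0, t0)) a / 2 + eps) / real (Suc (q n)))"
proof -
 define z0 where "z0 = (x0, t0)"
 define pen where "pen z = ((fst z - x0) \<bullet> (fst z - x0))^2 + (snd z - t0)^2" for z :: "(real^'m) \<times> real"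
 define ps where "ps = (\<lambda>z. ph z + pen z)"
 define pst where "pst = (\<lambda>z. pht z + (2 * (snd z - t0)))"
 define k where "k = (\<lambda>z. g z + (4 * ((fst z - x0) \<bullet> (fst z - x0))) *\<^sub>R (fst z - x0))"
 define J where "J = (\<lambda>z. H z + ((4 * ((fst z - x0) \<bullet> (fst z - x0))) *\<^sub>R mat 1 + 8 *\<^sub>R (\<chi> i j. (fst z - x0) $ i * (fst z - x0) $ j)))"
 have T': "is_test_function N ps pst k J"
  using test_function_penalized[OF T, of 1 x0 t0] by (simp add: ps_def pst_def k_def J_def pen_def)
 have at0: "ps z0 = ph z0" "pst z0 = pht z0" "k z0 = g z0" "J z0 = H z0"
  by (simp_all add: ps_def pst_def k_def J_def pen_def z0_def vec_eq_iff)
 have "\<forall>\<^sub>F z in nhds (x0, t0). z \<in> N" using N by (simp add: eventually_nhds_in_open)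
 with mx have "\<forall>\<^sub>F z in nhds (x0, t0). z \<in> N \<and> U z - ph z \<le> U (x0, t0) - ph (x0, t0)" by eventually_elim auto
 then obtain rh where rh: "0 < rh" "!!x t. x \<in> cball x0 rh ==> t \<in> cball t0 rh ==> (x, t) \<in> N \<and> U (x, t) - ph (x, t) \<le> U (x0, t0) - ph (x0, t0)"
  by (rule box_in_nhds[where a = 1]) auto
 have cont: "continuous_on (cball x0 rh \<times> cball t0 rh) ps"
  by (rule continuous_on_subset[OF test_function_continuous[OF T' N(1)]]) (use rh in auto)
 obtain r where r: "strict_mono r" "(\<lambda>n. sg * V (r n) (x0, t0)) \<longlonglongrightarrow> U (x0, t0)" using U unfolding limit_above_def by blast
 obtain q X S where q: "strict_mono q" "X \<longlonglongrightarrow> x0" "S \<longlonglongrightarrow> t0" "!!n. \<exists>k::int. S n = t0 + k / real (Suc (q n))"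
  "!!n x t. x \<in> cball x0 rh ==> t \<in> cball t0 rh ==> (\<exists>k::int. t = t0 + k / real (Suc (q n))) ==>
   sg * V (q n) (x, t) - ps (x, t) \<le> sg * V (q n) (X n, S n) - ps (X n, S n)"
 proof (rule maximum_points_concentrate[where F = "\<lambda>n z. sg * V n z" and U = U and L = La and L' = "La * R" and ph = ps and ?x0.0 = x0 and ?t0.0 = t0 and r = r])
  show "\<forall>\<^sub>F n in sequentially. sg * V n z < U z + eps" if "0 < eps" for z eps using U that unfolding limit_above_def by blast
  show "U (x, t) - ps (x, t) < U (x0, t0) - ps (x0, t0)" if "x \<in> cball x0 rh" "t \<in> cball t0 rh" "(x, t) \<noteq> (x0, t0)" for x t
  proof -
   have "pen (x, t) > 0" using that(3) unfolding pen_def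
    by (auto simp: add_pos_nonneg add_nonneg_pos zero_less_power2)
   thus ?thesis using rh(2)[OF that(1,2)] at0(1) by (simp add: ps_def z0_def pen_def)
  qed
 qed (use V_lip V_time r rh(1) cont in \<open>auto simp: sign_mult\<close>)
 define h where "h n = 1 / real (Suc (q n))" for n
 have hpos: "h n > 0" for n by (simp add: h_def)
 have h0: "h \<longlonglongrightarrow> 0"
  using LIMSEQ_subseq_LIMSEQ[OF LIMSEQ_inverse_real_of_nat q(1)] by (simp add: h_def[abs_def] o_def inverse_eq_divide)
 have zlim: "(\<lambda>n. (X n, S n)) \<longlonglongrightarrow> z0" unfolding z0_def by (intro tendsto_Pair q)
 have "continuous_on N k" using T' unfolding is_test_function_def by auto
 hence "isCont k z0" using N by (simp add: continuous_on_eq_continuous_at z0_def)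
 from isCont_tendsto_compose[OF this zlim] have kl: "(\<lambda>n. k (X n, S n)) \<longlonglongrightarrow> g (x0, t0)" by (simp add: at0) (simp add: z0_def)
 show thesis
 proof (rule that[OF q(1) kl])
  fix eps :: real assume eps: "eps > 0"
  obtain dl where dl: "0 < dl" "!!x t a h. dist (x, t) z0 < dl ==> norm a \<le> R ==> 0 < h ==> h < dl ==>
  \<bar>ps (x + sqrt h *\<^sub>R a, t + h) - ps (x, t) - sqrt h * (k (x, t) \<bullet> a) - h * (pst z0 + quad (J z0) a / 2)\<bar> \<le> eps * h"
   using test_function_taylor[OF T' N(1) N(2)[folded z0_def] eps R_pos] by blast
  have "(\<lambda>n. dist (X n) x0 + sqrt (h n) * R) \<longlonglongrightarrow> dist x0 x0 + sqrt 0 * R" by (intro tendsto_intros q h0)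
  hence e1: "\<forall>\<^sub>F n in sequentially. dist (X n) x0 + sqrt (h n) * R < rh" using rh(1) by (intro order_tendstoD(2)) auto
  have "(\<lambda>n. dist (S n) t0 + h n) \<longlonglongrightarrow> dist t0 t0 + 0" by (intro tendsto_intros q h0)
  hence e2: "\<forall>\<^sub>F n in sequentially. dist (S n) t0 + h n < rh" using rh(1) by (intro order_tendstoD(2)) auto
  have "(\<lambda>n. S n + h n) \<longlonglongrightarrow> t0 + 0" by (intro tendsto_intros q h0)
  hence e3: "\<forall>\<^sub>F n in sequentially. S n + h n < 0" using t0 by (intro order_tendstoD(2)) auto
  have e4: "\<forall>\<^sub>F n in sequentially. h n < dl" using h0 dl(1) by (intro order_tendstoD(2)) auto
  have e5: "\<forall>\<^sub>F n in sequentially. dist (X n, S n) z0 < dl" using zlim dl(1) by (rule tendstoD)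
  have "\<forall>\<^sub>F n in sequentially. S n \<le> - h n \<and> (\<forall>a. norm a \<le> R -->
   sg * (V (q n) (X n + sqrt (h n) *\<^sub>R a, S n + h n) - V (q n) (X n, S n)) \<le> sqrt (h n) * (k (X n, S n) \<bullet> a) + (pht z0 + quad (H z0) a / 2 + eps) * h n)"
   using e1 e2 e3 e4 e5
  proof eventually_elim
   case (elim n)
   have "sg * (V (q n) (x', t') - V (q n) (X n, S n)) \<le> sqrt (h n) * (k (X n, S n) \<bullet> a) + (pht z0 + quad (H z0) a / 2 + eps) * h n"
    if na: "norm a \<le> R" and x': "x' = X n + sqrt (h n) *\<^sub>R a" and t': "t' = S n + h n" for a x' t'
   proof -
    have "sg * V (q n) (x', t') - ps (x', t') \<le> sg * V (q n) (X n, S n) - ps (X n, S n)"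
    proof (rule q(5))
     have "dist x0 x' \<le> dist (X n) x0 + norm (sqrt (h n) *\<^sub>R a)"
      using dist_triangle[of x0 x' "X n"] by (simp add: x' dist_norm norm_minus_commute)
     also have "norm (sqrt (h n) *\<^sub>R a) \<le> sqrt (h n) * R" using na hpos[of n] by (simp add: mult_left_mono)
     finally show "x' \<in> cball x0 rh" using elim(1) by simp
     show "t' \<in> cball t0 rh" using elim(2) hpos[of n] by (simp add: t' dist_real_def)
     obtain i :: int where "S n = t0 + i / real (Suc (q n))" using q(4) by blast
     hence "t' = t0 + (i + 1 :: int) / real (Suc (q n))" by (simp add: t' h_def add_divide_distrib)
     thus "\<exists>k::int. t' = t0 + k / real (Suc (q n))" by blast
    qed
    moreover have "\<bar>ps (x', t') - ps (X n, S n) - sqrt (h n) * (k (X n, S n) \<bullet> a) - h n * (pst z0 + quad (J z0) a / 2)\<bar> \<le> eps * h n"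
     unfolding x' t' by (rule dl(2)[OF elim(5) na hpos elim(4)])
    moreover have "(pht z0 + quad (H z0) a / 2 + eps) * h n = h n * (pst z0 + quad (J z0) a / 2) + eps * h n" by (simp add: at0 algebra_simps)
    ultimately show ?thesis unfolding right_diff_distrib by linarith
   qed
   thus ?case using elim(3) by simp
  qed
  thus "\<forall>\<^sub>F n in sequentially. S n \<le> - 1 / real (Suc (q n)) \<and> (\<forall>a. norm a \<le> R -->
   sg * (V (q n) (X n + sqrt (1 / real (Suc (q n))) *\<^sub>R a, S n + 1 / real (Suc (q n))) - V (q n) (X n, S n))
    \<le> sqrt (1 / real (Suc (q n))) * (k (X n, S n) \<bullet> a) + (pht (x0, t0) + quad (H (x0, t0)) a / 2 + eps) / real (Suc (q n)))"
   by (simp add: h_def z0_def del: of_nat_Suc)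
 qed
qed

end

text \<open>Near-optimal matrices at the maximum points converge along a subsequence because
  \<open>AA\<close> is compact. At order \<open>sqrt h\<close> the expansion forces the limit to be
  tangent to \<open>p\<close>; at order \<open>h\<close> it gives the second order
  inequality.\<close>

theorem (in game_scheme) upper_limit_touched:
 assumes U: "limit_above 1 U"
 shows "touched_above (sub_condition AA) U"
 unfolding touched_above_def
proof (intro allI impI, elim conjE)
 fix N ph pht g H x0 t0
 assume *: "open N" "(x0, t0) \<in> N" "t0 < 0" "is_test_function N ph pht g H"
  "\<forall>\<^sub>F z in nhds (x0, t0). U z - ph z \<le> U (x0, t0) - ph (x0, t0)"
 interpret S: signed_scheme AA f La R 1 by unfold_locales simp
 define p a X where "p = g (x0, t0)" and "a = pht (x0, t0)" and "X = H (x0, t0)"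
 obtain q k S Y where q: "strict_mono q" "k \<longlonglongrightarrow> p"
  "!!eps. 0 < eps ==> \<forall>\<^sub>F n in sequentially. S n \<le> - 1 / real (Suc (q n)) \<and> (\<forall>b. norm b \<le> R -->
   1 * (V (q n) (Y n + sqrt (1 / real (Suc (q n))) *\<^sub>R b, S n + 1 / real (Suc (q n))) - V (q n) (Y n, S n))
    \<le> sqrt (1 / real (Suc (q n))) * (k n \<bullet> b) + (a + quad X b / 2 + eps) / real (Suc (q n)))"
  by (rule S.touching_points[OF U *, folded p_def a_def X_def]) (rule that, assumption+)
 \<comment> \<open>A round lasts \<open>h = 1 / real (Suc (q n))\<close>; a tolerance of
   \<open>h^2\<close> in the choice of the matrix is negligible at the relevant order
   \<open>h\<close>.\<close>
 have "\<exists>A\<in>AA. S n \<le> - 1 / real (Suc (q n)) --> (\<forall>e\<in>sign_vectors. V (q n) (Y n, S n) - (1 / real (Suc (q n)))^2 \<le>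
   V (q n) (Y n + sqrt (1 / real (Suc (q n))) *\<^sub>R (A *v e), S n + 1 / real (Suc (q n))))" for n
  using V_le[of "S n" "q n" "(1 / real (Suc (q n)))^2" "Y n"] AA_nonempty by (cases "S n \<le> - 1 / real (Suc (q n))") auto
 then obtain A where A: "!!n. A n \<in> AA" "!!n e. S n \<le> - 1 / real (Suc (q n)) ==> e \<in> sign_vectors ==> V (q n) (Y n, S n) - (1 / real (Suc (q n)))^2 \<le>
   V (q n) (Y n + sqrt (1 / real (Suc (q n))) *\<^sub>R (A n *v e), S n + 1 / real (Suc (q n)))" by metis
 obtain A0 s where A0: "A0 \<in> AA" and s: "strict_mono s" "(A \<circ> s) \<longlonglongrightarrow> A0"
  using AA_compact A(1) unfolding compact_def by metis
 have As: "(\<lambda>n. A (s n)) \<longlonglongrightarrow> A0" using s(2) by (simp add: o_def)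
 have ks: "(\<lambda>n. k (s n)) \<longlonglongrightarrow> p" using LIMSEQ_subseq_LIMSEQ[OF q(2) s(1)] by (simp add: o_def)
 define w where "w n = sqrt (1 / real (Suc (q (s n))))" for n
 have w: "w n > 0" "1 / real (Suc (q (s n))) = w n * w n" for n by (simp_all add: w_def)
 have w0: "w \<longlonglongrightarrow> 0"
  using tendsto_real_sqrt[OF LIMSEQ_subseq_LIMSEQ[OF LIMSEQ_inverse_real_of_nat strict_mono_o[OF q(1) s(1)]]]
  by (simp add: w_def[abs_def] o_def inverse_eq_divide)
 have main: "\<forall>\<^sub>F n in sequentially. \<forall>e\<in>sign_vectors. 0 \<le> w n * w n * w n + k (s n) \<bullet> (A (s n) *v e) + w n * (a + quad X (A (s n) *v e) / 2 + eps)"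
  if eps: "eps > 0" for eps
  using eventually_subseq[OF s(1) q(3)[OF eps]]
 proof (eventually_elim, intro ballI)
  case (elim n)
  fix e :: "real^'n" assume e: "e \<in> sign_vectors"
  define b where "b = A (s n) *v e"
  have gen: "- c \<le> 1 * (y - x)" if "x - c \<le> y" for x y c :: real using that by simp
  have "norm b \<le> R" unfolding b_def by (rule AA_bound[OF A(1) e])
  have "- ((1 / real (Suc (q (s n))))^2) \<le> 1 * (V (q (s n)) (Y (s n) + sqrt (1 / real (Suc (q (s n)))) *\<^sub>R b, S (s n) + 1 / real (Suc (q (s n)))) - V (q (s n)) (Y (s n), S (s n)))"
   by (rule gen[OF A(2)[OF elim[THEN conjunct1] e, folded b_def]])
  also have "\<dots> \<le> w n * (k (s n) \<bullet> b) + (a + quad X b / 2 + eps) / real (Suc (q (s n)))"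
   using elim \<open>norm b \<le> R\<close> unfolding w_def by blast
  also have "\<dots> = w n * (k (s n) \<bullet> b) + (a + quad X b / 2 + eps) * (1 / real (Suc (q (s n))))" by simp
  finally have "- ((1 / real (Suc (q (s n))))^2) \<le> w n * (k (s n) \<bullet> b) + (a + quad X b / 2 + eps) * (1 / real (Suc (q (s n))))" .
  hence "0 \<le> w n * (w n * w n * w n + k (s n) \<bullet> b + w n * (a + quad X b / 2 + eps))"
   unfolding w(2) by (simp add: algebra_simps power2_eq_square)
  thus "0 \<le> w n * w n * w n + k (s n) \<bullet> (A (s n) *v e) + w n * (a + quad X (A (s n) *v e) / 2 + eps)"
   using w(1)[of n] by (simp add: zero_le_mult_iff b_def)
 qed
 have A0g: "0 \<le> p \<bullet> (A0 *v e)" if e: "e \<in> sign_vectors" for e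
 proof -
  have "(\<lambda>n. w n * w n * w n + k (s n) \<bullet> (A (s n) *v e) + w n * (a + quad X (A (s n) *v e) / 2 + 1))
   \<longlonglongrightarrow> 0 * 0 * 0 + p \<bullet> (A0 *v e) + 0 * (a + quad X (A0 *v e) / 2 + 1)"
   by (intro tendsto_intros w0 ks As) simp
  moreover have "\<forall>\<^sub>F n in sequentially. 0 \<le> w n * w n * w n + k (s n) \<bullet> (A (s n) *v e) + w n * (a + quad X (A (s n) *v e) / 2 + 1)"
   using main[of 1] e by (auto elim: eventually_mono)
  ultimately show ?thesis using tendsto_lowerbound by fastforce
 qed
 have "p \<bullet> (A0 *v e) = 0" if e: "e \<in> sign_vectors" for e
  using A0g[OF e] A0g[OF minus_sign_vector[OF e]] by (simp add: matrix_vector_mult_minus_right)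
 hence tr: "transpose A0 *v p = 0"
  by (intro sign_vectors_orthogonal) (simp add: transpose_vec_inner del: transpose_matrix_vector)
 have "0 \<le> a + quad X (A0 *v e) / 2" if e: "e \<in> sign_vectors" for e
 proof (rule field_le_epsilon)
  fix eps :: real assume eps: "eps > 0"
  have ev: "\<forall>\<^sub>F n in sequentially. 0 \<le> w n * w n + (a + quad X (A (s n) *v e) / 2 + eps)"
   using main[OF eps]
  proof eventually_elim
   case (elim n)
   \<comment> \<open>The inequalities for \<open>e\<close> and \<open>- e\<close> are added: the
     first order terms, still not tangent for finite \<open>n\<close>, cancel, while the quadratic
     form is even.\<close>
   have "0 \<le> w n * (w n * w n + (a + quad X (A (s n) *v e) / 2 + eps))"
    using elim[rule_format, OF e] elim[rule_format, OF minus_sign_vector[OF e]]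
    by (simp add: matrix_vector_mult_minus_right quad_minus distrib_left mult.assoc)
   thus ?case using w(1)[of n] by (simp add: zero_le_mult_iff)
  qed
  have "(\<lambda>n. w n * w n + (a + quad X (A (s n) *v e) / 2 + eps)) \<longlonglongrightarrow> 0 * 0 + (a + quad X (A0 *v e) / 2 + eps)"
   by (intro tendsto_intros w0 As) simp
  from tendsto_lowerbound[OF this ev] show "0 \<le> a + quad X (A0 *v e) / 2 + eps" by simp
 qed
 with A0 tr show "sub_condition AA (pht (x0, t0)) (g (x0, t0)) (H (x0, t0))"
  unfolding sub_condition_def p_def a_def X_def by blast
qed

text \<open>A matrix tangent to the limit direction \<open>d\<close> need not be tangent to the
  gradients at the approximating points, and the first order error would spoil the inequality. It is
  therefore rotated by the \<open>Q n\<close> that takes \<open>d\<close> to the actual gradient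
  direction, which makes the first order term vanish exactly.\<close>

theorem (in game_scheme) lower_limit_touched:
 assumes U: "limit_above (- 1) U"
 shows "touched_above (super_condition AA) U"
 unfolding touched_above_def
proof (intro allI impI, elim conjE)
 fix N ph pht g H x0 t0
 assume *: "open N" "(x0, t0) \<in> N" "t0 < 0" "is_test_function N ph pht g H"
  "\<forall>\<^sub>F z in nhds (x0, t0). U z - ph z \<le> U (x0, t0) - ph (x0, t0)"
 interpret S: signed_scheme AA f La R "- 1" by unfold_locales simp
 define p a X where "p = g (x0, t0)" and "a = pht (x0, t0)" and "X = H (x0, t0)"
 obtain q k S Y where q: "strict_mono q" "k \<longlonglongrightarrow> p"
  "!!eps. 0 < eps ==> \<forall>\<^sub>F n in sequentially. S n \<le> - 1 / real (Suc (q n)) \<and> (\<forall>b. norm b \<le> R -->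
   - 1 * (V (q n) (Y n + sqrt (1 / real (Suc (q n))) *\<^sub>R b, S n + 1 / real (Suc (q n))) - V (q n) (Y n, S n))
    \<le> sqrt (1 / real (Suc (q n))) * (k n \<bullet> b) + (a + quad X b / 2 + eps) / real (Suc (q n)))"
  by (rule S.touching_points[OF U *, folded p_def a_def X_def]) (rule that, assumption+)
 \<comment> \<open>At a vanishing gradient any unit vector may serve as direction, since
   \<open>k n = norm (k n) *\<^sub>R D n\<close> remains true.\<close>
 define D where "D n = (if k n = 0 then axis (SOME i. True) 1 else k n /\<^sub>R norm (k n))" for n
 have D: "norm (D n) = 1" "k n = norm (k n) *\<^sub>R D n" for n by (auto simp: D_def)
 hence "\<forall>n. D n \<in> sphere 0 1" by simp
 then obtain d s where "d \<in> sphere 0 1" and s: "strict_mono s" "(D \<circ> s) \<longlonglongrightarrow> d"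
  using compact_sphere[of "0::real^'m" 1] unfolding compact_def by metis
 hence d: "norm d = 1" by simp
 have Ds: "(\<lambda>n. D (s n)) \<longlonglongrightarrow> d" using s(2) by (simp add: o_def)
 have ks: "(\<lambda>n. k (s n)) \<longlonglongrightarrow> p" using LIMSEQ_subseq_LIMSEQ[OF q(2) s(1)] by (simp add: o_def)
 have "(\<lambda>n. norm (k (s n)) *\<^sub>R D (s n)) \<longlonglongrightarrow> norm p *\<^sub>R d" by (intro tendsto_intros ks Ds)
 hence pd: "p = norm p *\<^sub>R d" using ks D(2) LIMSEQ_unique by (metis (no_types, lifting) ext)
 have "\<exists>e\<in>sign_vectors. 0 \<le> a + quad X (A *v e) / 2" if A: "A \<in> AA" "transpose A *v d = 0" for A
 proof (rule ccontr)
  assume "\<not> ?thesis"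
  hence neg: "!!e. e \<in> sign_vectors ==> a + quad X (A *v e) / 2 < 0" by force
  define m where "m = - Max ((\<lambda>e. a + quad X (A *v e) / 2) ` sign_vectors)"
  have fin: "finite ((\<lambda>e. a + quad X (A *v e) / 2) ` sign_vectors)" "(\<lambda>e. a + quad X (A *v e) / 2) ` sign_vectors \<noteq> {}"
   using finite_sign_vectors sign_vectors_nonempty by auto
  have m: "m > 0" "!!e. e \<in> sign_vectors ==> a + quad X (A *v e) / 2 \<le> - m"
   using Max_in[OF fin] neg Max_ge[OF fin(1)] unfolding m_def by auto
  have "\<exists>Q. norm (d - D (s n)) \<le> 1 --> orthogonal_transformation Q \<and> Q d = D (s n) \<and> (\<forall>x. norm (Q x - x) \<le> 4 * norm (d - D (s n)) * norm x)" for n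
   using rotation_between_unit_vectors[of d "D (s n)"] d D(1) by metis
  then obtain Q where Q: "!!n. norm (d - D (s n)) \<le> 1 ==> orthogonal_transformation (Q n)" "!!n. norm (d - D (s n)) \<le> 1 ==> Q n d = D (s n)"
   "!!n x. norm (d - D (s n)) \<le> 1 ==> norm (Q n x - x) \<le> 4 * norm (d - D (s n)) * norm x" by metis
  have "(\<lambda>n. norm (d - D (s n))) \<longlonglongrightarrow> norm (d - d)" by (intro tendsto_intros Ds)
  hence dn: "(\<lambda>n. norm (d - D (s n))) \<longlonglongrightarrow> 0" by simp
  hence e0: "\<forall>\<^sub>F n in sequentially. norm (d - D (s n)) < 1" by (intro order_tendstoD(2)) auto
  have ql: "(\<lambda>n. Q n x) \<longlonglongrightarrow> x" for x
  proof (rule LIM_zero_cancel, rule Lim_null_comparison)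
   show "\<forall>\<^sub>F n in sequentially. norm (Q n x - x) \<le> 4 * norm (d - D (s n)) * norm x"
    using e0 by eventually_elim (use Q in auto)
   show "(\<lambda>n. 4 * norm (d - D (s n)) * norm x) \<longlonglongrightarrow> 0"
    using tendsto_mult_right[OF tendsto_mult_left[OF dn, of 4], of "norm x"] by simp
  qed
  have evm: "\<forall>\<^sub>F n in sequentially. \<forall>e\<in>sign_vectors. a + quad X (Q n (A *v e)) / 2 < - (m / 2)"
  proof (intro eventually_ball_finite finite_sign_vectors ballI)
   fix e :: "real^'n" assume e: "e \<in> sign_vectors"
   have "(\<lambda>n. a + quad X (Q n (A *v e)) / 2) \<longlonglongrightarrow> a + quad X (A *v e) / 2"
    by (intro tendsto_intros ql) simp
   thus "\<forall>\<^sub>F n in sequentially. a + quad X (Q n (A *v e)) / 2 < - (m / 2)"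
    by (rule order_tendstoD(2)) (use m(1) m(2)[OF e] in linarith)
  qed
  have "0 < m / 4" using m(1) by simp
  from evm e0 eventually_subseq[OF s(1) q(3)[OF this]] have "\<forall>\<^sub>F n in sequentially. False"
  proof eventually_elim
   case (elim n)
   have Qn: "orthogonal_transformation (Q n)" "Q n d = D (s n)" using Q elim(2) by auto
   have QA: "(matrix (Q n) ** A) *v e = Q n (A *v e)" for e
    using Qn(1) by (simp add: matrix_vector_mul_assoc[symmetric] orthogonal_transformation_def matrix_works)
   define h where "h = 1 / real (Suc (q (s n)))"
   have h: "h > 0" by (simp add: h_def)
   from V_ge[OF elim(3)[THEN conjunct1] AA_rot[OF Qn(1) A(1)], of "Y (s n)"] obtain e where e: "e \<in> sign_vectors"
    "V (q (s n)) (Y (s n) + sqrt h *\<^sub>R Q n (A *v e), S (s n) + h) \<le> V (q (s n)) (Y (s n), S (s n))"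
    unfolding QA h_def by blast
   define b where "b = Q n (A *v e)"
   have nb: "norm b \<le> R" using AA_bound[OF AA_rot[OF Qn(1) A(1)] e(1)] by (simp add: b_def QA)
   have "D (s n) \<bullet> b = d \<bullet> (A *v e)" using Qn unfolding b_def by (metis orthogonal_transformation_def)
   also have "\<dots> = 0" using A(2) transpose_vec_inner[of A d e] by (simp del: transpose_matrix_vector)
   finally have kb: "k (s n) \<bullet> b = 0" by (subst D(2)) simp
   have "0 \<le> (a + quad X b / 2 + m / 4) * h"
    using elim(3)[THEN conjunct2, rule_format, OF nb] e(2) unfolding b_def[symmetric] kb h_def by (simp del: of_nat_Suc)
   hence "0 \<le> a + quad X b / 2 + m / 4" using h by (simp add: zero_le_mult_iff)
   thus False using elim(1) e(1) m(1) unfolding b_def by fastforce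
  qed
  thus False by simp
 qed
 thus "super_condition AA (pht (x0, t0)) (g (x0, t0)) (H (x0, t0))"
  using d pd unfolding super_condition_def p_def a_def X_def by blast
qed

section \<open>Sup-convolution and comparison\<close>

text \<open>Homogeneous under parabolic scaling. Its spatial Hessian is quadratic in the
  displacement and its gradient cubic, so a small gradient forces a small Hessian.\<close>

definition penalty :: "(real^'m) \<times> real => real" where
 "penalty z = (fst z \<bullet> fst z)^2 + (snd z)^2"

lemma penalty_nonneg: "0 \<le> penalty z" by (simp add: penalty_def)

lemma penalty_minus: "penalty (- z) = penalty z" by (simp add: penalty_def)

lemma penalty_minus_commute: "penalty (z - z') = penalty (z' - z)"
 using penalty_minus[of "z - z'"] by simp

text \<open>Semiconcavity on bounded displacements. The terms of second and higher order in the
  spatial increment contribute \<open>2 + 4 + 4 + 1 = 11\<close>.\<close>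

lemma penalty_add_le:
 fixes z y :: "(real^'m) \<times> real"
 assumes "norm (fst z) \<le> 1" "norm y \<le> 1"
 shows "penalty (z + y) \<le> penalty z + ((4 * (fst z \<bullet> fst z)) *\<^sub>R fst z, 2 * snd z) \<bullet> y + 11 * (norm y)^2"
proof -
 define d b s where "d = fst z" and "b = fst y" and "s = snd y"
 have nb: "norm b \<le> 1" using assms(2) norm_fst_le[of b s] by (simp add: b_def s_def)
 have ny: "(norm y)^2 = b \<bullet> b + s^2"
  by (simp add: norm_prod_def b_def s_def power2_norm_eq_inner)
 have dd: "d \<bullet> d \<le> 1" "d \<bullet> d \<ge> 0" using assms(1) by (simp_all add: d_def flip: power2_norm_eq_inner) (simp add: power_le_one)
 have bb: "b \<bullet> b \<le> 1" "b \<bullet> b \<ge> 0" using nb by (simp_all flip: power2_norm_eq_inner) (simp add: power_le_one)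
 have db: "(d \<bullet> b)^2 \<le> b \<bullet> b"
 proof -
  have "(d \<bullet> b)^2 \<le> (d \<bullet> d) * (b \<bullet> b)" by (rule Cauchy_Schwarz_ineq)
  also have "\<dots> \<le> 1 * (b \<bullet> b)" using dd bb by (intro mult_right_mono) auto
  finally show ?thesis by simp
 qed
 have db1: "\<bar>d \<bullet> b\<bar> \<le> 1"
 proof -
  have "(d \<bullet> b)^2 \<le> 1^2" using db bb by simp
  thus ?thesis by (simp only: abs_le_square_iff[symmetric] abs_one)
 qed
 have 1: "2 * (d \<bullet> d) * (b \<bullet> b) \<le> 2 * (b \<bullet> b)" using mult_right_mono[OF dd(1) bb(2)] by simp
 have 2: "4 * (d \<bullet> b) * (b \<bullet> b) \<le> 4 * (b \<bullet> b)" using mult_right_mono[of "d \<bullet> b" 1, OF _ bb(2)] db1 by simp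
 have 3: "(b \<bullet> b) * (b \<bullet> b) \<le> b \<bullet> b" using mult_right_mono[OF bb(1) bb(2)] by simp
 have "((d + b) \<bullet> (d + b))^2 = (d \<bullet> d)^2 + 4 * (d \<bullet> d) * (d \<bullet> b) + (2 * (d \<bullet> d) * (b \<bullet> b) + 4 * (d \<bullet> b)^2 + 4 * (d \<bullet> b) * (b \<bullet> b) + (b \<bullet> b) * (b \<bullet> b))"
  by (simp add: inner_add_left inner_add_right inner_commute[of b d] power2_eq_square algebra_simps)
 also have "\<dots> \<le> (d \<bullet> d)^2 + 4 * (d \<bullet> d) * (d \<bullet> b) + 11 * (b \<bullet> b)"
  using 1 2 3 db by linarith
 finally have f1: "((d + b) \<bullet> (d + b))^2 \<le> (d \<bullet> d)^2 + 4 * (d \<bullet> d) * (d \<bullet> b) + 11 * (b \<bullet> b)" .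
 have f2: "(snd z + s)^2 = (snd z)^2 + 2 * snd z * s + s^2" by (simp add: power2_eq_square algebra_simps)
 have f3: "0 \<le> s^2" by simp
 have f4: "penalty (z + y) = ((d + b) \<bullet> (d + b))^2 + (snd z + s)^2" "penalty z = (d \<bullet> d)^2 + (snd z)^2"
  by (simp_all add: penalty_def d_def b_def s_def)
 have f5: "((4 * (fst z \<bullet> fst z)) *\<^sub>R fst z, 2 * snd z) \<bullet> y = 4 * (d \<bullet> d) * (d \<bullet> b) + 2 * snd z * s"
  by (simp add: inner_prod_def d_def b_def s_def)
 have "P' \<le> P + I + 11 * (b' + c')"
  if "a \<le> A + I1 + 11 * b'" "q = Q + I2 + c'" "0 \<le> c'" "P' = a + q" "P = A + Q" "I = I1 + I2" for P P' I I1 I2 a A b' c' q Q :: real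
  using that by simp
 from this[OF f1 f2 f3 f4 f5] show ?thesis unfolding ny .
qed

text \<open>At parabolic distance \<open>c\<close> the function gains at most
  \<open>(L + B) * c\<close>, while the penalty costs at least \<open>c^4 / eps\<close>. The choice
  of \<open>eps\<close> balances the two at \<open>c = th\<close>, so every maximizer lies within
  parabolic distance \<open>th\<close>.\<close>

lemma sup_convolution:
 fixes w :: "(real^'m) \<times> real => real"
 assumes mod: "!!x t y s. \<bar>w (x, t) - w (y, s)\<bar> \<le> L * norm (x - y) + B * sqrt \<bar>t - s\<bar>"
  and LB: "0 < L" "0 < B" and th: "0 < th" and eps: "eps = th^3 / (L + B)"
 obtains m where "!!z z'. w z' - penalty (z - z') / eps \<le> w (m z) - penalty (z - m z) / eps"
  "!!z. norm (fst z - fst (m z)) \<le> th" "!!z. \<bar>snd z - snd (m z)\<bar> \<le> th^2"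
proof -
 have eps0: "eps > 0" using LB th by (simp add: eps)
 have cont: "continuous_on S w" for S by (rule modulus_continuous[OF mod])
 have far: "w z' - penalty (z - z') / eps < w z" if far: "norm (fst z - fst z') > th \<or> \<bar>snd z - snd z'\<bar> > th^2" for z z'
 proof -
  define c where "c = max (norm (fst z - fst z')) (sqrt \<bar>snd z - snd z'\<bar>)"
  have cth: "c > th"
  proof (cases "norm (fst z - fst z') > th")
   case False
   hence "sqrt (th^2) < sqrt \<bar>snd z - snd z'\<bar>" using far by (subst real_sqrt_less_iff) auto
   thus ?thesis using th by (simp add: c_def)
  qed (simp add: c_def)
  have "w z' - w z \<le> L * norm (fst z - fst z') + B * sqrt \<bar>snd z - snd z'\<bar>"
   using mod[of "fst z'" "snd z'" "fst z" "snd z"] by (simp add: norm_minus_commute abs_minus_commute)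
  also have "\<dots> \<le> L * c + B * c" using LB by (intro add_mono mult_left_mono) (auto simp: c_def)
  also have "\<dots> = (L + B) * c" by (simp add: algebra_simps)
  also have "\<dots> < c^4 / eps"
  proof -
   have "th^3 < c^3" using cth th by (intro power_strict_mono) auto
   hence "th^3 * c < c^3 * c" using cth th by simp
   moreover have "c^4 / eps = (L + B) * (c^3 * c) / th^3" using th LB by (simp add: eps field_simps eval_nat_numeral)
   moreover have "(L + B) * c = (L + B) * (th^3 * c) / th^3" using th by simp
   moreover have "(L + B) * (th^3 * c) < (L + B) * (c^3 * c)"
    using LB \<open>th^3 * c < c^3 * c\<close> by (intro mult_strict_left_mono) auto
   hence "(L + B) * (th^3 * c) / th^3 < (L + B) * (c^3 * c) / th^3"
    using th by (intro divide_strict_right_mono) auto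
   ultimately show ?thesis by linarith
  qed
  also have "c^4 \<le> penalty (z - z')"
  proof -
   have "c = norm (fst z - fst z') \<or> c = sqrt \<bar>snd z - snd z'\<bar>" by (auto simp: c_def max_def)
   thus ?thesis
   proof
    assume c: "c = norm (fst z - fst z')"
    have "c^4 = (c^2)^2" by simp
    also have "c^2 = (fst z - fst z') \<bullet> (fst z - fst z')" by (simp add: c power2_norm_eq_inner)
    finally show ?thesis by (simp add: penalty_def)
   next
    assume c: "c = sqrt \<bar>snd z - snd z'\<bar>"
    have "c^4 = (c^2)^2" by simp
    also have "c^2 = \<bar>snd z - snd z'\<bar>" by (simp add: c)
    finally show ?thesis by (simp add: penalty_def)
   qed
  qed
  finally show ?thesis using eps0 by (simp add: divide_right_mono)
 qed
 have "\<exists>y. (\<forall>z'. w z' - penalty (z - z') / eps \<le> w y - penalty (z - y) / eps) \<and> norm (fst z - fst y) \<le> th \<and> \<bar>snd z - snd y\<bar> \<le> th^2" for z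
 proof -
  define C where "C = cball (fst z) th \<times> cball (snd z) (th^2)"
  have "compact C" unfolding C_def by (intro compact_Times compact_cball)
  moreover have zC: "z \<in> C" using th by (auto simp: C_def mem_Times_iff)
  moreover have "continuous_on C (\<lambda>z'. w z' - penalty (z - z') / eps)"
   unfolding penalty_def using eps0 by (intro continuous_intros cont) auto
  ultimately obtain y where y: "y \<in> C" "!!z'. z' \<in> C ==> w z' - penalty (z - z') / eps \<le> w y - penalty (z - y) / eps"
   using continuous_attains_sup[of C "\<lambda>z'. w z' - penalty (z - z') / eps"] by blast
  have "w z' - penalty (z - z') / eps \<le> w y - penalty (z - y) / eps" for z'
  proof (cases "z' \<in> C")
   case False
   hence "norm (fst z - fst z') > th \<or> \<bar>snd z - snd z'\<bar> > th^2"
    by (auto simp: C_def mem_Times_iff dist_norm dist_real_def)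
   from far[OF this] y(2)[OF zC] show ?thesis by (simp add: penalty_def)
  qed (use y in auto)
  thus ?thesis using y(1) by (intro exI[of _ y]) (auto simp: C_def mem_Times_iff dist_norm dist_real_def)
 qed
 thus thesis using that by metis
qed

text \<open>The supremum in the sup-convolution of \<open>w\<close> is attained at \<open>m z\<close>.\<close>

locale sup_conv =
 fixes w :: "(real^'m) \<times> real => real" and L B th eps :: real and m :: "(real^'m) \<times> real => (real^'m) \<times> real"
 assumes mod: "!!x t y s. \<bar>w (x, t) - w (y, s)\<bar> \<le> L * norm (x - y) + B * sqrt \<bar>t - s\<bar>"
  and LB: "0 < L" "0 < B" and th: "0 < th" "th \<le> 1" and eps: "0 < eps"
  and m: "!!z z'. w z' - penalty (z - z') / eps \<le> w (m z) - penalty (z - m z) / eps"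
  and m_close: "!!z. norm (fst z - fst (m z)) \<le> th" "!!z. \<bar>snd z - snd (m z)\<bar> \<le> th^2"
begin

definition W :: "(real^'m) \<times> real => real" where "W z = w (m z) - penalty (z - m z) / eps"

text \<open>The gradient in \<open>z\<close> of \<open>- penalty (z - m z) / eps\<close> with the
  maximizer \<open>m z\<close> held fixed, hence the slope of a lower paraboloid of \<open>W\<close>
  at \<open>z\<close>.\<close>

definition l :: "(real^'m) \<times> real => (real^'m) \<times> real" where
 "l z = (- ((4 * ((fst z - fst (m z)) \<bullet> (fst z - fst (m z))) / eps) *\<^sub>R (fst z - fst (m z))), - (2 * (snd z - snd (m z)) / eps))"

lemma W_ge: "w z \<le> W z"
 using m[of z z] by (simp add: W_def penalty_def)

lemma W_le: "W z \<le> w z + (L + B) * th"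
proof -
 have "w (m z) - w z \<le> L * norm (fst (m z) - fst z) + B * sqrt \<bar>snd (m z) - snd z\<bar>"
  using mod[of "fst (m z)" "snd (m z)" "fst z" "snd z"] by simp
 also have "\<dots> \<le> L * th + B * sqrt (th^2)"
  using m_close[of z] LB by (intro add_mono mult_left_mono real_sqrt_le_mono) (auto simp: norm_minus_commute abs_minus_commute)
 finally show ?thesis using penalty_nonneg[of "z - m z"] eps th by (simp add: W_def algebra_simps) (smt (verit) divide_nonneg_pos)
qed

text \<open>Moving \<open>z\<close> and its maximizer by the same vector leaves the penalty
  unchanged. A test function that touches \<open>W\<close> from above at \<open>z\<close> thus
  touches \<open>w\<close> from above at \<open>m z\<close> after a translation.\<close>

lemma W_shift: "w (m z + y) \<le> W (z + y) + penalty (z - m z) / eps"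
 using m[of "m z + y" "z + y"] by (simp add: W_def)

lemma W_mod: "W z \<le> W (z + y) + (L * norm (fst y) + B * sqrt \<bar>snd y\<bar>)"
proof -
 have "w (m z) - w (m z + y) \<le> L * norm (fst y) + B * sqrt \<bar>snd y\<bar>"
 proof -
  have "\<bar>w (m z) - w (m z + y)\<bar> \<le> L * norm (fst (m z) - fst (m z + y)) + B * sqrt \<bar>snd (m z) - snd (m z + y)\<bar>"
   using mod[of "fst (m z)" "snd (m z)" "fst (m z + y)" "snd (m z + y)"] by (simp only: prod.collapse)
  hence "\<bar>w (m z) - w (m z + y)\<bar> \<le> L * norm (fst y) + B * sqrt \<bar>snd y\<bar>" by simp
  thus ?thesis by linarith
 qed
 thus ?thesis using W_shift[of z y] by (simp add: W_def)
qed

lemma W_lower: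
 assumes "norm y \<le> 1"
 shows "W z + l z \<bullet> y - (11 / eps) * (norm y)^2 \<le> W (z + y)"
proof -
 have "norm (fst (z - m z)) \<le> 1" using m_close(1)[of z] th by simp
 from penalty_add_le[OF this assms]
 have "penalty (z + y - m z) / eps \<le> (penalty (z - m z) + ((4 * (fst (z - m z) \<bullet> fst (z - m z))) *\<^sub>R fst (z - m z), 2 * snd (z - m z)) \<bullet> y + 11 * (norm y)^2) / eps"
  using eps by (intro divide_right_mono) (auto simp: algebra_simps)
 moreover have "w (m z) - penalty (z + y - m z) / eps \<le> W (z + y)" using m[of "m z" "z + y"] by (simp add: W_def)
 moreover have "l z \<bullet> y = - (((4 * (fst (z - m z) \<bullet> fst (z - m z))) *\<^sub>R fst (z - m z), 2 * snd (z - m z)) \<bullet> y) / eps"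
 proof -
  define d ta where "d = fst z - fst (m z)" and "ta = snd z - snd (m z)"
  show ?thesis unfolding l_def fst_diff snd_diff d_def[symmetric] ta_def[symmetric]
   using eps by (simp add: inner_prod_def field_simps)
 qed
 ultimately show ?thesis by (simp add: W_def add_divide_distrib algebra_simps)
qed

lemma W_continuous: "continuous_on S W"
proof (rule modulus_continuous)
 show "\<bar>W (x, t) - W (y, s)\<bar> \<le> L * norm (x - y) + B * sqrt \<bar>t - s\<bar>" for x t y s
  using W_mod[of "(x, t)" "(y, s) - (x, t)"] W_mod[of "(y, s)" "(x, t) - (y, s)"]
  by (simp add: abs_le_iff norm_minus_commute abs_minus_commute)
qed

lemma norm_fst_l: "norm (fst (l z)) = 4 * norm (fst z - fst (m z))^3 / eps"
proof -
 have "norm (fst (l z)) = 4 * ((fst z - fst (m z)) \<bullet> (fst z - fst (m z))) / eps * norm (fst z - fst (m z))"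
  using eps by (simp add: l_def)
 also have "(fst z - fst (m z)) \<bullet> (fst z - fst (m z)) = (norm (fst z - fst (m z)))^2" by (simp add: power2_norm_eq_inner)
 finally show ?thesis by (simp add: eval_nat_numeral)
qed

end

lemma test_function_zero: "is_test_function N (\<lambda>_. 0) (\<lambda>_. 0) (\<lambda>_. 0) (\<lambda>_. 0)"
 unfolding is_test_function_def by (auto intro!: derivative_eq_intros simp: fun_eq_iff)

lemma test_function_polynomial:
 assumes X: "transpose X = X"
 shows "is_test_function N (\<lambda>z. p \<bullet> (fst z - x0) + quad X (fst z - x0) / 2 + (a * (snd z - t0) + C * (snd z - t0)^2))
  (\<lambda>z. a + C * (2 * (snd z - t0))) (\<lambda>z. p + X *v (fst z - x0)) (\<lambda>z. X)"
proof -
 have "is_test_function N (\<lambda>(x, t). a * (t - t0) + C * (t - t0)^2) (\<lambda>(x, t). a + C * (2 * (t - t0))) (\<lambda>_. 0) (\<lambda>_. 0)"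
  by (rule test_function_time) (auto intro!: derivative_eq_intros continuous_intros)
 from test_function_add[OF test_function_quadratic[OF X] this]
 show ?thesis by (simp add: case_prod_unfold)
qed

lemma touched_above_polynomial:
 assumes u: "touched_above P u" and t0: "t0 < 0" and X: "transpose X = X"
  and touch: "\<forall>\<^sub>F y in nhds 0. u ((x0, t0) + y) \<le> u (x0, t0) + p \<bullet> fst y + quad X (fst y) / 2 + a * snd y + C * (snd y)^2"
 shows "P a p X"
proof -
 define ph where "ph = (\<lambda>z. p \<bullet> (fst z - x0) + quad X (fst z - x0) / 2 + (a * (snd z - t0) + C * (snd z - t0)^2))"
 have T: "is_test_function UNIV ph (\<lambda>z. a + C * (2 * (snd z - t0))) (\<lambda>z. p + X *v (fst z - x0)) (\<lambda>z. X)"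
  unfolding ph_def by (rule test_function_polynomial[OF X])
 have "filterlim (\<lambda>z. z - (x0, t0)) (nhds ((x0, t0) - (x0, t0))) (nhds (x0, t0))"
  by (intro tendsto_intros filterlim_ident)
 hence "filterlim (\<lambda>z. z - (x0, t0)) (nhds 0) (nhds (x0, t0))" by simp
 from eventually_compose_filterlim[OF touch this]
 have "\<forall>\<^sub>F z in nhds (x0, t0). u z - ph z \<le> u (x0, t0) - ph (x0, t0)"
  by eventually_elim (simp add: ph_def quad_def)
 from touched_aboveD[OF u open_UNIV UNIV_I t0 T this] show ?thesis by simp
qed

lemma quad_penalty_hessian:
 "quad ((4 * (d \<bullet> d)) *\<^sub>R mat 1 + 8 *\<^sub>R (\<chi> i j. d $ i * d $ j)) b = 4 * (d \<bullet> d) * (b \<bullet> b) + 8 * (d \<bullet> b)^2"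
 by (simp add: quad_add quad_scaleR quad_mat_1 power2_norm_eq_inner) (simp add: quad_def outer_vec power2_eq_square inner_commute)

text \<open>The penalty centered at \<open>z\<close> is itself a test function for \<open>w\<close>
  at \<open>m z\<close>. By Cauchy-Schwarz its quadratic form is at most
  \<open>12 * norm d ^ 2 * R^2 / eps\<close> on the moves. When \<open>z\<close> is close to
  \<open>m z\<close>, the time derivative is therefore almost nonnegative, and the singular
  dependence on the direction of the gradient does not enter.\<close>

lemma (in sup_conv) touched_small_gradient:
 fixes AA :: "(real^'n^'m) set"
 assumes u: "touched_above P w" and t: "snd (m z) < 0"
  and P: "!!a p X. P a p X ==> \<exists>A\<in>AA. \<exists>e\<in>sign_vectors. 0 \<le> a + quad X (A *v e) / 2"
  and R: "!!A e. A \<in> AA ==> e \<in> sign_vectors ==> norm (A *v e) \<le> R"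
 shows "- (6 * norm (fst z - fst (m z))^2 * R^2 / eps) \<le> snd (l z)"
proof -
 define d where "d = fst (m z) - fst z"
 let ?H = "\<lambda>z'. 0 + (1/eps) *\<^sub>R ((4 * ((fst z' - fst z) \<bullet> (fst z' - fst z))) *\<^sub>R mat 1 + 8 *\<^sub>R (\<chi> i j. (fst z' - fst z) $ i * (fst z' - fst z) $ j))"
 let ?ph = "\<lambda>z'. 0 + (1/eps) * (((fst z' - fst z) \<bullet> (fst z' - fst z))^2 + (snd z' - snd z)^2)"
 have T: "is_test_function UNIV ?ph (\<lambda>z'. 0 + (1/eps) * (2 * (snd z' - snd z)))
  (\<lambda>z'. 0 + (1/eps) *\<^sub>R ((4 * ((fst z' - fst z) \<bullet> (fst z' - fst z))) *\<^sub>R (fst z' - fst z))) ?H"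
  by (rule test_function_penalized[OF test_function_zero])
 have "w z' - ?ph z' \<le> w (fst (m z), snd (m z)) - ?ph (fst (m z), snd (m z))" for z'
  using m[of z' z] by (simp only: penalty_minus_commute[of z]) (simp add: penalty_def)
 hence "\<forall>\<^sub>F z' in nhds (fst (m z), snd (m z)). w z' - ?ph z' \<le> w (fst (m z), snd (m z)) - ?ph (fst (m z), snd (m z))"
  by (intro always_eventually allI)
 from P[OF touched_aboveD[OF u open_UNIV UNIV_I t T this]]
 obtain A e where A: "A \<in> AA" "e \<in> sign_vectors" "0 \<le> (1/eps) * (2 * (snd (m z) - snd z)) + quad (?H (m z)) (A *v e) / 2"
  by auto
 have "quad (?H (m z)) (A *v e) = (4 * (d \<bullet> d) * ((A *v e) \<bullet> (A *v e)) + 8 * (d \<bullet> (A *v e))^2) / eps"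
  unfolding d_def[symmetric] by (simp only: quad_scaleR quad_penalty_hessian add_0_left) simp
 also have "\<dots> \<le> (12 * (norm d)^2 * R^2) / eps"
 proof (rule divide_right_mono)
  have "(A *v e) \<bullet> (A *v e) \<le> R^2" using power_mono[OF R[OF A(1,2)], of 2] by (simp add: power2_norm_eq_inner)
  hence 1: "(d \<bullet> d) * ((A *v e) \<bullet> (A *v e)) \<le> (d \<bullet> d) * R^2" by (intro mult_left_mono) auto
  have "(d \<bullet> (A *v e))^2 \<le> (d \<bullet> d) * ((A *v e) \<bullet> (A *v e))" by (rule Cauchy_Schwarz_ineq)
  thus "4 * (d \<bullet> d) * ((A *v e) \<bullet> (A *v e)) + 8 * (d \<bullet> (A *v e))^2 \<le> 12 * (norm d)^2 * R^2"
   using 1 by (simp add: power2_norm_eq_inner)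
 qed (use eps in simp)
 finally have *: "quad (?H (m z)) (A *v e) \<le> (12 * (norm d)^2 * R^2) / eps" .
 have "0 \<le> p + y / 2" if "x \<le> y" "0 \<le> p + x / 2" for p x y :: real using that by linarith
 from this[OF * A(3)] have "0 \<le> (1/eps) * (2 * (snd (m z) - snd z)) + (12 * (norm d)^2 * R^2) / eps / 2" .
 thus ?thesis using eps by (simp add: l_def d_def norm_minus_commute field_simps)
qed

lemma (in sup_conv) touched_at_convolution:
 assumes u: "touched_above P w" and t: "snd (m z) < 0" and X: "transpose X = X"
  and touch: "\<forall>\<^sub>F y in nhds 0. W (z + y) \<le> W z + p \<bullet> fst y + quad X (fst y) / 2 + a * snd y + C * (snd y)^2"
 shows "P a p X"
proof (rule touched_above_polynomial[OF u t X])
 show "\<forall>\<^sub>F y in nhds 0. w ((fst (m z), snd (m z)) + y) \<le> w (fst (m z), snd (m z)) + p \<bullet> fst y + quad X (fst y) / 2 + a * snd y + C * (snd y)^2"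
  using touch
 proof eventually_elim
  case (elim y)
  thus ?case using W_shift[of z y] by (simp add: W_def)
 qed
qed

text \<open>The condition is homogeneous in \<open>a\<close>, \<open>p\<close> and \<open>X\<close>
  jointly; the comparison needs this to shrink a subsolution slightly.\<close>

lemma touched_above_scale:
 assumes u: "touched_above (sub_condition AA) u" and c: "0 < c"
 shows "touched_above (sub_condition AA) (\<lambda>z. c * u z)"
 unfolding touched_above_def
proof (intro allI impI, elim conjE)
 fix N ph pht g H x0 t0
 assume N: "open N" "(x0, t0) \<in> N" and t0: "t0 < 0" and T: "is_test_function N ph pht g H"
  and mx: "\<forall>\<^sub>F z in nhds (x0, t0). c * u z - ph z \<le> c * u (x0, t0) - ph (x0, t0)"
 have "\<forall>\<^sub>F z in nhds (x0, t0). u z - (1/c) * ph z \<le> u (x0, t0) - (1/c) * ph (x0, t0)"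
  using mx
 proof eventually_elim
  case (elim z)
  hence "(c * u z - ph z) / c \<le> (c * u (x0, t0) - ph (x0, t0)) / c" using c by (intro divide_right_mono) auto
  thus ?case using c by (simp add: diff_divide_distrib)
 qed
 from touched_aboveD[OF u N t0 test_function_scale[OF T] this]
 have "sub_condition AA ((1/c) * pht (x0, t0)) ((1/c) *\<^sub>R g (x0, t0)) ((1/c) *\<^sub>R H (x0, t0))" .
 moreover have eq: "(0 \<le> a / c + q / (c * 2)) = (0 \<le> a + q / 2)" for a q :: real
 proof -
  have "a / c + q / (c * 2) = (a + q / 2) / c" by (simp add: add_divide_distrib mult.commute)
  thus ?thesis using c by (simp add: zero_le_divide_iff)
 qed
 ultimately show "sub_condition AA (pht (x0, t0)) (g (x0, t0)) (H (x0, t0))"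
  using c by (simp add: sub_condition_def quad_scaleR matrix_vector_mult_scaleR eq del: transpose_matrix_vector)
qed

lemma linear_le_quadratic_imp_zero:
 fixes p :: "'a::euclidean_space"
 assumes le: "!!y. norm y \<le> rh ==> p \<bullet> y \<le> C * (norm y)^2" and rh: "0 < rh"
 shows "p = 0"
proof (rule ccontr)
 assume p: "p \<noteq> 0"
 define t where "t = min (rh / norm p) (1 / (\<bar>C\<bar> + 1))"
 have t: "t > 0" "t * norm p \<le> rh" "t \<le> 1 / (\<bar>C\<bar> + 1)"
  using p rh by (auto simp: t_def min_def field_simps)
 have "p \<bullet> (t *\<^sub>R p) \<le> C * (norm (t *\<^sub>R p))^2" using t by (intro le) auto
 hence "t * (norm p)^2 \<le> C * (t * t) * (norm p)^2" using t
  by (simp add: power2_norm_eq_inner power_mult_distrib power2_eq_square[of t] mult_ac)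
 moreover have "(norm p)^2 > 0" using p by simp
 ultimately have "t \<le> C * (t * t)" by (rule mult_right_le_imp_le)
 hence "1 \<le> C * t" using t by (simp add: mult_ac)
 also have "\<dots> \<le> \<bar>C\<bar> * (1 / (\<bar>C\<bar> + 1))" using t by (intro mult_mono) auto
 also have "\<dots> < 1" by simp
 finally show False by simp
qed

lemma symmetrized_matrix:
 fixes C :: "real^'m => real^'m"
 assumes "linear C"
 obtains X where "transpose X = X" "!!y. quad X y = C y \<bullet> y"
proof -
 define M where "M = matrix C"
 have M: "M *v y = C y" for y using assms by (simp add: M_def matrix_works)
 define X where "X = (1/2) *\<^sub>R (M + transpose M)"
 have "transpose X = X" by (simp add: X_def transpose_def vec_eq_iff)
 moreover have "quad X y = C y \<bullet> y" for y
 proof -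
  have "(transpose M *v y) \<bullet> y = (M *v y) \<bullet> y" unfolding transpose_vec_inner by (rule inner_commute)
  hence "quad (transpose M) y = quad M y" unfolding quad_def .
  moreover have "quad M y = C y \<bullet> y" by (simp add: quad_def M)
  ultimately show ?thesis unfolding X_def quad_scaleR quad_add by simp
 qed
 ultimately show thesis using that by blast
qed

lemma quadratic_form_lipschitz:
 fixes C :: "'a::euclidean_space => 'a"
 assumes "linear C" "!!y. norm (C y) \<le> K * norm y"
 shows "\<bar>C b \<bullet> b - C b' \<bullet> b'\<bar> \<le> K * (norm b + norm b') * norm (b - b')"
proof -
 have "C b \<bullet> b - C b' \<bullet> b' = C (b - b') \<bullet> b + C b' \<bullet> (b - b')"
  using assms(1) by (simp add: linear_diff inner_diff_left inner_diff_right)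
 also have "\<bar>\<dots>\<bar> \<le> norm (C (b - b')) * norm b + norm (C b') * norm (b - b')"
  by (intro order_trans[OF abs_triangle_ineq] add_mono Cauchy_Schwarz_ineq2)
 also have "\<dots> \<le> (K * norm (b - b')) * norm b + (K * norm b') * norm (b - b')"
  by (intro add_mono mult_right_mono assms(2)) auto
 finally show ?thesis by (simp add: algebra_simps)
qed

text \<open>The time slope changes by up to \<open>6 * c * norm (b, s)\<close>, which produces a
  product of \<open>norm b\<close> and \<open>s\<close>. It is split with a small weight
  \<open>et\<close> on \<open>b\<close> and a large one on \<open>s\<close>: a large multiple of
  \<open>s^2\<close> does not affect the time derivative of a test function.\<close>

lemma semiconvex_time_increment:
 fixes W :: "'a::euclidean_space \<times> real => real"
 assumes lower: "!!z y. norm y \<le> rh ==> W z + l z \<bullet> y - c * (norm y)^2 \<le> W (z + y)"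
  and upper: "!!y. norm y \<le> rh ==> W (z + y) \<le> W z + l z \<bullet> y + c * (norm y)^2"
  and c: "0 \<le> c" and et: "0 < et" and bs: "norm (b, s) \<le> rh / 2"
 shows "\<bar>W (z + (b, s)) - W (z + (b, 0)) - snd (l z) * s\<bar> \<le> et * (norm b)^2 + (9 * c^2 / et + 7 * c) * s^2"
proof -
 have nb: "norm b \<le> rh / 2" "\<bar>s\<bar> \<le> rh / 2" using bs norm_fst_le[of b s] norm_snd_le[of s b] by auto
 hence rh0: "rh \<ge> 0" using norm_ge_zero[of b] by linarith
 have amgm: "6 * c * \<bar>s\<bar> * norm b \<le> et * (norm b)^2 + 9 * c^2 / et * s^2"
 proof -
  have "0 \<le> (et * norm b - 3 * c * \<bar>s\<bar>)^2" by simp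
  also have "\<dots> = et * (et * (norm b)^2 + 9 * c^2 / et * s^2 - 6 * c * \<bar>s\<bar> * norm b)"
   using et by (simp add: power2_diff power_mult_distrib field_simps power2_eq_square)
  finally show ?thesis using et by (simp add: zero_le_mult_iff)
 qed
 have lip: "\<bar>snd (l (z + y)) - snd (l z)\<bar> \<le> 6 * c * norm y" if "norm y \<le> rh / 2" for y
 proof -
  have "\<bar>snd (l (z + y)) - snd (l z)\<bar> \<le> norm (l (z + y) - l z)"
  proof -
   have "\<bar>snd w\<bar> \<le> norm w" for w :: "'a \<times> real" using norm_snd_le[of "snd w" "fst w"] by simp
   from this[of "l (z + y) - l z"] show ?thesis by simp
  qed
  also have "\<dots> \<le> 6 * c * norm (z + y - z)"
   by (rule semiconvex_gradient_lipschitz[OF lower upper]) (use that c in auto)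
  finally show ?thesis by simp
 qed
 have ns: "norm (0 :: 'a, s) = \<bar>s\<bar>" "norm (0 :: 'a, - s) = \<bar>s\<bar>" "norm (b, 0 :: real) = norm b" by (simp_all add: norm_Pair)
 have n2: "norm (b, s) \<le> norm b + \<bar>s\<bar>" using norm_Pair_le[of b s] by simp
 have up: "W (z + (b, s)) - W (z + (b, 0)) \<le> snd (l (z + (b, s))) * s + c * s^2"
  using lower[of "(0, - s)" "z + (b, s)"] nb rh0 ns by (simp add: inner_prod_def add.assoc algebra_simps)
 have "\<bar>(snd (l (z + (b, s))) - snd (l z)) * s\<bar> \<le> 6 * c * (norm b + \<bar>s\<bar>) * \<bar>s\<bar>"
  unfolding abs_mult
  by (intro mult_right_mono order_trans[OF lip[OF bs]] mult_left_mono n2) (use c in auto)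
 hence up2: "snd (l (z + (b, s))) * s \<le> snd (l z) * s + 6 * c * \<bar>s\<bar> * norm b + 6 * c * s^2"
 proof -
  assume "\<bar>(snd (l (z + (b, s))) - snd (l z)) * s\<bar> \<le> 6 * c * (norm b + \<bar>s\<bar>) * \<bar>s\<bar>"
  moreover have "6 * c * (norm b + \<bar>s\<bar>) * \<bar>s\<bar> = 6 * c * \<bar>s\<bar> * norm b + 6 * c * s^2"
   by (simp add: algebra_simps power2_eq_square)
  moreover have "(snd (l (z + (b, s))) - snd (l z)) * s = snd (l (z + (b, s))) * s - snd (l z) * s" by (simp add: algebra_simps)
  ultimately show ?thesis by (simp only: abs_le_iff) linarith
 qed
 have lo: "snd (l (z + (b, 0))) * s - c * s^2 \<le> W (z + (b, s)) - W (z + (b, 0))"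
  using lower[of "(0, s)" "z + (b, 0)"] nb rh0 ns by (simp add: inner_prod_def add.assoc algebra_simps)
 have "\<bar>(snd (l (z + (b, 0))) - snd (l z)) * s\<bar> \<le> 6 * c * norm b * \<bar>s\<bar>"
  unfolding abs_mult
  using lip[of "(b, 0)"] nb(1) ns(3) by (intro mult_right_mono) auto
 hence lo2: "snd (l z) * s - 6 * c * \<bar>s\<bar> * norm b \<le> snd (l (z + (b, 0))) * s"
  by (simp add: algebra_simps abs_le_iff)
 have "0 \<le> c * s^2" using c by simp
 thus ?thesis using up up2 lo lo2 amgm by (simp add: abs_le_iff algebra_simps)
qed

text \<open>Each function lies above its own paraboloid, so a linear upper bound for the sum bounds
  the other function from above.\<close>

lemma sup_conv_contact:
 fixes W V :: "'a::euclidean_space => real"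
 assumes W: "!!z y. norm y \<le> rh ==> W z + l z \<bullet> y - c * (norm y)^2 \<le> W (z + y)"
  and V: "!!z y. norm y \<le> rh ==> V z + k z \<bullet> y - c * (norm y)^2 \<le> V (z + y)"
  and contact: "!!y. norm y \<le> rh ==> W (z + y) + V (z + y) \<le> W z + V z + q \<bullet> y" and rh: "0 < rh"
 shows "l z + k z = q" "!!y. norm y \<le> rh ==> W (z + y) \<le> W z + l z \<bullet> y + c * (norm y)^2"
  "!!y. norm y \<le> rh ==> V (z + y) \<le> V z + k z \<bullet> y + c * (norm y)^2"
proof -
 have "l z + k z - q = 0"
 proof (rule linear_le_quadratic_imp_zero[OF _ rh])
  fix y :: 'a assume y: "norm y \<le> rh"
  show "(l z + k z - q) \<bullet> y \<le> (2 * c) * (norm y)^2"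
   using W[OF y, of z] V[OF y, of z] contact[OF y] by (simp add: inner_add_left inner_diff_left)
 qed
 thus eq: "l z + k z = q" by simp
 fix y :: 'a assume y: "norm y \<le> rh"
 show "W (z + y) \<le> W z + l z \<bullet> y + c * (norm y)^2"
  using V[OF y, of z] contact[OF y] by (simp add: eq[symmetric] inner_add_left)
 show "V (z + y) \<le> V z + k z \<bullet> y + c * (norm y)^2"
  using W[OF y, of z] contact[OF y] by (simp add: eq[symmetric] inner_add_left)
qed

text \<open>All small slopes \<open>q\<close> are realized, so the contact set is not negligible and
  contains a point \<open>z\<close> with a second order expansion. There the term
  \<open>al * snd z\<close> forces the two time derivatives apart by about \<open>al\<close>, which
  the two conditions forbid. Only \<open>SU.W\<close> is expanded: the contact inequality turns its
  expansion into an upper one for \<open>SV.W\<close> with Hessian \<open>- X\<close>, so both sides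
  are tested with the same \<open>X\<close>.\<close>

lemma (in game_scheme) no_strict_contact:
 assumes SU: "sup_conv u L B th eps mu" and SV: "sup_conv v L B th eps mv"
  and usub: "touched_above (sub_condition AA) u" and vsuper: "touched_above (super_condition AA) v"
  and rh: "0 < rh" "rh \<le> 1" and al: "0 < al" and dl0: "0 < dl0"
  and K: "!!dl q. 0 < dl ==> dl \<le> dl0 ==> norm q < dl ==> \<exists>z. z \<in> T \<and>
   (\<forall>y. norm y \<le> rh --> sup_conv.W u eps mu (z + y) + sup_conv.W v eps mv (z + y) + al * snd (z + y)
     \<le> sup_conv.W u eps mu z + sup_conv.W v eps mv z + al * snd z + q \<bullet> y)"
  and T: "!!z. z \<in> T ==> snd (mu z) < 0 \<and> snd (mv z) < 0"
 shows False
proof -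
 interpret SU: sup_conv u L B th eps mu by fact
 interpret SV: sup_conv v L B th eps mv by fact
 have eps: "eps > 0" by (rule SU.eps)
 define c where "c = 11 / eps"
 have c: "c > 0" using eps by (simp add: c_def)
 have Wl: "SU.W z + SU.l z \<bullet> y - c * (norm y)^2 \<le> SU.W (z + y)" if "norm y \<le> rh" for z y
  unfolding c_def using that rh by (intro SU.W_lower) simp
 have Vl: "(SV.W z + al * snd z) + (SV.l z + (0, al)) \<bullet> y - c * (norm y)^2 \<le> SV.W (z + y) + al * snd (z + y)" if "norm y \<le> rh" for z y
  using SV.W_lower[of y z] that rh by (simp add: inner_add_left inner_prod_def c_def algebra_simps)
 \<comment> \<open>If \<open>z\<close> is closer than \<open>sg\<close> to its maximizer, the error
   in \<open>touched_small_gradient\<close> is at most \<open>al / 8\<close>. By the cubic law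
   \<open>norm_fst_l\<close>, the distance \<open>sg\<close> corresponds to a gradient of length
   \<open>2 * ka\<close>.\<close>
 define sg where "sg = sqrt (al * eps / (48 * R^2))"
 have sg: "sg > 0" "6 * sg^2 * R^2 / eps = al / 8" using al eps R_pos by (auto simp: sg_def)
 define ka where "ka = 2 * sg^3 / eps"
 have ka: "ka > 0" using sg eps by (simp add: ka_def)
 define et where "et = min 1 (al / (32 * R^2))"
 have et: "et > 0" "4 * et * R^2 \<le> al / 8"
 proof -
  show "et > 0" using al R_pos by (simp add: et_def)
  have "4 * et * R^2 \<le> 4 * (al / (32 * R^2)) * R^2" by (intro mult_right_mono mult_left_mono) (auto simp: et_def)
  also have "\<dots> = al / 8" using R_pos by simp
  finally show "4 * et * R^2 \<le> al / 8" .
 qed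
 define BC where "BC = real DIM(real^'m) * (6 * c + et)"
 have BC: "BC > 0" using c et by (simp add: BC_def)
 \<comment> \<open>A slope below \<open>dl\<close> can tilt the two gradient directions by
   \<open>2 * dl / ka\<close>, and the bound \<open>BC\<close> on the second derivatives amplifies
   this. Since \<open>BC\<close> depends on \<open>eps\<close> but not on \<open>dl\<close>, the
   size of the slopes can be fixed last.\<close>
 define dl where "dl = min (min dl0 (al / 4)) (min (ka / 2) (al * ka / (64 * BC * R^2)))"
 have dl: "dl > 0" "dl \<le> dl0" "dl \<le> al / 4" "dl \<le> ka / 2" "8 * BC * R^2 * dl / ka \<le> al / 8"
 proof -
  show "dl > 0" "dl \<le> dl0" "dl \<le> al / 4" "dl \<le> ka / 2" using dl0 al ka BC R_pos by (auto simp: dl_def)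
  have "8 * BC * R^2 * dl / ka \<le> 8 * BC * R^2 * (al * ka / (64 * BC * R^2)) / ka"
   using BC ka by (intro divide_right_mono mult_left_mono) (auto simp: dl_def)
  also have "\<dots> = al / 8" using BC ka R_pos by (simp add: field_simps)
  finally show "8 * BC * R^2 * dl / ka \<le> al / 8" .
 qed
 define KK where "KK = {z \<in> T. \<exists>q. norm q < dl \<and> (\<forall>y. norm y \<le> rh --> SU.W (z + y) + (SV.W (z + y) + al * snd (z + y)) \<le> SU.W z + (SV.W z + al * snd z) + q \<bullet> y)}"
 define D where "D z = SU.l z + (SV.l z + (0, al))" for z
 have con: "norm (D z) < dl"
  "!!y. norm y \<le> rh ==> SU.W (z + y) + (SV.W (z + y) + al * snd (z + y)) \<le> SU.W z + (SV.W z + al * snd z) + D z \<bullet> y"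
  "!!y. norm y \<le> rh ==> SU.W (z + y) \<le> SU.W z + SU.l z \<bullet> y + c * (norm y)^2"
  "!!y. norm y \<le> rh ==> SV.W (z + y) + al * snd (z + y) \<le> (SV.W z + al * snd z) + (SV.l z + (0, al)) \<bullet> y + c * (norm y)^2"
  if zK: "z \<in> KK" for z
 proof -
  obtain q where q: "norm q < dl" "!!y. norm y \<le> rh ==> SU.W (z + y) + (SV.W (z + y) + al * snd (z + y)) \<le> SU.W z + (SV.W z + al * snd z) + q \<bullet> y"
   using zK by (auto simp: KK_def)
  note C = sup_conv_contact[where W = SU.W and V = "\<lambda>z. SV.W z + al * snd z" and l = SU.l and k = "\<lambda>z. SV.l z + (0, al)" and c = c and z = z, OF Wl Vl q(2) rh(1)]
  have "D z = q" unfolding D_def by (rule C(1))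
  thus "norm (D z) < dl" "!!y. norm y \<le> rh ==> SU.W (z + y) + (SV.W (z + y) + al * snd (z + y)) \<le> SU.W z + (SV.W z + al * snd z) + D z \<bullet> y"
   using q by auto
  show "SU.W (z + y) \<le> SU.W z + SU.l z \<bullet> y + c * (norm y)^2" if "norm y \<le> rh" for y
   by (rule C(2)) (use that in auto)
  show "SV.W (z + y) + al * snd (z + y) \<le> (SV.W z + al * snd z) + (SV.l z + (0, al)) \<bullet> y + c * (norm y)^2" if "norm y \<le> rh" for y
   by (rule C(3)) (use that in auto)
 qed
 have "\<not> negligible KK"
 proof (rule contact_set_not_negligible)
  show "ball 0 dl \<subseteq> D ` KK"
  proof
   fix q :: "(real^'m) \<times> real" assume "q \<in> ball 0 dl"
   hence q: "norm q < dl" by simp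
   obtain z where z: "z \<in> T" "!!y. norm y \<le> rh ==> SU.W (z + y) + SV.W (z + y) + al * snd (z + y) \<le> SU.W z + SV.W z + al * snd z + q \<bullet> y"
    using K[OF dl(1,2) q] by blast
   hence z2: "!!y. norm y \<le> rh ==> SU.W (z + y) + (SV.W (z + y) + al * snd (z + y)) \<le> SU.W z + (SV.W z + al * snd z) + q \<bullet> y"
    by (simp add: add.assoc)
   have "D z = q" unfolding D_def
    by (rule sup_conv_contact(1)[where W = SU.W and V = "\<lambda>z. SV.W z + al * snd z" and l = SU.l and k = "\<lambda>z. SV.l z + (0, al)" and c = c and z = z, OF Wl Vl z2 rh(1)])
   moreover have "z \<in> KK" using z(1) z2 q unfolding KK_def by blast
   ultimately show "q \<in> D ` KK" by blast
  qed
  show "0 < dl" "0 < rh / 2" using dl rh by auto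
  fix z1 z2 assume z: "z1 \<in> KK" "z2 \<in> KK" "norm (z2 - z1) \<le> rh / 2"
  have "norm (SU.l z2 - SU.l z1) \<le> 6 * c * norm (z2 - z1)"
   by (rule semiconvex_gradient_lipschitz[OF Wl con(3)[OF z(1)] z(3)]) (use c in auto)
  moreover have "norm ((SV.l z2 + (0, al)) - (SV.l z1 + (0, al))) \<le> 6 * c * norm (z2 - z1)"
   by (rule semiconvex_gradient_lipschitz[where W = "\<lambda>z. SV.W z + al * snd z", OF Vl con(4)[OF z(1)] z(3)]) (use c in auto)
  ultimately show "norm (D z2 - D z1) \<le> 12 * c * norm (z2 - z1)"
   using norm_triangle_ineq[of "SU.l z2 - SU.l z1" "(SV.l z2 + (0, al)) - (SV.l z1 + (0, al))"]
   by (simp add: D_def algebra_simps)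
 qed
 then obtain z C r where z: "z \<in> KK" and C: "linear C" "!!y. norm (C y) \<le> BC * norm y" and r: "r > 0"
  "!!y. norm y < r ==> \<bar>SU.W (z + (y, 0)) - SU.W z - fst (SU.l z) \<bullet> y - (C y \<bullet> y) / 2\<bar> \<le> et * (norm y)^2"
  using semiconvex_second_order_on_contact_set[where W = SU.W and l = SU.l and c = c and rh = rh and K = KK and et = et, OF Wl con(3) rh(1) c _ et(1)]
  unfolding BC_def by metis
 have zT: "snd (mu z) < 0" "snd (mv z) < 0" using T z by (auto simp: KK_def)
 define p a where "p = fst (SU.l z)" and "a = snd (SU.l z)"
 define pv av where "pv = - fst (SV.l z)" and "av = - snd (SV.l z)"
 have pq: "p - pv = fst (D z)" "a - av + al = snd (D z)" by (auto simp: p_def pv_def a_def av_def D_def)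
 have pn: "norm (p - pv) < dl" "\<bar>a - av + al\<bar> < dl"
  unfolding pq using con(1)[OF z] norm_fst_le[of "fst (D z)" "snd (D z)"] norm_snd_le[of "snd (D z)" "fst (D z)"] by auto
 show False
 proof (cases "norm p < ka")
  \<comment> \<open>Both gradients are then below \<open>2 * ka\<close>, so both functions are close
    to their maximizers and the penalty alone bounds both time derivatives.\<close>
  case True
  have small: "norm (fst z - fst (m z)) < sg" if "4 * norm (fst z - fst (m z))^3 / eps < 2 * ka" for m :: "(real^'m) \<times> real => (real^'m) \<times> real"
  proof (rule ccontr)
   assume "\<not> ?thesis"
   hence "sg^3 \<le> norm (fst z - fst (m z))^3" using sg by (intro power_mono) auto
   hence "4 * sg^3 / eps \<le> 4 * norm (fst z - fst (m z))^3 / eps" using eps by (intro divide_right_mono) auto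
   thus False using that by (simp add: ka_def)
  qed
  have bd: "6 * norm (fst z - fst (m z))^2 * R^2 / eps \<le> al / 8" if "norm (fst z - fst (m z)) < sg" for m :: "(real^'m) \<times> real => (real^'m) \<times> real"
  proof -
   have "6 * norm (fst z - fst (m z))^2 * R^2 / eps \<le> 6 * sg^2 * R^2 / eps"
    using that eps by (intro divide_right_mono mult_right_mono mult_left_mono power_mono) auto
   thus ?thesis using sg(2) by simp
  qed
  have "norm pv < 2 * ka" using True pn(1) dl(4) ka norm_triangle_ineq2[of pv p] by (simp add: norm_minus_commute)
  hence "norm (fst z - fst (mv z)) < sg" using SV.norm_fst_l[of z] by (intro small) (simp add: pv_def)
  moreover have "norm (fst z - fst (mu z)) < sg" using SU.norm_fst_l[of z] True ka by (intro small) (simp add: p_def)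
  moreover have "- (6 * norm (fst z - fst (mu z))^2 * R^2 / eps) \<le> a"
   unfolding a_def by (rule SU.touched_small_gradient[OF usub zT(1) _ AA_bound]) (use one_sign_vector in \<open>auto simp: sub_condition_def\<close>)
  moreover have "- (6 * norm (fst z - fst (mv z))^2 * R^2 / eps) \<le> - av"
   unfolding av_def minus_minus by (rule SV.touched_small_gradient[OF vsuper zT(2) _ AA_bound]) (unfold super_condition_def, use AA_tangent in blast)
  ultimately have "- (al / 8) \<le> a" "av \<le> al / 8" using bd[of mu] bd[of mv] by auto
  thus False using pn(2) dl(3) al by linarith
 next
  case False
  obtain X where X: "transpose X = X" "!!y. quad X y = C y \<bullet> y" using symmetrized_matrix[OF C(1)] by blast
  define E where "E = 9 * c^2 / et + 7 * c"
  have near: "\<forall>\<^sub>F y in nhds (0 :: (real^'m) \<times> real). norm y < min r (rh/2)"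
   using r(1) rh by (auto simp: eventually_nhds_metric intro!: exI[of _ "min r (rh/2)"])
  have expand: "\<bar>SU.W (z + y) - SU.W z - p \<bullet> fst y - quad X (fst y) / 2 - a * snd y\<bar> \<le> 2 * et * (norm (fst y))^2 + E * (snd y)^2"
   if y: "norm y < min r (rh/2)" for y
  proof -
   obtain b s where bs: "y = (b, s)" by (cases y)
   have 1: "\<bar>SU.W (z + (b, s)) - SU.W (z + (b, 0)) - snd (SU.l z) * s\<bar> \<le> et * (norm b)^2 + (9 * c^2 / et + 7 * c) * s^2"
    by (rule semiconvex_time_increment[OF Wl con(3)[OF z]]) (use c et y bs in auto)
   have 2: "\<bar>SU.W (z + (b, 0)) - SU.W z - fst (SU.l z) \<bullet> b - (C b \<bullet> b) / 2\<bar> \<le> et * (norm b)^2"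
    using norm_fst_le[of b s] y bs by (intro r(2)) auto
   have "\<bar>w2 - w0 - pb - q - as\<bar> \<le> 2 * t + e" if "\<bar>w2 - w1 - as\<bar> \<le> t + e" "\<bar>w1 - w0 - pb - q\<bar> \<le> t" for w0 w1 w2 pb q as t e :: real
    using that by linarith
   from this[OF 1 2] show ?thesis by (simp add: bs p_def a_def X(2) E_def mult.assoc)
  qed
  \<comment> \<open>The error of the expansion is put into the Hessian: a multiple
    \<open>4 * et\<close> of the identity turns the approximate expansion into touching from
    above.\<close>
  have quad_shift: "quad (c *\<^sub>R X + (4 * et) *\<^sub>R mat 1) b / 2 = c * (quad X b / 2) + 2 * et * (norm b)^2" for b c
   unfolding quad_add quad_scaleR quad_mat_1 by (simp add: add_divide_distrib)
  have tr: "transpose (c *\<^sub>R X + (4 * et) *\<^sub>R mat 1) = c *\<^sub>R X + (4 * et) *\<^sub>R mat 1" for c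
   using X(1) by (simp add: transpose_def mat_def vec_eq_iff)
  have "sub_condition AA a p (1 *\<^sub>R X + (4 * et) *\<^sub>R mat 1)"
  proof (rule SU.touched_at_convolution[OF usub zT(1) tr])
   show "\<forall>\<^sub>F y in nhds 0. SU.W (z + y) \<le> SU.W z + p \<bullet> fst y + quad (1 *\<^sub>R X + (4 * et) *\<^sub>R mat 1) (fst y) / 2 + a * snd y + E * (snd y)^2"
    using near
   proof eventually_elim
    case (elim y)
    thus ?case unfolding quad_shift using expand[OF elim] by linarith
   qed
  qed
  then obtain A0 where A0: "A0 \<in> AA" "transpose A0 *v p = 0" "!!e. e \<in> sign_vectors ==> 0 \<le> a + (1 * (quad X (A0 *v e) / 2) + 2 * et * (norm (A0 *v e))^2)"
   unfolding sub_condition_def quad_shift by blast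
  have "super_condition AA (- av) (- pv) ((- 1) *\<^sub>R X + (4 * et) *\<^sub>R mat 1)"
  proof (rule SV.touched_at_convolution[OF vsuper zT(2) tr])
   show "\<forall>\<^sub>F y in nhds 0. SV.W (z + y) \<le> SV.W z + (- pv) \<bullet> fst y + quad ((- 1) *\<^sub>R X + (4 * et) *\<^sub>R mat 1) (fst y) / 2 + (- av) * snd y + E * (snd y)^2"
    using near
   proof eventually_elim
    case (elim y)
    have "SU.W (z + y) + (SV.W (z + y) + al * snd (z + y)) \<le> SU.W z + (SV.W z + al * snd z) + D z \<bullet> y"
     using con(2)[OF z, of y] elim rh by simp
    moreover have "D z \<bullet> y = p \<bullet> fst y - pv \<bullet> fst y + (a * snd y - av * snd y + al * snd y)"
     unfolding inner_prod_def pq[symmetric] by (simp add: inner_diff_left algebra_simps)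
    moreover have "al * snd (z + y) = al * snd z + al * snd y" by (simp add: algebra_simps)
    moreover have "(- pv) \<bullet> fst y = - (pv \<bullet> fst y)" "(- av) * snd y = - (av * snd y)" by simp_all
    ultimately show ?case unfolding quad_shift using expand[OF elim] by linarith
   qed
  qed
  then obtain d' where d': "norm d' = 1" "- pv = norm (- pv) *\<^sub>R d'" "!!A. A \<in> AA ==> transpose A *v d' = 0 ==>
    \<exists>e\<in>sign_vectors. 0 \<le> - av + ((- 1) * (quad X (A *v e) / 2) + 2 * et * (norm (A *v e))^2)"
   unfolding super_condition_def quad_shift by blast
  define d where "d = - d'"
  have d: "norm d = 1" "pv = norm pv *\<^sub>R d" "d' = - d"
   using d'(1,2) by (simp_all add: d_def) (metis minus_minus)
  have p0: "norm p \<ge> ka" "norm p > 0" using False ka by auto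
  define d0 where "d0 = p /\<^sub>R norm p"
  have d0: "norm d0 = 1" "p = norm p *\<^sub>R d0" using p0 by (auto simp: d0_def)
  have dd: "norm (d0 - d) \<le> 2 * dl / ka"
  proof -
   have "norm p *\<^sub>R (d0 - d) = (p - pv) + (norm pv - norm p) *\<^sub>R d"
    using d(2) d0(2) by (simp add: algebra_simps)
   hence "norm p * norm (d0 - d) = norm ((p - pv) + (norm pv - norm p) *\<^sub>R d)" by (metis abs_norm_cancel norm_scaleR)
   also have "\<dots> \<le> norm (p - pv) + \<bar>norm pv - norm p\<bar>" using norm_triangle_ineq[of "p - pv" "(norm pv - norm p) *\<^sub>R d"] d(1) by simp
   also have "\<dots> \<le> 2 * dl" using pn(1) norm_triangle_ineq3[of pv p] by (simp add: norm_minus_commute)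
   finally have "norm p * norm (d0 - d) \<le> 2 * dl" .
   moreover have "ka * norm (d0 - d) \<le> norm p * norm (d0 - d)" using p0 by (intro mult_right_mono) auto
   ultimately show ?thesis using ka by (simp add: pos_le_divide_eq mult.commute)
  qed
  also have "\<dots> \<le> 1" using dl(4) ka by (simp add: divide_le_eq)
  finally have dd1: "norm (d0 - d) \<le> 1" .
  \<comment> \<open>The subsolution supplies a matrix tangent to \<open>d0\<close>, whereas the
    supersolution is tested with matrices tangent to \<open>d'\<close>, equivalently to
    \<open>d\<close>. The rotation bridges this at a cost of at most \<open>al / 4\<close> in the
    quadratic form.\<close>
  obtain Q where Q: "orthogonal_transformation Q" "Q d0 = d" "!!x. norm (Q x - x) \<le> 4 * norm (d0 - d) * norm x"
   using rotation_between_unit_vectors[OF d0(1) d(1) dd1] by blast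
  define A where "A = matrix Q ** A0"
  have QA: "A *v e = Q (A0 *v e)" for e
   using Q(1) by (simp add: A_def matrix_vector_mul_assoc[symmetric] orthogonal_transformation_def matrix_works)
  have AA: "A \<in> AA" unfolding A_def by (rule AA_rot[OF Q(1) A0(1)])
  have A0d: "d0 \<bullet> (A0 *v e) = 0" for e
  proof -
   have "p \<bullet> (A0 *v e) = 0" using A0(2) transpose_vec_inner[of A0 p e] by (simp del: transpose_matrix_vector)
   thus ?thesis by (simp add: d0_def)
  qed
  have "transpose A *v d = 0"
  proof (rule sign_vectors_orthogonal)
   fix e :: "real^'n"
   have "d \<bullet> (A *v e) = Q d0 \<bullet> Q (A0 *v e)" by (simp add: Q(2) QA)
   also have "\<dots> = d0 \<bullet> (A0 *v e)" using Q(1) by (simp add: orthogonal_transformation_def)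
   finally show "(transpose A *v d) \<bullet> e = 0" unfolding transpose_vec_inner by (simp add: A0d)
  qed
  hence "transpose A *v d' = 0" unfolding d(3) matrix_vector_mult_minus_right by simp
  from d'(3)[OF AA this] obtain e where e: "e \<in> sign_vectors" "0 \<le> - av + ((- 1) * (quad X (A *v e) / 2) + 2 * et * (norm (A *v e))^2)" by blast
  define b b0 where "b = A *v e" and "b0 = A0 *v e"
  have nb: "norm b \<le> R" "norm b0 \<le> R" unfolding b_def b0_def using AA_bound AA A0(1) e(1) by auto
  have nb2: "(norm b)^2 \<le> R^2" "(norm b0)^2 \<le> R^2" using nb by (auto intro: power_mono)
  have bb: "norm (b - b0) \<le> 8 * dl / ka * R"
  proof -
   have "norm (b - b0) \<le> 4 * norm (d0 - d) * norm b0" unfolding b_def b0_def QA by (rule Q(3))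
   also have "\<dots> \<le> 4 * (2 * dl / ka) * R" using dd nb dl ka by (intro mult_mono) auto
   finally show ?thesis by simp
  qed
  have "\<bar>quad X b - quad X b0\<bar> \<le> BC * (norm b + norm b0) * norm (b - b0)"
   unfolding X(2) by (rule quadratic_form_lipschitz[OF C])
  also have "\<dots> \<le> BC * (R + R) * (8 * dl / ka * R)"
   using nb bb BC R_pos by (intro mult_mono add_mono) auto
  also have "\<dots> = 2 * (8 * BC * R^2 * dl / ka)" by (simp add: power2_eq_square)
  also have "\<dots> \<le> al / 4" using dl(5) by simp
  finally have qd: "\<bar>quad X b - quad X b0\<bar> \<le> al / 4" .
  have "0 \<le> a + quad X b0 / 2 + 2 * et * (norm b0)^2" "av + quad X b / 2 - 2 * et * (norm b)^2 \<le> 0"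
   using A0(3)[OF e(1)] e(2) unfolding b0_def b_def by linarith+
  moreover have "2 * et * (norm b)^2 \<le> 2 * et * R^2" "2 * et * (norm b0)^2 \<le> 2 * et * R^2"
   using nb2 et by (auto intro: mult_left_mono)
  ultimately have "av - a \<le> al / 8 + 4 * et * R^2" using qd by linarith
  thus False using et(2) pn(2) dl(3) al by linarith
 qed
qed

lemma divide_mult_cancel: "0 < k ==> d / (c * k) * k = d / (c :: real)"
 by simp

text \<open>Both functions are regularized with the same \<open>eps\<close>, and their sum is
  maximized at a common point after adding \<open>al * snd z\<close> and a small slope. Coercivity
  makes the maximum exist, the common terminal data keep it away from time \<open>0\<close>, and
  \<open>no_strict_contact\<close> excludes it.\<close>

theorem (in game_scheme) comparison:
 assumes B: "0 < B"
  and umod: "!!x t y s. \<bar>u (x, t) - u (y, s)\<bar> \<le> La * norm (x - y) + B * sqrt \<bar>t - s\<bar>"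
  and vmod: "!!x t y s. \<bar>v (x, t) - v (y, s)\<bar> \<le> La * norm (x - y) + B * sqrt \<bar>t - s\<bar>"
  and u0: "!!x t. 0 \<le> t ==> u (x, t) = f x" and v0: "!!x t. 0 \<le> t ==> v (x, t) = - f x"
  and usub: "touched_above (sub_condition AA) u" and vsuper: "touched_above (super_condition AA) v"
  and lam: "0 < lam" "!!x. lam * norm x \<le> f x"
 shows "u z + v z \<le> 0"
proof (rule ccontr)
 assume "\<not> u z + v z \<le> 0"
 hence u1: "u z + v z > 0" by simp
 obtain x1 t1 where z: "z = (x1, t1)" by (cases z)
 have t1: "t1 < 0" using u1 u0[of t1 x1] v0[of t1 x1] by (cases "0 \<le> t1") (auto simp: z)
 \<comment> \<open>Replacing \<open>u\<close> by \<open>(1 - et) * u\<close> gains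
   \<open>- (et * lam * norm x)\<close>, so the sum decays at spatial infinity. The size of
   \<open>et\<close> sacrifices at most half of the assumed excess \<open>u z + v z\<close>; the
   term in \<open>al\<close> takes another quarter and leaves \<open>gap\<close>.\<close>
 define et where "et = min (1/2) ((u z + v z) / (2 * (\<bar>u z\<bar> + 1)))"
 have et: "0 < et" "et < 1" using u1 by (auto simp: et_def)
 have etu: "et * \<bar>u z\<bar> \<le> (u z + v z) / 2"
 proof -
  have "et * (\<bar>u z\<bar> + 1) \<le> (u z + v z) / (2 * (\<bar>u z\<bar> + 1)) * (\<bar>u z\<bar> + 1)" by (intro mult_right_mono) (auto simp: et_def)
  also have "\<dots> = (u z + v z) / 2" by (rule divide_mult_cancel) (simp add: add_nonneg_pos)
  finally show ?thesis using et by (simp add: algebra_simps)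
 qed
 define u' where "u' = (\<lambda>z. (1 - et) * u z)"
 define al where "al = (u z + v z) / (4 * (\<bar>t1\<bar> + 1))"
 have al: "al > 0" using u1 by (simp add: al_def)
 define gap where "gap = (u z + v z) / 4"
 have gap: "gap > 0" using u1 by (simp add: gap_def)
 have M1: "u' z + v z + al * t1 \<ge> gap"
 proof -
  have "al * \<bar>t1\<bar> \<le> al * (\<bar>t1\<bar> + 1)" using al by simp
  also have "\<dots> = gap" unfolding al_def gap_def by (rule divide_mult_cancel) (simp add: add_nonneg_pos)
  finally have "al * \<bar>t1\<bar> \<le> gap" .
  moreover have "al * t1 = - (al * \<bar>t1\<bar>)" using t1 by simp
  moreover have "u' z \<ge> u z - et * \<bar>u z\<bar>" using mult_left_mono[of "u z" "\<bar>u z\<bar>" et] et by (simp add: u'_def algebra_simps)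
  ultimately show ?thesis using etu by (simp add: gap_def)
 qed
 have u'mod: "\<bar>u' (x, t) - u' (y, s)\<bar> \<le> La * norm (x - y) + B * sqrt \<bar>t - s\<bar>" for x t y s
 proof -
  have "\<bar>u' (x, t) - u' (y, s)\<bar> = (1 - et) * \<bar>u (x, t) - u (y, s)\<bar>" using et by (simp add: u'_def right_diff_distrib[symmetric] abs_mult)
  also have "\<dots> \<le> 1 * \<bar>u (x, t) - u (y, s)\<bar>" using et by (intro mult_right_mono) auto
  finally show ?thesis using umod[of x t y s] by simp
 qed
 have upper: "u' (x, t) + v (x, t) \<le> - (et * lam * norm x) + 2 * B * sqrt \<bar>t\<bar>" for x t
 proof -
  have "u (x, t) \<le> f x + B * sqrt \<bar>t\<bar>" using umod[of x t x 0] u0[of 0 x] by simp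
  hence "u' (x, t) \<le> (1 - et) * (f x + B * sqrt \<bar>t\<bar>)" unfolding u'_def using et by (intro mult_left_mono) auto
  also have "\<dots> \<le> f x - et * f x + B * sqrt \<bar>t\<bar>" using et B by (simp add: algebra_simps)
  also have "\<dots> \<le> f x - et * (lam * norm x) + B * sqrt \<bar>t\<bar>" using et lam(2)[of x] by (simp add: mult_left_mono)
  finally show ?thesis using vmod[of x t x 0] v0[of 0 x] by (simp add: algebra_simps)
 qed
 \<comment> \<open>At a contact point \<open>2 * B * sqrt \<bar>t\<bar>\<close> has to supply at
   least \<open>gap / 4\<close>, so its time is at most \<open>- tm\<close>. With
   \<open>th^2\<close> at most \<open>tm / 2\<close>, the maximizers \<open>mu z\<close> and
   \<open>mv z\<close> still have negative times, where the conditions apply.\<close>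
 define tm where "tm = (gap / (8 * B))^2"
 have tm: "tm > 0" using gap B by (simp add: tm_def)
 define th where "th = min 1 (min (gap / (8 * (La + B))) (sqrt (tm / 2)))"
 have th: "th > 0" "th \<le> 1" "(La + B) * th \<le> gap / 8" "th^2 \<le> tm / 2"
 proof -
  show "th > 0" "th \<le> 1" using gap La_pos B tm by (auto simp: th_def)
  have "th * (La + B) \<le> gap / (8 * (La + B)) * (La + B)" using La_pos B by (intro mult_right_mono) (auto simp: th_def)
  also have "\<dots> = gap / 8" using La_pos B by (intro divide_mult_cancel) simp
  finally show "(La + B) * th \<le> gap / 8" by (simp only: mult.commute)
  have "th^2 \<le> (sqrt (tm / 2))^2" using \<open>th > 0\<close> by (intro power_mono) (auto simp: th_def)
  thus "th^2 \<le> tm / 2" using tm by simp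
 qed
 define eps where "eps = th^3 / (La + B)"
 have eps: "eps > 0" using th La_pos B by (simp add: eps_def)
 obtain mu where mu: "sup_conv u' La B th eps mu"
  using sup_convolution[OF u'mod La_pos B th(1) eps_def] u'mod La_pos B th eps unfolding sup_conv_def by metis
 obtain mv where mv: "sup_conv v La B th eps mv"
  using sup_convolution[OF vmod La_pos B th(1) eps_def] vmod La_pos B th eps unfolding sup_conv_def by metis
 interpret SU: sup_conv u' La B th eps mu by fact
 interpret SV: sup_conv v La B th eps mv by fact
 define M where "M z = SU.W z + SV.W z + al * snd z" for z
 have Mcont: "continuous_on S M" for S
  unfolding M_def by (intro continuous_intros SU.W_continuous SV.W_continuous)
 have Mup: "M (x, t) \<le> - (et * lam * norm x) + 2 * B * sqrt \<bar>t\<bar> + al * t + gap / 4" for x t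
  using SU.W_le[of "(x, t)"] SV.W_le[of "(x, t)"] upper[of x t] th(3) by (simp add: M_def)
 have Mz: "M z \<ge> gap" using SU.W_ge[of z] SV.W_ge[of z] M1 by (simp add: M_def z)
 define c1 where "c1 = gap / 4 + 4 * B^2 / al"
 have c1: "c1 > 0" using gap al by (simp add: c1_def add_pos_nonneg)
 define R1 where "R1 = 2 * c1 / (et * lam) + 2 * c1 / al"
 define dl0 where "dl0 = min (min (et * lam / 2) (al / 4)) (gap / (4 * (R1 + norm z + 1)))"
 have R1: "R1 > 0" using c1 et lam al by (simp add: R1_def add_pos_pos)
 have dl0: "dl0 > 0" "dl0 \<le> et * lam / 2" "dl0 \<le> al / 4" "dl0 * (R1 + norm z + 1) \<le> gap / 4"
 proof -
  have k: "R1 + norm z + 1 > 0" using R1 by (simp add: add_pos_nonneg)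
  show "dl0 > 0" using et lam al gap k by (simp add: dl0_def)
  show "dl0 \<le> et * lam / 2" "dl0 \<le> al / 4"
   unfolding dl0_def by (meson min.cobounded1 min.cobounded2 order_trans)+
  have "dl0 * (R1 + norm z + 1) \<le> gap / (4 * (R1 + norm z + 1)) * (R1 + norm z + 1)" using k by (intro mult_right_mono) (auto simp: dl0_def)
  also have "\<dots> = gap / 4" using k by (rule divide_mult_cancel)
  finally show "dl0 * (R1 + norm z + 1) \<le> gap / 4" .
 qed
 define rh where "rh = min 1 tm"
 have rh: "0 < rh" "rh \<le> 1" "rh \<le> tm" using tm by (auto simp: rh_def)
 define T where "T = {z :: (real^'m) \<times> real. snd z \<le> - tm}"
 \<comment> \<open>A weighted arithmetic-geometric mean inequality: a quarter of the linear decay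
   \<open>al * t\<close> absorbs the square root growth, so the maximum is also confined in
   time.\<close>
 have sq: "2 * B * sqrt \<bar>t\<bar> \<le> (al / 4) * \<bar>t\<bar> + 4 * B^2 / al" for t
 proof -
  define r where "r = sqrt \<bar>t\<bar>"
  have "0 \<le> (al * r / 2 - 2 * B)^2" by simp
  also have "\<dots> = al * ((al / 4) * r^2 + 4 * B^2 / al - 2 * B * r)" using al by (simp add: power2_eq_square field_simps)
  finally have "0 \<le> (al / 4) * r^2 + 4 * B^2 / al - 2 * B * r" using al by (simp add: zero_le_mult_iff)
  thus ?thesis by (simp add: r_def)
 qed
 show False
 proof (rule no_strict_contact[OF mu mv touched_above_scale[OF usub, of "1 - et", folded u'_def] vsuper rh(1,2) al dl0(1)])
  show "0 < 1 - et" using et by simp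
  fix dl and q :: "(real^'m) \<times> real" assume dl: "0 < dl" "dl \<le> dl0" and q: "norm q < dl"
  have qz: "\<bar>q \<bullet> w\<bar> \<le> dl0 * norm w" for w
   using Cauchy_Schwarz_ineq2[of q w] q dl mult_right_mono[of "norm q" dl0 "norm w"] by (meson less_imp_le norm_ge_zero order_trans)
  have bound: "norm x + \<bar>t\<bar> \<le> R1" if t: "t \<le> 0" and v0: "0 \<le> M (x, t) - q \<bullet> (x, t)" for x t
  proof -
   have "\<bar>q \<bullet> (x, t)\<bar> \<le> dl0 * (norm x + \<bar>t\<bar>)"
    using qz[of "(x, t)"] norm_Pair_le[of x t] dl0(1) by (smt (verit) mult_left_mono real_norm_def)
   also have "\<dots> \<le> (et * lam / 2) * norm x + (al / 4) * \<bar>t\<bar>"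
    unfolding distrib_left using dl0 by (intro add_mono mult_right_mono) auto
   finally have "0 \<le> - (et * lam * norm x) + 2 * B * sqrt \<bar>t\<bar> + al * t + gap / 4 + (et * lam / 2) * norm x + (al / 4) * \<bar>t\<bar>"
    using Mup[of x t] v0 by linarith
   moreover have "al * t = - (al * \<bar>t\<bar>)" using t by simp
   ultimately have k: "(et * lam) * norm x / 2 + al * \<bar>t\<bar> / 2 \<le> c1" using sq[of t] by (simp add: c1_def)
   have "(et * lam) * norm x \<ge> 0" "al * \<bar>t\<bar> \<ge> 0" using et lam al by auto
   hence "(et * lam) * norm x \<le> 2 * c1" "al * \<bar>t\<bar> \<le> 2 * c1" using k by linarith+
   hence "norm x \<le> 2 * c1 / (et * lam)" "\<bar>t\<bar> \<le> 2 * c1 / al"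
    using et lam al by (simp_all add: pos_le_divide_eq mult.commute)
   thus ?thesis by (simp add: R1_def)
  qed
  have valz: "0 < M z - q \<bullet> z"
  proof -
   have "dl0 * norm z \<le> dl0 * (R1 + norm z + 1)" using dl0(1) R1 by (intro mult_left_mono) auto
   thus ?thesis using qz[of z] Mz dl0(4) gap by linarith
  qed
  define S where "S = cball (0 :: real^'m) R1 \<times> {- R1..0 :: real}"
  have inS: "(x, t) \<in> S" if "t \<le> 0" "0 \<le> M (x, t) - q \<bullet> (x, t)" for x t
   proof -
   have "norm x \<le> R1" "- t \<le> R1" using bound[OF that] that(1) norm_ge_zero[of x] by linarith+
   thus ?thesis using that(1) by (simp add: S_def)
  qed
  have "compact S" unfolding S_def by (intro compact_Times compact_cball compact_Icc)
  moreover have zS: "z \<in> S" using inS[of t1 x1] valz t1 by (simp add: z)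
  moreover have "continuous_on S (\<lambda>w. M w - q \<bullet> w)" by (intro continuous_intros Mcont)
  ultimately obtain w where w: "w \<in> S" "!!w'. w' \<in> S ==> M w' - q \<bullet> w' \<le> M w - q \<bullet> w"
   using continuous_attains_sup[of S "\<lambda>w. M w - q \<bullet> w"] by blast
  have glob: "M w' - q \<bullet> w' \<le> M w - q \<bullet> w" if "snd w' \<le> 0" for w'
  proof (cases "0 \<le> M w' - q \<bullet> w'")
   case True
   thus ?thesis using inS[of "snd w'" "fst w'"] that w(2) by simp
  next
   case False
   thus ?thesis using w(2)[OF zS] valz by linarith
  qed
  obtain xw tw where xw: "w = (xw, tw)" by (cases w)
  have tw: "tw \<le> 0" "\<bar>tw\<bar> \<le> R1" "norm xw \<le> R1" using w(1) by (auto simp: S_def xw)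
  have "norm w \<le> R1"
  proof -
   have "0 \<le> M (xw, tw) - q \<bullet> (xw, tw)" using w(2)[OF zS] valz by (simp add: xw)
   from bound[OF tw(1) this] norm_Pair_le[of xw tw] show ?thesis by (simp add: xw)
  qed
  have "M w \<ge> gap / 2"
  proof -
   have "M w \<ge> M z - q \<bullet> z + q \<bullet> w" using w(2)[OF zS] by linarith
   moreover have "dl0 * norm z + dl0 * norm w \<le> dl0 * (R1 + norm z + 1)"
    unfolding distrib_left[symmetric] using dl0(1) \<open>norm w \<le> R1\<close> by (intro mult_left_mono) auto
   ultimately show ?thesis using qz[of z] qz[of w] Mz dl0(4) gap by linarith
  qed
  hence "gap / 4 \<le> 2 * B * sqrt \<bar>tw\<bar>"
  proof -
   assume "M w \<ge> gap / 2"
   moreover have "0 \<le> et * lam * norm xw" using et lam by simp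
   moreover have "al * tw \<le> 0" using al tw by (simp add: mult_nonneg_nonpos)
   ultimately show ?thesis using Mup[of xw tw] unfolding xw by linarith
  qed
  hence "gap / (8 * B) \<le> sqrt \<bar>tw\<bar>" using B by (simp add: field_simps)
  hence "tm \<le> (sqrt \<bar>tw\<bar>)^2" unfolding tm_def using gap B by (intro power_mono) auto
  hence twm: "tw \<le> - tm" using tw by simp
  show "\<exists>z. z \<in> T \<and> (\<forall>y. norm y \<le> rh --> SU.W (z + y) + SV.W (z + y) + al * snd (z + y) \<le> SU.W z + SV.W z + al * snd z + q \<bullet> y)"
  proof (intro exI conjI allI impI)
   show "w \<in> T" using twm by (simp add: T_def xw)
   fix y :: "(real^'m) \<times> real" assume y: "norm y \<le> rh"
   have "\<bar>snd y\<bar> \<le> norm y" using norm_snd_le[of "snd y" "fst y"] by simp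
   hence "snd (w + y) \<le> 0" using y rh(3) twm by (simp add: xw)
   from glob[OF this] show "SU.W (w + y) + SV.W (w + y) + al * snd (w + y) \<le> SU.W w + SV.W w + al * snd w + q \<bullet> y"
    by (simp add: M_def inner_add_right)
  qed
 next
  fix z assume "z \<in> T"
  hence "snd z \<le> - tm" by (simp add: T_def)
  thus "snd (mu z) < 0 \<and> snd (mv z) < 0"
   using SU.m_close(2)[of z] SV.m_close(2)[of z] th(4) tm by (simp add: abs_le_iff)
 qed
qed

theorem (in game_scheme) scheme_converges:
 assumes lam: "0 < lam" "!!x. lam * norm x \<le> f x"
 obtains u where "!!z. (\<lambda>n. V n z) \<longlonglongrightarrow> u z"
  "!!x t y s. \<bar>u (x, t) - u (y, s)\<bar> \<le> La * norm (x - y) + La * R * sqrt \<bar>t - s\<bar>"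
  "!!x t. 0 \<le> t ==> u (x, t) = f x" "touched_above (sub_condition AA) u" "touched_above (super_condition AA) (\<lambda>z. - u z)"
proof -
 interpret P: signed_scheme AA f La R 1 by unfold_locales simp
 interpret N: signed_scheme AA f La R "- 1" by unfold_locales simp
 obtain u v where u: "limit_above 1 u" and v: "limit_above (- 1) v" using P.limit_exists N.limit_exists by auto
 have up: "\<forall>\<^sub>F n in sequentially. V n z < u z + eps" if "eps > 0" for z eps
  using u that unfolding limit_above_def mult_1 by blast
 have lo: "\<forall>\<^sub>F n in sequentially. - v z - eps < V n z" if "eps > 0" for z eps
 proof -
  have "\<forall>\<^sub>F n in sequentially. - 1 * V n z < v z + eps" using v that unfolding limit_above_def by blast
  thus ?thesis by eventually_elim simp
 qed
 have B: "0 < La * R" using La_pos R_pos by simp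
 have "u z + v z \<le> 0" for z
  by (rule comparison[OF B P.limit_modulus[OF u] N.limit_modulus[OF v] _ _ upper_limit_touched[OF u] lower_limit_touched[OF v] lam])
   (use P.limit_nonneg_time[OF u] N.limit_nonneg_time[OF v] in auto)
 moreover have "0 \<le> u z + v z" for z
 proof (rule field_le_epsilon)
  fix eps :: real assume "eps > 0"
  hence "0 < eps / 2" by simp
  from up[OF this, of z] lo[OF this, of z] have "\<forall>\<^sub>F n in sequentially. 0 \<le> u z + v z + eps" by eventually_elim simp
  thus "0 \<le> u z + v z + eps" by simp
 qed
 ultimately have v': "v z = - u z" for z by (smt (verit))
 have "(\<lambda>n. V n z) \<longlonglongrightarrow> u z" for z
  by (rule order_tendstoI) (use up[of "a - u z" z for a] lo[of "u z - a" z for a] in \<open>auto simp: v'\<close>)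
 moreover have "touched_above (super_condition AA) (\<lambda>z. - u z)" using lower_limit_touched[OF v] unfolding v'[abs_def] .
 ultimately show thesis
  by (intro that[OF _ P.limit_modulus[OF u] _ upper_limit_touched[OF u]]) (use P.limit_nonneg_time[OF u] in auto)
qed

section \<open>The two sets of admissible matrices\<close>

lemma compact_matrices_bounded:
 fixes AA :: "(real^'n^'m) set"
 assumes "compact AA"
 obtains R where "0 < R" "!!A e. A \<in> AA ==> e \<in> sign_vectors ==> norm (A *v e) \<le> R"
proof -
 have "compact (sign_vectors :: (real^'n) set)" by (rule finite_imp_compact[OF finite_sign_vectors])
 with assms have "compact (AA \<times> (sign_vectors :: (real^'n) set))" by (rule compact_Times)
 moreover have "continuous_on (AA \<times> (sign_vectors :: (real^'n) set)) (\<lambda>(A, e). A *v e)"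
  unfolding case_prod_unfold by (intro continuous_intros)
 ultimately have "compact ((\<lambda>(A, e). A *v e) ` (AA \<times> (sign_vectors :: (real^'n) set)))" by (rule compact_continuous_image[rotated])
 then obtain R where "R > 0" "!!x. x \<in> (\<lambda>(A, e). A *v e) ` (AA \<times> (sign_vectors :: (real^'n) set)) ==> norm x \<le> R"
  by (meson compact_imp_bounded bounded_pos)
 thus thesis using that by blast
qed

lemma column_matrix_mult: "column j (Q ** A) = Q *v column j (A :: real^'n^'m)"
 by (simp add: column_def matrix_matrix_mult_def matrix_vector_mult_def vec_eq_iff)

lemma compact_short_column_matrices: "compact (short_column_matrices :: (real^'n^'m) set)"
proof -
 have "closed (short_column_matrices :: (real^'n^'m) set)"
 proof -
  have "short_column_matrices = (\<Inter>j. {A :: real^'n^'m. norm (A *v axis j 1) \<le> 1})"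
   by (auto simp: short_column_matrices_def matrix_vector_mul_component matrix_vector_mult_basis)
  also have "closed \<dots>" by (intro closed_INT ballI closed_Collect_le continuous_intros)
  finally show ?thesis .
 qed
 moreover have "bounded (short_column_matrices :: (real^'n^'m) set)"
 proof (rule boundedI)
  fix A :: "real^'n^'m" assume A: "A \<in> short_column_matrices"
  have "\<bar>A $ i $ j\<bar> \<le> 1" for i j
  proof -
   have "\<bar>column j A $ i\<bar> \<le> norm (column j A)" by (rule component_le_norm_cart)
   also have "\<dots> \<le> 1" using A by (simp add: short_column_matrices_def)
   finally show ?thesis by (simp add: column_def)
  qed
  hence "norm (A $ i) \<le> real CARD('n)" for i
   by (intro order_trans[OF norm_le_l1_cart] order_trans[OF sum_bounded_above[where K = 1]]) auto
  hence "(\<Sum>i\<in>UNIV. norm (A $ i)) \<le> real CARD('m) * real CARD('n)"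
   by (intro sum_bounded_above[THEN order_trans]) auto
  thus "norm A \<le> real CARD('m) * real CARD('n)"
   unfolding norm_vec_def[of A] by (rule order_trans[OF L2_set_le_sum, rotated]) simp
 qed
 ultimately show ?thesis by (simp add: compact_eq_bounded_closed)
qed

lemma short_column_matrices_scheme:
 assumes "!!x y. \<bar>f x - f y\<bar> \<le> La * norm (x - y)" "0 < La" "!!c x. 0 \<le> c ==> f (c *\<^sub>R x) = c * f (x :: real^'m)"
 obtains R where "game_scheme (short_column_matrices :: (real^'n^'m) set) f La R"
proof -
 obtain R where R: "0 < R" "!!A e. A \<in> (short_column_matrices :: (real^'n^'m) set) ==> e \<in> sign_vectors ==> norm (A *v e) \<le> R"
  using compact_matrices_bounded[OF compact_short_column_matrices] by blast
 have "game_scheme (short_column_matrices :: (real^'n^'m) set) f La R"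
 proof
  fix d :: "real^'m"
  have "(0 :: real^'n^'m) \<in> short_column_matrices" by (simp add: short_column_matrices_def column_def vec_eq_iff norm_eq_zero zero_vec_def[symmetric])
  moreover have "transpose (0 :: real^'n^'m) *v d = 0" by (simp add: vec_eq_iff transpose_def matrix_vector_mult_def)
  ultimately show "\<exists>A\<in>(short_column_matrices :: (real^'n^'m) set). transpose A *v d = 0" by blast
 next
  fix Q :: "real^'m => real^'m" and A :: "real^'n^'m"
  assume "orthogonal_transformation Q" "A \<in> short_column_matrices"
  thus "matrix Q ** A \<in> short_column_matrices"
   by (simp add: short_column_matrices_def column_matrix_mult matrix_works orthogonal_transformation_def orthogonal_transformation_norm)
 qed (use assms R compact_short_column_matrices in auto)
 thus thesis by (rule that)
qed

definition outer :: "real^'m => real^'m^'m" where "outer nu = (\<chi> i j. nu $ i * nu $ j)"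

lemma outer_mult_vec: "outer nu *v x = (nu \<bullet> x) *\<^sub>R nu"
 unfolding outer_def by (rule outer_vec)

text \<open>For these matrices the average of \<open>quad H (A e) / 2\<close> over the sign vectors is
 \<open>tr H - quad H nu\<close>, so that the corresponding game is governed by the mean curvature flow.\<close>

definition tangential_matrices :: "(real^'m^'m) set" where
 "tangential_matrices = {A. \<exists>nu. norm nu = 1 \<and> A ** transpose A = 2 *\<^sub>R (mat 1 - outer nu)}"

lemma projection_tangential:
 assumes "norm nu = 1"
 shows "sqrt 2 *\<^sub>R (mat 1 - outer nu) \<in> tangential_matrices" "transpose (sqrt 2 *\<^sub>R (mat 1 - outer nu)) *v nu = 0"
proof -
 have t: "transpose (sqrt 2 *\<^sub>R (mat 1 - outer nu)) = sqrt 2 *\<^sub>R (mat 1 - outer nu)"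
  by (simp add: transpose_def outer_def mat_def vec_eq_iff mult.commute)
 have nn: "nu \<bullet> nu = 1" using assms by (simp add: norm_eq_1)
 have P: "(mat 1 - outer nu) *v x = x - (nu \<bullet> x) *\<^sub>R nu" for x
  by (simp add: matrix_vector_mult_diff_rdistrib outer_mult_vec)
 have "sqrt 2 *\<^sub>R (mat 1 - outer nu) ** (sqrt 2 *\<^sub>R (mat 1 - outer nu)) = 2 *\<^sub>R (mat 1 - outer nu)"
  unfolding matrix_eq matrix_vector_mul_assoc[symmetric] scaleR_matrix_vector_assoc[symmetric] P
  by (simp add: inner_diff_right nn matrix_vector_mult_scaleR P)
 thus "sqrt 2 *\<^sub>R (mat 1 - outer nu) \<in> tangential_matrices"
  using assms unfolding tangential_matrices_def by (auto simp: t)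
 show "transpose (sqrt 2 *\<^sub>R (mat 1 - outer nu)) *v nu = 0"
  unfolding t scaleR_matrix_vector_assoc[symmetric] P by (simp add: nn)
qed

lemma trace_mult_transpose: "trace (A ** transpose A) = (norm (A :: real^'n^'m))^2"
 by (simp add: trace_def matrix_matrix_mult_def transpose_def power2_norm_eq_inner inner_vec_def)

text \<open>The set is the projection of a closed set of pairs \<open>(A, nu)\<close>, bounded
  because the squared norm of \<open>A\<close> is the trace of
  \<open>A ** transpose A\<close>.\<close>

lemma compact_tangential_matrices: "compact (tangential_matrices :: (real^'m^'m) set)"
proof -
 define S where "S = {z :: (real^'m^'m) \<times> (real^'m). norm (snd z) = 1 \<and> fst z ** transpose (fst z) = 2 *\<^sub>R (mat 1 - outer (snd z))}"
 have ct: "continuous_on UNIV (\<lambda>z :: (real^'m^'m) \<times> (real^'m). transpose (fst z))"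
  unfolding transpose_def by (intro continuous_intros)
 have "closed S"
  unfolding S_def outer_def by (intro closed_Collect_conj closed_Collect_eq continuous_intros ct)
 moreover have "bounded S"
 proof (rule boundedI)
  fix z assume z: "z \<in> S"
  have "(norm (fst z))^2 = trace (2 *\<^sub>R (mat 1 - outer (snd z)))" using z by (simp add: S_def trace_mult_transpose[symmetric])
  also have "\<dots> \<le> 2 * real CARD('m)"
  proof -
   have "(2 *\<^sub>R (mat 1 - outer (snd z))) $ i $ i \<le> 2" for i by (simp add: mat_def outer_def)
   thus ?thesis unfolding trace_def by (intro order_trans[OF sum_bounded_above[where K = 2]]) auto
  qed
  finally have "norm (fst z) \<le> sqrt (2 * real CARD('m))" by (simp add: real_le_rsqrt)
  thus "norm z \<le> sqrt (2 * real CARD('m)) + 1"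
   using norm_Pair_le[of "fst z" "snd z"] z by (simp add: S_def)
 qed
 ultimately have "compact S" by (simp add: compact_eq_bounded_closed)
 hence "compact (fst ` S)" by (intro compact_continuous_image continuous_intros)
 moreover have "fst ` S = tangential_matrices"
  unfolding S_def tangential_matrices_def by (intro equalityI subsetI) (auto intro: image_eqI[of _ fst "(x, y)" for x y])
 ultimately show ?thesis by simp
qed

lemma tangential_matrices_scheme:
 assumes "!!x y. \<bar>f x - f y\<bar> \<le> La * norm (x - y)" "0 < La" "!!c x. 0 \<le> c ==> f (c *\<^sub>R x) = c * f (x :: real^'m)"
 obtains R where "game_scheme (tangential_matrices :: (real^'m^'m) set) f La R"
proof -
 obtain R where R: "0 < R" "!!A e. A \<in> (tangential_matrices :: (real^'m^'m) set) ==> e \<in> sign_vectors ==> norm (A *v e) \<le> R"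
  using compact_matrices_bounded[OF compact_tangential_matrices] by blast
 have "game_scheme (tangential_matrices :: (real^'m^'m) set) f La R"
 proof
  fix d :: "real^'m"
  show "\<exists>A\<in>(tangential_matrices :: (real^'m^'m) set). transpose A *v d = 0"
  proof (cases "d = 0")
   case True
   obtain i :: 'm where True by simp
   have "norm (axis i 1 :: real^'m) = 1" by simp
   from projection_tangential(1)[OF this] True show ?thesis by (intro bexI) auto
  next
   case False
   define nu where "nu = d /\<^sub>R norm d"
   have "norm nu = 1" "d = norm d *\<^sub>R nu" using False by (auto simp: nu_def)
   thus ?thesis using projection_tangential[OF \<open>norm nu = 1\<close>] by (metis matrix_vector_mult_scaleR scaleR_zero_right)
  qed
 next
  fix Q :: "real^'m => real^'m" and A :: "real^'m^'m"
  assume Q: "orthogonal_transformation Q" and "A \<in> tangential_matrices"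
  then obtain nu where nu: "norm nu = 1" "A ** transpose A = 2 *\<^sub>R (mat 1 - outer nu)" by (auto simp: tangential_matrices_def)
  have lin: "linear Q" using Q by (simp add: orthogonal_transformation_def)
  have MQ: "matrix Q *v x = Q x" for x using lin by (simp add: matrix_works)
  have QQ: "Q (transpose (matrix Q) *v x) = x" for x
  proof -
   have "orthogonal_matrix (matrix Q)" using Q by (simp add: orthogonal_transformation_matrix)
   hence "matrix Q ** transpose (matrix Q) = mat 1" by (simp add: orthogonal_matrix_def)
   hence "matrix Q *v (transpose (matrix Q) *v x) = x" by (metis matrix_vector_mul_assoc matrix_vector_mul_lid)
   thus ?thesis by (simp only: MQ)
  qed
  have "(matrix Q ** A) ** transpose (matrix Q ** A) = 2 *\<^sub>R (mat 1 - outer (Q nu))"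
   unfolding matrix_eq
  proof
   fix x
   have "((matrix Q ** A) ** transpose (matrix Q ** A)) *v x = Q ((A ** transpose A) *v (transpose (matrix Q) *v x))"
    unfolding matrix_transpose_mul matrix_vector_mul_assoc[symmetric] MQ ..
   also have "\<dots> = Q (2 *\<^sub>R ((transpose (matrix Q) *v x) - (nu \<bullet> (transpose (matrix Q) *v x)) *\<^sub>R nu))"
    unfolding nu(2) scaleR_matrix_vector_assoc[symmetric] matrix_vector_mult_diff_rdistrib outer_mult_vec matrix_vector_mul_lid ..
   also have "nu \<bullet> (transpose (matrix Q) *v x) = Q nu \<bullet> x"
    using transpose_vec_inner[of "matrix Q" x nu] unfolding MQ by (metis inner_commute)
   also have "Q (2 *\<^sub>R ((transpose (matrix Q) *v x) - (Q nu \<bullet> x) *\<^sub>R nu)) = 2 *\<^sub>R (x - (Q nu \<bullet> x) *\<^sub>R Q nu)"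
    using lin QQ by (simp add: linear_diff linear_scale)
   finally show "((matrix Q ** A) ** transpose (matrix Q ** A)) *v x = (2 *\<^sub>R (mat 1 - outer (Q nu))) *v x"
    unfolding scaleR_matrix_vector_assoc[symmetric] matrix_vector_mult_diff_rdistrib outer_mult_vec matrix_vector_mul_lid .
  qed
  moreover have "norm (Q nu) = 1" using Q nu(1) by (simp add: orthogonal_transformation_norm)
  ultimately show "matrix Q ** A \<in> tangential_matrices" unfolding tangential_matrices_def by blast
 qed (use assms R compact_tangential_matrices in auto)
 thus thesis by (rule that)
qed

lemma game_value_eq_steps:
 "game_value n E k x = (game_step (short_column_matrices :: (real^'n^'m) set) ^^ k) (body_norm E) x"
 for n :: "'n::finite itself"
 by (induction k arbitrary: x) (simp_all add: game_step_def)

section \<open>The norm of a symmetric convex body\<close>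

lemma symmetric_convex_body_ball:
 assumes "symmetric_convex_body E"
 obtains r where "0 < r" "cball 0 r \<subseteq> E"
proof -
 have E: "convex E" "interior E \<noteq> {}" "E = uminus ` E" using assms by (auto simp: symmetric_convex_body_def)
 obtain x where x: "x \<in> interior E" using E(2) by auto
 have "interior E = uminus ` interior E" using E(3) interior_negations by metis
 hence "- x \<in> interior E" using x by (metis image_eqI)
 hence "(1/2) *\<^sub>R x + (1/2) *\<^sub>R (- x) \<in> interior E"
  using x convex_interior[OF E(1)] by (intro convexD) auto
 hence "0 \<in> interior E" by simp
 then obtain e where "e > 0" "ball 0 e \<subseteq> E" by (meson mem_interior)
 thus thesis by (intro that[of "e/2"]) (auto simp: subset_eq)
qed

locale convex_body =
 fixes E :: "(real^'m) set" and r R :: real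
 assumes E: "symmetric_convex_body E" and r: "0 < r" "cball 0 r \<subseteq> E" and R: "0 < R" "!!x. x \<in> E ==> norm x \<le> R"
begin

lemma cvx: "convex E" using E by (simp add: symmetric_convex_body_def)

lemma zero_in: "0 \<in> E" using r by auto

lemma scaled_mono:
 assumes "0 \<le> s" "s \<le> s'" "x \<in> (*\<^sub>R) s ` E" shows "x \<in> (*\<^sub>R) s' ` E"
proof (cases "s' = 0")
 case False
 hence s': "s' > 0" using assms by linarith
 obtain y where y: "y \<in> E" "x = s *\<^sub>R y" using assms(3) by auto
 have "(s / s') *\<^sub>R y + (1 - s / s') *\<^sub>R 0 \<in> E"
  using assms s' y zero_in cvx by (intro convexD) auto
 moreover have "x = s' *\<^sub>R ((s / s') *\<^sub>R y + (1 - s / s') *\<^sub>R 0)" using s' y by simp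
 ultimately show ?thesis by blast
qed (use assms in auto)

lemma bdd: "bdd_below {s. 0 \<le> s \<and> x \<in> (*\<^sub>R) s ` E}"
 by (rule bdd_belowI[of _ 0]) auto

lemma norm_le: "0 \<le> s ==> x \<in> (*\<^sub>R) s ` E ==> body_norm E x \<le> s"
 unfolding body_norm_def by (rule cInf_lower[OF _ bdd]) auto

lemma in_scaled: "x \<in> (*\<^sub>R) (norm x / r) ` E"
proof (cases "x = 0")
 case False
 have "(r / norm x) *\<^sub>R x \<in> E" using r False by (intro subsetD[OF r(2)]) auto
 moreover have "x = (norm x / r) *\<^sub>R ((r / norm x) *\<^sub>R x)" using False r by simp
 ultimately show ?thesis by blast
qed (use zero_in in auto)

lemma norm_upper: "body_norm E x \<le> norm x / r"
 by (rule norm_le[OF _ in_scaled]) (use r in simp)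

lemma nonempty: "{s. 0 \<le> s \<and> x \<in> (*\<^sub>R) s ` E} \<noteq> {}"
 using in_scaled[of x] r by (auto intro!: exI[of _ "norm x / r"])

lemma norm_lower: "norm x / R \<le> body_norm E x"
 unfolding body_norm_def
proof (rule cInf_greatest[OF nonempty])
 fix s assume "s \<in> {s. 0 \<le> s \<and> x \<in> (*\<^sub>R) s ` E}"
 then obtain y where "0 \<le> s" "y \<in> E" "x = s *\<^sub>R y" by auto
 hence "norm x \<le> s * R" using R(2)[of y] by (simp add: mult_left_mono)
 thus "norm x / R \<le> s" using R(1) by (simp add: pos_divide_le_eq)
qed

lemma norm_nonneg: "0 \<le> body_norm E x"
 using norm_lower[of x] R by (smt (verit) divide_nonneg_pos norm_ge_zero)

lemma in_scaled_gt: assumes "body_norm E x < s" shows "x \<in> (*\<^sub>R) s ` E"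
proof -
 obtain s' where "0 \<le> s'" "x \<in> (*\<^sub>R) s' ` E" "s' < s"
  using cInf_lessD[OF nonempty, of x s] assms unfolding body_norm_def by auto
 thus ?thesis using scaled_mono by (meson less_imp_le)
qed

lemma norm_triangle: "body_norm E (x + y) \<le> body_norm E x + body_norm E y"
proof (rule field_le_epsilon)
 fix e :: real assume e: "e > 0"
 define a b where "a = body_norm E x + e / 2" and "b = body_norm E y + e / 2"
 have ab: "a > 0" "b > 0" using norm_nonneg[of x] norm_nonneg[of y] e by (auto simp: a_def b_def)
 have "x \<in> (*\<^sub>R) a ` E" "y \<in> (*\<^sub>R) b ` E" using e by (auto intro!: in_scaled_gt simp: a_def b_def)
 then obtain p q where p: "p \<in> E" "x = a *\<^sub>R p" and q: "q \<in> E" "y = b *\<^sub>R q" by auto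
 have "(a / (a + b)) *\<^sub>R p + (b / (a + b)) *\<^sub>R q \<in> E"
  using ab p q cvx by (intro convexD) (auto simp: add_divide_distrib[symmetric])
 moreover have "x + y = (a + b) *\<^sub>R ((a / (a + b)) *\<^sub>R p + (b / (a + b)) *\<^sub>R q)"
  using ab p q by (simp add: scaleR_right_distrib)
 ultimately have "body_norm E (x + y) \<le> a + b" using ab by (intro norm_le) auto
 thus "body_norm E (x + y) \<le> body_norm E x + body_norm E y + e" by (simp add: a_def b_def)
qed

lemma norm_minus: "body_norm E (- x) = body_norm E x"
proof -
 have "(- x \<in> (*\<^sub>R) s ` E) = (x \<in> (*\<^sub>R) s ` E)" for s and x
 proof -
  have sub: "- x \<in> (*\<^sub>R) s ` E" if x: "x \<in> (*\<^sub>R) s ` E" for x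
  proof -
   obtain y where y: "y \<in> E" "x = s *\<^sub>R y" using x by auto
   have "- y \<in> E" using y(1) E unfolding symmetric_convex_body_def by (metis image_eqI)
   thus ?thesis using y(2) by (intro image_eqI[of _ _ "- y"]) auto
  qed
  show ?thesis using sub[of x] sub[of "- x"] by auto
 qed
 thus ?thesis by (simp add: body_norm_def)
qed

lemma norm_scale:
 assumes "0 \<le> c" shows "body_norm E (c *\<^sub>R x) = c * body_norm E x"
proof -
 have le: "body_norm E (c *\<^sub>R x) \<le> c * body_norm E x" if c: "c > 0" for c x
 proof (rule field_le_epsilon)
  fix e :: real assume e: "e > 0"
  have "x \<in> (*\<^sub>R) (body_norm E x + e / c) ` E" using e c by (intro in_scaled_gt) simp
  then obtain y where "y \<in> E" "x = (body_norm E x + e / c) *\<^sub>R y" by auto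
  hence "c *\<^sub>R x \<in> (*\<^sub>R) (c * (body_norm E x + e / c)) ` E" by (metis image_eqI scaleR_scaleR)
  moreover have "0 \<le> c * (body_norm E x + e / c)" using norm_nonneg[of x] c e by simp
  ultimately have "body_norm E (c *\<^sub>R x) \<le> c * (body_norm E x + e / c)" by (intro norm_le)
  thus "body_norm E (c *\<^sub>R x) \<le> c * body_norm E x + e" using c by (simp add: distrib_left)
 qed
 show ?thesis
 proof (cases "c = 0")
  case True
  thus ?thesis using norm_upper[of 0] norm_nonneg[of 0] by simp
 next
  case False
  hence c: "c > 0" using assms by simp
  have "body_norm E x \<le> (1/c) * body_norm E (c *\<^sub>R x)" using le[of "1/c" "c *\<^sub>R x"] c by simp
  hence "c * body_norm E x \<le> body_norm E (c *\<^sub>R x)" using c by (simp add: field_simps)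
  thus ?thesis using le[OF c] by (intro antisym)
 qed
qed

lemma norm_lipschitz: "\<bar>body_norm E x - body_norm E y\<bar> \<le> (1 / r) * norm (x - y)"
proof -
 have "body_norm E x \<le> body_norm E y + norm (x - y) / r" for x y
  using norm_triangle[of "x - y" y] norm_upper[of "x - y"] by simp
 from this[of x y] this[of y x] show ?thesis by (simp add: norm_minus_commute abs_le_iff)
qed

lemma norm_convex: "convex_on UNIV (body_norm E)"
proof (rule convex_onI)
 fix t :: real and x y assume "0 < t" "t < 1"
 thus "body_norm E ((1 - t) *\<^sub>R x + t *\<^sub>R y) \<le> (1 - t) * body_norm E x + t * body_norm E y"
  using norm_triangle[of "(1 - t) *\<^sub>R x" "t *\<^sub>R y"] by (simp add: norm_scale)
qed simp

lemma dual_bdd: "bdd_above ((\<lambda>y. z \<bullet> y) ` {y. body_norm E y \<le> 1})"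
proof (rule bdd_aboveI2)
 fix y assume "y \<in> {y. body_norm E y \<le> 1}"
 hence "norm y / R \<le> 1" using norm_lower[of y] by simp
 hence "norm y \<le> R" using R(1) by simp
 thus "z \<bullet> y \<le> norm z * R"
  using norm_cauchy_schwarz[of z y] by (meson mult_left_mono norm_ge_zero order_trans)
qed

lemma inner_le_dual: "z \<bullet> x \<le> body_norm E x * body_dual_norm E z"
proof (cases "x = 0")
 case False
 define s where "s = body_norm E x"
 have s: "s > 0" using norm_lower[of x] False R unfolding s_def by (smt (verit) divide_pos_pos zero_less_norm_iff)
 have "body_norm E ((1/s) *\<^sub>R x) = 1" using s norm_scale[of "1/s" x] by (simp add: s_def)
 hence "z \<bullet> ((1/s) *\<^sub>R x) \<le> body_dual_norm E z"
  unfolding body_dual_norm_def by (intro cSUP_upper dual_bdd) simp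
 thus ?thesis using s by (simp add: s_def field_simps)
qed (use norm_upper[of 0] norm_nonneg[of 0] in simp)

lemma dual_pos: "0 < body_dual_norm E (axis i 1)"
proof -
 have "body_norm E (r *\<^sub>R axis i 1) \<le> 1" using norm_upper[of "r *\<^sub>R axis i 1"] r by simp
 hence "axis i 1 \<bullet> (r *\<^sub>R axis i 1 :: real^'m) \<le> body_dual_norm E (axis i 1)"
  unfolding body_dual_norm_def by (intro cSUP_upper dual_bdd) simp
 thus ?thesis using r by (simp add: inner_axis_axis)
qed

lemma C_pos: "0 < body_C E"
proof -
 have "0 < Max (range (\<lambda>i. body_dual_norm E (axis i 1)))"
  using dual_pos by (subst Max_gr_iff) auto
 thus ?thesis by (simp add: body_C_def)
qed

text \<open>Duality bounds \<open>x $ i\<close> by \<open>body_norm E x\<close> times the dual norm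
  of the basis vector, and \<open>body_C E\<close> is the reciprocal of the largest such dual norm.
  This is how \<open>body_C E\<close> enters the lower bounds.\<close>

lemma C_coordinate_le: "body_C E * x $ i \<le> body_norm E x"
proof -
 define D where "D = Max (range (\<lambda>i. body_dual_norm E (axis i 1)))"
 have D: "D > 0" using C_pos by (simp add: body_C_def D_def)
 have "x $ i \<le> body_norm E x * body_dual_norm E (axis i 1)"
  using inner_le_dual[of "axis i 1" x] by (simp add: inner_axis' )
 also have "\<dots> \<le> body_norm E x * D" unfolding D_def by (intro mult_left_mono norm_nonneg) simp
 finally show ?thesis using D unfolding body_C_def D_def[symmetric] by (simp add: field_simps)
qed

end

lemma convex_body_exists:
 assumes "symmetric_convex_body E"
 obtains r R where "convex_body E r R"
proof -
 obtain r where r: "0 < r" "cball 0 r \<subseteq> E" using symmetric_convex_body_ball[OF assms] .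
 have "bounded E" using assms by (auto simp: symmetric_convex_body_def compact_imp_bounded)
 then obtain R where "R > 0" "!!x. x \<in> E ==> norm x \<le> R" by (meson bounded_pos)
 with r assms have "convex_body E r R" by unfold_locales auto
 thus thesis by (rule that)
qed

section \<open>Gaussian averages\<close>

lemma integrable_gaussian:
 assumes "0 < c"
 shows "integrable lborel (\<lambda>v :: real^'m. exp (- c * (norm v)^2))"
proof -
 define s where "s = 1 / sqrt (2 * c)"
 have s: "s > 0" "2 * s^2 = 1 / c" using assms by (simp_all add: s_def power_divide)
 let ?g = "\<lambda>x. ennreal (exp (- c * x^2))"
 have "exp (- c * x^2) = sqrt (2 * pi * s^2) * normal_density 0 s x" for x
  using s assms by (simp add: normal_density_def)
 hence "integrable lborel (\<lambda>x. exp (- c * x^2))" using s(1) by (simp add: integrable_mult_right)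
 hence fin: "(\<integral>\<^sup>+x. ?g x \<partial>lborel) < \<infinity>" by (simp add: integrable_iff_bounded)
 have n: "(norm v)^2 = (\<Sum>b\<in>Basis. (v \<bullet> b)^2)" for v :: "real^'m"
  unfolding power2_norm_eq_inner by (subst euclidean_inner) (simp add: power2_eq_square)
 have "ennreal (exp (- c * (norm v)^2)) = (\<Prod>b\<in>Basis. ?g (v \<bullet> b))" for v :: "real^'m"
  unfolding n sum_distrib_left by (simp only: exp_sum finite_Basis prod_ennreal exp_ge_zero)
 hence "(\<integral>\<^sup>+v. ennreal (exp (- c * (norm (v :: real^'m))^2)) \<partial>lborel) = (\<integral>\<^sup>+v. (\<Prod>b\<in>Basis. ?g ((v :: real^'m) \<bullet> b)) \<partial>lborel)"
  by (simp only:)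
 also have "\<dots> = (\<Prod>b\<in>(Basis :: (real^'m) set). (\<integral>\<^sup>+x. ?g x \<partial>lborel))"
  by (rule nn_integral_lborel_prod) auto
 also have "\<dots> < \<infinity>" using fin by (simp add: power_less_top_ennreal)
 finally show ?thesis by (intro integrableI_bounded) auto
qed

lemma integral_affine:
 fixes g :: "real^'m => real"
 assumes "g \<in> borel_measurable borel" "c \<noteq> 0"
 shows "(\<integral>v. g v \<partial>lborel) = \<bar>c\<bar>^CARD('m) * (\<integral>v. g (t + c *\<^sub>R v) \<partial>lborel)"
proof -
 have "(\<integral>v. g v \<partial>lborel) = (\<integral>v. g v \<partial>density (distr lborel borel (\<lambda>x. t + c *\<^sub>R x)) (\<lambda>_. \<bar>c\<bar>^DIM(real^'m)))"
  using lborel_affine[OF assms(2), of t] by metis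
 also have "\<dots> = \<bar>c\<bar>^CARD('m) * (\<integral>v. g (t + c *\<^sub>R v) \<partial>lborel)"
  using assms(1) by (subst integral_density) (auto simp: integral_distr)
 finally show ?thesis .
qed

definition gauss :: "real^'m => real" where "gauss v = (\<Prod>i\<in>UNIV. std_normal_density (v $ i))"

lemma gauss_eq: "gauss (v :: real^'m) = gauss (0 :: real^'m) * exp (- (1 / 2) * (norm v)^2)"
proof -
 have "(norm v)^2 = (\<Sum>i\<in>UNIV. (v $ i)^2)" unfolding power2_norm_eq_inner by (simp add: inner_vec_def power2_eq_square)
 hence "exp (- (1 / 2) * (norm v)^2) = (\<Prod>i\<in>UNIV. exp (- ((v $ i)^2) / 2))"
  by (simp add: exp_sum[symmetric] sum_negf sum_divide_distrib)
 thus ?thesis unfolding gauss_def by (simp add: std_normal_density_def prod_dividef prod.distrib power_one_over)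
qed

lemma gauss_pos: "0 < gauss v"
 unfolding gauss_def by (intro prod_pos) (auto simp: normal_density_pos)

lemma gauss_minus: "gauss (- v) = gauss v"
 unfolding gauss_eq[of "- v"] gauss_eq[of v] by simp

text \<open>Completing the square moves a translation from a merely Lipschitz function to the
  Gaussian weight, where differentiation in \<open>x\<close> acts on
  \<open>exp (v \<bullet> x)\<close>.\<close>

lemma gauss_shift: "gauss (v - x) = exp (- (x \<bullet> x) / 2) * (exp (v \<bullet> x) * gauss (v :: real^'m))"
proof -
 have "- (1 / 2) * (norm (v - x))^2 = - (x \<bullet> x) / 2 + (v \<bullet> x + - (1 / 2) * (norm v)^2)"
  by (simp add: power2_norm_eq_inner inner_diff_left inner_diff_right inner_commute[of x v] field_simps)
 thus ?thesis unfolding gauss_eq[of "v - x"] gauss_eq[of v] by (simp only: exp_add mult_ac)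
qed

text \<open>A class closed under products that contains the coordinates and the exponentials
  \<open>exp (v \<bullet> x)\<close>: differentiating under the integral stays inside it, and
  Gaussian weights make its members integrable.\<close>

definition exp_growth :: "(real^'m => real) => bool" where
 "exp_growth f \<longleftrightarrow> f \<in> borel_measurable borel \<and> (\<exists>a K. \<forall>v. \<bar>f v\<bar> \<le> K * exp (a * norm v))"

lemma exp_growthI: "f \<in> borel_measurable borel ==> (!!v. \<bar>f v\<bar> \<le> K * exp (a * norm v)) ==> exp_growth f"
 unfolding exp_growth_def by blast

lemma exp_growth_mult:
 assumes "exp_growth f" "exp_growth g"
 shows "exp_growth (\<lambda>v. f v * g v)"
proof -
 obtain a K b L where "!!v. \<bar>f v\<bar> \<le> K * exp (a * norm v)" "!!v. \<bar>g v\<bar> \<le> L * exp (b * norm v)"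
  using assms unfolding exp_growth_def by metis
 hence "\<bar>f v * g v\<bar> \<le> (K * exp (a * norm v)) * (L * exp (b * norm v))" for v
  unfolding abs_mult by (intro mult_mono) (auto intro: order_trans[OF abs_ge_zero])
 moreover have "(K * exp (a * n)) * (L * exp (b * n)) = (K * L) * exp ((a + b) * n)" for n by (simp add: distrib_right exp_add)
 ultimately have "\<bar>f v * g v\<bar> \<le> (K * L) * exp ((a + b) * norm v)" for v by simp
 thus ?thesis using assms unfolding exp_growth_def by (intro conjI exI allI) auto
qed

lemma exp_growth_abs: "exp_growth f ==> exp_growth (\<lambda>v. \<bar>f v\<bar>)"
 by (auto simp: exp_growth_def)

lemma norm_le_exp: "norm (v :: real^'m) \<le> exp (norm v)"
 using exp_ge_add_one_self[of "norm v"] by linarith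

lemma exp_growth_basic:
 "exp_growth (\<lambda>v :: real^'m. v $ i)" "exp_growth (\<lambda>v :: real^'m. norm v)" "exp_growth (\<lambda>v :: real^'m. exp (a * norm v))"
 "exp_growth (\<lambda>v :: real^'m. exp (v \<bullet> x))"
proof -
 show "exp_growth (\<lambda>v :: real^'m. v $ i)"
  by (rule exp_growthI[where K = 1 and a = 1]) (auto intro: order_trans[OF component_le_norm_cart norm_le_exp])
 show "exp_growth (\<lambda>v :: real^'m. norm v)" by (rule exp_growthI[where K = 1 and a = 1]) (auto intro: norm_le_exp)
 show "exp_growth (\<lambda>v :: real^'m. exp (a * norm v))" by (rule exp_growthI[where K = 1 and a = a]) auto
 show "exp_growth (\<lambda>v :: real^'m. exp (v \<bullet> x))"
  by (rule exp_growthI[where K = 1 and a = "norm x"]) (use norm_cauchy_schwarz in \<open>auto simp: mult.commute\<close>)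
qed

text \<open>Completing the square lets half of the Gaussian exponent absorb the exponential
  growth.\<close>

lemma growth_integrable:
 fixes f :: "real^'m => real"
 assumes f: "exp_growth f" and c: "0 < c"
 shows "integrable lborel (\<lambda>v. f v * exp (- c * (norm v)^2))"
proof -
 obtain a K where K: "!!v. \<bar>f v\<bar> \<le> K * exp (a * norm v)" and m: "f \<in> borel_measurable borel" using f by (auto simp: exp_growth_def)
 have b: "\<bar>f v * exp (- c * (norm v)^2)\<bar> \<le> (K * exp (a^2 / (2 * c))) * exp (- (c / 2) * (norm v)^2)" for v
 proof -
  have "0 \<le> (c * norm v - a)^2 / (2 * c)" using c by simp
  hence "a * norm v + - c * (norm v)^2 \<le> a^2 / (2 * c) + - (c / 2) * (norm v)^2"
   using c by (simp add: power2_diff power_mult_distrib field_simps power2_eq_square)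
  hence "exp (a * norm v) * exp (- c * (norm v)^2) \<le> exp (a^2 / (2 * c)) * exp (- (c / 2) * (norm v)^2)"
   unfolding exp_add[symmetric] exp_le_cancel_iff .
  moreover have "0 \<le> K" using order_trans[OF abs_ge_zero K[of 0]] by simp
  ultimately have "K * (exp (a * norm v) * exp (- c * (norm v)^2)) \<le> K * (exp (a^2 / (2 * c)) * exp (- (c / 2) * (norm v)^2))"
   by (rule mult_left_mono)
  moreover have "\<bar>f v\<bar> * exp (- c * (norm v)^2) \<le> K * exp (a * norm v) * exp (- c * (norm v)^2)" by (intro mult_right_mono K) simp
  ultimately show ?thesis unfolding abs_mult abs_exp_cancel mult.assoc by (rule order_trans[rotated])
 qed
 show ?thesis
 proof (rule Bochner_Integration.integrable_bound)
  show "integrable lborel (\<lambda>v :: real^'m. (K * exp (a^2 / (2 * c))) * exp (- (c / 2) * (norm v)^2))"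
   using c by (intro integrable_mult_right integrable_gaussian) simp
  show "AE v in lborel. norm (f v * exp (- c * (norm v)^2)) \<le> norm ((K * exp (a^2 / (2 * c))) * exp (- (c / 2) * (norm v)^2))"
   unfolding real_norm_def by (intro AE_I2 order_trans[OF b abs_ge_self])
 qed (use m in simp)
qed

lemma growth_gauss_integrable:
 assumes "exp_growth f" shows "integrable lborel (\<lambda>v. f v * gauss v)"
 using integrable_mult_right[OF growth_integrable[OF assms, of "1 / 2"], of "gauss 0"]
 by (subst gauss_eq) (simp add: mult_ac)

lemma has_derivative_quadratic_remainder:
 fixes F :: "'a::real_normed_vector => real"
 assumes "bounded_linear D" "0 < r" and le: "!!y. norm (y - x) \<le> r ==> \<bar>F y - F x - D (y - x)\<bar> \<le> C * (norm (y - x))^2"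
 shows "(F has_derivative D) (at x)"
proof (rule has_derivativeI_sandwich[where e = r and H = "\<lambda>y. C * norm (y - x)"])
 show "norm (F y - F x - D (y - x)) / norm (y - x) \<le> C * norm (y - x)" if "y \<in> UNIV" "y \<noteq> x" "dist y x < r" for y
  using le[of y] that by (simp add: dist_norm pos_divide_le_eq power2_eq_square mult.assoc)
 have "((\<lambda>y. C * norm (y - x)) \<longlongrightarrow> C * norm (x - x)) (at x)" by (intro tendsto_intros)
 thus "((\<lambda>y. C * norm (y - x)) \<longlongrightarrow> 0) (at x)" by simp
qed (use assms in auto)

lemma exp_second_order: "\<bar>exp b - exp a - (b - a) * exp a\<bar> \<le> (b - a)^2 * max (exp a) (exp b)" for a b :: real
proof -
 have "exp b * (1 + (a - b)) \<le> exp b * exp (a - b)" "exp a * (1 + (b - a)) \<le> exp a * exp (b - a)"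
  by (intro mult_left_mono exp_ge_add_one_self; simp)+
 hence *: "exp b - exp a \<le> exp b * (b - a)" "exp a - exp b \<le> exp a * (a - b)" by (auto simp: exp_diff algebra_simps)
 hence "\<bar>exp b - exp a\<bar> \<le> max (exp a) (exp b) * \<bar>b - a\<bar>"
  by (cases "a \<le> b") (auto simp: max_def abs_if)
 hence "\<bar>b - a\<bar> * \<bar>exp b - exp a\<bar> \<le> \<bar>b - a\<bar> * (max (exp a) (exp b) * \<bar>b - a\<bar>)" by (intro mult_left_mono) auto
 hence "\<bar>(b - a) * (exp b - exp a)\<bar> \<le> (b - a)^2 * max (exp a) (exp b)"
  by (simp add: abs_mult power2_eq_square mult_ac abs_mult_self_eq)
 thus ?thesis using * by (simp add: abs_le_iff algebra_simps)
qed

section \<open>Smoothness of Gaussian averages through the Laplace transform\<close>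

definition laplace :: "(real^'m => real) => real^'m => real" where
 "laplace f x = (\<integral>v. f v * exp (v \<bullet> x) * gauss v \<partial>lborel)"

definition laplace_grad :: "(real^'m => real) => real^'m => real^'m" where
 "laplace_grad f x = (\<chi> i. laplace (\<lambda>v. v $ i * f v) x)"

lemma laplace_integrable: "exp_growth f ==> integrable lborel (\<lambda>v. f v * exp (v \<bullet> x) * gauss v)"
 by (intro growth_gauss_integrable exp_growth_mult exp_growth_basic)

lemma laplace_grad_inner:
 assumes f: "exp_growth f"
 shows "integrable lborel (\<lambda>v. f v * (v \<bullet> h) * exp (v \<bullet> x) * gauss v)"
  "laplace_grad f x \<bullet> h = (\<integral>v. f v * (v \<bullet> h) * exp (v \<bullet> x) * gauss v \<partial>lborel)"
proof -
 have i: "integrable lborel (\<lambda>v. v $ i * f v * exp (v \<bullet> x) * gauss v)" for i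
  by (intro laplace_integrable exp_growth_mult exp_growth_basic f)
 have e: "f v * (v \<bullet> h) * exp (v \<bullet> x) * gauss v = (\<Sum>i\<in>UNIV. v $ i * f v * exp (v \<bullet> x) * gauss v * h $ i)" for v
  by (simp add: inner_vec_def sum_distrib_left sum_distrib_right mult_ac)
 show "integrable lborel (\<lambda>v. f v * (v \<bullet> h) * exp (v \<bullet> x) * gauss v)"
  unfolding e using i by (intro Bochner_Integration.integrable_sum integrable_mult_left)
 show "laplace_grad f x \<bullet> h = (\<integral>v. f v * (v \<bullet> h) * exp (v \<bullet> x) * gauss v \<partial>lborel)"
  unfolding e using i by (subst Bochner_Integration.integral_sum) (auto simp: inner_vec_def laplace_grad_def laplace_def)
qed

lemma laplace_derivative:
 assumes f: "exp_growth f"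
 shows "(laplace f has_derivative (\<lambda>h. laplace_grad f x \<bullet> h)) (at x)"
proof (rule has_derivative_quadratic_remainder[where r = 1
   and C = "\<integral>v. \<bar>f v\<bar> * (norm v * norm v) * exp ((norm x + 1) * norm v) * gauss v \<partial>lborel"])
 fix y assume y: "norm (y - x) \<le> 1"
 let ?k = "\<lambda>v. \<bar>f v\<bar> * (norm v * norm v) * exp ((norm x + 1) * norm v) * gauss v"
 have g: "integrable lborel ?k"
  by (intro growth_gauss_integrable exp_growth_mult exp_growth_basic exp_growth_abs f)
 let ?d = "\<lambda>v. f v * exp (v \<bullet> y) * gauss v - f v * exp (v \<bullet> x) * gauss v - f v * (v \<bullet> (y - x)) * exp (v \<bullet> x) * gauss v"
 have i: "integrable lborel ?d"
  by (intro Bochner_Integration.integrable_diff laplace_integrable laplace_grad_inner f)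
 have e: "laplace f y - laplace f x - laplace_grad f x \<bullet> (y - x) = (\<integral>v. ?d v \<partial>lborel)"
  unfolding laplace_grad_inner(2)[OF f] laplace_def using laplace_integrable[OF f] laplace_grad_inner(1)[OF f]
  by (simp add: Bochner_Integration.integral_diff)
 have "\<bar>\<integral>v. ?d v \<partial>lborel\<bar> \<le> (\<integral>v. ?k v * (norm (y - x))^2 \<partial>lborel)"
 proof (rule order_trans[OF integral_abs_bound integral_mono])
  fix v
  have n: "norm y \<le> norm x + 1" using norm_triangle_ineq2[of y x] y by linarith
  have "v \<bullet> x \<le> (norm x + 1) * norm v" "v \<bullet> y \<le> (norm x + 1) * norm v"
   using norm_cauchy_schwarz[of v x] norm_cauchy_schwarz[of v y] mult_right_mono[OF n, of "norm v"] norm_ge_zero[of v]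
   unfolding distrib_right mult.commute[of "norm v"] by linarith+
  hence "max (exp (v \<bullet> x)) (exp (v \<bullet> y)) \<le> exp ((norm x + 1) * norm v)" by simp
  moreover have "(v \<bullet> y - v \<bullet> x)^2 \<le> (norm v * norm (y - x))^2"
   unfolding inner_diff_right[symmetric] by (rule power2_le_iff_abs_le[THEN iffD2]) (auto intro: Cauchy_Schwarz_ineq2)
  ultimately have "(v \<bullet> y - v \<bullet> x)^2 * max (exp (v \<bullet> x)) (exp (v \<bullet> y)) \<le> (norm v * norm (y - x))^2 * exp ((norm x + 1) * norm v)"
   by (intro mult_mono) (auto simp: max_def)
  from order_trans[OF exp_second_order this]
  have "(\<bar>f v\<bar> * gauss v) * \<bar>exp (v \<bullet> y) - exp (v \<bullet> x) - (v \<bullet> y - v \<bullet> x) * exp (v \<bullet> x)\<bar>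
   \<le> (\<bar>f v\<bar> * gauss v) * ((norm v * norm (y - x))^2 * exp ((norm x + 1) * norm v))"
   by (rule mult_left_mono) (rule mult_nonneg_nonneg[OF abs_ge_zero less_imp_le[OF gauss_pos]])
  also have "(\<bar>f v\<bar> * gauss v) * \<bar>exp (v \<bullet> y) - exp (v \<bullet> x) - (v \<bullet> y - v \<bullet> x) * exp (v \<bullet> x)\<bar> = \<bar>?d v\<bar>"
  proof -
   have "?d v = (f v * gauss v) * (exp (v \<bullet> y) - exp (v \<bullet> x) - (v \<bullet> y - v \<bullet> x) * exp (v \<bullet> x))"
    by (simp add: inner_diff_right algebra_simps)
   thus ?thesis using gauss_pos[of v] by (simp add: abs_mult)
  qed
  finally show "\<bar>?d v\<bar> \<le> ?k v * (norm (y - x))^2" by (simp add: power_mult_distrib power2_eq_square mult_ac)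
 qed (rule integrable_abs[OF i] integrable_mult_left[OF g])+
 thus "\<bar>laplace f y - laplace f x - laplace_grad f x \<bullet> (y - x)\<bar> \<le> (\<integral>v. ?k v \<partial>lborel) * (norm (y - x))^2"
  unfolding e integral_mult_left_zero .
qed (rule bounded_linear_inner_right, simp)

lemma laplace_continuous: "exp_growth f ==> continuous_on UNIV (laplace f)"
 using laplace_derivative by (meson differentiable_imp_continuous_on differentiable_on_def differentiable_def has_derivative_at_withinI)

lemma laplace_grad_continuous: "exp_growth f ==> continuous_on UNIV (laplace_grad f)"
 unfolding laplace_grad_def by (intro continuous_intros laplace_continuous exp_growth_mult exp_growth_basic)

lemma trace_scaleR: "trace (c *\<^sub>R (A :: real^'m^'m)) = c * trace A"
 by (simp add: trace_def sum_distrib_left)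

lemma is_test_functionI:
 assumes "!!x t. (x, t) \<in> N ==> ((\<lambda>s. ph (x, s)) has_real_derivative pht (x, t)) (at t)"
  "!!x t. (x, t) \<in> N ==> ((\<lambda>y. ph (y, t)) has_derivative (\<lambda>h. g (x, t) \<bullet> h)) (at x)"
  "!!x t. (x, t) \<in> N ==> ((\<lambda>y. g (y, t)) has_derivative (\<lambda>h. H (x, t) *v h)) (at x)"
  "continuous_on N pht" "continuous_on N g" "continuous_on N H"
 shows "is_test_function N ph pht g H"
 using assms unfolding is_test_function_def by auto

locale homogeneous_lipschitz =
 fixes f :: "real^'m => real" and La :: real
 assumes lip: "!!x y. \<bar>f x - f y\<bar> \<le> La * norm (x - y)" and La: "0 < La"
  and hom: "!!c x. 0 \<le> c ==> f (c *\<^sub>R x) = c * f x"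
begin

lemma f_0: "f 0 = 0" using hom[of 0 0] by simp

lemma f_bound: "\<bar>f x\<bar> \<le> La * norm x" using lip[of x 0] f_0 by simp

lemma f_continuous: "continuous_on UNIV f"
proof -
 have "La-lipschitz_on UNIV f" using lip La by (intro lipschitz_onI) (auto simp: dist_norm)
 thus ?thesis by (rule lipschitz_on_continuous_on)
qed

lemma f_measurable [measurable]: "f \<in> borel_measurable borel"
 using f_continuous by (rule borel_measurable_continuous_onI)

lemma exp_growth_affine: "exp_growth (\<lambda>v. f (x + s *\<^sub>R v))"
proof (rule exp_growthI[where a = 1])
 fix v
 have "\<bar>f (x + s *\<^sub>R v)\<bar> \<le> La * (norm x + \<bar>s\<bar> * norm v)"
  using norm_triangle_ineq[of x "s *\<^sub>R v"] La by (intro order_trans[OF f_bound]) simp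
 also have "\<dots> \<le> La * (norm x * exp (norm v) + \<bar>s\<bar> * exp (norm v))"
  using La norm_le_exp[of v] by (intro mult_left_mono add_mono) (auto simp: mult_le_cancel_left1 not_less)
 finally show "\<bar>f (x + s *\<^sub>R v)\<bar> \<le> (La * (norm x + \<bar>s\<bar>)) * exp (1 * norm v)" by (simp add: algebra_simps)
qed simp

lemma growth: "exp_growth f" "exp_growth (\<lambda>v. v $ i * f v)" "exp_growth (\<lambda>v. v $ j * (v $ i * f v))"
 using exp_growth_affine[of 0 1] by (simp_all add: exp_growth_mult exp_growth_basic)

lemma affine_integrable: "integrable lborel (\<lambda>v. f (x + s *\<^sub>R v) * gauss v)"
 by (rule growth_gauss_integrable[OF exp_growth_affine])

lemma shift_integrable: "integrable lborel (\<lambda>v. f (x + v) * gauss v)"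
 using affine_integrable[of x 1] by simp

definition avg :: "real^'m => real" where "avg x = (\<integral>v. f (x + v) * gauss v \<partial>lborel)"

text \<open>The product rule applied to \<open>exp (- (x \<bullet> x) / 2) * laplace f x\<close>;
  the rows of \<open>avg_hess\<close> arise from differentiating the components once more.\<close>

definition avg_grad :: "real^'m => real^'m" where
 "avg_grad x = exp (- (x \<bullet> x) / 2) *\<^sub>R (laplace_grad f x - laplace f x *\<^sub>R x)"

definition avg_hess :: "real^'m => real^'m^'m" where
 "avg_hess x = (\<chi> i. exp (- (x \<bullet> x) / 2) *\<^sub>R (laplace_grad (\<lambda>v. v $ i * f v) x - x $ i *\<^sub>R laplace_grad f x
  - laplace f x *\<^sub>R axis i 1 - (laplace_grad f x $ i - laplace f x * x $ i) *\<^sub>R x))"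

lemma avg_laplace: "avg x = exp (- (x \<bullet> x) / 2) * laplace f x"
proof -
 have e: "f v * gauss (v - x) = exp (- (x \<bullet> x) / 2) * (f v * exp (v \<bullet> x) * gauss v)" for v
  unfolding gauss_shift by (simp only: mult_ac)
 have "(\<lambda>v. f v * gauss (v - x)) \<in> borel_measurable borel"
  using borel_measurable_integrable[OF integrable_mult_right[OF laplace_integrable[OF growth(1), of x], of "exp (- (x \<bullet> x) / 2)"]] unfolding e by simp
 from integral_affine[OF this, of 1 x]
 have "avg x = (\<integral>v. f v * gauss (v - x) \<partial>lborel)" by (simp add: avg_def)
 thus ?thesis unfolding e by (simp add: laplace_def)
qed

lemma avg_derivative: "(avg has_derivative (\<lambda>h. avg_grad x \<bullet> h)) (at x)"
proof -
 have "((\<lambda>x. exp (- (x \<bullet> x) / 2) * laplace f x) has_derivative (\<lambda>h. exp (- (x \<bullet> x) / 2) * (laplace_grad f x \<bullet> h)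
   + exp (- (x \<bullet> x) / 2) * - (x \<bullet> h) * laplace f x)) (at x)"
  by (auto intro!: derivative_eq_intros laplace_derivative growth simp: inner_commute)
 thus ?thesis unfolding avg_laplace[abs_def]
  by (rule has_derivative_eq_rhs) (simp add: fun_eq_iff avg_grad_def inner_diff_left right_diff_distrib mult_ac)
qed

lemma avg_grad_derivative: "(avg_grad has_derivative (\<lambda>h. avg_hess x *v h)) (at x)"
proof (subst has_derivative_componentwise_within, rule ballI)
 fix b :: "real^'m" assume "b \<in> Basis"
 then obtain i where b: "b = axis i 1" by (auto simp: Basis_vec_def)
 have c: "avg_grad y \<bullet> b = exp (- (y \<bullet> y) / 2) * (laplace (\<lambda>v. v $ i * f v) y - laplace f y * (y \<bullet> b))" for y
  by (simp add: b avg_grad_def laplace_grad_def inner_axis)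
 have "((\<lambda>y. exp (- (y \<bullet> y) / 2) * (laplace (\<lambda>v. v $ i * f v) y - laplace f y * (y \<bullet> b))) has_derivative
  (\<lambda>h. exp (- (x \<bullet> x) / 2) * (laplace_grad (\<lambda>v. v $ i * f v) x \<bullet> h - (laplace f x * (h \<bullet> b) + (laplace_grad f x \<bullet> h) * (x \<bullet> b)))
   + exp (- (x \<bullet> x) / 2) * - (x \<bullet> h) * (laplace (\<lambda>v. v $ i * f v) x - laplace f x * (x \<bullet> b)))) (at x)"
  by (auto intro!: derivative_eq_intros laplace_derivative growth simp: inner_commute)
 thus "((\<lambda>x. avg_grad x \<bullet> b) has_derivative (\<lambda>h. (avg_hess x *v h) \<bullet> b)) (at x)"
  unfolding c by (rule has_derivative_eq_rhs)
   (simp add: fun_eq_iff b inner_axis inner_axis' avg_hess_def matrix_vector_mul_component inner_diff_left laplace_grad_def algebra_simps)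
qed

lemma avg_grad_continuous: "continuous_on UNIV avg_grad"
 using avg_grad_derivative by (meson differentiable_imp_continuous_on differentiable_on_def differentiable_def has_derivative_at_withinI)

lemma avg_hess_continuous: "continuous_on UNIV avg_hess"
 unfolding avg_hess_def by (intro continuous_intros laplace_continuous laplace_grad_continuous growth) auto

lemma avg_test_function: "is_test_function N (\<lambda>z. avg (fst z)) (\<lambda>_. 0) (\<lambda>z. avg_grad (fst z)) (\<lambda>z. avg_hess (fst z))"
 unfolding is_test_function_def
 by (auto intro!: avg_derivative avg_grad_derivative continuous_intros
   continuous_on_compose2[OF avg_grad_continuous] continuous_on_compose2[OF avg_hess_continuous])

lemma avg_hess_symmetric: "transpose (avg_hess x) = avg_hess x"
 using test_function_hessian_symmetric[OF avg_test_function[of UNIV], of x 0] by simp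

lemma avg_taylor:
 assumes "0 < eps" "0 < R"
 obtains dl where "0 < dl" "!!a r. norm a \<le> R ==> 0 < r ==> r < dl ==>
  \<bar>avg (x + r *\<^sub>R a) - avg x - r * (avg_grad x \<bullet> a) - r^2 * (quad (avg_hess x) a / 2)\<bar> \<le> eps * r^2"
proof -
 obtain dl where dl: "0 < dl" "!!y t a h. dist (y :: real^'m, t) (x, 0) < dl ==> norm a \<le> R ==> 0 < h ==> h < dl ==>
  \<bar>avg (fst (y + sqrt h *\<^sub>R a, t + h)) - avg (fst (y, t)) - sqrt h * (avg_grad (fst (y, t)) \<bullet> a) - h * (0 + quad (avg_hess (fst (x, 0 :: real))) a / 2)\<bar> \<le> eps * h"
  using test_function_taylor[OF avg_test_function[of UNIV] open_UNIV UNIV_I assms, of "(x, 0)"] by metis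
 show thesis
 proof (rule that[of "sqrt dl"])
  fix a :: "real^'m" and r :: real assume a: "norm a \<le> R" "0 < r" "r < sqrt dl"
  hence "r^2 < dl" using dl(1) real_less_rsqrt[of r] by (metis less_imp_le power_strict_mono real_sqrt_pow2 zero_less_numeral)
  thus "\<bar>avg (x + r *\<^sub>R a) - avg x - r * (avg_grad x \<bullet> a) - r^2 * (quad (avg_hess x) a / 2)\<bar> \<le> eps * r^2"
   using dl(2)[of x 0 a "r^2"] a dl(1) by simp
 qed (use dl in simp)
qed

text \<open>Since \<open>f\<close> is homogeneous, the integral of \<open>f v * exp (s * (v \<bullet> x) - s\<^sup>2 * |v|\<^sup>2 / 2)\<close> is a multiple
 of \<open>1 / s ^ (m + 1)\<close>. Differentiating at \<open>s = 1\<close> gives the heat equation in self-similar form.\<close>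

lemma dilation_estimate:
 fixes v x :: "real^'m"
 assumes mu: "\<bar>mu\<bar> \<le> 1 / 2"
 defines "p \<equiv> (\<lambda>s. s * (v \<bullet> x) - s^2 * (norm v)^2 / 2)"
 shows "\<bar>exp (p (1 + mu)) - exp (p 1) - mu * ((v \<bullet> x - (norm v)^2) * exp (p 1))\<bar>
  \<le> 2 * (norm x + 2)^2 * (exp ((4 + 2 * norm x) * norm v) * exp (- (1 / 8) * (norm v)^2)) * mu^2"
proof -
 define n D M where "n = norm v" and "D = (norm x + 2) * exp (2 * n)" and "M = exp (2 * norm x * n) * exp (- (1 / 8) * n^2)"
 have n: "n \<ge> 0" by (simp add: n_def)
 have vx: "\<bar>v \<bullet> x\<bar> \<le> norm x * n" unfolding n_def using Cauchy_Schwarz_ineq2[of v x] by (simp add: mult.commute)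
 have p: "p (1 + mu) - p 1 = mu * (v \<bullet> x - n^2) - mu^2 * n^2 / 2"
  unfolding p_def n_def by (simp add: power2_eq_square algebra_simps add_divide_distrib)
 have m2: "mu^2 \<le> \<bar>mu\<bar>" using mult_left_mono[OF mu, of "\<bar>mu\<bar>"] abs_mult_self_eq[of mu] by (simp add: power2_eq_square)
 have "(1 + n)^2 \<le> (exp n)^2" using n exp_ge_add_one_self[of n] by (intro power_mono) auto
 hence e: "n + n^2 \<le> exp (2 * n)" using n by (simp add: power2_eq_square exp_double[symmetric] algebra_simps mult_exp_exp)
 have "n \<le> exp (2 * n)" using e zero_le_power2[of n] by linarith
 also have "\<dots> \<le> D" unfolding D_def by (simp add: distrib_right add_increasing)
 finally have nD: "n \<le> D" .
 have "\<bar>p (1 + mu) - p 1\<bar> \<le> \<bar>mu\<bar> * (norm x * n + n^2) + \<bar>mu\<bar> * n^2 / 2"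
 proof -
  have "\<bar>v \<bullet> x - n^2\<bar> \<le> norm x * n + n^2" using vx zero_le_power2[of n] by linarith
  hence "\<bar>mu * (v \<bullet> x - n^2)\<bar> \<le> \<bar>mu\<bar> * (norm x * n + n^2)" unfolding abs_mult by (rule mult_left_mono) simp
  moreover have "\<bar>mu^2 * n^2 / 2\<bar> \<le> \<bar>mu\<bar> * n^2 / 2" using mult_right_mono[OF m2, of "n^2"] by simp
  ultimately show ?thesis unfolding p by linarith
 qed
 also have "\<dots> \<le> \<bar>mu\<bar> * ((norm x + 2) * (n + n^2))"
  unfolding distrib_left[symmetric] times_divide_eq_right[symmetric] using n by (intro mult_left_mono) (auto simp: algebra_simps)
 also have "\<dots> \<le> \<bar>mu\<bar> * D" unfolding D_def by (intro mult_left_mono e) auto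
 finally have bd: "\<bar>p (1 + mu) - p 1\<bar> \<le> \<bar>mu\<bar> * D" .
 \<comment> \<open>For \<open>s\<close> between \<open>1 / 2\<close> and \<open>2\<close> the
   Gaussian exponent keeps the factor \<open>1 / 8\<close>, which gives an integrable bound uniform
   in \<open>s\<close>.\<close>
 have "exp (p s) \<le> M" if s: "1 / 2 \<le> s" "s \<le> 2" for s
 proof -
  have "s * (v \<bullet> x) \<le> \<bar>s\<bar> * \<bar>v \<bullet> x\<bar>" unfolding abs_mult[symmetric] by (rule abs_ge_self)
  also have "\<dots> \<le> 2 * (norm x * n)" using vx s by (intro mult_mono) auto
  finally have "s * (v \<bullet> x) \<le> 2 * norm x * n" by simp
  moreover have "(1 / 2)^2 * n^2 \<le> s^2 * n^2" using s by (intro mult_right_mono power_mono) auto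
  ultimately show ?thesis unfolding M_def exp_add[symmetric] p_def n_def by (simp add: power2_eq_square)
 qed
 hence mx: "max (exp (p 1)) (exp (p (1 + mu))) \<le> M" "exp (p 1) \<le> M" using mu by (auto simp: abs_le_iff)
 have "\<bar>exp (p (1 + mu)) - exp (p 1) - mu * ((v \<bullet> x - (norm v)^2) * exp (p 1))\<bar>
   = \<bar>(exp (p (1 + mu)) - exp (p 1) - (p (1 + mu) - p 1) * exp (p 1)) - mu^2 * (n^2 / 2) * exp (p 1)\<bar>"
  unfolding p by (simp add: n_def algebra_simps)
 also have "\<dots> \<le> mu^2 * D^2 * M + mu^2 * D^2 * M"
 proof (rule order_trans[OF abs_triangle_ineq4 add_mono])
  have "(p (1 + mu) - p 1)^2 \<le> (\<bar>mu\<bar> * D)^2" using power_mono[OF bd abs_ge_zero, of 2] by simp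
  hence "(p (1 + mu) - p 1)^2 * max (exp (p 1)) (exp (p (1 + mu))) \<le> (\<bar>mu\<bar> * D)^2 * M"
   using mx(1) by (intro mult_mono) (auto simp: max_def)
  from order_trans[OF exp_second_order this]
  show "\<bar>exp (p (1 + mu)) - exp (p 1) - (p (1 + mu) - p 1) * exp (p 1)\<bar> \<le> mu^2 * D^2 * M" by (simp add: power_mult_distrib)
  have "n^2 \<le> D^2" using nD n by (intro power_mono) auto
  hence "n^2 / 2 \<le> D^2" using zero_le_power2[of n] by linarith
  hence "mu^2 * (n^2 / 2) * exp (p 1) \<le> mu^2 * D^2 * M" using mx(2) by (intro mult_mono mult_left_mono) auto
  thus "\<bar>mu^2 * (n^2 / 2) * exp (p 1)\<bar> \<le> mu^2 * D^2 * M" by simp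
 qed
 also have "\<dots> = 2 * (norm x + 2)^2 * (exp ((4 + 2 * norm x) * norm v) * exp (- (1 / 8) * (norm v)^2)) * mu^2"
 proof -
  have "D^2 * M = (norm x + 2)^2 * (exp ((4 + 2 * norm x) * n) * exp (- (1 / 8) * n^2))"
   unfolding D_def M_def by (simp add: power2_eq_square exp_add[symmetric] algebra_simps)
  thus ?thesis unfolding n_def by (simp add: mult_ac)
 qed
 finally show ?thesis .
qed

lemma laplace_dilation:
 "(\<integral>v. f v * (v \<bullet> x - (norm v)^2) * exp (v \<bullet> x) * gauss v \<partial>lborel) = - (real CARD('m) + 1) * laplace f x"
proof -
 define c where "c = gauss (0 :: real^'m)"
 define p where "p s v = s * (v \<bullet> x) - s^2 * (norm v)^2 / 2" for s :: real and v :: "real^'m"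
 define J where "J s = (\<integral>v. f v * exp (p s v) \<partial>lborel)" for s
 have p1: "exp (v \<bullet> x) * gauss v = c * exp (p 1 v)" for v
  unfolding gauss_eq[of v] p_def c_def by (simp add: exp_add[symmetric])
 have c: "c > 0" unfolding c_def by (rule gauss_pos)
 let ?q = "\<lambda>v. v \<bullet> x - (norm v)^2"
 define D where "D = (\<integral>v. f v * (?q v * exp (p 1 v)) \<partial>lborel)"
 have pi: "integrable lborel (\<lambda>v. f v * exp (p s v))" if "0 < s" for s
 proof -
  have "f v * exp (p s v) = (f v * exp (v \<bullet> (s *\<^sub>R x))) * exp (- (s^2 / 2) * (norm v)^2)" for v
   by (simp add: p_def mult.assoc exp_add[symmetric])
  thus ?thesis using that by (simp only:) (intro growth_integrable exp_growth_mult exp_growth_basic growth; simp)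
 qed
 have p2: "a * exp (v \<bullet> x) * gauss v = a * (c * exp (p 1 v))" for v a by (simp only: mult.assoc p1)
 have "f v * (?q v * exp (p 1 v)) = (f v * (v \<bullet> x) * exp (v \<bullet> x) * gauss v - (f v * (norm v * norm v)) * exp (v \<bullet> x) * gauss v) / c" for v
  unfolding p2 using c by (simp add: power2_eq_square field_simps)
 hence Di: "integrable lborel (\<lambda>v. f v * (?q v * exp (p 1 v)))"
  by (simp only:) (intro integrable_divide Bochner_Integration.integrable_diff laplace_integrable laplace_grad_inner exp_growth_mult exp_growth_basic growth)
 let ?k = "\<lambda>v. \<bar>f v\<bar> * exp ((4 + 2 * norm x) * norm v) * exp (- (1 / 8) * (norm v)^2)"
 have ki: "integrable lborel ?k"
  by (intro growth_integrable exp_growth_mult exp_growth_basic exp_growth_abs growth) simp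
 define C where "C = 2 * (norm x + 2)^2 * (\<integral>v. ?k v \<partial>lborel)"
 have "(J has_field_derivative D) (at 1)"
  unfolding has_field_derivative_def
 proof (rule has_derivative_quadratic_remainder[where r = "1 / 2" and C = C])
  fix s :: real assume s: "norm (s - 1) \<le> 1 / 2"
  hence s0: "0 < s" unfolding real_norm_def by linarith
  let ?d = "\<lambda>v. f v * exp (p s v) - f v * exp (p 1 v) - (s - 1) * (f v * (?q v * exp (p 1 v)))"
  have "\<bar>\<integral>v. ?d v \<partial>lborel\<bar> \<le> (\<integral>v. 2 * (norm x + 2)^2 * ?k v * (s - 1)^2 \<partial>lborel)"
  proof (rule order_trans[OF integral_abs_bound integral_mono])
   fix v
   have "?d v = f v * (exp (p s v) - exp (p 1 v) - (s - 1) * (?q v * exp (p 1 v)))" by (simp add: algebra_simps)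
   hence "\<bar>?d v\<bar> = \<bar>f v\<bar> * \<bar>exp (p s v) - exp (p 1 v) - (s - 1) * (?q v * exp (p 1 v))\<bar>" by (simp only: abs_mult)
   also have "\<dots> \<le> \<bar>f v\<bar> * (2 * (norm x + 2)^2 * (exp ((4 + 2 * norm x) * norm v) * exp (- (1 / 8) * (norm v)^2)) * (s - 1)^2)"
    using dilation_estimate[of "s - 1" v x] s by (intro mult_left_mono) (simp_all add: p_def)
   finally show "\<bar>?d v\<bar> \<le> 2 * (norm x + 2)^2 * ?k v * (s - 1)^2" by (simp add: mult_ac)
  qed (intro integrable_abs integrable_mult_left integrable_mult_right Bochner_Integration.integrable_diff pi ki Di s0 zero_less_one)+
  also have "(\<integral>v. 2 * (norm x + 2)^2 * ?k v * (s - 1)^2 \<partial>lborel) = C * (norm (s - 1))^2"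
   unfolding integral_mult_left_zero integral_mult_right_zero C_def by simp
  also have "(\<integral>v. ?d v \<partial>lborel) = J s - J 1 - D * (s - 1)"
   unfolding J_def D_def using pi[OF s0] pi[OF zero_less_one] Di by (simp add: Bochner_Integration.integral_diff)
  finally show "\<bar>J s - J 1 - D * (s - 1)\<bar> \<le> C * (norm (s - 1))^2" .
 qed (auto intro: bounded_linear_mult_right)
 \<comment> \<open>The same derivative computed by scaling: substituting
   \<open>s *\<^sub>R v\<close> for \<open>v\<close> yields \<open>CARD('m)\<close> powers of
   \<open>s\<close> from the volume and one more from the homogeneity of \<open>f\<close>.\<close>
 moreover have "(J has_field_derivative - (real CARD('m) + 1) * J 1) (at 1)"
 proof (rule DERIV_cong_ev[THEN iffD1, OF refl _ refl])
  have Js: "J 1 * (1 / s) ^ (CARD('m) + 1) = J s" if "0 < s" for s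
  proof -
   have "(\<lambda>v. f v * exp (p 1 v)) \<in> borel_measurable borel" using pi[of 1] by (simp add: integrable_iff_bounded)
   from integral_affine[OF this, of s 0]
   have "J 1 = s ^ CARD('m) * (\<integral>v. s * (f v * exp (p s v)) \<partial>lborel)"
    using that by (simp add: J_def p_def hom power_mult_distrib mult.assoc)
   hence "J 1 = s ^ CARD('m) * (s * J s)" by (simp add: J_def)
   thus ?thesis using that by (simp add: power_divide)
  qed
  have "eventually (\<lambda>s. s \<in> {0<..}) (nhds (1::real))" by (rule eventually_nhds_in_open) auto
  thus "eventually (\<lambda>s. J 1 * (1 / s) ^ (CARD('m) + 1) = J s) (nhds 1)" by (rule eventually_mono) (rule Js, simp)
  show "((\<lambda>s. J 1 * (1 / s) ^ (CARD('m) + 1)) has_field_derivative - (real CARD('m) + 1) * J 1) (at 1)"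
   by (auto intro!: derivative_eq_intros simp: algebra_simps)
 qed
 ultimately have D: "D = - (real CARD('m) + 1) * J 1" by (rule DERIV_unique)
 have "f v * ?q v * exp (v \<bullet> x) * gauss v = c * (f v * (?q v * exp (p 1 v)))" for v unfolding p2 by simp
 moreover have "laplace f x = c * J 1" unfolding laplace_def J_def p2 by (simp add: mult.left_commute[of _ c])
 ultimately show ?thesis using D by (simp only: D_def[symmetric] integral_mult_right_zero) simp
qed

text \<open>For \<open>s = sqrt (- (2 * th * t))\<close> this identity says exactly that
  \<open>s * avg ((1 / s) *\<^sub>R x)\<close> solves the backward heat equation with diffusivity
  \<open>th\<close>.\<close>

lemma avg_heat: "avg x = trace (avg_hess x) + x \<bullet> avg_grad x"
proof -
 define T where "T = (\<Sum>i\<in>UNIV. laplace (\<lambda>v. v $ i * (v $ i * f v)) x)"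
 have i: "integrable lborel (\<lambda>v. v $ i * (v $ i * f v) * exp (v \<bullet> x) * gauss v)" for i by (intro laplace_integrable growth)
 have "T = (\<integral>v. f v * (norm v)^2 * exp (v \<bullet> x) * gauss v \<partial>lborel)"
  and Ti: "integrable lborel (\<lambda>v. f v * (norm v)^2 * exp (v \<bullet> x) * gauss v)"
 proof -
  have e: "f v * (norm v)^2 * exp (v \<bullet> x) * gauss v = (\<Sum>i\<in>UNIV. v $ i * (v $ i * f v) * exp (v \<bullet> x) * gauss v)" for v
   unfolding power2_norm_eq_inner inner_vec_def by (simp add: sum_distrib_left sum_distrib_right mult_ac)
  show "T = (\<integral>v. f v * (norm v)^2 * exp (v \<bullet> x) * gauss v \<partial>lborel)"
   unfolding T_def laplace_def e using i by (subst Bochner_Integration.integral_sum) auto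
  show "integrable lborel (\<lambda>v. f v * (norm v)^2 * exp (v \<bullet> x) * gauss v)"
   unfolding e using i by (intro Bochner_Integration.integrable_sum)
 qed
 moreover have "f v * (v \<bullet> x - (norm v)^2) * exp (v \<bullet> x) * gauss v
   = f v * (v \<bullet> x) * exp (v \<bullet> x) * gauss v - f v * (norm v)^2 * exp (v \<bullet> x) * gauss v" for v by (simp add: algebra_simps)
 ultimately have d: "laplace_grad f x \<bullet> x - T = - (real CARD('m) + 1) * laplace f x"
  using laplace_dilation[of x] laplace_grad_inner[OF growth(1)] by (simp add: Bochner_Integration.integral_diff)
 have "avg_hess x $ i $ i = exp (- (x \<bullet> x) / 2) * (laplace (\<lambda>v. v $ i * (v $ i * f v)) x - x $ i * laplace_grad f x $ i - laplace f x
   - (laplace_grad f x $ i * x $ i - laplace f x * (x $ i * x $ i)))" for i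
  by (simp add: avg_hess_def laplace_grad_def left_diff_distrib)
 hence "trace (avg_hess x) = exp (- (x \<bullet> x) / 2) * (\<Sum>i\<in>UNIV. laplace (\<lambda>v. v $ i * (v $ i * f v)) x - x $ i * laplace_grad f x $ i - laplace f x
   - (laplace_grad f x $ i * x $ i - laplace f x * (x $ i * x $ i)))"
  by (simp add: trace_def sum_distrib_left)
 also have "\<dots> = exp (- (x \<bullet> x) / 2) * (T - x \<bullet> laplace_grad f x - CARD('m) * laplace f x - (laplace_grad f x \<bullet> x - laplace f x * (x \<bullet> x)))"
  by (simp only: sum_subtractf T_def inner_vec_def inner_real_def sum_distrib_left sum_constant)
 finally have "trace (avg_hess x) + x \<bullet> avg_grad x = exp (- (x \<bullet> x) / 2) * (T - laplace_grad f x \<bullet> x - CARD('m) * laplace f x)"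
  by (simp add: avg_grad_def inner_diff_right inner_commute algebra_simps)
 moreover have "T - laplace_grad f x \<bullet> x - CARD('m) * laplace f x = laplace f x" using d by (simp add: algebra_simps)
 ultimately show ?thesis by (simp add: avg_laplace)
qed

text \<open>The backward heat flow with value \<open>f\<close> at \<open>t = 0\<close>: at
  \<open>t < 0\<close> the Gaussian has variance \<open>- (2 * th * t)\<close> in each
  coordinate.\<close>

definition heat :: "real => (real^'m) \<times> real => real" where
 "heat th = (\<lambda>(x, t). \<integral>v. f (x + sqrt (- (2 * th * t)) *\<^sub>R v) * gauss v \<partial>lborel)"

lemma heat_avg:
 assumes "0 < s" "s = sqrt (- (2 * th * t))"
 shows "heat th (x, t) = s * avg ((1 / s) *\<^sub>R x)"
proof -
 have "f (x + s *\<^sub>R v) = s * f ((1 / s) *\<^sub>R x + v)" for v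
  using hom[of s "(1 / s) *\<^sub>R x + v"] assms(1) by (simp add: scaleR_right_distrib)
 thus ?thesis unfolding heat_def prod.case assms(2)[symmetric] avg_def by (simp add: mult.assoc)
qed

lemma heat_test_function:
 assumes th: "0 < th"
 shows "is_test_function (UNIV \<times> {..<0}) (heat th)
  (\<lambda>(x, t). - (th / sqrt (- (2 * th * t))) * trace (avg_hess ((1 / sqrt (- (2 * th * t))) *\<^sub>R x)))
  (\<lambda>(x, t). avg_grad ((1 / sqrt (- (2 * th * t))) *\<^sub>R x))
  (\<lambda>(x, t). (1 / sqrt (- (2 * th * t))) *\<^sub>R avg_hess ((1 / sqrt (- (2 * th * t))) *\<^sub>R x))"
proof -
 have main: "((\<lambda>s. heat th (x, s)) has_real_derivative - (th / sqrt (- (2 * th * t))) * trace (avg_hess ((1 / sqrt (- (2 * th * t))) *\<^sub>R x))) (at t)"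
  "((\<lambda>y. heat th (y, t)) has_derivative (\<lambda>h. avg_grad ((1 / sqrt (- (2 * th * t))) *\<^sub>R x) \<bullet> h)) (at x)"
  "((\<lambda>y. avg_grad ((1 / sqrt (- (2 * th * t))) *\<^sub>R y)) has_derivative (\<lambda>h. (1 / sqrt (- (2 * th * t))) *\<^sub>R avg_hess ((1 / sqrt (- (2 * th * t))) *\<^sub>R x) *v h)) (at x)"
  if t: "t < 0" for x :: "real^'m" and t :: real
 proof -
 define S where "S t = sqrt (- (2 * th * t))" for t
 have pos: "0 < - (2 * th * t)" using th t by (simp add: mult_pos_neg)
 have S: "S t > 0" using pos by (simp add: S_def)
 have dS: "(S has_real_derivative - (th / S t)) (at t)"
  unfolding S_def using pos by (auto intro!: derivative_eq_intros simp: field_simps)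
 define y where "y = (1 / S t) *\<^sub>R x"
 have "((\<lambda>t. 1 / S t) has_real_derivative th / (S t)^3) (at t)"
  using S by (auto intro!: derivative_eq_intros dS simp: field_simps power3_eq_cube)
 hence "((\<lambda>t. (1 / S t) *\<^sub>R x) has_derivative (\<lambda>h. (th / (S t)^3 * h) *\<^sub>R x)) (at t)"
  unfolding has_field_derivative_def by (rule bounded_linear.has_derivative[OF bounded_linear_scaleR_left])
 from has_derivative_compose[OF this avg_derivative[of "(1 / S t) *\<^sub>R x"]]
 have da: "((\<lambda>t. avg ((1 / S t) *\<^sub>R x)) has_real_derivative th / (S t)^3 * (avg_grad y \<bullet> x)) (at t)"
  unfolding has_field_derivative_def by (rule has_derivative_eq_rhs) (simp add: y_def fun_eq_iff mult_ac)
 have "((\<lambda>t. S t * avg ((1 / S t) *\<^sub>R x)) has_real_derivative - (th / S t) * avg y + (th / (S t)^3 * (avg_grad y \<bullet> x)) * S t) (at t)"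
  unfolding y_def by (rule DERIV_mult[OF dS da[unfolded y_def]])
 moreover have "- (th / S t) * avg y + (th / (S t)^3 * (avg_grad y \<bullet> x)) * S t = - (th / S t) * trace (avg_hess y)"
 proof -
  have "x = S t *\<^sub>R y" using S by (simp add: y_def)
  hence "avg_grad y \<bullet> x = S t * (y \<bullet> avg_grad y)" by (simp add: inner_commute)
  thus ?thesis using S by (simp add: avg_heat[of y] field_simps power3_eq_cube)
 qed
 ultimately have D: "((\<lambda>t. S t * avg ((1 / S t) *\<^sub>R x)) has_real_derivative - (th / S t) * trace (avg_hess y)) (at t)" by simp
 have "eventually (\<lambda>s. s \<in> {..<0}) (nhds t)" using t by (intro eventually_nhds_in_open) auto
 hence "eventually (\<lambda>s. heat th (x, s) = S s * avg ((1 / S s) *\<^sub>R x)) (nhds t)"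
  by (rule eventually_mono) (use th in \<open>auto intro!: heat_avg simp: S_def mult_pos_neg\<close>)
 from DERIV_cong_ev[OF refl this refl, THEN iffD2, OF D]
 show "((\<lambda>s. heat th (x, s)) has_real_derivative - (th / sqrt (- (2 * th * t))) * trace (avg_hess ((1 / sqrt (- (2 * th * t))) *\<^sub>R x))) (at t)"
  unfolding y_def S_def .
 have h: "heat th (y, t) = S t * avg ((1 / S t) *\<^sub>R y)" for y by (rule heat_avg[OF S]) (simp add: S_def)
 have "((\<lambda>y. (1 / S t) *\<^sub>R y) has_derivative (\<lambda>h. (1 / S t) *\<^sub>R h)) (at x)" by (auto intro!: derivative_eq_intros)
 note c = has_derivative_compose[OF this avg_derivative] has_derivative_compose[OF this avg_grad_derivative]
 have "((\<lambda>y. S t * avg ((1 / S t) *\<^sub>R y)) has_derivative (\<lambda>h. S t * (avg_grad ((1 / S t) *\<^sub>R x) \<bullet> ((1 / S t) *\<^sub>R h)))) (at x)"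
  by (intro has_derivative_mult_right c)
 thus "((\<lambda>y. heat th (y, t)) has_derivative (\<lambda>h. avg_grad ((1 / sqrt (- (2 * th * t))) *\<^sub>R x) \<bullet> h)) (at x)"
  unfolding h S_def[symmetric] by (rule has_derivative_eq_rhs) (use S in \<open>simp add: fun_eq_iff\<close>)
 have "(1 / S t) *\<^sub>R avg_hess ((1 / S t) *\<^sub>R x) *v h = avg_hess ((1 / S t) *\<^sub>R x) *v ((1 / S t) *\<^sub>R h)" for h
  by (simp add: scaleR_matrix_vector_assoc[symmetric] matrix_vector_mult_scaleR)
 thus "((\<lambda>y. avg_grad ((1 / sqrt (- (2 * th * t))) *\<^sub>R y)) has_derivative (\<lambda>h. (1 / sqrt (- (2 * th * t))) *\<^sub>R avg_hess ((1 / sqrt (- (2 * th * t))) *\<^sub>R x) *v h)) (at x)"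
  unfolding S_def[symmetric] using c(2) by simp
 qed
 let ?S = "\<lambda>z :: (real^'m) \<times> real. sqrt (- (2 * th * snd z))"
 have nz: "?S z \<noteq> 0" if "z \<in> UNIV \<times> {..<0}" for z using that th by auto
 have cS: "continuous_on (UNIV \<times> {..<0}) (\<lambda>z. (1 / ?S z) *\<^sub>R fst z)"
  using nz by (intro continuous_intros) auto
 note cH = continuous_on_compose2[OF avg_hess_continuous cS subset_UNIV] and cG = continuous_on_compose2[OF avg_grad_continuous cS subset_UNIV]
 show ?thesis
 proof (rule is_test_functionI)
 show "continuous_on (UNIV \<times> {..<0}) (\<lambda>(x, t). - (th / sqrt (- (2 * th * t))) * trace (avg_hess ((1 / sqrt (- (2 * th * t))) *\<^sub>R x)))"
  unfolding case_prod_unfold trace_def using nz by (intro continuous_intros cH) auto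
 show "continuous_on (UNIV \<times> {..<0}) (\<lambda>(x, t). avg_grad ((1 / sqrt (- (2 * th * t))) *\<^sub>R x))"
  unfolding case_prod_unfold by (rule cG)
 show "continuous_on (UNIV \<times> {..<0}) (\<lambda>(x, t). (1 / sqrt (- (2 * th * t))) *\<^sub>R avg_hess ((1 / sqrt (- (2 * th * t))) *\<^sub>R x))"
  unfolding case_prod_unfold using nz by (intro continuous_intros cH) auto
 qed (use main in auto)
qed

end

lemma gauss_integral: "integrable lborel (gauss :: real^'m => real)" "(\<integral>v. gauss (v :: real^'m) \<partial>lborel) = 1"
proof -
 have B: "(Basis :: (real^'m) set) = range (\<lambda>i. axis i 1)" by (auto simp: Basis_vec_def)
 have inj: "inj (\<lambda>i :: 'm. axis i (1::real))" by (auto simp: inj_on_def axis_eq_axis)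
 have g: "ennreal (gauss v) = (\<Prod>b\<in>Basis. ennreal (std_normal_density (v \<bullet> b)))" for v :: "real^'m"
  unfolding B gauss_def by (simp add: prod.reindex[OF inj] inner_axis prod_ennreal)
 show i: "integrable lborel (gauss :: real^'m => real)"
  using growth_gauss_integrable[OF exp_growth_basic(3)[of 0]] by simp
 have "(\<integral>\<^sup>+x. ennreal (std_normal_density x) \<partial>lborel) = 1"
  using prob_space.emeasure_space_1[OF prob_space_normal_density[of 1 0]] by (simp add: emeasure_density)
 hence "(\<integral>\<^sup>+v. ennreal (gauss (v :: real^'m)) \<partial>lborel) = 1"
  unfolding g by (subst nn_integral_lborel_prod) auto
 thus "(\<integral>v. gauss (v :: real^'m) \<partial>lborel) = 1"
  using i by (subst integral_eq_nn_integral) (auto intro: less_imp_le[OF gauss_pos])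
qed

lemma norm_gauss_integrable: "integrable lborel (\<lambda>v :: real^'m. norm v * gauss v)"
 by (rule growth_gauss_integrable[OF exp_growth_basic(2)])

context homogeneous_lipschitz begin

lemma heat_0: "heat th (x, 0) = f x"
 by (simp add: heat_def gauss_integral)

lemma heat_center: "t \<le> 0 ==> heat th (0, t) = sqrt (- (2 * th * t)) * avg 0" if "0 < th"
proof -
 assume "t \<le> 0"
 hence "0 \<le> sqrt (- (2 * th * t))" using that by (simp add: mult_nonneg_nonpos)
 thus ?thesis unfolding heat_def avg_def by (simp add: hom mult.assoc)
qed

lemma heat_modulus:
 "\<bar>heat th (x, t) - heat th (y, s)\<bar> \<le> La * norm (x - y)
  + La * (\<integral>v. norm (v :: real^'m) * gauss v \<partial>lborel) * \<bar>sqrt (- (2 * th * t)) - sqrt (- (2 * th * s))\<bar>"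
proof -
 define a b where "a = sqrt (- (2 * th * t))" and "b = sqrt (- (2 * th * s))"
 let ?n = "\<lambda>v :: real^'m. norm v * gauss v"
 have "\<bar>heat th (x, t) - heat th (y, s)\<bar> = \<bar>\<integral>v. f (x + a *\<^sub>R v) * gauss v - f (y + b *\<^sub>R v) * gauss v \<partial>lborel\<bar>"
  unfolding heat_def prod.case a_def[symmetric] b_def[symmetric] by (simp add: affine_integrable)
 also have "\<dots> \<le> (\<integral>v. (La * norm (x - y)) * gauss v + (La * \<bar>a - b\<bar>) * ?n v \<partial>lborel)"
 proof (rule order_trans[OF integral_abs_bound integral_mono])
  fix v
  have "\<bar>f (x + a *\<^sub>R v) - f (y + b *\<^sub>R v)\<bar> \<le> La * norm ((x - y) + (a - b) *\<^sub>R v)"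
   using lip[of "x + a *\<^sub>R v" "y + b *\<^sub>R v"] by (simp add: algebra_simps)
  also have "\<dots> \<le> La * (norm (x - y) + \<bar>a - b\<bar> * norm v)"
   using norm_triangle_ineq[of "x - y" "(a - b) *\<^sub>R v"] La by (intro mult_left_mono) auto
  finally have "\<bar>f (x + a *\<^sub>R v) - f (y + b *\<^sub>R v)\<bar> * gauss v \<le> La * (norm (x - y) + \<bar>a - b\<bar> * norm v) * gauss v"
   by (rule mult_right_mono) (rule order_less_imp_le[OF gauss_pos])
  moreover have "\<bar>f (x + a *\<^sub>R v) * gauss v - f (y + b *\<^sub>R v) * gauss v\<bar> = \<bar>f (x + a *\<^sub>R v) - f (y + b *\<^sub>R v)\<bar> * gauss v"
   unfolding left_diff_distrib[symmetric] abs_mult abs_of_pos[OF gauss_pos] ..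
  ultimately show "\<bar>f (x + a *\<^sub>R v) * gauss v - f (y + b *\<^sub>R v) * gauss v\<bar> \<le> (La * norm (x - y)) * gauss v + (La * \<bar>a - b\<bar>) * ?n v"
   by (simp add: algebra_simps)
 qed (intro integrable_abs Bochner_Integration.integrable_diff Bochner_Integration.integrable_add integrable_mult_right affine_integrable gauss_integral norm_gauss_integrable)+
 also have "\<dots> = La * norm (x - y) + La * (\<integral>v. ?n v \<partial>lborel) * \<bar>a - b\<bar>"
  by (simp add: gauss_integral norm_gauss_integrable)
 finally show ?thesis unfolding a_def b_def .
qed

lemma heat_continuous: "continuous_on UNIV (heat th)"
proof -
 define m1 where "m1 = (\<integral>v. norm (v :: real^'m) * gauss v \<partial>lborel)"
 have "(heat th \<longlongrightarrow> heat th z) (at z)" for z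
 proof (rule LIM_zero_cancel, rule Lim_null_comparison)
  let ?b = "\<lambda>w. La * norm (fst w - fst z) + La * m1 * \<bar>sqrt (- (2 * th * snd w)) - sqrt (- (2 * th * snd z))\<bar>"
  show "\<forall>\<^sub>F w in at z. norm (heat th w - heat th z) \<le> ?b w"
   using heat_modulus[of th "fst w" "snd w" "fst z" "snd z" for w] by (auto intro!: always_eventually simp: m1_def)
  have "(?b \<longlongrightarrow> ?b z) (at z)" by (intro tendsto_intros)
  thus "(?b \<longlongrightarrow> 0) (at z)" by simp
 qed
 thus ?thesis by (simp add: continuous_on_def)
qed

lemma heat_near_boundary:
 obtains c where "0 \<le> c" "!!x t. \<bar>heat th (x, t) - f x\<bar> \<le> c * \<bar>sqrt (- (2 * th * t))\<bar>"
proof -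
 have "0 \<le> (\<integral>v. norm (v :: real^'m) * gauss v \<partial>lborel)"
  by (intro Bochner_Integration.integral_nonneg mult_nonneg_nonneg order_less_imp_le[OF gauss_pos]) auto
 thus thesis using heat_modulus[of th x t x 0 for x t] La
  by (intro that[of "La * (\<integral>v. norm (v :: real^'m) * gauss v \<partial>lborel)"]) (auto simp: heat_0)
qed

lemma avg_hess_nonneg:
 assumes "convex_on UNIV f"
 shows "0 \<le> quad (avg_hess x) a"
proof (rule field_le_epsilon)
 fix e :: real assume e: "e > 0"
 obtain dl where dl: "0 < dl" "!!b r. norm b \<le> norm a + 1 ==> 0 < r ==> r < dl ==>
  \<bar>avg (x + r *\<^sub>R b) - avg x - r * (avg_grad x \<bullet> b) - r^2 * (quad (avg_hess x) b / 2)\<bar> \<le> (e / 2) * r^2"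
  using avg_taylor[of "e / 2" "norm a + 1" x] e by (auto simp: add_nonneg_pos)
 define r where "r = dl / 2"
 have r: "0 < r" "r < dl" using dl(1) by (auto simp: r_def)
 have "2 * avg x \<le> avg (x + r *\<^sub>R a) + avg (x + r *\<^sub>R - a)"
 proof -
  have "(\<integral>v. 2 * (f (x + v) * gauss v) \<partial>lborel) \<le> (\<integral>v. f (x + r *\<^sub>R a + v) * gauss v + f (x + r *\<^sub>R - a + v) * gauss v \<partial>lborel)"
  proof (rule integral_mono)
   fix v
   have "(1 / 2) *\<^sub>R (x + r *\<^sub>R a + v) + (1 - 1 / 2) *\<^sub>R (x + r *\<^sub>R - a + v) = x + v" by (simp add: vec_eq_iff field_simps)
   hence "f (x + v) \<le> (1 / 2) * f (x + r *\<^sub>R a + v) + (1 - 1 / 2) * f (x + r *\<^sub>R - a + v)"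
    using convex_onD[OF assms, of "1/2" "x + r *\<^sub>R - a + v" "x + r *\<^sub>R a + v"] by (simp add: algebra_simps)
   hence "2 * f (x + v) \<le> f (x + r *\<^sub>R a + v) + f (x + r *\<^sub>R - a + v)" by simp
   from mult_right_mono[OF this order_less_imp_le[OF gauss_pos[of v]]]
   show "2 * (f (x + v) * gauss v) \<le> f (x + r *\<^sub>R a + v) * gauss v + f (x + r *\<^sub>R - a + v) * gauss v" by (simp add: distrib_right)
  qed (intro Bochner_Integration.integrable_add integrable_mult_right shift_integrable)+
  thus ?thesis unfolding avg_def using shift_integrable by (simp del: scaleR_minus_right)
 qed
 moreover have "r * (avg_grad x \<bullet> (- a)) = - (r * (avg_grad x \<bullet> a))" "quad (avg_hess x) (- a) = quad (avg_hess x) a" "norm (- a) = norm a"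
  by (simp_all add: quad_minus)
 moreover note dl(2)[of a r] dl(2)[of "- a" r]
 ultimately have "0 \<le> 2 * (r^2 * (quad (avg_hess x) a / 2)) + 2 * ((e / 2) * r^2)"
  using r by (smt (verit))
 hence "0 \<le> r^2 * quad (avg_hess x) a + e * r^2" by simp
 hence "0 \<le> r^2 * (quad (avg_hess x) a + e)" by (simp add: algebra_simps)
 thus "0 \<le> quad (avg_hess x) a + e" using r by (simp add: zero_le_mult_iff)
qed

end

section \<open>The largest coordinate\<close>

text \<open>With \<open>sg = 1\<close> or \<open>sg = - 1\<close> this is the largest coordinate of
  \<open>x\<close> or of \<open>- x\<close>; the bound for the flow combines both.\<close>

definition coord_max :: "real => real^'m => real" where
 "coord_max sg x = Max (range (\<lambda>i. sg * x $ i))"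

lemma coord_max_ge: "sg * x $ i \<le> coord_max sg x" unfolding coord_max_def by (intro Max_ge) auto

lemma coord_max_le: "(!!i. sg * x $ i \<le> c) ==> coord_max sg x \<le> c" unfolding coord_max_def by simp

lemma coord_max_attained: obtains i where "coord_max sg x = sg * x $ i"
proof -
 have "coord_max sg x \<in> range (\<lambda>i. sg * x $ i)" unfolding coord_max_def by (rule Max_in) auto
 thus thesis using that by auto
qed

lemma coord_max_homogeneous_lipschitz:
 assumes "\<bar>sg\<bar> = 1" shows "homogeneous_lipschitz (coord_max sg) 1"
proof
 have "coord_max sg x \<le> coord_max sg y + norm (x - y)" for x y :: "real^'m"
 proof (rule coord_max_le)
  fix i
  have "sg * x $ i = sg * y $ i + sg * (x - y) $ i" by (simp add: algebra_simps)
  also have "sg * (x - y) $ i \<le> \<bar>sg * (x - y) $ i\<bar>" by simp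
  also have "\<dots> \<le> norm (x - y)" unfolding abs_mult assms using component_le_norm_cart[of "x - y" i] by simp
  finally show "sg * x $ i \<le> coord_max sg y + norm (x - y)" using coord_max_ge[of sg y i] by simp
 qed
 thus "\<bar>coord_max sg x - coord_max sg y\<bar> \<le> 1 * norm (x - y)" for x y :: "real^'m"
  using \<open>!!y x. coord_max sg x \<le> coord_max sg y + norm (x - y)\<close>[of x y] \<open>!!y x. coord_max sg x \<le> coord_max sg y + norm (x - y)\<close>[of y x]
  by (simp add: abs_le_iff norm_minus_commute)
 fix c :: real and x :: "real^'m" assume c: "0 \<le> c"
 show "coord_max sg (c *\<^sub>R x) = c * coord_max sg x"
 proof (rule antisym)
  show "coord_max sg (c *\<^sub>R x) \<le> c * coord_max sg x"
   using mult_left_mono[OF coord_max_ge[of sg x] c] by (intro coord_max_le) (simp add: mult.left_commute)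
  obtain i where "coord_max sg x = sg * x $ i" by (rule coord_max_attained)
  thus "c * coord_max sg x \<le> coord_max sg (c *\<^sub>R x)"
   using coord_max_ge[of sg "c *\<^sub>R x" i] by (simp add: mult.left_commute)
 qed
qed simp

lemma coord_max_convex: "convex_on UNIV (coord_max sg :: real^'m => real)"
proof (rule convex_onI)
 fix t :: real and x y :: "real^'m" assume t: "0 < t" "t < 1"
 show "coord_max sg ((1 - t) *\<^sub>R x + t *\<^sub>R y) \<le> (1 - t) * coord_max sg x + t * coord_max sg y"
 proof (rule coord_max_le)
  fix i
  have "(1 - t) * (sg * x $ i) + t * (sg * y $ i) \<le> (1 - t) * coord_max sg x + t * coord_max sg y"
   using t by (intro add_mono mult_left_mono coord_max_ge) auto
  thus "sg * ((1 - t) *\<^sub>R x + t *\<^sub>R y) $ i \<le> (1 - t) * coord_max sg x + t * coord_max sg y" by (simp add: algebra_simps)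
 qed
qed simp

lemma coord_max_minus: "coord_max (- sg) x = coord_max sg (- x)"
 by (simp add: coord_max_def)

text \<open>The key structural fact: the inequality \<open>(p\<^sub>i - p\<^sub>j)\<^sup>2 \<le> |p|\<^sup>2\<close> controls the
 Dirichlet form \<open>quad X p = 1/2 \<Sum> (- X\<^sub>i\<^sub>j) (p\<^sub>i - p\<^sub>j)\<^sup>2\<close>.\<close>

lemma quad_le_half_trace:
 fixes X :: "real^'m^'m"
 assumes sym: "transpose X = X" and row: "!!i. (\<Sum>j\<in>UNIV. X $ i $ j) = 0"
  and off: "!!i j. i \<noteq> j ==> X $ i $ j \<le> 0" and p: "!!i j. 0 \<le> p $ i * p $ j"
 shows "quad X p \<le> trace X * (norm p)^2 / 2"
proof -
 have X: "X $ i $ j = X $ j $ i" for i j using sym by (metis transpose_def vec_lambda_beta)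
 have q: "quad X p = (\<Sum>i\<in>UNIV. \<Sum>j\<in>UNIV. X $ i $ j * (p $ i * p $ j))"
  by (simp add: quad_def inner_vec_def matrix_vector_mult_def sum_distrib_left sum_distrib_right mult_ac)
 have z1: "(\<Sum>i\<in>UNIV. \<Sum>j\<in>UNIV. X $ i $ j * (p $ i)^2) = 0"
  using row by (simp add: sum_distrib_right[symmetric])
 have z2: "(\<Sum>i\<in>UNIV. \<Sum>j\<in>UNIV. X $ i $ j * (p $ j)^2) = 0"
  using z1 by (subst sum.swap) (simp add: X)
 have "(\<Sum>i\<in>UNIV. \<Sum>j\<in>UNIV. - X $ i $ j * (p $ i - p $ j)^2)
  = (\<Sum>i\<in>UNIV. \<Sum>j\<in>UNIV. 2 * (X $ i $ j * (p $ i * p $ j)) - X $ i $ j * (p $ i)^2 - X $ i $ j * (p $ j)^2)"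
  by (intro sum.cong refl) (simp add: power2_diff algebra_simps)
 also have "\<dots> = 2 * quad X p" unfolding q sum_subtractf z1 z2 by (simp add: sum_distrib_left)
 finally have d: "2 * quad X p = (\<Sum>i\<in>UNIV. \<Sum>j\<in>UNIV. - X $ i $ j * (p $ i - p $ j)^2)" ..
 also have "\<dots> \<le> (\<Sum>i\<in>UNIV. \<Sum>j\<in>UNIV. (if i = j then 0 else - X $ i $ j) * (norm p)^2)"
 proof (intro sum_mono)
  fix i j
  show "- X $ i $ j * (p $ i - p $ j)^2 \<le> (if i = j then 0 else - X $ i $ j) * (norm p)^2"
  proof (cases "i = j")
   case False
   have "(p $ i - p $ j)^2 \<le> (p $ i)^2 + (p $ j)^2" using p[of i j] by (simp add: power2_diff mult.assoc)
   also have "\<dots> = (\<Sum>k\<in>{i, j}. (p $ k)^2)" using False by simp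
   also have "\<dots> \<le> (\<Sum>k\<in>UNIV. (p $ k)^2)" by (intro sum_mono2) auto
   also have "\<dots> = (norm p)^2" unfolding power2_norm_eq_inner by (simp add: inner_vec_def power2_eq_square)
   finally show ?thesis using False off[OF False] by (simp add: mult_left_mono_neg)
  qed simp
 qed
 also have "\<dots> = trace X * (norm p)^2"
 proof -
  have "(\<Sum>j\<in>UNIV. if i = j then 0 else - X $ i $ j) = X $ i $ i" for i
  proof -
   have "(\<Sum>j\<in>UNIV. if i = j then 0 else - X $ i $ j) = (\<Sum>j\<in>UNIV. (if i = j then X $ i $ i else 0) - X $ i $ j)"
    by (intro sum.cong refl) auto
   thus ?thesis using row[of i] by (simp add: sum_subtractf)
  qed
  thus ?thesis by (simp add: trace_def sum_distrib_right[symmetric])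
 qed
 finally show ?thesis by simp
qed

text \<open>The parameter \<open>dummy\<close> carries the dimension, so that an interpretation can
  name it.\<close>

locale largest_coordinate =
 fixes sg :: real and dummy :: "'m::finite itself"
 assumes sg: "\<bar>sg\<bar> = 1"
begin

sublocale homogeneous_lipschitz "coord_max sg :: real^'m => real" 1
 by (rule coord_max_homogeneous_lipschitz[OF sg])

lemma line_derivative: "((\<lambda>r. avg (x + r *\<^sub>R a)) has_real_derivative avg_grad (x + r *\<^sub>R a) \<bullet> a) (at r)"
 using test_function_line(1)[OF avg_test_function[of UNIV], of x r a 0] by simp

lemma avg_mono: "0 \<le> sg * c ==> avg x \<le> avg (x + c *\<^sub>R axis i 1)"
 unfolding avg_def
proof (intro integral_mono shift_integrable mult_right_mono coord_max_le order_less_imp_le[OF gauss_pos])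
 fix v :: "real^'m" and j assume "0 \<le> sg * c"
 hence "sg * (x + v) $ j \<le> sg * (x + c *\<^sub>R axis i 1 + v) $ j" by (simp add: axis_def algebra_simps)
 thus "sg * (x + v) $ j \<le> coord_max sg (x + c *\<^sub>R axis i 1 + v)" using coord_max_ge order_trans by blast
qed

lemma avg_grad_sign: "0 \<le> sg * avg_grad x $ i"
proof -
 have ss: "sg * sg = 1" using sg by (auto simp: abs_if split: if_splits)
 have "mono_on UNIV (\<lambda>r. sg * avg (x + r *\<^sub>R axis i 1))"
 proof (rule mono_onI)
  fix r s :: real assume "r \<le> s"
  show "sg * avg (x + r *\<^sub>R axis i 1) \<le> sg * avg (x + s *\<^sub>R axis i 1)"
  proof (cases "sg = 1")
   case True
   thus ?thesis using avg_mono[of "s - r" "x + r *\<^sub>R axis i 1" i] \<open>r \<le> s\<close> by (simp add: algebra_simps)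
  next
   case False
   hence "sg = - 1" using sg by (auto simp: abs_if split: if_splits)
   thus ?thesis using avg_mono[of "r - s" "x + s *\<^sub>R axis i 1" i] \<open>r \<le> s\<close> by (simp add: algebra_simps)
  qed
 qed
 moreover have "((\<lambda>r. sg * avg (x + r *\<^sub>R axis i 1)) has_real_derivative sg * (avg_grad (x + 0 *\<^sub>R axis i 1) \<bullet> axis i 1)) (at 0)"
  by (intro DERIV_cmult line_derivative)
 ultimately have "0 \<le> sg * (avg_grad (x + 0 *\<^sub>R axis i 1) \<bullet> axis i 1)" by (rule mono_on_imp_deriv_nonneg) simp
 thus ?thesis by (simp add: inner_axis)
qed

definition ones :: "real^'m" where "ones = (\<chi> i. 1)"

lemma avg_ones: "avg (x + r *\<^sub>R ones) = avg x + sg * r"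
proof -
 have "coord_max sg (x + r *\<^sub>R ones) = coord_max sg x + sg * r" for x :: "real^'m"
 proof (rule antisym)
  show "coord_max sg (x + r *\<^sub>R ones) \<le> coord_max sg x + sg * r"
   using coord_max_ge[of sg x] by (intro coord_max_le) (simp add: ones_def algebra_simps)
  obtain i where "coord_max sg x = sg * x $ i" by (rule coord_max_attained)
  thus "coord_max sg x + sg * r \<le> coord_max sg (x + r *\<^sub>R ones)"
   using coord_max_ge[of sg "x + r *\<^sub>R ones" i] by (simp add: ones_def algebra_simps)
 qed
 from this[of "x + v" for v] have "coord_max sg (x + r *\<^sub>R ones + v) * gauss v = coord_max sg (x + v) * gauss v + (sg * r) * gauss v" for v
  by (metis add.commute add.left_commute distrib_right)
 thus ?thesis unfolding avg_def using shift_integrable gauss_integral[where 'm = 'm] by simp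
qed

lemma avg_grad_ones: "avg_grad x \<bullet> ones = sg"
proof -
 have "((\<lambda>r. avg x + sg * r) has_real_derivative sg) (at 0)" by (auto intro!: derivative_eq_intros)
 moreover have "((\<lambda>r. avg x + sg * r) has_real_derivative avg_grad x \<bullet> ones) (at 0)"
  using line_derivative[of x ones 0] unfolding avg_ones by simp
 ultimately show ?thesis by (rule DERIV_unique[symmetric])
qed

text \<open>These averages are therefore tested against the equation only at nonzero gradients,
  where it is regular.\<close>

lemma avg_grad_nonzero: "avg_grad x \<noteq> 0"
 using avg_grad_ones[of x] sg by auto

lemma avg_grad_shift_ones: "avg_grad (x + r *\<^sub>R ones) = avg_grad x"
proof -
 have "((\<lambda>y. avg (y + r *\<^sub>R ones)) has_derivative (\<lambda>h. avg_grad (x + r *\<^sub>R ones) \<bullet> h)) (at x)"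
  by (rule has_derivative_compose[of "\<lambda>y. y + r *\<^sub>R ones" "\<lambda>h. h" x UNIV avg, OF _ avg_derivative]) (auto intro!: derivative_eq_intros)
 moreover have "((\<lambda>y. avg (y + r *\<^sub>R ones)) has_derivative (\<lambda>h. avg_grad x \<bullet> h)) (at x)"
  unfolding avg_ones by (auto intro!: derivative_eq_intros avg_derivative)
 ultimately have "(\<lambda>h. avg_grad (x + r *\<^sub>R ones) \<bullet> h) = (\<lambda>h. avg_grad x \<bullet> h)" by (rule has_derivative_unique)
 from fun_cong[OF this] show ?thesis using vector_eq_rdot by blast
qed

text \<open>Adding the same number to all coordinates changes the average by a constant, so the
  gradient is invariant along \<open>ones\<close> and the Hessian annihilates
  \<open>ones\<close>.\<close>

lemma avg_hess_row_sum: "(\<Sum>j\<in>UNIV. avg_hess x $ i $ j) = 0"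
proof -
 have "((\<lambda>s. avg_grad (x + s *\<^sub>R ones) \<bullet> axis i 1) has_real_derivative (avg_hess (x + 0 *\<^sub>R ones) *v ones) \<bullet> axis i 1) (at 0)"
  using test_function_line(2)[OF avg_test_function[of UNIV], of x 0 ones 0 "axis i 1"] by simp
 hence "((\<lambda>s. avg_grad x \<bullet> axis i 1) has_real_derivative (avg_hess x *v ones) \<bullet> axis i 1) (at (0::real))"
  unfolding avg_grad_shift_ones by simp
 hence "(avg_hess x *v ones) \<bullet> axis i 1 = 0" by (rule DERIV_unique) simp
 thus ?thesis by (simp add: inner_axis matrix_vector_mult_def ones_def)
qed

text \<open>The largest coordinate is submodular: the mixed second difference in two different
  coordinates is nonpositive. Averaging preserves this, and the second order expansions turn it into
  the sign of the mixed derivative.\<close>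

lemma avg_hess_off_diagonal:
 assumes ij: "i \<noteq> j" shows "avg_hess x $ i $ j \<le> 0"
proof (rule field_le_epsilon)
 fix e :: real assume e: "e > 0"
 obtain dl where dl: "0 < dl" "!!b r. norm b \<le> 2 ==> 0 < r ==> r < dl ==>
  \<bar>avg (x + r *\<^sub>R b) - avg x - r * (avg_grad x \<bullet> b) - r^2 * (quad (avg_hess x) b / 2)\<bar> \<le> (e / 3) * r^2"
  using avg_taylor[of "e / 3" 2 x] e by auto
 define r a b where "r = dl / 2" and "a = (axis i 1 :: real^'m)" and "b = (axis j 1 :: real^'m)"
 have r: "0 < r" "r < dl" using dl(1) by (auto simp: r_def)
 have nab: "norm a \<le> 2" "norm b \<le> 2" "norm (a + b) \<le> 2"
  using norm_triangle_ineq[of a b] by (auto simp: a_def b_def)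
 have submodular: "coord_max sg (y + r *\<^sub>R (a + b)) + coord_max sg y \<le> coord_max sg (y + r *\<^sub>R a) + coord_max sg (y + r *\<^sub>R b)" for y :: "real^'m"
 proof -
  obtain k where k: "coord_max sg (y + r *\<^sub>R (a + b)) = sg * (y + r *\<^sub>R (a + b)) $ k" by (rule coord_max_attained)
  obtain l where l: "coord_max sg y = sg * y $ l" by (rule coord_max_attained)
  have ge: "sg * (y + r *\<^sub>R a) $ k \<le> coord_max sg (y + r *\<^sub>R a)" "sg * (y + r *\<^sub>R b) $ k \<le> coord_max sg (y + r *\<^sub>R b)"
   "sg * (y + r *\<^sub>R a) $ l \<le> coord_max sg (y + r *\<^sub>R a)" "sg * (y + r *\<^sub>R b) $ l \<le> coord_max sg (y + r *\<^sub>R b)"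
   "sg * y $ k \<le> coord_max sg y" "sg * (y + r *\<^sub>R (a + b)) $ l \<le> coord_max sg (y + r *\<^sub>R (a + b))" by (rule coord_max_ge)+
  consider "sg = 1" | "sg = -1" using sg by (auto simp: abs_if split: if_splits)
  thus ?thesis using ge k l ij r
   by cases (auto simp: a_def b_def axis_def algebra_simps split: if_splits)
 qed
 have "avg (x + r *\<^sub>R (a + b)) + avg x \<le> avg (x + r *\<^sub>R a) + avg (x + r *\<^sub>R b)"
 proof -
  have "(\<integral>v. coord_max sg (x + r *\<^sub>R (a + b) + v) * gauss v + coord_max sg (x + v) * gauss v \<partial>lborel)
   \<le> (\<integral>v. coord_max sg (x + r *\<^sub>R a + v) * gauss v + coord_max sg (x + r *\<^sub>R b + v) * gauss v \<partial>lborel)"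
  proof (rule integral_mono)
   fix v
   show "coord_max sg (x + r *\<^sub>R (a + b) + v) * gauss v + coord_max sg (x + v) * gauss v
    \<le> coord_max sg (x + r *\<^sub>R a + v) * gauss v + coord_max sg (x + r *\<^sub>R b + v) * gauss v"
    using mult_right_mono[OF submodular[of "x + v"] order_less_imp_le[OF gauss_pos[of v]]]
    unfolding distrib_right by (simp only: add_ac)
  qed (intro Bochner_Integration.integrable_add shift_integrable)+
  thus ?thesis unfolding avg_def using shift_integrable by simp
 qed
 moreover have "avg_grad x \<bullet> (a + b) = avg_grad x \<bullet> a + avg_grad x \<bullet> b" by (rule inner_add_right)
 moreover have "quad (avg_hess x) (a + b) = quad (avg_hess x) a + quad (avg_hess x) b + 2 * avg_hess x $ i $ j"
 proof -
  have "avg_hess x $ j $ i = avg_hess x $ i $ j" using avg_hess_symmetric[of x] by (metis transpose_def vec_lambda_beta)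
  hence "(avg_hess x *v a) \<bullet> b = avg_hess x $ i $ j" "(avg_hess x *v b) \<bullet> a = avg_hess x $ i $ j"
   by (simp_all add: a_def b_def matrix_vector_mult_basis inner_axis column_def)
  thus ?thesis by (simp add: quad_def matrix_vector_right_distrib inner_add_left inner_add_right)
 qed
 ultimately have "r^2 * avg_hess x $ i $ j \<le> e * r^2"
 proof -
  assume *: "avg (x + r *\<^sub>R (a + b)) + avg x \<le> avg (x + r *\<^sub>R a) + avg (x + r *\<^sub>R b)"
   "avg_grad x \<bullet> (a + b) = avg_grad x \<bullet> a + avg_grad x \<bullet> b"
   "quad (avg_hess x) (a + b) = quad (avg_hess x) a + quad (avg_hess x) b + 2 * avg_hess x $ i $ j"
  have "r^2 * (quad (avg_hess x) (a + b) / 2) = r^2 * (quad (avg_hess x) a / 2) + r^2 * (quad (avg_hess x) b / 2) + r^2 * avg_hess x $ i $ j"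
   "r * (avg_grad x \<bullet> (a + b)) = r * (avg_grad x \<bullet> a) + r * (avg_grad x \<bullet> b)" unfolding * by (auto simp: algebra_simps)
  with *(1) dl(2)[OF nab(1) r] dl(2)[OF nab(2) r] dl(2)[OF nab(3) r] show ?thesis by linarith
 qed
 thus "avg_hess x $ i $ j \<le> 0 + e" using r by simp
qed

lemma avg_curvature: "quad (avg_hess x) (avg_grad x) \<le> trace (avg_hess x) * (norm (avg_grad x))^2 / 2"
proof (rule quad_le_half_trace[OF avg_hess_symmetric avg_hess_row_sum avg_hess_off_diagonal])
 fix i j
 have "sg * sg = 1" using sg by (auto simp: abs_if split: if_splits)
 hence "avg_grad x $ i * avg_grad x $ j = (sg * avg_grad x $ i) * (sg * avg_grad x $ j)" by (simp add: mult_ac)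
 also have "\<dots> \<ge> 0" by (intro mult_nonneg_nonneg avg_grad_sign)
 finally show "0 \<le> avg_grad x $ i * avg_grad x $ j" .
qed

lemma reflect: "(\<integral>v. coord_max sg (x + s *\<^sub>R (v :: real^'m)) * gauss v \<partial>lborel) = (\<integral>v. coord_max (- sg) (- x + s *\<^sub>R v) * gauss v \<partial>lborel)"
proof -
 have "(\<lambda>v. coord_max sg (x + s *\<^sub>R v) * gauss v) \<in> borel_measurable borel"
  using affine_integrable[of x s] by (simp add: integrable_iff_bounded)
 from integral_affine[OF this, of "-1" 0] show ?thesis by (simp add: coord_max_minus gauss_minus)
qed

text \<open>Averaging over \<open>v\<close> and \<open>- v\<close> replaces the maximum by half the
  spread between largest and smallest coordinate. With two or more coordinates the spread vanishes
  only on a null set.\<close>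

lemma avg_0_pos:
 assumes "2 \<le> CARD('m)" shows "0 < avg 0"
proof (rule ccontr)
 assume neg: "\<not> 0 < avg 0"
 have "\<not> CARD('m) \<le> Suc 0" using assms by simp
 then obtain i j :: 'm where ij: "i \<noteq> j" using card_le_Suc0_iff_eq[of "UNIV :: 'm set"] by auto
 let ?g = "\<lambda>v :: real^'m. coord_max sg v * gauss v + coord_max sg (- v) * gauss v"
 have i1: "integrable lborel (\<lambda>v :: real^'m. coord_max sg v * gauss v)" "integrable lborel (\<lambda>v :: real^'m. coord_max sg (- v) * gauss v)"
  using affine_integrable[of 0 1] affine_integrable[of 0 "-1"] by auto
 have ge: "0 \<le> coord_max sg v + coord_max sg (- v)" for v :: "real^'m"
  using coord_max_ge[of sg v i] coord_max_ge[of sg "- v" i] by simp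
 have gg: "?g v = (coord_max sg v + coord_max sg (- v)) * gauss v" for v :: "real^'m" by (simp add: distrib_right)
 have "(\<integral>v. coord_max sg (v :: real^'m) * gauss v \<partial>lborel) = (\<integral>v. coord_max sg (- v :: real^'m) * gauss v \<partial>lborel)"
  using reflect[of 0 1] by (simp add: coord_max_minus)
 hence "(\<integral>v. ?g v \<partial>lborel) = 2 * avg 0" using i1 avg_def[of 0] by simp
 moreover have "0 \<le> (\<integral>v. ?g v \<partial>lborel)" unfolding gg by (intro Bochner_Integration.integral_nonneg mult_nonneg_nonneg ge order_less_imp_le[OF gauss_pos])
 ultimately have "(\<integral>v. ?g v \<partial>lborel) = 0" using neg by simp
 moreover have gi: "integrable lborel ?g" using i1 by (rule Bochner_Integration.integrable_add)
 moreover have g0: "AE v in lborel. 0 \<le> ?g v"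
  unfolding gg by (intro AE_I2 mult_nonneg_nonneg ge order_less_imp_le[OF gauss_pos])
 ultimately have "AE v in lborel. ?g v = 0" using integral_nonneg_eq_0_iff_AE[OF gi g0] by blast
 hence "AE v in lborel. v \<in> {v. (axis i 1 - axis j 1 :: real^'m) \<bullet> v = 0}"
 proof (rule AE_mp, intro AE_I2 impI)
  fix v :: "real^'m" assume "?g v = 0"
  hence "coord_max sg v + coord_max sg (- v) = 0" unfolding gg using gauss_pos[of v] by simp
  hence "sg * v $ i = sg * v $ j"
   using coord_max_ge[of sg v i] coord_max_ge[of sg "- v" i] coord_max_ge[of sg v j] coord_max_ge[of sg "- v" j]
   unfolding vector_uminus_component mult_minus_right by linarith
  thus "v \<in> {v. (axis i 1 - axis j 1 :: real^'m) \<bullet> v = 0}" using sg by (auto simp: inner_diff_left inner_axis')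
 qed
 moreover have "axis i 1 - axis j 1 \<noteq> (0 :: real^'m)" using ij by (simp add: axis_eq_axis)
 hence "negligible {v. (axis i 1 - axis j 1 :: real^'m) \<bullet> v = 0}" by (intro negligible_hyperplane) auto
 hence "AE v in lebesgue. v \<notin> {v. (axis i 1 - axis j 1 :: real^'m) \<bullet> v = 0}"
  by (simp add: AE_iff_null_sets negligible_iff_null_sets)
 hence "AE v in lborel. v \<notin> {v. (axis i 1 - axis j 1 :: real^'m) \<bullet> v = 0}" by (simp add: AE_completion_iff)
 ultimately have "AE v in (lborel :: (real^'m) measure). False" by eventually_elim auto
 thus False by (simp add: eventually_False ae_filter_eq_bot_iff emeasure_lborel_UNIV)
qed

end

section \<open>Comparison with Gaussian averages\<close>

lemma usc_attains_sup:
 assumes usc: "usc_on T f" and K: "compact K" "K \<noteq> {}" "K \<subseteq> T"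
 obtains x where "x \<in> K" "!!y. y \<in> K ==> f y \<le> f x"
proof (rule ccontr)
 assume "\<not> thesis"
 hence neg: "\<exists>y\<in>K. f x < f y" if "x \<in> K" for x using that \<open>!!x. [|x \<in> K; !!y. y \<in> K ==> f y \<le> f x|] ==> thesis\<close> by (meson not_less)
 have "\<exists>y V. y \<in> K \<and> open V \<and> x \<in> V \<and> (\<forall>z\<in>V \<inter> T. f z < f y)" if x: "x \<in> K" for x
 proof -
  obtain y where y: "y \<in> K" "f x < f y" using neg x by auto
  hence "\<forall>\<^sub>F z in at x within T. f z < f y" using usc x K unfolding usc_on_def by auto
  then obtain U where "open U" "x \<in> U" "\<forall>z\<in>U. z \<noteq> x --> z \<in> T --> f z < f y" unfolding eventually_at_topological by blast
  thus ?thesis using y by (metis IntE)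
 qed
 then obtain Y U where YU: "!!x. x \<in> K ==> Y x \<in> K \<and> open (U x) \<and> x \<in> U x \<and> (\<forall>z\<in>U x \<inter> T. f z < f (Y x))" by metis
 obtain F where F: "F \<subseteq> K" "finite F" "K \<subseteq> (\<Union>x\<in>F. U x)"
 proof (rule compactE_image[OF K(1), of K U])
  show "K \<subseteq> (\<Union>c\<in>K. U c)" using YU by blast
 qed (use YU in auto)
 have Fn: "F \<noteq> {}" using F K by auto
 then obtain x where x: "x \<in> F" "!!x'. x' \<in> F ==> f (Y x') \<le> f (Y x)"
  using F(2) by (metis arg_min_if_finite(1,2)[of F "\<lambda>x. - f (Y x)"] neg_le_iff_le not_less)
 hence "Y x \<in> K" using YU F by auto
 then obtain x' where "x' \<in> F" "Y x \<in> U x'" using F(3) by auto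
 hence "f (Y x) < f (Y x')" using YU[of x'] F(1) \<open>Y x \<in> K\<close> K(3) by auto
 thus False using x(2)[OF \<open>x' \<in> F\<close>] by simp
qed

lemma usc_on_add_continuous:
 assumes "usc_on T f" "continuous_on T g"
 shows "usc_on T (\<lambda>x. f x + g x)"
 unfolding usc_on_def
proof (intro ballI allI impI)
 fix x c assume x: "x \<in> T" and c: "f x + g x < c"
 define e where "e = (c - f x - g x) / 2"
 have e: "e > 0" using c by (simp add: e_def)
 have "\<forall>\<^sub>F y in at x within T. f y < f x + e" using assms(1) x e by (auto simp: usc_on_def)
 moreover have "\<forall>\<^sub>F y in at x within T. g y < g x + e"
  using assms(2) x e by (intro order_tendstoD) (auto simp: continuous_on_def)
 ultimately show "\<forall>\<^sub>F y in at x within T. f y + g y < c" by eventually_elim (simp add: e_def field_simps)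
qed

lemma usc_on_minus_iff: "usc_on T (\<lambda>x. - f x) \<longleftrightarrow> lsc_on T f"
proof -
 have "(\<forall>c>- f x. \<forall>\<^sub>F y in at x within T. - f y < c) \<longleftrightarrow> (\<forall>c<f x. \<forall>\<^sub>F y in at x within T. c < f y)" for x
  by (metis (mono_tags, lifting) eventually_mono minus_less_iff neg_less_iff_less minus_minus)
 thus ?thesis unfolding usc_on_def lsc_on_def by simp
qed

text \<open>The strip has no boundary condition at its early end, so \<open>dl / (snd z + S)\<close>
  is subtracted, which blows up there. It removes half of the positive value at
  \<open>(x1, t1)\<close>, so a positive maximum survives; by \<open>bd\<close> and
  \<open>out\<close> it lies neither at time \<open>0\<close> nor far out.\<close>

lemma interior_maximum:
 fixes D :: "(real^'m) \<times> real => real"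
 assumes usc: "usc_on (UNIV \<times> {..0}) D" and pos: "0 < D (x1, t1)" "t1 \<le> 0" and S: "- S < t1"
  and bd: "!!x. D (x, 0) \<le> 0" and out: "!!x t. rh < norm x ==> - S \<le> t ==> t \<le> 0 ==> D (x, t) \<le> 0"
 obtains dl x0 t0 where "0 < dl" "- S < t0" "t0 < 0"
  "\<forall>\<^sub>F z in nhds (x0, t0). D z - dl / (snd z + S) \<le> D (x0, t0) - dl / (t0 + S)"
proof -
 define dl where "dl = D (x1, t1) * (t1 + S) / 2"
 have dl: "dl > 0" using pos S by (simp add: dl_def)
 have nx1: "norm x1 \<le> rh" using out[of x1 t1] pos S by (meson less_imp_le not_less)
 define K where "K = cball (0 :: real^'m) rh \<times> {- S..0}"
 have rh0: "0 \<le> rh" using nx1 norm_ge_zero[of x1] by linarith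
 have K: "compact K" "K \<noteq> {}" "K \<subseteq> UNIV \<times> {..0}" using nx1 rh0 pos S unfolding K_def by (auto intro!: compact_Times)
 obtain zm where zm: "zm \<in> K" "!!z. z \<in> K ==> D z \<le> D zm" using usc_attains_sup[OF usc K] by blast
 define B where "B = D zm"
 have z1: "(x1, t1) \<in> K" using nx1 pos S by (auto simp: K_def)
 have B: "B > 0" using zm(2)[OF z1] pos unfolding B_def by simp
 \<comment> \<open>Within \<open>e\<close> of the early end the barrier exceeds the maximum
   \<open>B\<close> of \<open>D\<close>, so the compact set \<open>K'\<close> can stop there; the
   second entry keeps \<open>(x1, t1)\<close> inside.\<close>
 define e where "e = min (dl / B) (t1 + S)"
 have e: "e > 0" "e \<le> dl / B" "e \<le> t1 + S" using B dl S by (auto simp: e_def)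
 define K' where "K' = cball (0 :: real^'m) rh \<times> {- S + e..0}"
 have z1': "(x1, t1) \<in> K'" using nx1 pos S e by (auto simp: K'_def)
 have "K' \<noteq> {}" using z1' by auto
 hence K': "compact K'" "K' \<noteq> {}" "K' \<subseteq> UNIV \<times> {- S<..0}" "K' \<subseteq> K" using e unfolding K'_def K_def by (auto intro!: compact_Times)
 define D' where "D' z = D z + - dl / (snd z + S)" for z
 have "usc_on (UNIV \<times> {- S<..0}) D" unfolding usc_on_def
 proof (intro ballI allI impI)
  fix z c assume "z \<in> (UNIV :: (real^'m) set) \<times> {- S<..0}" "D z < c"
  hence "\<forall>\<^sub>F y in at z within UNIV \<times> {..0}. D y < c" using usc unfolding usc_on_def by auto
  thus "\<forall>\<^sub>F y in at z within UNIV \<times> {- S<..0}. D y < c" by (rule filter_leD[OF at_le, rotated]) auto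
 qed
 hence "usc_on (UNIV \<times> {- S<..0}) D'" unfolding D'_def by (rule usc_on_add_continuous) (auto intro!: continuous_intros)
 then obtain z0 where z0: "z0 \<in> K'" "!!z. z \<in> K' ==> D' z \<le> D' z0" using usc_attains_sup[OF _ K'(1-3)] by blast
 have "dl / (t1 + S) = D (x1, t1) / 2" using S by (simp add: dl_def field_simps)
 hence "D' (x1, t1) > 0" using pos by (simp add: D'_def)
 hence p0: "D' z0 > 0" using z0(2)[OF z1'] by simp
 obtain x0 t0 where zz: "z0 = (x0, t0)" by (cases z0)
 have t0: "- S + e \<le> t0" "t0 \<le> 0" using z0(1) by (auto simp: zz K'_def)
 have t0S: "0 < t0 + S" using t0 e by simp
 have "t0 \<noteq> 0"
 proof
  assume "t0 = 0"
  hence "D' z0 \<le> - dl / (t0 + S)" using bd[of x0] by (simp add: D'_def zz)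
  thus False using p0 dl t0S by (smt (verit) divide_neg_pos)
 qed
 hence t0n: "t0 < 0" using t0 by simp
 have all: "D' (x, t) \<le> D' z0" if t: "- S < t" "t \<le> 0" for x t
 proof (cases "norm x \<le> rh")
  case False
  hence "D (x, t) \<le> 0" using t by (intro out) auto
  moreover have "0 < dl / (t + S)" using dl t by simp
  ultimately show ?thesis using p0 by (simp add: D'_def)
 next
  case True
  show ?thesis
  proof (cases "- S + e \<le> t")
   case True
   thus ?thesis using \<open>norm x \<le> rh\<close> t by (intro z0(2)) (auto simp: K'_def)
  next
   case False
   have "D (x, t) \<le> B" unfolding B_def using \<open>norm x \<le> rh\<close> t by (intro zm(2)) (auto simp: K_def)
   moreover have "B \<le> dl / (t + S)"
   proof -
    have "t + S \<le> dl / B" using False e(2) by linarith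
    thus ?thesis using B t by (simp add: field_simps)
   qed
   ultimately show ?thesis using p0 by (simp add: D'_def)
  qed
 qed
 have "\<forall>\<^sub>F z in nhds (x0, t0). z \<in> UNIV \<times> {- S<..<0}"
  using t0n t0S by (intro eventually_nhds_in_open open_Times) auto
 hence "\<forall>\<^sub>F z in nhds (x0, t0). D z - dl / (snd z + S) \<le> D (x0, t0) - dl / (t0 + S)"
 proof eventually_elim
  case (elim z)
  thus ?case using all[of "snd z" "fst z"] by (auto simp: D'_def zz)
 qed
 moreover have "- S < t0" using t0S by simp
 ultimately show thesis using that[OF dl _ t0n] by blast
qed

text \<open>For semidefinite \<open>X\<close> the curvature term is at most the trace whatever the
  gradient, so this much can be tested by convex barriers even at critical points. The rate
  \<open>ka\<close> is \<open>1\<close> for the flow and \<open>1 / 2\<close> for the game.\<close>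

definition gradient_free_condition :: "real => real => real^'m => real^'m^'m => bool" where
 "gradient_free_condition ka a p X \<longleftrightarrow> ((\<forall>b. 0 \<le> quad X b) --> 0 \<le> a + ka * trace X)"

text \<open>The curvature equation with rate \<open>ka\<close>, restricted to nonzero gradients,
  where no envelope is involved.\<close>

definition regular_condition :: "real => real => real^'m => real^'m^'m => bool" where
 "regular_condition ka a p X \<longleftrightarrow> (p \<noteq> 0 --> 0 \<le> a + ka * mcf_F X p)"

lemma mcf_F_scale: "d \<noteq> 0 ==> mcf_F (c *\<^sub>R X) (d *\<^sub>R p) = c * mcf_F X p"
 unfolding mcf_F_def trace_scaleR scaleR_matrix_vector_assoc[symmetric] matrix_vector_mult_scaleR
 by (simp add: power_mult_distrib power2_eq_square[of d] right_diff_distrib)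

lemma trace_mat: "trace (mat c :: real^'m^'m) = c * real CARD('m)"
 by (simp add: trace_def mat_def)

lemma test_function_penalty_time:
 assumes "S > 0"
 shows "is_test_function (UNIV \<times> {- S<..<0}) (\<lambda>z :: (real^'m) \<times> real. k * snd z + dl / (snd z + S)) (\<lambda>z. k - dl / (snd z + S)^2) (\<lambda>_. 0) (\<lambda>_. 0)"
proof -
 have s: "snd ` ((UNIV :: (real^'m) set) \<times> {- S<..<0}) = {- S<..<0}" using assms by force
 have "is_test_function (UNIV \<times> {- S<..<0}) (\<lambda>(x :: real^'m, t). k * t + dl / (t + S)) (\<lambda>(x, t). k - dl / (t + S)^2) (\<lambda>_. 0) (\<lambda>_. 0)"
  by (rule test_function_time) (auto simp: s power2_eq_square intro!: derivative_eq_intros continuous_intros)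
 thus ?thesis by (simp add: case_prod_unfold)
qed

lemma test_function_isotropic:
 "is_test_function N (\<lambda>z :: (real^'m) \<times> real. p \<bullet> fst z + be * (norm (fst z))^2) (\<lambda>_. 0) (\<lambda>z. p + (2 * be) *\<^sub>R fst z) (\<lambda>_. mat (2 * be))"
proof -
 have "transpose (mat (2 * be) :: real^'m^'m) = mat (2 * be)" by (simp add: transpose_def mat_def vec_eq_iff)
 from test_function_quadratic[OF this, of N p 0] show ?thesis by (simp add: case_prod_unfold quad_mat_1 mat_vec)
qed

lemma quadratic_dominates_linear:
 fixes be c d :: real
 assumes "0 < be"
 obtains rh where "!!y. rh < y ==> c * y + d \<le> be * y^2"
proof
 fix y assume y: "max 1 ((\<bar>c\<bar> + \<bar>d\<bar>) / be) < y"
 hence "\<bar>c\<bar> + \<bar>d\<bar> < be * y" "1 < y" using assms by (auto simp: field_simps)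
 hence "(\<bar>c\<bar> + \<bar>d\<bar>) * y \<le> (be * y) * y" by (intro mult_right_mono) auto
 moreover have "\<bar>d\<bar> * 1 \<le> \<bar>d\<bar> * y" "c * y \<le> \<bar>c\<bar> * y" using \<open>1 < y\<close> by (intro mult_left_mono mult_right_mono; simp)+
 ultimately show "c * y + d \<le> be * y^2" by (simp add: power2_eq_square distrib_right mult.assoc)
qed

context homogeneous_lipschitz begin

lemma heat_strip_test_function:
 assumes "0 < th"
 shows "is_test_function (UNIV \<times> {- S<..<0}) (heat th)
  (\<lambda>z. - (th / sqrt (- (2 * th * snd z))) * trace (avg_hess ((1 / sqrt (- (2 * th * snd z))) *\<^sub>R fst z)))
  (\<lambda>z. avg_grad ((1 / sqrt (- (2 * th * snd z))) *\<^sub>R fst z))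
  (\<lambda>z. (1 / sqrt (- (2 * th * snd z))) *\<^sub>R avg_hess ((1 / sqrt (- (2 * th * snd z))) *\<^sub>R fst z))"
 by (rule test_function_subset[OF heat_test_function[OF assms, unfolded case_prod_unfold]]) auto

text \<open>By convexity the heat flow has a semidefinite Hessian and solves the equation with the
  trace. A small quadratic added to it beats the linear growth of \<open>u\<close> and keeps the
  Hessian semidefinite.\<close>

theorem heat_upper_bound:
 assumes conv: "convex_on UNIV f" and ka: "0 < ka" and usc: "usc_on (UNIV \<times> {..0}) u"
  and growth: "!!S. \<exists>c. \<forall>x. \<forall>t\<in>{- S..0}. u (x, t) \<le> c * (1 + norm x)"
  and init: "!!x. u (x, 0) \<le> f x" and sub: "touched_above (gradient_free_condition ka) u" and t: "t1 \<le> 0"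
 shows "u (x1, t1) \<le> heat ka (x1, t1)"
proof (rule field_le_epsilon)
 fix e :: real assume e: "e > 0"
 \<comment> \<open>The quadratic has trace \<open>2 * be * CARD('m)\<close>; \<open>k0\<close>
   exceeds the resulting growth by one, so the barrier is strict. \<open>W\<close> is chosen so that
   the total correction at \<open>(x1, t1)\<close> is at most \<open>e\<close>.\<close>
 define k0 where "k0 = 2 * ka * CARD('m) + 1"
 have k0: "k0 > 0" using ka by (simp add: k0_def add_nonneg_pos)
 define W where "W = (norm x1)^2 + k0 * (- t1) + 1"
 have W: "W > 0" unfolding W_def using k0 t by (intro add_nonneg_pos add_nonneg_nonneg) (auto simp: mult_nonneg_nonpos)
 define be where "be = e / W"
 have be: "be > 0" "be * W = e" using W e by (auto simp: be_def)
 define S where "S = 1 - t1"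
 have S: "S > 0" "- S < t1" using t by (auto simp: S_def)
 let ?q = "\<lambda>z :: (real^'m) \<times> real. be * (norm (fst z))^2 - be * k0 * snd z"
 define D where "D z = u z + - (heat ka z + ?q z)" for z
 have usc': "usc_on (UNIV \<times> {..0}) D" unfolding D_def
  by (intro usc_on_add_continuous[OF usc] continuous_intros continuous_on_subset[OF heat_continuous]) auto
 show "u (x1, t1) \<le> heat ka (x1, t1) + e"
 proof (rule ccontr)
  assume "\<not> u (x1, t1) \<le> heat ka (x1, t1) + e"
  moreover have "?q (x1, t1) \<le> e" using be unfolding W_def by (simp add: algebra_simps)
  ultimately have pos: "0 < D (x1, t1)" by (simp add: D_def)
  have bd: "D (x, 0) \<le> 0" for x
  proof -
   have "0 \<le> be * (norm x)^2" using be(1) by simp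
   thus ?thesis using init[of x] by (simp add: D_def heat_0)
  qed
  obtain c where c: "!!x t. - S \<le> t ==> t \<le> 0 ==> u (x, t) \<le> c * (1 + norm x)" using growth[of S] by (metis atLeastAtMost_iff)
  obtain c' where c': "0 \<le> c'" "!!x t. \<bar>heat ka (x, t) - f x\<bar> \<le> c' * \<bar>sqrt (- (2 * ka * t))\<bar>" by (rule heat_near_boundary[of ka]) blast
  obtain rh where rh: "!!y. rh < y ==> (c + La) * y + (c + c' * sqrt (2 * ka * S)) \<le> be * y^2" by (rule quadratic_dominates_linear[OF be(1)]) blast
  have out: "D (x, t) \<le> 0" if "rh < norm x" "- S \<le> t" "t \<le> 0" for x t
  proof -
   have "sqrt (- (2 * ka * t)) \<le> sqrt (2 * ka * S)" "0 \<le> - (2 * ka * t)" using that ka mult_left_mono[of "- t" S "2 * ka"] by (auto simp: mult_nonneg_nonpos)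
   hence "c' * \<bar>sqrt (- (2 * ka * t))\<bar> \<le> c' * sqrt (2 * ka * S)" using c'(1) by (intro mult_left_mono) auto
   moreover have "be * k0 * t \<le> 0" using be k0 that by (simp add: mult_nonneg_nonpos)
   ultimately show ?thesis using c[OF that(2,3), of x] c'(2)[of x t] f_bound[of x] rh[OF that(1)]
    unfolding D_def by (simp add: algebra_simps abs_le_iff)
  qed
  obtain dl x0 t0 where z0: "0 < dl" "- S < t0" "t0 < 0"
   "\<forall>\<^sub>F z in nhds (x0, t0). D z - dl / (snd z + S) \<le> D (x0, t0) - dl / (t0 + S)"
   by (rule interior_maximum[OF usc' pos t S(2) bd out])
  define s where "s = sqrt (- (2 * ka * t0))"
  have s: "s > 0" using ka z0 by (simp add: s_def mult_pos_neg)
  let ?X = "avg_hess ((1 / s) *\<^sub>R x0)"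
  have N: "open ((UNIV :: (real^'m) set) \<times> {- S<..<0})" "(x0, t0) \<in> UNIV \<times> {- S<..<0}" using z0 by (auto intro!: open_Times)
  note T = test_function_add[OF test_function_add[OF heat_strip_test_function[OF ka, of S] test_function_isotropic[of _ 0 be]]
   test_function_penalty_time[OF S(1), of "- be * k0" dl]]
  have touch: "\<forall>\<^sub>F z in nhds (x0, t0). u z - (heat ka z + (0 \<bullet> fst z + be * (norm (fst z))^2) + (- be * k0 * snd z + dl / (snd z + S)))
   \<le> u (x0, t0) - (heat ka (x0, t0) + (0 \<bullet> fst (x0, t0) + be * (norm (fst (x0, t0)))^2) + (- be * k0 * snd (x0, t0) + dl / (snd (x0, t0) + S)))"
   using z0(4) by eventually_elim (simp add: D_def algebra_simps)
  have psd: "0 \<le> quad ((1 / s) *\<^sub>R ?X + mat (2 * be)) a" for a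
   using s be avg_hess_nonneg[OF conv, of "(1 / s) *\<^sub>R x0" a] unfolding quad_add quad_scaleR quad_mat_1
   by (intro add_nonneg_nonneg mult_nonneg_nonneg) auto
  have tr: "trace ((1 / s) *\<^sub>R ?X + mat (2 * be)) = (1 / s) * trace ?X + 2 * be * CARD('m)"
   by (simp only: trace_add trace_scaleR trace_mat)
  have "0 \<le> - (ka / s) * trace ?X + (- be * k0 - dl / (t0 + S)^2) + ka * trace ((1 / s) *\<^sub>R ?X + mat (2 * be))"
   using touched_aboveD[OF sub N z0(3) T touch] psd unfolding s_def gradient_free_condition_def by simp
  hence "0 \<le> - (ka / s) * trace ?X + (- be * k0 - dl / (t0 + S)^2) + ka * ((1 / s) * trace ?X + 2 * be * CARD('m))"
   unfolding tr .
  moreover have "ka * ((1 / s) * trace ?X + 2 * be * CARD('m)) = (ka / s) * trace ?X + 2 * ka * CARD('m) * be" by (simp add: algebra_simps)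
  moreover have "be * k0 = 2 * ka * CARD('m) * be + be" by (simp add: k0_def algebra_simps)
  moreover have "0 < dl / (t0 + S)^2" using z0 by simp
  ultimately show False using be(1) by simp
 qed
qed

end

context largest_coordinate begin

text \<open>By \<open>avg_curvature\<close> the curvature term of these averages is at least half of
  their trace, so diffusion at rate \<open>ka / 2\<close> stays below \<open>u\<close>. A factor
  \<open>b < c\<close> leaves a positive multiple of \<open>norm x\<close> to spare at infinity;
  afterwards \<open>b\<close> tends to \<open>c\<close>.\<close>

theorem heat_lower_bound:
 assumes c: "0 < c" and ka: "0 < ka" and usc: "usc_on (UNIV \<times> {..0}) (\<lambda>z. - u z)"
  and coercive: "!!x t i. t \<le> 0 ==> c * \<bar>x $ i\<bar> \<le> u (x, t)"
  and super: "touched_above (regular_condition ka) (\<lambda>z. - u z)" and t: "t1 \<le> 0"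
 shows "c * heat (ka / 2) (x1, t1) \<le> u (x1, t1)"
proof -
 define th where "th = ka / 2"
 have th: "th > 0" using ka by (simp add: th_def)
 define S where "S = 1 - t1"
 have S: "S > 0" "- S < t1" using t by (auto simp: S_def)
 obtain c' where c': "0 \<le> c'" "!!x t. \<bar>heat th (x, t) - coord_max sg x\<bar> \<le> c' * \<bar>sqrt (- (2 * th * t))\<bar>" by (rule heat_near_boundary[of th]) blast
 have main: "b * heat th (x1, t1) \<le> u (x1, t1)" if b: "0 < b" "b < c" for b
 proof (rule ccontr)
  assume gt: "\<not> b * heat th (x1, t1) \<le> u (x1, t1)"
  define D where "D z = - u z + b * heat th z" for z
  have usc': "usc_on (UNIV \<times> {..0}) D" unfolding D_def
   by (intro usc_on_add_continuous[OF usc] continuous_intros continuous_on_subset[OF heat_continuous]) auto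
  have pos: "0 < D (x1, t1)" using gt by (simp add: D_def)
  have cm: "b * coord_max sg x \<le> u (x, t) - (c - b) * (norm x / CARD('m))" if "t \<le> 0" for x t
  proof -
   have "Max (range (\<lambda>i. \<bar>x $ i\<bar>)) \<in> range (\<lambda>i. \<bar>x $ i\<bar>)" by (rule Max_in) auto
   then obtain i where im: "Max (range (\<lambda>i. \<bar>x $ i\<bar>)) = \<bar>x $ i\<bar>" by (rule imageE)
   have i: "\<bar>x $ j\<bar> \<le> \<bar>x $ i\<bar>" for j unfolding im[symmetric] by (rule Max_ge) auto
   have "coord_max sg x \<le> \<bar>x $ i\<bar>"
   proof (rule coord_max_le)
    fix j
    have "sg * x $ j \<le> \<bar>sg * x $ j\<bar>" by (rule abs_ge_self)
    also have "\<dots> \<le> \<bar>x $ i\<bar>" unfolding abs_mult sg using i[of j] by simp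
    finally show "sg * x $ j \<le> \<bar>x $ i\<bar>" .
   qed
   hence "b * coord_max sg x \<le> b * \<bar>x $ i\<bar>" using b by (intro mult_left_mono) auto
   moreover have "norm x \<le> CARD('m) * \<bar>x $ i\<bar>" using i by (intro order_trans[OF norm_le_l1_cart] sum_bounded_above[THEN order_trans]) auto
   hence "(c - b) * (norm x / CARD('m)) \<le> (c - b) * \<bar>x $ i\<bar>" using b by (intro mult_left_mono) (auto simp: field_simps)
   ultimately show ?thesis using coercive[OF that, of x i] by (simp add: left_diff_distrib)
  qed
  have bd: "D (x, 0) \<le> 0" for x
   using cm[of 0 x] b by (simp add: D_def heat_0) (smt (verit) divide_nonneg_nonneg mult_nonneg_nonneg norm_ge_zero of_nat_0_le_iff)
  define rh where "rh = b * c' * sqrt (2 * th * S) * CARD('m) / (c - b)"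
  have out: "D (x, t) \<le> 0" if "rh < norm x" "- S \<le> t" "t \<le> 0" for x t
  proof -
   have "sqrt (- (2 * th * t)) \<le> sqrt (2 * th * S)" "0 \<le> - (2 * th * t)" using that th mult_left_mono[of "- t" S "2 * th"] by (auto simp: mult_nonneg_nonpos)
   hence "c' * \<bar>sqrt (- (2 * th * t))\<bar> \<le> c' * sqrt (2 * th * S)" using c'(1) by (intro mult_left_mono) auto
   hence "heat th (x, t) \<le> coord_max sg x + c' * sqrt (2 * th * S)" using c'(2)[of x t] by linarith
   hence "b * heat th (x, t) \<le> b * coord_max sg x + b * c' * sqrt (2 * th * S)"
    using b mult_left_mono[of "heat th (x, t)" "coord_max sg x + c' * sqrt (2 * th * S)" b] by (simp add: distrib_left mult.assoc)
   moreover have "b * c' * sqrt (2 * th * S) \<le> (c - b) * (norm x / CARD('m))"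
    using that(1) b unfolding rh_def by (simp add: field_simps)
   ultimately show ?thesis using cm[OF that(3), of x] by (simp add: D_def)
  qed
  obtain dl x0 t0 where z0: "0 < dl" "- S < t0" "t0 < 0"
   "\<forall>\<^sub>F z in nhds (x0, t0). D z - dl / (snd z + S) \<le> D (x0, t0) - dl / (t0 + S)"
   by (rule interior_maximum[OF usc' pos t S(2) bd out])
  define s where "s = sqrt (- (2 * th * t0))"
  have s: "s > 0" using th z0 by (simp add: s_def mult_pos_neg)
  define X p where "X = avg_hess ((1 / s) *\<^sub>R x0)" and "p = avg_grad ((1 / s) *\<^sub>R x0)"
  have p: "p \<noteq> 0" unfolding p_def by (rule avg_grad_nonzero)
  have N: "open ((UNIV :: (real^'m) set) \<times> {- S<..<0})" "(x0, t0) \<in> UNIV \<times> {- S<..<0}" using z0 by (auto intro!: open_Times)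
  note T = test_function_add[OF test_function_scale[OF heat_strip_test_function[OF th, of S], of "- b"] test_function_penalty_time[OF S(1), of 0 dl]]
  have gen: False if "0 \<le> P + (0 - d) + K" "Y \<le> Z" "0 < d" "P = Z" "K = Y - 2 * Z" for P d K Y Z :: real
   using that by linarith
  have touch: "\<forall>\<^sub>F z in nhds (x0, t0). - u z - (- b * heat th z + (0 * snd z + dl / (snd z + S)))
    \<le> - u (x0, t0) - (- b * heat th (x0, t0) + (0 * snd (x0, t0) + dl / (snd (x0, t0) + S)))"
   using z0(4) by eventually_elim (simp add: D_def algebra_simps)
  have "- b *\<^sub>R p + 0 \<noteq> 0" using b p by simp
  hence "0 \<le> (- b * (- (th / s) * trace X) + (0 - dl / (t0 + S)^2)) + ka * mcf_F (- b *\<^sub>R (1 / s) *\<^sub>R X + 0) (- b *\<^sub>R p + 0)"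
   using touched_aboveD[OF super N z0(3) T touch, unfolded regular_condition_def fst_conv snd_conv, folded s_def X_def p_def] by blast
  moreover have "mcf_F (- b *\<^sub>R (1 / s) *\<^sub>R X + 0) (- b *\<^sub>R p + 0) = (b / s) * (quad X p / (norm p)^2) - (b / s) * trace X"
  proof -
   have "- b *\<^sub>R (1 / s) *\<^sub>R X + 0 = (- (b / s)) *\<^sub>R X" by simp
   hence "mcf_F (- b *\<^sub>R (1 / s) *\<^sub>R X + 0) (- b *\<^sub>R p + 0) = - (b / s) * mcf_F X p"
    using mcf_F_scale[of "- b" "- (b / s)" X p] b by simp
   thus ?thesis by (simp add: mcf_F_def quad_def right_diff_distrib)
  qed
  ultimately have "0 \<le> - b * (- (th / s) * trace X) + (0 - dl / (t0 + S)^2) + ka * ((b / s) * (quad X p / (norm p)^2) - (b / s) * trace X)"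
   by (simp only:)
  moreover have "quad X p / (norm p)^2 \<le> trace X / 2"
   using avg_curvature[of "(1 / s) *\<^sub>R x0"] p by (simp add: X_def[symmetric] p_def[symmetric] divide_le_eq)
  hence "ka * (b / s) * (quad X p / (norm p)^2) \<le> ka * (b / s) * (trace X / 2)" using ka b s by (intro mult_left_mono) auto
  moreover have "0 < dl / (t0 + S)^2" using z0 by simp
  moreover have "- b * (- (th / s) * trace X) = ka * (b / s) * (trace X / 2)" by (simp add: th_def mult_ac)
  moreover have "ka * ((b / s) * (quad X p / (norm p)^2) - (b / s) * trace X) = ka * (b / s) * (quad X p / (norm p)^2) - 2 * (ka * (b / s) * (trace X / 2))"
   by (simp add: right_diff_distrib)
  ultimately show False by (rule gen)
 qed
 have "((\<lambda>b. b * heat th (x1, t1)) \<longlongrightarrow> c * heat th (x1, t1)) (at_left c)" by (intro tendsto_intros)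
 moreover have "\<forall>\<^sub>F b in at_left c. b * heat th (x1, t1) \<le> u (x1, t1)"
  using eventually_at_left_real[OF c] by eventually_elim (use main in auto)
 ultimately show ?thesis unfolding th_def[symmetric] by (intro tendsto_upperbound) auto
qed

end

section \<open>Orthonormal frames and the balancing of short vectors\<close>

definition orthonormal :: "'a::euclidean_space set => bool" where
 "orthonormal B \<longleftrightarrow> pairwise orthogonal B \<and> (\<forall>b\<in>B. norm b = 1)"

lemma orthonormal_inner: "orthonormal B ==> a \<in> B ==> b \<in> B ==> a \<bullet> b = (if a = b then 1 else 0)"
 by (auto simp: orthonormal_def pairwise_def orthogonal_def norm_eq_1)

lemma orthonormal_independent: "orthonormal B ==> independent B"
 by (rule pairwise_orthogonal_independent) (auto simp: orthonormal_def)

lemma orthonormal_finite: "orthonormal B ==> finite B"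
 using orthonormal_independent independent_imp_finite by blast

lemma orthonormal_insert:
 assumes "orthonormal B" "norm a = 1" "!!b. b \<in> B ==> orthogonal a b"
 shows "orthonormal (insert a B)"
 using assms by (auto simp: orthonormal_def pairwise_insert orthogonal_commute)

lemma orthonormal_expand:
 assumes "orthonormal B" "x \<in> span B"
 shows "(\<Sum>b\<in>B. (x \<bullet> b) *\<^sub>R b) = x"
proof -
 have fin: "finite B" using assms(1) by (rule orthonormal_finite)
 have "x - (\<Sum>b\<in>B. (x \<bullet> b) *\<^sub>R b) \<in> span B" by (intro span_diff assms(2) span_sum span_scale span_base)
 moreover have o: "orthogonal (x - (\<Sum>b\<in>B. (x \<bullet> b) *\<^sub>R b)) c" if "c \<in> B" for c
 proof -
  have "(\<Sum>b\<in>B. (x \<bullet> b) * (b \<bullet> c)) = (\<Sum>b\<in>B. if b = c then x \<bullet> c else 0)"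
   using orthonormal_inner[OF assms(1)] that by (intro sum.cong refl) auto
  thus ?thesis using that fin by (simp add: orthogonal_def inner_diff_left inner_sum_left)
 qed
 ultimately have "orthogonal (x - (\<Sum>b\<in>B. (x \<bullet> b) *\<^sub>R b)) (x - (\<Sum>b\<in>B. (x \<bullet> b) *\<^sub>R b))"
  by (rule orthogonal_to_span) (simp add: o)
 thus ?thesis by (simp add: orthogonal_self)
qed

lemma trace_orthonormal:
 fixes Q :: "real^'m^'m"
 assumes B: "orthonormal B" "span B = UNIV"
 shows "trace Q = (\<Sum>b\<in>B. quad Q b)"
proof -
 have "Q $ i $ i = (\<Sum>b\<in>B. b $ i * (Q *v b) $ i)" for i
 proof -
  have "Q $ i $ i = (Q *v (\<Sum>b\<in>B. (axis i 1 \<bullet> b) *\<^sub>R b)) $ i"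
   using orthonormal_expand[OF B(1), of "axis i 1"] B(2) by (simp add: matrix_vector_mult_basis column_def)
  also have "\<dots> = (\<Sum>b\<in>B. b $ i * (Q *v b) $ i)"
   by (simp add: linear_sum[OF matrix_vector_mul_linear] matrix_vector_mult_scaleR inner_axis')
  finally show ?thesis .
 qed
 hence "trace Q = (\<Sum>i\<in>UNIV. \<Sum>b\<in>B. b $ i * (Q *v b) $ i)" by (simp add: trace_def)
 also have "\<dots> = (\<Sum>b\<in>B. quad Q b)" by (subst sum.swap) (simp add: quad_def inner_vec_def mult.commute)
 finally show ?thesis .
qed

lemma orthonormal_span_UNIV:
 fixes B :: "'a::euclidean_space set"
 assumes "orthonormal B" "card B = DIM('a)"
 shows "span B = UNIV"
 using card_eq_dim[of B UNIV] orthonormal_independent[OF assms(1)] assms(2) orthonormal_finite[OF assms(1)] by auto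

lemma dim_orthogonal_complement:
 fixes B S :: "'a::euclidean_space set"
 assumes "orthonormal B" "subspace S" "B \<subseteq> S"
 shows "dim {y \<in> S. \<forall>b\<in>B. orthogonal b y} + card B = dim S"
proof -
 have "{y \<in> S. \<forall>b\<in>B. orthogonal b y} = {y \<in> S. \<forall>x\<in>span B. orthogonal x y}"
  using orthogonal_to_span orthogonal_commute by (metis (no_types, lifting) span_base)
 moreover have "dim (span B) = card B" using orthonormal_independent[OF assms(1)] by (simp add: dim_eq_card_independent)
 ultimately show ?thesis
  using dim_subspace_orthogonal_to_vectors[OF subspace_span assms(2) span_minimal[OF assms(3,2)]] by simp
qed

lemma orthonormal_extension:
 fixes B :: "'a::euclidean_space set"
 assumes B: "orthonormal B"
 obtains C where "B \<subseteq> C" "orthonormal C" "span C = UNIV"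
proof -
 let ?S = "{y \<in> UNIV. \<forall>b\<in>B. orthogonal b y}"
 have "subspace ?S" using subspace_orthogonal_to_vectors[of B] by simp
 then obtain D where D: "D \<subseteq> ?S" "pairwise orthogonal D" "!!x. x \<in> D ==> norm x = 1" "independent D" "card D = dim ?S" "span D = ?S"
  using orthonormal_basis_subspace by blast
 have BD: "orthogonal b y" "orthogonal y b" if "b \<in> B" "y \<in> D" for b y
  using D(1) that by (auto simp: orthogonal_commute)
 have o: "orthonormal (B \<union> D)"
  using B D(2,3) BD by (auto simp: orthonormal_def pairwise_def)
 have "B \<inter> D = {}" using B BD by (force simp: orthonormal_def orthogonal_self)
 hence "card (B \<union> D) = card B + card D" using orthonormal_finite[OF o] by (intro card_Un_disjoint) auto
 also have "\<dots> = DIM('a)" using dim_orthogonal_complement[OF B subspace_UNIV subset_UNIV] D(5) by simp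
 finally have "span (B \<union> D) = UNIV" by (rule orthonormal_span_UNIV[OF o])
 thus thesis using that o by blast
qed

text \<open>The first vector of the frame maximizes the quadratic form on the unit sphere of the subspace;
 the first order condition makes it conjugate to its orthogonal complement.\<close>

lemma conjugate_frame:
 fixes H :: "real^'m^'m"
 assumes sym: "transpose H = H"
 shows "subspace S ==> dim S = k ==> \<exists>B. B \<subseteq> S \<and> orthonormal B \<and> card B = k \<and> pairwise (\<lambda>a b. (H *v a) \<bullet> b = 0) B"
proof (induction k arbitrary: S)
 case 0
 thus ?case by (intro exI[of _ "{}"]) (auto simp: orthonormal_def)
next
 case (Suc k)
 have symH: "(H *v a) \<bullet> b = (H *v b) \<bullet> a" for a b
  using transpose_vec_inner[of H a b] unfolding sym by (simp add: inner_commute)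
 define K where "K = S \<inter> sphere 0 1"
 have "compact K" unfolding K_def using closed_subspace[OF Suc.prems(1)] by (intro closed_Int_compact) auto
 moreover have "K \<noteq> {}"
 proof -
  obtain x where "x \<in> S" "x \<noteq> 0" using Suc.prems by (metis dim_eq_0 nat.simps(3) subsetI singletonI)
  hence "x /\<^sub>R norm x \<in> K" using Suc.prems(1) by (auto simp: K_def subspace_scale)
  thus ?thesis by auto
 qed
 moreover have "continuous_on K (quad H)" unfolding quad_def by (intro continuous_intros)
 ultimately obtain b where b: "b \<in> K" "!!x. x \<in> K ==> quad H x \<le> quad H b"
  using continuous_attains_sup[of K "quad H"] by blast
 have bS: "b \<in> S" "norm b = 1" using b(1) by (auto simp: K_def)
 have ob: "orthonormal {b}" using bS by (simp add: orthonormal_def)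
 have le: "quad H x \<le> quad H b * (norm x)^2" if "x \<in> S" for x
 proof (cases "x = 0")
  case False
  have "quad H x = (norm x)^2 * quad H (x /\<^sub>R norm x)" using quad_scale[of H "norm x" "x /\<^sub>R norm x"] False by simp
  also have "\<dots> \<le> (norm x)^2 * quad H b"
   using that Suc.prems(1) False by (intro mult_left_mono b(2)) (auto simp: K_def subspace_scale)
  finally show ?thesis by (simp add: mult.commute)
 qed (simp add: quad_def)
 have conj: "(H *v b) \<bullet> v = 0" if v: "v \<in> S" "orthogonal b v" for v
 proof -
  define p q where "p = (H *v b) \<bullet> v" and "q = quad H b * (norm v)^2 - quad H v"
  have ineq: "2 * s * p \<le> s^2 * q" for s :: real
  proof -
   have "quad H (b + s *\<^sub>R v) \<le> quad H b * (norm (b + s *\<^sub>R v))^2"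
    using bS v(1) Suc.prems(1) by (intro le subspace_add subspace_scale) auto
   moreover have "(norm (b + s *\<^sub>R v))^2 = 1 + s^2 * (norm v)^2"
    using v(2) bS(2) unfolding power2_norm_eq_inner
    by (simp add: inner_add_left inner_add_right orthogonal_def inner_commute norm_eq_1 power2_eq_square)
   moreover have "quad H (b + s *\<^sub>R v) = quad H b + 2 * s * p + s^2 * quad H v"
    using symH[of v b] by (simp add: quad_def p_def matrix_vector_right_distrib matrix_vector_mult_scaleR inner_add_left inner_add_right power2_eq_square distrib_left)
   ultimately show ?thesis by (simp add: q_def algebra_simps)
  qed
  show "p = 0"
  proof (rule ccontr)
   assume p: "p \<noteq> 0"
   define r where "r = p / (\<bar>q\<bar> + 1)"
   have "2 * r * p \<le> r^2 * (\<bar>q\<bar> + 1)" using ineq[of r] by (smt (verit) mult_left_mono zero_le_power2)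
   also have "\<dots> = r * p" by (simp add: r_def power2_eq_square)
   finally have "r * p \<le> 0" by (simp add: mult.commute)
   moreover have "p * p > 0" using p by (auto simp: zero_less_mult_iff linorder_neq_iff)
   hence "r * p > 0" by (simp add: r_def add_nonneg_pos)
   ultimately show False by simp
  qed
 qed
 let ?S = "{y \<in> S. \<forall>c\<in>{b}. orthogonal c y}"
 have "subspace ?S" using Suc.prems(1) by (auto simp: subspace_def orthogonal_def inner_add_right)
 moreover have "dim ?S = k" using dim_orthogonal_complement[OF ob Suc.prems(1)] bS Suc.prems(2) by simp
 ultimately obtain B where B: "B \<subseteq> ?S" "orthonormal B" "card B = k" "pairwise (\<lambda>a b. (H *v a) \<bullet> b = 0) B"
  using Suc.IH by blast
 have "b \<notin> B" using B(1) bS by (auto simp: orthogonal_self)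
 moreover have "orthonormal (insert b B)" using B bS by (intro orthonormal_insert) auto
 moreover have "pairwise (\<lambda>a b. (H *v a) \<bullet> b = 0) (insert b B)"
  using B conj symH by (auto simp: pairwise_insert subset_iff)
 ultimately show ?case
  using B bS orthonormal_finite[OF B(2)] by (intro exI[of _ "insert b B"]) auto
qed

text \<open>A frame of the complement of \<open>d\<close> that diagonalizes \<open>H\<close> there.
  All cross terms vanish, so every choice of signs gives the trace of \<open>H\<close> on that
  complement and the minimizing player has no influence.\<close>

lemma tangential_frame:
 fixes H :: "real^'m^'m"
 assumes sym: "transpose H = H" and d: "norm d = 1"
 obtains B where "orthonormal B" "card B = CARD('m) - 1" "\<forall>b\<in>B. orthogonal d b" "d \<notin> B" "span (insert d B) = UNIV"
  "\<forall>s. (\<forall>b\<in>B. s b \<in> {-1, 1}) --> quad H (\<Sum>b\<in>B. s b *\<^sub>R b) = trace H - quad H d"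
proof -
 have od: "orthonormal {d}" using d by (simp add: orthonormal_def)
 let ?S = "{y \<in> UNIV. \<forall>c\<in>{d}. orthogonal c y}"
 have "subspace ?S" by (auto simp: subspace_def orthogonal_def inner_add_right)
 moreover have "dim ?S = CARD('m) - 1" using dim_orthogonal_complement[OF od subspace_UNIV subset_UNIV] by simp
 ultimately obtain B where B: "B \<subseteq> ?S" "orthonormal B" "card B = CARD('m) - 1" "pairwise (\<lambda>a b. (H *v a) \<bullet> b = 0) B"
  using conjugate_frame[OF sym] by blast
 have fin: "finite B" by (rule orthonormal_finite[OF B(2)])
 have dB: "d \<notin> B" using B(1) d by (auto simp: orthogonal_self)
 have od': "orthonormal (insert d B)" using B d by (intro orthonormal_insert) auto
 have sp: "span (insert d B) = UNIV" using dB fin B(3) by (intro orthonormal_span_UNIV[OF od']) (simp add: Suc_diff_1)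
 have "trace H = quad H d + (\<Sum>b\<in>B. quad H b)" using trace_orthonormal[OF od' sp, of H] dB fin by simp
 moreover have "quad H (\<Sum>b\<in>B. s b *\<^sub>R b) = (\<Sum>b\<in>B. quad H b)" if s: "!!b. b \<in> B ==> s b \<in> {-1, 1}" for s
 proof -
  have "quad H (\<Sum>b\<in>B. s b *\<^sub>R b) = (\<Sum>b\<in>B. \<Sum>a\<in>B. s a * s b * ((H *v a) \<bullet> b))"
   by (simp add: quad_def linear_sum[OF matrix_vector_mul_linear] matrix_vector_mult_scaleR inner_sum_left inner_sum_right sum_distrib_left mult_ac)
  also have "\<dots> = (\<Sum>b\<in>B. \<Sum>a\<in>B. if a = b then quad H a else 0)"
  proof (intro sum.cong refl)
   fix a b assume ab: "a \<in> B" "b \<in> B"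
   show "s a * s b * ((H *v a) \<bullet> b) = (if a = b then quad H a else 0)"
    using B(4) ab s[OF ab(1)] s[OF ab(2)] by (auto simp: pairwise_def quad_def)
  qed
  also have "\<dots> = (\<Sum>b\<in>B. quad H b)" using fin by simp
  finally show ?thesis .
 qed
 ultimately have "\<forall>s. (\<forall>b\<in>B. s b \<in> {-1, 1}) --> quad H (\<Sum>b\<in>B. s b *\<^sub>R b) = trace H - quad H d" by simp
 thus thesis using that[of B] B(1-3) dB sp by (auto simp: subset_iff)
qed

text \<open>For semidefinite \<open>Q\<close> this is the trace of \<open>Q\<close> compressed to
  \<open>span X\<close>; as a supremum over orthonormal sets it is monotone in \<open>X\<close> by
  construction.\<close>

definition span_trace :: "real^'m^'m => (real^'m) set => real" where
 "span_trace Q X = Sup {\<Sum>b\<in>B. quad Q b | B. orthonormal B \<and> B \<subseteq> span X}"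

text \<open>The signs are found by the Gram-Schmidt walk: the fractional signing \<open>x\<close> moves in the
 direction that changes \<open>A x\<close> only orthogonally to the span of the other alive columns, and
 of the two senses of this direction one does not increase the potential.\<close>

locale short_columns =
 fixes Q :: "real^'m^'m" and A :: "real^'n^'m"
 assumes psd: "!!a. 0 \<le> quad Q a" and Qsym: "transpose Q = Q" and A: "A \<in> short_column_matrices"
begin

lemma frame_le_trace:
 assumes "orthonormal B" shows "(\<Sum>b\<in>B. quad Q b) \<le> trace Q"
proof -
 obtain C where "B \<subseteq> C" "orthonormal C" "span C = UNIV" using orthonormal_extension[OF assms] .
 thus ?thesis using psd orthonormal_finite[of C] by (auto simp: trace_orthonormal intro!: sum_mono2)
qed

lemma span_trace_bdd: "bdd_above {\<Sum>b\<in>B. quad Q b | B. orthonormal B \<and> B \<subseteq> span X}"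
 using frame_le_trace by (intro bdd_aboveI[of _ "trace Q"]) auto

lemma span_trace_ge: "orthonormal B ==> B \<subseteq> span X ==> (\<Sum>b\<in>B. quad Q b) \<le> span_trace Q X"
 unfolding span_trace_def by (intro cSup_upper span_trace_bdd) auto

lemma span_trace_le: "(!!B. orthonormal B ==> B \<subseteq> span X ==> (\<Sum>b\<in>B. quad Q b) \<le> c) ==> span_trace Q X \<le> c"
 unfolding span_trace_def by (intro cSup_least) (auto intro!: exI[of _ "{}"] simp: orthonormal_def)

lemma span_trace_mono: "X \<subseteq> Y ==> span_trace Q X \<le> span_trace Q Y"
 by (intro span_trace_le span_trace_ge) (use span_mono in blast)+

lemma span_trace_nonneg: "0 \<le> span_trace Q X"
 using span_trace_ge[of "{}" X] by (simp add: orthonormal_def)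

text \<open>Stretching \<open>w\<close> to unit length can only increase its form because
  \<open>Q\<close> is semidefinite, and the unit vector extends every frame of \<open>span X\<close>
  to one inside \<open>span Y\<close>.\<close>

lemma span_trace_insert:
 assumes w: "w \<in> span Y" "norm w \<le> 1" "!!z. z \<in> span X ==> orthogonal w z" and XY: "X \<subseteq> Y"
 shows "span_trace Q X + quad Q w \<le> span_trace Q Y"
proof (cases "w = 0")
 case True
 thus ?thesis using span_trace_mono[OF XY] by (simp add: quad_def)
next
 case False
 define a where "a = w /\<^sub>R norm w"
 have a: "norm a = 1" "w = norm w *\<^sub>R a" using False by (auto simp: a_def)
 have "quad Q w = (norm w)^2 * quad Q a" using a(2) quad_scale by metis
 also have "\<dots> \<le> 1 * quad Q a" using w(2) psd by (intro mult_right_mono) (auto simp: power_le_one)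
 finally have qa: "quad Q w \<le> quad Q a" by simp
 have "span_trace Q X \<le> span_trace Q Y - quad Q a"
 proof (rule span_trace_le)
  fix B assume B: "orthonormal B" "B \<subseteq> span X"
  have ort: "orthogonal a b" if "b \<in> B" for b using w(3)[of b] that B by (auto simp: a_def orthogonal_def)
  hence "a \<notin> B" using a(1) ort[of a] by (auto simp: orthogonal_self)
  moreover have "(\<Sum>b\<in>insert a B. quad Q b) \<le> span_trace Q Y"
   using B a(1) ort w(1) span_mono[OF XY] by (intro span_trace_ge orthonormal_insert) (auto simp: a_def span_scale)
  ultimately show "(\<Sum>b\<in>B. quad Q b) \<le> span_trace Q Y - quad Q a"
   using orthonormal_finite[OF B(1)] by simp
 qed
 thus ?thesis using qa by simp
qed

definition alive :: "'n set => (real^'m) set" where "alive S = (\<lambda>j. column j A) ` S"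

text \<open>\<open>A *v u\<close> is the part of column \<open>i\<close> orthogonal to the other
  alive columns. Its length is at most one, so its form is paid for by the loss of trace when
  \<open>i\<close> dies.\<close>

lemma walk_direction:
 assumes i: "i \<in> S"
 obtains u where "u $ i = 1" "!!j. j \<notin> S ==> u $ j = 0"
  "quad Q (A *v u) \<le> span_trace Q (alive S) - span_trace Q (alive (S - {i}))"
proof -
 obtain y z where yz: "y \<in> span (alive (S - {i}))" "!!w. w \<in> span (alive (S - {i})) ==> orthogonal z w" "column i A = y + z"
  using orthogonal_subspace_decomp_exists[of "alive (S - {i})" "column i A"] by metis
 have "span (alive (S - {i})) \<subseteq> (\<lambda>c. A *v c) ` {c. \<forall>j. j \<notin> S - {i} --> c $ j = 0}"
 proof (rule span_minimal)
  show "alive (S - {i}) \<subseteq> (\<lambda>c. A *v c) ` {c. \<forall>j. j \<notin> S - {i} --> c $ j = 0}"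
  proof
   fix w assume "w \<in> alive (S - {i})"
   then obtain j where j: "j \<in> S - {i}" "w = column j A" by (auto simp: alive_def)
   hence "w = A *v axis j 1" by (simp add: matrix_vector_mult_basis)
   thus "w \<in> (\<lambda>c. A *v c) ` {c. \<forall>j. j \<notin> S - {i} --> c $ j = 0}"
    using j(1) by (intro image_eqI) (auto simp: axis_def)
  qed
  show "subspace ((\<lambda>c. A *v c) ` {c. \<forall>j. j \<notin> S - {i} --> c $ j = 0})"
   by (intro linear_subspace_image matrix_vector_mul_linear) (auto simp: subspace_def)
 qed
 then obtain c where c: "y = A *v c" "!!j. j \<notin> S - {i} ==> c $ j = 0" using yz(1) by auto
 define u where "u = axis i 1 - c"
 have Au: "A *v u = z" using yz(3) c(1) by (simp add: u_def matrix_vector_mult_diff_distrib matrix_vector_mult_basis)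
 have sub: "alive (S - {i}) \<subseteq> alive S" by (auto simp: alive_def)
 have "column i A \<in> span (alive S)" using i by (auto simp: alive_def intro: span_base)
 hence "column i A - y \<in> span (alive S)" using yz(1) span_mono[OF sub] by (intro span_diff) auto
 hence z1: "z \<in> span (alive S)" using yz(3) by simp
 have "(norm (column i A))^2 = (norm y)^2 + (norm z)^2"
  unfolding yz(3) using yz(2)[OF yz(1)] by (intro norm_add_Pythagorean) (simp add: orthogonal_commute)
 moreover have "norm (column i A) \<le> 1" using A by (simp add: short_column_matrices_def)
 hence "(norm (column i A))^2 \<le> 1" by (simp add: power_le_one)
 ultimately have "(norm z)^2 \<le> 1^2" using zero_le_power2[of "norm y"] unfolding one_power2 by linarith
 hence z2: "norm z \<le> 1" by (rule power2_le_imp_le) simp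
 show thesis
 proof (rule that[of u])
  show "u $ i = 1" using c(2)[of i] by (simp add: u_def)
  show "u $ j = 0" if "j \<notin> S" for j using c(2)[of j] that i by (auto simp: u_def axis_def)
  show "quad Q (A *v u) \<le> span_trace Q (alive S) - span_trace Q (alive (S - {i}))"
   using span_trace_insert[OF z1 z2 yz(2) sub] unfolding Au by simp
 qed
qed

lemma walk_hits_boundary:
 fixes x u :: "real^'n"
 assumes x: "!!j. \<bar>x $ j\<bar> \<le> 1" and S: "!!j. j \<in> S ==> \<bar>x $ j\<bar> < 1" and u: "!!j. j \<notin> S ==> u $ j = 0" and i: "i \<in> S" "u $ i \<noteq> 0"
 obtains dl k where "0 \<le> dl" "!!j. \<bar>(x + dl *\<^sub>R u) $ j\<bar> \<le> 1" "k \<in> S" "\<bar>(x + dl *\<^sub>R u) $ k\<bar> = 1"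
proof -
 \<comment> \<open>The time at which coordinate \<open>j\<close>, moving along \<open>u\<close>,
   reaches the face of the cube that \<open>u\<close> points to.\<close>
 define h where "h j = (1 - sgn (u $ j) * x $ j) / \<bar>u $ j\<bar>" for j
 define T where "T = {j. u $ j \<noteq> 0}"
 have T: "T \<subseteq> S" "i \<in> T" using u i by (auto simp: T_def)
 have pos: "0 < h j" if "j \<in> T" for j
 proof -
  have "\<bar>sgn (u $ j) * x $ j\<bar> < 1" using S[of j] that T by (auto simp: T_def abs_mult sgn_if)
  thus ?thesis using that by (simp add: h_def T_def)
 qed
 have "finite (h ` T)" "h ` T \<noteq> {}" using T by auto
 define dl where "dl = Min (h ` T)"
 have "dl \<in> h ` T" unfolding dl_def using T by (intro Min_in) auto
 then obtain k where k: "k \<in> T" "dl = h k" by auto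
 have le: "dl \<le> h j" if "j \<in> T" for j unfolding dl_def using that by (intro Min_le) auto
 show thesis
 proof (rule that[of dl k])
  show d: "0 \<le> dl" using pos[OF k(1)] k(2) by simp
  show "k \<in> S" using k T by auto
  have su: "sgn (u $ j) * (x + dl *\<^sub>R u) $ j = sgn (u $ j) * x $ j + dl * \<bar>u $ j\<bar>" for j
   by (simp add: sgn_if algebra_simps)
  have ab: "\<bar>y\<bar> = \<bar>sgn (u $ j) * y\<bar>" if "j \<in> T" for j y using that by (auto simp: T_def sgn_if)
  have "dl * \<bar>u $ k\<bar> = 1 - sgn (u $ k) * x $ k" using k by (simp add: h_def T_def)
  hence "sgn (u $ k) * (x + dl *\<^sub>R u) $ k = 1" unfolding su by simp
  thus "\<bar>(x + dl *\<^sub>R u) $ k\<bar> = 1" using ab[OF k(1), of "(x + dl *\<^sub>R u) $ k"] by linarith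
  show "\<bar>(x + dl *\<^sub>R u) $ j\<bar> \<le> 1" for j
  proof (cases "j \<in> T")
   case True
   have "dl * \<bar>u $ j\<bar> \<le> h j * \<bar>u $ j\<bar>" using le[OF True] by (intro mult_right_mono) auto
   also have "\<dots> = 1 - sgn (u $ j) * x $ j" using True by (simp add: h_def T_def)
   finally have "sgn (u $ j) * (x + dl *\<^sub>R u) $ j \<le> 1" unfolding su by simp
   moreover have "\<bar>sgn (u $ j) * x $ j\<bar> \<le> 1" using x[of j] by (simp add: abs_mult sgn_if)
   hence "- 1 \<le> sgn (u $ j) * (x + dl *\<^sub>R u) $ j" unfolding su using d
    by (smt (verit) mult_nonneg_nonneg abs_ge_zero)
   ultimately show ?thesis using ab[OF True, of "(x + dl *\<^sub>R u) $ j"] by linarith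
  qed (use x in \<open>simp add: T_def\<close>)
 qed
qed

text \<open>An interpolation for the pivot \<open>i\<close>: its share of the trace is fully
  available at \<open>x $ i = 0\<close> and used up when \<open>x $ i\<close> reaches
  \<open>1\<close> or \<open>- 1\<close>.\<close>

definition potential :: "'n set => 'n => real^'n => real" where
 "potential S i x = (x $ i)^2 * span_trace Q (alive (S - {i})) + (1 - (x $ i)^2) * span_trace Q (alive S)"

lemma potential_eq: "potential S i x = span_trace Q (alive S) - (x $ i)^2 * (span_trace Q (alive S) - span_trace Q (alive (S - {i})))"
 by (simp add: potential_def algebra_simps)

lemma alive_mono: "S \<subseteq> T ==> span_trace Q (alive S) \<le> span_trace Q (alive T)"
 by (rule span_trace_mono) (auto simp: alive_def)

lemma potential_mono:
 assumes "S \<subseteq> T" "\<bar>x $ i\<bar> \<le> 1" shows "potential S i x \<le> potential T i x"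
proof -
 have "(x $ i)^2 \<le> 1" using assms(2) by (simp add: abs_square_le_1)
 thus ?thesis unfolding potential_def using assms(1) by (intro add_mono mult_left_mono alive_mono) auto
qed

lemma potential_le: "potential S i x \<le> span_trace Q (alive S)"
 unfolding potential_eq using alive_mono[of "S - {i}" S] by simp

text \<open>The linear term \<open>b\<close> is what makes the induction work: it collects the cross
  terms that completed moves leave in the quadratic form. A move ends when some coordinate is
  frozen; if it is the pivot, a new pivot starts with the trace that remains.\<close>

lemma walk:
 assumes "card S = k" "!!j. \<bar>x $ j\<bar> \<le> 1" "!!j. j \<notin> S ==> \<bar>x $ j\<bar> = 1" "i \<in> S"
 shows "\<exists>e\<in>sign_vectors. quad Q (A *v (e - x)) + b \<bullet> (e - x) \<le> potential S i x"
 using assms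
proof (induction k arbitrary: S i x b)
 case 0
 thus ?case by (simp add: card_eq_0_iff)
next
 case (Suc k)
 have freeze: "\<exists>e\<in>sign_vectors. quad Q (A *v (e - y)) + c \<bullet> (e - y) \<le> potential S i y"
  if y: "!!j. \<bar>y $ j\<bar> \<le> 1" "!!j. j \<notin> S ==> \<bar>y $ j\<bar> = 1" and l: "l \<in> S" "\<bar>y $ l\<bar> = 1" for y c l
 proof -
  have card: "card (S - {l}) = k" using Suc.prems(1) l(1) by simp
  have off: "\<bar>y $ j\<bar> = 1" if "j \<notin> S - {l}" for j using y(2) l(2) that by auto
  show ?thesis
  proof (cases "l = i")
   case False
   then obtain e where "e \<in> sign_vectors" "quad Q (A *v (e - y)) + c \<bullet> (e - y) \<le> potential (S - {l}) i y"
    using Suc.IH[OF card y(1) off, of i c] Suc.prems(4) by auto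
   thus ?thesis using potential_mono[of "S - {l}" S y i] y(1) by (intro bexI[of _ e]) auto
  next
   case True
   have "(y $ i)^2 = 1" using l(2) True by (simp add: power2_eq_1_iff abs_if split: if_splits)
   hence pot: "potential S i y = span_trace Q (alive (S - {i}))" by (simp add: potential_def)
   show ?thesis
   proof (cases "S - {l} = {}")
    case True
    have "\<bar>y $ j\<bar> = \<bar>1\<bar>" for j using off[of j] True by auto
    hence "y \<in> sign_vectors" unfolding abs_eq_iff by (auto simp: sign_vectors_def)
    thus ?thesis using span_trace_nonneg by (intro bexI[of _ y]) (auto simp: pot quad_def)
   next
    case False
    then obtain i' where i': "i' \<in> S - {l}" by auto
    then obtain e where "e \<in> sign_vectors" "quad Q (A *v (e - y)) + c \<bullet> (e - y) \<le> potential (S - {l}) i' y"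
     using Suc.IH[OF card y(1) off, of i' c] by auto
    thus ?thesis using potential_le[of "S - {l}" i' y] \<open>l = i\<close> by (intro bexI[of _ e]) (auto simp: pot)
   qed
  qed
 qed
 show ?case
 proof (cases "\<exists>l\<in>S. \<bar>x $ l\<bar> = 1")
  case True
  thus ?thesis using freeze[of x _ b] Suc.prems by blast
 next
  case False
  hence int: "\<bar>x $ j\<bar> < 1" if "j \<in> S" for j using Suc.prems(2)[of j] that by (meson order_le_less)
  obtain u where u: "u $ i = 1" "!!j. j \<notin> S ==> u $ j = 0"
   "quad Q (A *v u) \<le> span_trace Q (alive S) - span_trace Q (alive (S - {i}))" using walk_direction[OF Suc.prems(4)] by blast
  define G where "G = span_trace Q (alive S) - span_trace Q (alive (S - {i}))"
  \<comment> \<open>The balance, to first order in the step \<open>s\<close>, between the linear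
    term and the potential released by the pivot; the sense \<open>ta\<close> makes it nonpositive.
    The terms in \<open>s^2\<close> balance by the choice of \<open>u\<close>.\<close>
  define m where "m = b \<bullet> u - 2 * (x $ i) * G"
  define ta where "ta = (if m \<le> 0 then 1 else - 1 :: real)"
  have ta: "ta * m \<le> 0" "ta^2 = 1" "ta \<noteq> 0" by (auto simp: ta_def)
  obtain dl l where dl: "0 \<le> dl" "!!j. \<bar>(x + dl *\<^sub>R (ta *\<^sub>R u)) $ j\<bar> \<le> 1" "l \<in> S" "\<bar>(x + dl *\<^sub>R (ta *\<^sub>R u)) $ l\<bar> = 1"
   by (rule walk_hits_boundary[OF Suc.prems(2) int, where u = "ta *\<^sub>R u" and i = i]) (use u ta Suc.prems(4) in auto)
  define s where "s = dl * ta"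
  define y where "y = x + s *\<^sub>R u"
  have y: "y = x + dl *\<^sub>R (ta *\<^sub>R u)" by (simp add: y_def s_def)
  have yoff: "\<bar>y $ j\<bar> = 1" if "j \<notin> S" for j using Suc.prems(3)[OF that] u(2)[OF that] by (simp add: y_def)
  \<comment> \<open>The product of this move with the rest of the walk is linear in the rest, so it
    joins the linear functional.\<close>
  define c where "c = b + (2 * s) *\<^sub>R (transpose A *v (Q *v (A *v u)))"
  obtain e where e: "e \<in> sign_vectors" "quad Q (A *v (e - y)) + c \<bullet> (e - y) \<le> potential S i y"
   using freeze[OF dl(2)[folded y] yoff dl(3) dl(4)[folded y], of c] by blast
  have ex: "e - x = (e - y) + s *\<^sub>R u" by (simp add: y_def)
  have cc: "c \<bullet> (e - y) = b \<bullet> (e - y) + 2 * s * ((Q *v (A *v u)) \<bullet> (A *v (e - y)))"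
   by (simp add: c_def inner_add_left transpose_vec_inner del: transpose_matrix_vector)
  have symQ: "(Q *v p) \<bullet> q = (Q *v q) \<bullet> p" for p q
   using transpose_vec_inner[of Q p q] unfolding Qsym by (simp add: inner_commute)
  have "quad Q (A *v (e - x)) = quad Q (A *v (e - y)) + 2 * s * ((Q *v (A *v u)) \<bullet> (A *v (e - y))) + s^2 * quad Q (A *v u)"
   unfolding ex using symQ[of "A *v (e - y)" "A *v u"]
   by (simp add: quad_def matrix_vector_right_distrib matrix_vector_mult_scaleR inner_add_left inner_add_right power2_eq_square distrib_left)
  moreover have "b \<bullet> (e - x) = b \<bullet> (e - y) + s * (b \<bullet> u)" unfolding ex by (simp add: inner_add_right)
  moreover have "potential S i y = potential S i x - (2 * (x $ i) * s + s^2) * G"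
   unfolding potential_eq G_def[symmetric] by (simp add: y_def u(1) power2_eq_square algebra_simps)
  moreover have "s^2 * quad Q (A *v u) \<le> s^2 * G" using u(3) by (intro mult_left_mono) (auto simp: G_def)
  moreover have "s * (b \<bullet> u) - 2 * (x $ i) * s * G \<le> 0"
  proof -
   have "s * (b \<bullet> u) - 2 * (x $ i) * s * G = dl * (ta * m)" by (simp add: m_def s_def algebra_simps)
   also have "\<dots> \<le> 0" using dl(1) ta(1) by (simp add: mult_nonneg_nonpos)
   finally show ?thesis .
  qed
  moreover have "(2 * (x $ i) * s + s^2) * G = 2 * (x $ i) * s * G + s^2 * G" by (simp add: distrib_right)
  ultimately have "quad Q (A *v (e - x)) + b \<bullet> (e - x) \<le> potential S i x"
   using e(2) cc by linarith
  thus ?thesis using e(1) by blast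
 qed
qed

theorem balanced_signs: "\<exists>e\<in>sign_vectors. quad Q (A *v e) \<le> trace Q"
proof -
 obtain i :: 'n where True by simp
 obtain e where "e \<in> sign_vectors" "quad Q (A *v e) \<le> potential UNIV i 0"
  using walk[of UNIV _ 0 i 0] by auto
 moreover have "potential UNIV i 0 \<le> trace Q"
  by (rule order_trans[OF potential_le span_trace_le]) (rule frame_le_trace)
 ultimately show ?thesis by (intro bexI[of _ e]) auto
qed

end

section \<open>Level set solutions of the mean curvature flow\<close>

lemma mcf_F_diff: "mcf_F A p - mcf_F H p = mcf_F (A - H) p"
 by (simp add: mcf_F_def trace_sub matrix_vector_mult_diff_rdistrib inner_diff_left diff_divide_distrib)

lemma mcf_F_bound:
 obtains K where "0 < K" "!!D p. \<bar>mcf_F (D :: real^'m^'m) p\<bar> \<le> K * norm D"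
proof -
 obtain k where k: "0 < k" "!!(A :: real^'m^'m) x. norm (A *v x) \<le> norm A * norm x * k"
  using bounded_bilinear.pos_bounded[OF bounded_bilinear_matrix_vector_mult] by blast
 have "\<bar>mcf_F D p\<bar> \<le> (CARD('m) + k) * norm D" for D :: "real^'m^'m" and p
 proof -
  have "\<bar>D $ i $ i\<bar> \<le> norm D" for i
   using component_le_norm_cart[of "D $ i" i] Finite_Cartesian_Product.norm_nth_le[of D i] by linarith
  hence t: "\<bar>trace D\<bar> \<le> CARD('m) * norm D"
   unfolding trace_def by (intro order_trans[OF sum_abs] sum_bounded_above[THEN order_trans]) auto
  have "\<bar>(D *v p) \<bullet> p\<bar> \<le> norm (D *v p) * norm p" by (rule Cauchy_Schwarz_ineq2)
  also have "\<dots> \<le> (norm D * norm p * k) * norm p" by (intro mult_right_mono k) auto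
  finally have "\<bar>(D *v p) \<bullet> p\<bar> \<le> (k * norm D) * (norm p)^2" by (simp add: power2_eq_square mult_ac)
  hence "\<bar>((D *v p) \<bullet> p) / (norm p)^2\<bar> \<le> k * norm D"
   using k(1) by (cases "p = 0") (auto simp: pos_divide_le_eq)
  thus ?thesis using t unfolding mcf_F_def distrib_right by linarith
 qed
 moreover have "0 < CARD('m) + k" using k(1) by simp
 ultimately show thesis by (rule that[rotated])
qed

text \<open>\<open>mcf_F\<close> is Lipschitz in the matrix uniformly in the direction. Near
  \<open>H\<close> only the direction of \<open>p\<close> remains free in the envelopes.\<close>

lemma mcf_F_near:
 fixes H :: "real^'m^'m"
 assumes "0 < e"
 shows "\<forall>\<^sub>F (A, p) in mcf_approach H g. p \<noteq> 0 \<and> \<bar>mcf_F A p - mcf_F H p\<bar> < e"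
proof -
 obtain K where K: "0 < K" "!!D p. \<bar>mcf_F (D :: real^'m^'m) p\<bar> \<le> K * norm D" using mcf_F_bound[where 'm = 'm] by blast
 have "\<forall>\<^sub>F z in nhds (H, g). z \<in> ball H (e / K) \<times> UNIV"
  using assms K by (intro eventually_nhds_in_open open_Times) auto
 hence "\<forall>\<^sub>F z in nhds (H, g). z \<in> {(A', p'). transpose A' = A' \<and> p' \<noteq> 0} --> (case z of (A, p) => p \<noteq> 0 \<and> \<bar>mcf_F A p - mcf_F H p\<bar> < e)"
 proof eventually_elim
  case (elim z)
  obtain A p where z: "z = (A, p)" by (cases z)
  have "norm (A - H) < e / K" using elim by (simp add: z dist_norm norm_minus_commute)
  hence "K * norm (A - H) < e" using K(1) by (simp add: field_simps)
  hence "\<bar>mcf_F A p - mcf_F H p\<bar> < e" unfolding mcf_F_diff using K(2)[of "A - H" p] by linarith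
  thus ?case by (simp add: z)
 qed
 thus ?thesis unfolding mcf_approach_def eventually_inf_principal .
qed

lemma mcf_F_upper_le:
 assumes "!!p. p \<noteq> 0 ==> mcf_F H p \<le> c"
 shows "mcf_F_upper H g \<le> ereal c"
proof (rule ereal_le_epsilon2)
 fix e :: real assume e: "0 < e"
 have "\<forall>\<^sub>F z in mcf_approach H g. (case z of (A, p) => ereal (mcf_F A p)) \<le> ereal (c + e)"
  using mcf_F_near[OF e, of H g]
 proof eventually_elim
  case (elim z)
  thus ?case using assms[of "snd z"] by (cases z) (auto simp: abs_less_iff)
 qed
 thus "mcf_F_upper H g \<le> ereal c + ereal e" unfolding mcf_F_upper_def using Limsup_bounded by fastforce
qed

lemma mcf_F_upper_regular:
 assumes g: "g \<noteq> 0"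
 shows "mcf_F_upper H g \<le> ereal (mcf_F H g)"
proof (rule ereal_le_epsilon2)
 fix e :: real assume e: "0 < e"
 have "((\<lambda>z. mcf_F (fst z) (snd z)) \<longlongrightarrow> mcf_F (fst (H, g)) (snd (H, g))) (nhds (H, g))"
  unfolding mcf_F_def trace_def using g by (intro tendsto_intros tendsto_fst[OF filterlim_ident] tendsto_snd[OF filterlim_ident]) (auto intro: filterlim_ident)
 hence "\<forall>\<^sub>F z in nhds (H, g). mcf_F (fst z) (snd z) < mcf_F H g + e" using e by (intro order_tendstoD(2)) auto
 hence "\<forall>\<^sub>F z in mcf_approach H g. (case z of (A, p) => ereal (mcf_F A p)) \<le> ereal (mcf_F H g + e)"
  unfolding mcf_approach_def eventually_inf_principal by eventually_elim auto
 thus "mcf_F_upper H g \<le> ereal (mcf_F H g) + ereal e" unfolding mcf_F_upper_def using Limsup_bounded by fastforce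
qed

text \<open>\<open>mcf_F\<close> is odd when both arguments change sign, and this change of sign
  preserves the approach filter. Supersolutions thereby become negatives of subsolutions.\<close>

lemma mcf_F_lower_minus: "mcf_F_lower (- H) (- g) = - mcf_F_upper H g"
proof -
 have t: "transpose (- A) = - transpose A" for A :: "real^'m^'m" by (simp add: transpose_def vec_eq_iff)
 have le: "filtermap uminus (mcf_approach A p) \<le> mcf_approach (- A) (- p)" for A :: "real^'m^'m" and p
  unfolding mcf_approach_def filterlim_def[symmetric]
 proof (rule filterlim_inf[THEN iffD2], rule conjI)
  show "filterlim uminus (nhds (- A, - p)) (inf (nhds (A, p)) (principal {(A', p'). transpose A' = A' \<and> p' \<noteq> 0}))"
   by (rule filterlim_mono[OF _ order_refl inf_le1]) (use tendsto_minus[OF filterlim_ident, of "(A, p)"] in simp)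
  show "filterlim uminus (principal {(A', p'). transpose A' = A' \<and> p' \<noteq> 0}) (inf (nhds (A, p)) (principal {(A', p'). transpose A' = A' \<and> p' \<noteq> 0}))"
   by (rule filterlim_mono[OF _ order_refl inf_le2]) (auto simp: filterlim_principal eventually_principal t)
 qed
 have "filtermap uminus (filtermap uminus (mcf_approach (- H) (- g))) \<le> filtermap uminus (mcf_approach H g)"
  using filtermap_mono[OF le[of "- H" "- g"]] by simp
 hence eq: "mcf_approach (- H) (- g) = filtermap uminus (mcf_approach H g)"
  using le[of H g] by (intro antisym) (simp_all add: filtermap_filtermap)
 have e: "(\<lambda>z. case - z of (A :: real^'m^'m, p) => ereal (mcf_F A p)) = (\<lambda>z. - (case z of (A, p) => ereal (mcf_F A p)))"
  by (rule ext) (use mcf_F_scale[of "- 1" "- 1" "fst z" "snd z" for z] in \<open>simp add: case_prod_unfold\<close>)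
 show ?thesis unfolding mcf_F_lower_def mcf_F_upper_def eq Liminf_filtermap_eq[OF inj_uminus] e by (rule ereal_Liminf_uminus)
qed

definition mcf_condition :: "real => real^'m => real^'m^'m => bool" where
 "mcf_condition a p X \<longleftrightarrow> 0 \<le> ereal a + mcf_F_upper X p"

lemma mcf_subsolution_iff: "mcf_subsolution u \<longleftrightarrow> usc_on (UNIV \<times> {..0}) u \<and> touched_above mcf_condition u"
 by (simp add: mcf_subsolution_def touched_above_def mcf_condition_def)

lemma test_function_minus:
 "is_test_function N (\<lambda>z. - ph z) (\<lambda>z. - pht z) (\<lambda>z. - g z) (\<lambda>z. - H z) \<longleftrightarrow> is_test_function N ph pht g H"
 using test_function_scale[of N ph pht g H "- 1"] test_function_scale[of N "\<lambda>z. - ph z" "\<lambda>z. - pht z" "\<lambda>z. - g z" "\<lambda>z. - H z" "- 1"] by auto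

lemma mcf_supersolution_iff: "mcf_supersolution u \<longleftrightarrow> mcf_subsolution (\<lambda>z. - u z)"
proof -
 have cond: "ereal (- a) + mcf_F_lower (- X) (- p) \<le> 0 \<longleftrightarrow> mcf_condition a p X" for a X p
  unfolding mcf_F_lower_minus mcf_condition_def by (cases "mcf_F_upper X p") auto
 have ev: "(\<forall>\<^sub>F z in F. u z0 - - ph z0 \<le> u z - - ph z) \<longleftrightarrow> (\<forall>\<^sub>F z in F. - u z - ph z \<le> - u z0 - ph z0)" for F ph z0
  by (rule arg_cong[of _ _ "\<lambda>P. eventually P F"]) (auto simp: fun_eq_iff)
 have "touched_above mcf_condition (\<lambda>z. - u z)" if super: "mcf_supersolution u"
  unfolding touched_above_def
 proof (intro allI impI)
  fix N ph pht g H x0 t0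
  assume "open N \<and> (x0, t0) \<in> N \<and> t0 < 0 \<and> is_test_function N ph pht g H \<and> (\<forall>\<^sub>F z in nhds (x0, t0). - u z - ph z \<le> - u (x0, t0) - ph (x0, t0))"
  thus "mcf_condition (pht (x0, t0)) (g (x0, t0)) (H (x0, t0))"
   using conjunct2[OF super[unfolded mcf_supersolution_def], rule_format, of N x0 t0 "\<lambda>z. - ph z" "\<lambda>z. - pht z" "\<lambda>z. - g z" "\<lambda>z. - H z"]
   unfolding test_function_minus ev cond by blast
 qed
 moreover have "mcf_supersolution u" if lsc: "lsc_on (UNIV \<times> {..0}) u" and u: "touched_above mcf_condition (\<lambda>z. - u z)"
  unfolding mcf_supersolution_def
 proof (intro conjI lsc allI impI)
  fix N ph pht g H x0 t0
  assume a: "open N \<and> (x0, t0) \<in> N \<and> t0 < 0 \<and> is_test_function N ph pht g H \<and> (\<forall>\<^sub>F z in nhds (x0, t0). u (x0, t0) - ph (x0, t0) \<le> u z - ph z)"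
  hence "mcf_condition (- pht (x0, t0)) (- g (x0, t0)) (- H (x0, t0))"
   using ev[of "(x0, t0)" "\<lambda>z. - ph z"]
   by (intro touched_aboveD[where ph = "\<lambda>z. - ph z" and pht = "\<lambda>z. - pht z" and g = "\<lambda>z. - g z" and H = "\<lambda>z. - H z", OF u])
    (auto simp: test_function_minus)
  thus "ereal (pht (x0, t0)) + mcf_F_lower (H (x0, t0)) (g (x0, t0)) \<le> 0" unfolding cond[symmetric] by simp
 qed
 ultimately show ?thesis unfolding mcf_subsolution_iff usc_on_minus_iff by (auto simp: mcf_supersolution_def)
qed

text \<open>The envelope is attained along \<open>g + s nu\<close>, \<open>s \<rightarrow> 0\<close>, which also covers \<open>g = 0\<close>.\<close>

lemma mcf_F_upper_direction:
 assumes "transpose H = H" "norm nu = 1" "g = c *\<^sub>R nu"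
 shows "ereal (mcf_F H nu) \<le> mcf_F_upper H g"
 unfolding mcf_F_upper_def Limsup_def
proof (rule INF_greatest)
 fix P assume P: "P \<in> {P. eventually P (mcf_approach H g)}"
 have nu: "nu \<noteq> 0" using assms(2) by auto
 have "\<forall>\<^sub>F z in nhds (H, g). z \<in> {(A', p'). transpose A' = A' \<and> p' \<noteq> 0} --> P z"
  using P unfolding mcf_approach_def mem_Collect_eq eventually_inf_principal .
 moreover have "filterlim (\<lambda>s. (H, (c + s) *\<^sub>R nu)) (nhds (H, (c + 0) *\<^sub>R nu)) (at (0::real))"
  by (intro tendsto_intros)
 ultimately have "\<forall>\<^sub>F s in at (0::real). (H, (c + s) *\<^sub>R nu) \<in> {(A', p'). transpose A' = A' \<and> p' \<noteq> 0} --> P (H, (c + s) *\<^sub>R nu)"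
  unfolding assms(3) filterlim_iff add_0_right by blast
 moreover have "\<forall>\<^sub>F s in at (0::real). c + s \<noteq> 0"
 proof (cases "c = 0")
  case True
  thus ?thesis by (simp add: eventually_at_filter)
 next
  case False
  have "((\<lambda>s. c + s) \<longlongrightarrow> c + 0) (at 0)" by (intro tendsto_intros)
  thus ?thesis using False by (intro tendsto_imp_eventually_ne) auto
 qed
 ultimately have "\<forall>\<^sub>F s in at (0::real). P (H, (c + s) *\<^sub>R nu) \<and> c + s \<noteq> 0"
  by eventually_elim (use assms(1) nu in auto)
 then obtain s where s: "P (H, (c + s) *\<^sub>R nu)" "c + s \<noteq> 0" using eventually_happens[of _ "at (0::real)"] by auto
 have "mcf_F H ((c + s) *\<^sub>R nu) = mcf_F H nu"
  using s(2) mcf_F_scale[of "c + s" 1 H nu] by simp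
 thus "ereal (mcf_F H nu) \<le> (SUP x\<in>Collect P. case x of (A', p') => ereal (mcf_F A' p'))"
  using s(1) by (intro SUP_upper2[of "(H, (c + s) *\<^sub>R nu)"]) auto
qed

lemma mcf_condition_gradient_free:
 assumes "mcf_condition a p X" shows "gradient_free_condition 1 a p X"
 unfolding gradient_free_condition_def
proof
 assume psd: "\<forall>b. 0 \<le> quad X b"
 have "0 \<le> ereal a + mcf_F_upper X p" using assms by (simp add: mcf_condition_def)
 also have "mcf_F_upper X p \<le> ereal (trace X)"
  using psd by (intro mcf_F_upper_le) (auto simp: mcf_F_def quad_def)
 finally show "0 \<le> a + 1 * trace X" by (simp add: add_left_mono)
qed

lemma mcf_condition_regular:
 assumes "mcf_condition a p X" shows "regular_condition 1 a p X"
 unfolding regular_condition_def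
proof
 assume "p \<noteq> 0"
 have "0 \<le> ereal a + mcf_F_upper X p" using assms by (simp add: mcf_condition_def)
 also have "mcf_F_upper X p \<le> ereal (mcf_F X p)" by (rule mcf_F_upper_regular) fact
 finally show "0 \<le> a + 1 * mcf_F X p" by (simp add: add_left_mono)
qed

text \<open>The Hessian of the barrier is a multiple of the identity, so its gradient does not matter.\<close>

lemma mcf_supersolution_linear_bound:
 fixes u :: "(real^'m) \<times> real => real"
 assumes u: "mcf_supersolution u" and growth: "!!S. \<exists>c. \<forall>x. \<forall>t\<in>{- S..0}. \<bar>u (x, t)\<bar> \<le> c * (1 + norm x)"
  and init: "!!x. p \<bullet> x \<le> u (x, 0)" and t: "t1 \<le> 0"
 shows "p \<bullet> x1 \<le> u (x1, t1)"
proof (rule field_le_epsilon)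
 fix e :: real assume e: "e > 0"
 \<comment> \<open>The Hessian \<open>mat (2 * be)\<close> has curvature term at most
   \<open>2 * be * (CARD('m) - 1)\<close>, so this slope in time makes the barrier strict with
   margin \<open>2 * be\<close>.\<close>
 define k0 where "k0 = 2 * CARD('m)"
 define W where "W = (norm x1)^2 + k0 * (- t1) + 1"
 have W: "W > 0" using t unfolding W_def by (intro add_nonneg_pos add_nonneg_nonneg) (auto simp: mult_nonneg_nonpos)
 define be where "be = e / W"
 have be: "be > 0" "be * W = e" using W e by (auto simp: be_def)
 define S where "S = 1 - t1"
 have S: "S > 0" "- S < t1" using t by (auto simp: S_def)
 define D where "D z = - u z + (p \<bullet> fst z - be * (norm (fst z))^2 + be * k0 * snd z)" for z
 have u': "usc_on (UNIV \<times> {..0}) (\<lambda>z. - u z)" and touched: "touched_above mcf_condition (\<lambda>z. - u z)"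
  using u unfolding mcf_supersolution_iff mcf_subsolution_iff by auto
 have usc: "usc_on (UNIV \<times> {..0}) D" unfolding D_def by (intro usc_on_add_continuous[OF u'] continuous_intros)
 show "p \<bullet> x1 \<le> u (x1, t1) + e"
 proof (rule ccontr)
  assume n: "\<not> p \<bullet> x1 \<le> u (x1, t1) + e"
  have "be * (norm x1)^2 - be * k0 * t1 \<le> e" using be unfolding W_def by (simp add: algebra_simps)
  with n have pos: "0 < D (x1, t1)" by (simp add: D_def)
  have bd: "D (x, 0) \<le> 0" for x
  proof -
   have "0 \<le> be * (norm x)^2" using be(1) by simp
   thus ?thesis using init[of x] by (simp add: D_def)
  qed
  obtain c where c: "!!x t. - S \<le> t ==> t \<le> 0 ==> \<bar>u (x, t)\<bar> \<le> c * (1 + norm x)" using growth[of S] by (metis atLeastAtMost_iff)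
  obtain rh where rh: "!!y. rh < y ==> (c + norm p) * y + c \<le> be * y^2" by (rule quadratic_dominates_linear[OF be(1)]) blast
  have out: "D (x, t) \<le> 0" if "rh < norm x" "- S \<le> t" "t \<le> 0" for x t
  proof -
   have "be * k0 * t \<le> 0" using be that by (simp add: mult_nonneg_nonpos k0_def)
   thus ?thesis using c[OF that(2,3), of x] rh[OF that(1)] norm_cauchy_schwarz[of p x]
    unfolding D_def by (simp add: algebra_simps abs_le_iff)
  qed
  obtain dl x0 t0 where z0: "0 < dl" "- S < t0" "t0 < 0"
   "\<forall>\<^sub>F z in nhds (x0, t0). D z - dl / (snd z + S) \<le> D (x0, t0) - dl / (t0 + S)"
   by (rule interior_maximum[OF usc pos t S(2) bd out])
  have N: "open ((UNIV :: (real^'m) set) \<times> {- S<..<0})" "(x0, t0) \<in> UNIV \<times> {- S<..<0}" using z0 by (auto intro!: open_Times)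
  note T = test_function_add[OF test_function_isotropic[of _ "- p" be] test_function_penalty_time[OF S(1), of "- (be * k0)" dl]]
  have "\<forall>\<^sub>F z in nhds (x0, t0). - u z - ((- p \<bullet> fst z + be * (norm (fst z))^2) + (- (be * k0) * snd z + dl / (snd z + S)))
    \<le> - u (x0, t0) - ((- p \<bullet> fst (x0, t0) + be * (norm (fst (x0, t0)))^2) + (- (be * k0) * snd (x0, t0) + dl / (snd (x0, t0) + S)))"
   using z0(4) by eventually_elim (simp add: D_def algebra_simps)
  note touched_aboveD[OF touched N z0(3) T this, unfolded mcf_condition_def]
  also have "mcf_F_upper (mat (2 * be) + 0) ((- p + (2 * be) *\<^sub>R fst (x0, t0)) + 0) \<le> ereal (2 * be * (real CARD('m) - 1))"
  proof (rule mcf_F_upper_le)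
   fix q :: "real^'m" assume "q \<noteq> 0"
   thus "mcf_F (mat (2 * be) + 0) q \<le> 2 * be * (real CARD('m) - 1)"
    unfolding mcf_F_def by (simp add: trace_mat mat_vec power2_norm_eq_inner[symmetric] algebra_simps)
  qed
  finally have "0 \<le> - (be * k0) - dl / (t0 + S)^2 + 2 * be * (real CARD('m) - 1)" by (simp add: add_left_mono)
  moreover have "0 < dl / (t0 + S)^2" using z0 by simp
  moreover have "- (be * k0) + 2 * be * (real CARD('m) - 1) = - 2 * be" by (simp add: k0_def algebra_simps)
  ultimately show False using be(1) by linarith
 qed
qed

section \<open>Limits of the game schemes\<close>

text \<open>Each new sign is taken against the cross term with the partial sum, so only diagonal
  terms accumulate, whatever the signature of \<open>H\<close>.\<close>

lemma sign_choice:
 fixes H :: "real^'m^'m" and a :: "'j => real^'m"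
 assumes sym: "transpose H = H" and fin: "finite S"
 shows "\<exists>s. (\<forall>j. s j \<in> {-1, 1}) \<and> quad H (\<Sum>j\<in>S. s j *\<^sub>R a j) \<le> (\<Sum>j\<in>S. quad H (a j))"
 using fin
proof induction
 case empty
 thus ?case by (intro exI[of _ "\<lambda>_. 1"]) (simp add: quad_def)
next
 case (insert i S)
 then obtain s where s: "!!j. s j \<in> {-1, 1}" "quad H (\<Sum>j\<in>S. s j *\<^sub>R a j) \<le> (\<Sum>j\<in>S. quad H (a j))" by blast
 define x where "x = (\<Sum>j\<in>S. s j *\<^sub>R a j)"
 define sg where "sg = (if (H *v x) \<bullet> a i \<le> 0 then 1 else - 1 :: real)"
 have sg: "sg * ((H *v x) \<bullet> a i) \<le> 0" "sg^2 = 1" "sg \<in> {-1, 1}" by (auto simp: sg_def)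
 have sym': "(H *v a i) \<bullet> x = (H *v x) \<bullet> a i"
  using transpose_vec_inner[of H "a i" x] unfolding sym by (simp add: inner_commute)
 have "(\<Sum>j\<in>insert i S. (s(i := sg)) j *\<^sub>R a j) = sg *\<^sub>R a i + x"
  using insert.hyps unfolding x_def by (simp cong: sum.cong) (intro sum.cong refl, auto)
 moreover have "quad H (sg *\<^sub>R a i + x) = quad H x + 2 * (sg * ((H *v x) \<bullet> a i)) + sg^2 * quad H (a i)"
  using sym' by (simp add: quad_def matrix_vector_right_distrib matrix_vector_mult_scaleR inner_add_left inner_add_right power2_eq_square distrib_left)
 ultimately have "quad H (\<Sum>j\<in>insert i S. (s(i := sg)) j *\<^sub>R a j) \<le> (\<Sum>j\<in>insert i S. quad H (a j))"
  using s(2) sg(1,2) insert.hyps unfolding x_def[symmetric] by simp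
 thus ?case using s(1) sg(3) by (intro exI[of _ "s(i := sg)"]) auto
qed

lemma matrix_vector_columns: "A *v e = (\<Sum>j\<in>UNIV. e $ j *\<^sub>R column j (A :: real^'n^'m))"
 by (simp add: matrix_mult_sum scalar_mult_eq_scaleR)

lemma sign_le_columns:
 fixes H :: "real^'m^'m" and A :: "real^'n^'m"
 assumes "transpose H = H"
 obtains e where "e \<in> sign_vectors" "quad H (A *v e) \<le> (\<Sum>j\<in>UNIV. quad H (column j A))"
proof -
 obtain s where s: "!!j :: 'n. s j \<in> {-1, 1}" "quad H (\<Sum>j\<in>UNIV. s j *\<^sub>R column j A) \<le> (\<Sum>j\<in>UNIV. quad H (column j A))"
  using sign_choice[OF assms, of "UNIV :: 'n set" "\<lambda>j. column j A"] by auto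
 thus thesis by (intro that[of "\<chi> j. s j"]) (auto simp: sign_vectors_def matrix_vector_columns)
qed

lemma columns_quad_sum:
 "(\<Sum>j\<in>UNIV. quad H (column j A)) = (\<Sum>i\<in>UNIV. \<Sum>k\<in>UNIV. H $ i $ k * (A ** transpose A) $ k $ i)"
 for H :: "real^'m^'m" and A :: "real^'n^'m"
proof -
 have "(\<Sum>j\<in>UNIV. quad H (column j A)) = (\<Sum>j\<in>UNIV. \<Sum>i\<in>UNIV. \<Sum>k\<in>UNIV. H $ i $ k * (A $ k $ j * A $ i $ j))"
  by (simp add: quad_def inner_vec_def matrix_vector_mult_def column_def sum_distrib_right mult.assoc)
 also have "\<dots> = (\<Sum>i\<in>UNIV. \<Sum>j\<in>UNIV. \<Sum>k\<in>UNIV. H $ i $ k * (A $ k $ j * A $ i $ j))" by (rule sum.swap)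
 also have "\<dots> = (\<Sum>i\<in>UNIV. \<Sum>k\<in>UNIV. \<Sum>j\<in>UNIV. H $ i $ k * (A $ k $ j * A $ i $ j))" by (intro sum.cong refl sum.swap)
 finally show ?thesis by (simp add: matrix_matrix_mult_def transpose_def sum_distrib_left)
qed

lemma tangential_columns:
 fixes A H :: "real^'m^'m"
 assumes A: "A ** transpose A = 2 *\<^sub>R (mat 1 - outer nu)" and nu: "norm nu = 1"
 shows "(\<Sum>j\<in>UNIV. quad H (column j A)) = 2 * mcf_F H nu"
proof -
 have "(\<Sum>k\<in>UNIV. H $ i $ k * (2 *\<^sub>R (mat 1 - outer nu)) $ k $ i) = 2 * H $ i $ i - 2 * (H *v nu) $ i * nu $ i" for i
 proof -
  have "(\<Sum>k\<in>UNIV. H $ i $ k * (2 *\<^sub>R (mat 1 - outer nu)) $ k $ i) = (\<Sum>k\<in>UNIV. (if k = i then 2 * H $ i $ k else 0) - 2 * (H $ i $ k * nu $ k * nu $ i))"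
   by (intro sum.cong refl) (simp add: mat_def outer_def algebra_simps)
  thus ?thesis by (simp add: sum_subtractf matrix_vector_mult_def sum_distrib_left sum_distrib_right mult.assoc)
 qed
 thus ?thesis unfolding columns_quad_sum A
  using nu by (simp add: sum_subtractf mcf_F_def trace_def inner_vec_def sum_distrib_left right_diff_distrib mult.assoc)
qed

lemma tangential_kernel:
 assumes A: "A ** transpose A = 2 *\<^sub>R (mat 1 - outer nu)" and g: "transpose A *v g = (0 :: real^'m)"
 shows "g = (nu \<bullet> g) *\<^sub>R nu"
proof -
 have "(A ** transpose A) *v g = A *v (transpose A *v g)" by (simp only: matrix_vector_mul_assoc)
 also have "\<dots> = 0" unfolding g by simp
 finally have "2 *\<^sub>R (g - (nu \<bullet> g) *\<^sub>R nu) = 0"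
  unfolding A scaleR_matrix_vector_assoc[symmetric] matrix_vector_mult_diff_rdistrib outer_mult_vec matrix_vector_mul_lid .
 thus ?thesis by simp
qed

text \<open>The vectors of \<open>B\<close> become distinct columns and the other columns are zero.
  Applied to a frame of a hyperplane, the cardinality bound is where the condition
  \<open>n >= m - 1\<close> enters.\<close>

lemma frame_matrix:
 fixes B :: "(real^'m) set"
 assumes fin: "finite B" and card: "card B \<le> CARD('n::finite)"
 obtains A :: "real^'n^'m" and h where "!!e. A *v e = (\<Sum>b\<in>B. e $ h b *\<^sub>R b)"
  "!!j. column j A = 0 \<or> column j A \<in> B" "!!b. b \<in> B ==> column (h b) A = b"
proof -
 obtain h :: "real^'m => 'n" where h: "inj_on h B" using card_le_inj[OF fin finite_class.finite_UNIV card] by auto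
 define a where "a j = (if j \<in> h ` B then inv_into B h j else 0)" for j
 define A :: "real^'n^'m" where "A = (\<chi> i j. a j $ i)"
 have col: "column j A = a j" for j by (simp add: column_def A_def vec_eq_iff)
 have ah: "a (h b) = b" if "b \<in> B" for b using that h by (simp add: a_def inv_into_f_f)
 show thesis
 proof (rule that[of A h])
  show "A *v e = (\<Sum>b\<in>B. e $ h b *\<^sub>R b)" for e
  proof -
   have "A *v e = (\<Sum>j\<in>h ` B. e $ j *\<^sub>R a j)"
    unfolding matrix_vector_columns col by (rule sum.mono_neutral_right) (auto simp: a_def)
   also have "\<dots> = (\<Sum>b\<in>B. e $ h b *\<^sub>R b)" unfolding sum.reindex[OF h] by (intro sum.cong refl) (simp add: ah)
   finally show ?thesis .
  qed
  show "column j A = 0 \<or> column j A \<in> B" for j unfolding col by (auto simp: a_def inv_into_into)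
  show "column (h b) A = b" if "b \<in> B" for b using ah[OF that] by (simp add: col)
 qed
qed

lemma transpose_mult_column: "(transpose A *v x) $ j = column j A \<bullet> (x :: real^'m)"
 for A :: "real^'n^'m"
 by (simp add: matrix_vector_mult_def transpose_def column_def inner_vec_def del: transpose_matrix_vector)

lemma tangential_frame_matrix:
 fixes H :: "real^'m^'m"
 assumes sym: "transpose H = H" and d: "norm d = 1" and n: "CARD('m) - 1 \<le> CARD('n::finite)"
 obtains A :: "real^'n^'m" where "A \<in> short_column_matrices" "transpose A *v d = 0"
  "A ** transpose A = mat 1 - outer d" "!!e. e \<in> sign_vectors ==> quad H (A *v e) = mcf_F H d"
proof -
 obtain B where B: "orthonormal B" "card B = CARD('m) - 1" "\<forall>b\<in>B. orthogonal d b" "d \<notin> B" "span (insert d B) = UNIV"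
  "\<forall>s. (\<forall>b\<in>B. s b \<in> {-1, 1}) --> quad H (\<Sum>b\<in>B. s b *\<^sub>R b) = trace H - quad H d"
  using tangential_frame[OF sym d] .
 have fin: "finite B" by (rule orthonormal_finite[OF B(1)])
 obtain A :: "real^'n^'m" and h where A: "!!e. A *v e = (\<Sum>b\<in>B. e $ h b *\<^sub>R b)"
  "!!j. column j A = 0 \<or> column j A \<in> B" "!!b. b \<in> B ==> column (h b) A = b"
  by (rule frame_matrix[OF fin, where 'n = 'n]) (use B(2) n in auto)
 show thesis
 proof (rule that[of A])
  have "norm (column j A) \<le> 1" for j using A(2)[of j] B(1) by (auto simp: orthonormal_def)
  thus "A \<in> short_column_matrices" by (simp add: short_column_matrices_def)
  show "transpose A *v d = 0"
   unfolding vec_eq_iff transpose_mult_column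
  proof
   fix j
   show "column j A \<bullet> d = 0 $ j" using A(2)[of j] B(3) by (auto simp: orthogonal_def inner_commute)
  qed
  have od: "orthonormal (insert d B)" using B(1,3) d by (intro orthonormal_insert) auto
  show "A ** transpose A = mat 1 - outer d"
   unfolding matrix_eq
  proof
   fix x
   have "(A ** transpose A) *v x = A *v (transpose A *v x)" by (simp only: matrix_vector_mul_assoc)
   also have "\<dots> = (\<Sum>b\<in>B. (x \<bullet> b) *\<^sub>R b)"
    unfolding A(1) transpose_mult_column using A(3) by (intro sum.cong refl) (simp add: inner_commute)
   also have "\<dots> = x - (x \<bullet> d) *\<^sub>R d"
    using orthonormal_expand[OF od, of x] B(4,5) fin by (simp add: algebra_simps)
   finally show "(A ** transpose A) *v x = (mat 1 - outer d) *v x"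
    unfolding matrix_vector_mult_diff_rdistrib outer_mult_vec matrix_vector_mul_lid by (simp add: inner_commute)
  qed
  fix e :: "real^'n" assume "e \<in> sign_vectors"
  thus "quad H (A *v e) = mcf_F H d"
   unfolding A(1) using d by (subst B(6)[rule_format]) (auto simp: sign_vectors_def mcf_F_def quad_def)
 qed
qed

lemma usc_lsc_continuous:
 assumes "continuous_on UNIV u"
 shows "usc_on T u" "lsc_on T u"
proof -
 have lim: "(u \<longlongrightarrow> u x) (at x within T)" for x
  by (rule tendsto_within_subset[OF _ subset_UNIV]) (use assms in \<open>simp add: continuous_on_def\<close>)
 show "usc_on T u" unfolding usc_on_def using order_tendstoD(2)[OF lim] by blast
 show "lsc_on T u" unfolding lsc_on_def using order_tendstoD(1)[OF lim] by blast
qed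

lemma modulus_growth:
 assumes "!!x t y s. \<bar>u (x :: real^'m, t) - u (y, s)\<bar> \<le> a * norm (x - y) + b * sqrt \<bar>t - s\<bar>" "u (0, 0) = 0" "0 \<le> a" "0 \<le> b"
 shows "\<exists>c. \<forall>x. \<forall>t\<in>{- S..0}. \<bar>u (x, t)\<bar> \<le> c * (1 + norm x)"
proof (intro exI allI ballI)
 fix x :: "real^'m" and t assume t: "t \<in> {- S..0}"
 have "\<bar>u (x, t)\<bar> \<le> a * norm x + b * sqrt \<bar>t\<bar>" using assms(1)[of x t 0 0] assms(2) by simp
 also have "\<dots> \<le> a * (1 + norm x) + b * sqrt S * (1 + norm x)"
 proof (rule add_mono)
  have "sqrt \<bar>t\<bar> \<le> sqrt S * 1" using t by simp
  also have "\<dots> \<le> sqrt S * (1 + norm x)" using t by (intro mult_left_mono) auto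
  finally show "b * sqrt \<bar>t\<bar> \<le> b * sqrt S * (1 + norm x)" using assms(4) by (simp add: mult.assoc mult_left_mono)
 qed (use assms(3) in \<open>intro mult_left_mono; simp\<close>)
 finally show "\<bar>u (x, t)\<bar> \<le> (a + b * sqrt S) * (1 + norm x)" by (simp add: distrib_right)
qed

text \<open>The best signs do no worse than the sum over the columns, which is
  \<open>2 * mcf_F X nu\<close>. Tangency makes \<open>p\<close> a multiple of \<open>nu\<close>, so
  \<open>nu\<close> is a direction seen by the upper envelope, even at \<open>p = 0\<close>.\<close>

lemma sub_condition_mcf:
 assumes sym: "transpose X = (X :: real^'m^'m)" and *: "sub_condition (tangential_matrices :: (real^'m^'m) set) a p X"
 shows "mcf_condition a p X"
proof -
 obtain A where A: "A \<in> tangential_matrices" "transpose A *v p = 0"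
  "!!e. e \<in> sign_vectors ==> 0 \<le> a + quad X (A *v e) / 2"
  using * unfolding sub_condition_def by blast
 obtain nu where nu: "norm nu = 1" "A ** transpose A = 2 *\<^sub>R (mat 1 - outer nu)" using A(1) by (auto simp: tangential_matrices_def)
 obtain e where e: "e \<in> sign_vectors" "quad X (A *v e) \<le> (\<Sum>j\<in>UNIV. quad X (column j A))"
  using sign_le_columns[OF sym] by blast
 have "0 \<le> ereal a + ereal (mcf_F X nu)"
  using A(3)[OF e(1)] e(2) unfolding tangential_columns[OF nu(2,1)] by simp
 also have "\<dots> \<le> ereal a + mcf_F_upper X p"
  by (rule add_left_mono[OF mcf_F_upper_direction[OF sym nu(1) tangential_kernel[OF nu(2) A(2)]]])
 finally show ?thesis unfolding mcf_condition_def .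
qed

text \<open>The maximizing player uses the diagonalizing frame of the complement of
  \<open>d\<close>, scaled by \<open>sqrt 2\<close> to be admissible; every reply then yields
  exactly \<open>mcf_F X d\<close>.\<close>

lemma super_condition_mcf:
 assumes sym: "transpose X = (X :: real^'m^'m)" and *: "super_condition (tangential_matrices :: (real^'m^'m) set) a p X"
 shows "mcf_condition a p X"
proof -
 obtain d where d: "norm d = 1" "p = norm p *\<^sub>R d"
  "!!A. A \<in> tangential_matrices ==> transpose A *v d = 0 ==> \<exists>e\<in>sign_vectors. 0 \<le> a + quad X (A *v e) / 2"
  using * unfolding super_condition_def by blast
 obtain A :: "real^'m^'m" where A: "transpose A *v d = 0" "A ** transpose A = mat 1 - outer d"
  "!!e. e \<in> sign_vectors ==> quad X (A *v e) = mcf_F X d"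
  using tangential_frame_matrix[OF sym d(1), where 'n = 'm] by (metis diff_le_self)
 have t: "transpose (sqrt 2 *\<^sub>R A) = sqrt 2 *\<^sub>R transpose A" by (simp add: transpose_def vec_eq_iff)
 have "(sqrt 2 *\<^sub>R A) ** transpose (sqrt 2 *\<^sub>R A) = 2 *\<^sub>R (A ** transpose A)"
  unfolding t matrix_eq matrix_vector_mul_assoc[symmetric] scaleR_matrix_vector_assoc[symmetric]
  by (simp add: matrix_vector_mult_scaleR del: transpose_matrix_vector)
 hence "sqrt 2 *\<^sub>R A \<in> tangential_matrices" using d(1) A(2) by (auto simp: tangential_matrices_def)
 moreover have "transpose (sqrt 2 *\<^sub>R A) *v d = 0" unfolding t scaleR_matrix_vector_assoc[symmetric] A(1) by simp
 ultimately obtain e where e: "e \<in> sign_vectors" "0 \<le> a + quad X ((sqrt 2 *\<^sub>R A) *v e) / 2" using d(3) by blast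
 have "quad X ((sqrt 2 *\<^sub>R A) *v e) = 2 * quad X (A *v e)"
  unfolding scaleR_matrix_vector_assoc[symmetric] quad_scale by simp
 hence "0 \<le> ereal a + ereal (mcf_F X d)" using e A(3) by simp
 also have "\<dots> \<le> ereal a + mcf_F_upper X p" by (rule add_left_mono[OF mcf_F_upper_direction[OF sym d(1,2)]])
 finally show ?thesis unfolding mcf_condition_def .
qed

text \<open>The greedy signs of \<open>sign_choice\<close> would only give the sum of the form over
  all columns, which grows with their number. The Gram-Schmidt walk gives the trace however many
  columns there are.\<close>

lemma sub_condition_gradient_free:
 assumes sym: "transpose X = X" and *: "sub_condition (short_column_matrices :: (real^'n^'m) set) a p X"
 shows "gradient_free_condition (1 / 2) a p X"
 unfolding gradient_free_condition_def
proof
 assume psd: "\<forall>b. 0 \<le> quad X b"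
 obtain A :: "real^'n^'m" where Ae: "A \<in> short_column_matrices" "!!e. e \<in> sign_vectors ==> 0 \<le> a + quad X (A *v e) / 2"
  using * unfolding sub_condition_def by blast
 interpret short_columns X A by unfold_locales (use psd Ae(1) sym in auto)
 obtain e :: "real^'n" where "e \<in> sign_vectors" "quad X (A *v e) \<le> trace X" using balanced_signs by blast
 thus "0 \<le> a + 1 / 2 * trace X" using Ae(2)[of e] by simp
qed

lemma super_condition_regular:
 assumes sym: "transpose X = (X :: real^'m^'m)" and *: "super_condition (short_column_matrices :: (real^'n^'m) set) a p X"
  and n: "CARD('m) - 1 \<le> CARD('n)"
 shows "regular_condition (1 / 2) a p X"
 unfolding regular_condition_def
proof
 assume p: "p \<noteq> 0"
 obtain d where d: "norm d = 1" "p = norm p *\<^sub>R d"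
  "!!A :: real^'n^'m. A \<in> short_column_matrices ==> transpose A *v d = 0 ==> \<exists>e\<in>sign_vectors. 0 \<le> a + quad X (A *v e) / 2"
  using * unfolding super_condition_def by blast
 obtain A :: "real^'n^'m" where A: "A \<in> short_column_matrices" "transpose A *v d = 0"
  "!!e. e \<in> sign_vectors ==> quad X (A *v e) = mcf_F X d"
  using tangential_frame_matrix[OF sym d(1) n] by metis
 have "mcf_F X p = mcf_F X d" using p mcf_F_scale[of "norm p" 1 X d, folded d(2)] by simp
 thus "0 \<le> a + 1 / 2 * mcf_F X p" using d(3)[OF A(1,2)] A(3) by auto
qed

lemma (in game_scheme) steps_ge_payoff:
 assumes "0 \<in> AA" shows "f x \<le> (game_step AA ^^ k) f x"
proof (induction k arbitrary: x)
 case (Suc k)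
 obtain e :: "real^'n" where "(game_step AA ^^ k) f (x + 0 *v e) \<le> game_step AA ((game_step AA ^^ k) f) x"
  using step_ge[OF steps_lip[OF lip_f] assms, of k x] by blast
 thus ?case using Suc.IH[of x] by simp
qed simp

context convex_body begin

lemma norm_0: "body_norm E 0 = 0" using norm_scale[of 0 0] by simp

lemma level_set_solution_exists: "\<exists>u. mcf_level_set_solution E u"
proof -
 have r': "0 < 1 / r" using r by simp
 obtain R' where "game_scheme (tangential_matrices :: (real^'m^'m) set) (body_norm E) (1 / r) R'"
  using tangential_matrices_scheme[OF norm_lipschitz r' norm_scale] .
 then interpret G: game_scheme "tangential_matrices :: (real^'m^'m) set" "body_norm E" "1 / r" R' .
 have low: "(1 / R) * norm x \<le> body_norm E x" for x using norm_lower[of x] by simp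
 obtain u where u: "!!x t y s. \<bar>u (x, t) - u (y, s)\<bar> \<le> (1 / r) * norm (x - y) + (1 / r) * R' * sqrt \<bar>t - s\<bar>"
  "!!x t. 0 \<le> t ==> u (x, t) = body_norm E x" "touched_above (sub_condition tangential_matrices) u" "touched_above (super_condition tangential_matrices) (\<lambda>z. - u z)"
  using G.scheme_converges[OF _ low] R(1) by (metis divide_pos_pos zero_less_one)
 have cont: "continuous_on UNIV u" by (rule modulus_continuous[OF u(1)])
 have "\<exists>c. \<forall>x. \<forall>t\<in>{- S..0}. \<bar>u (x, t)\<bar> \<le> c * (1 + norm x)" for S
  using r' G.R_pos by (intro modulus_growth[OF u(1)]) (auto simp: u(2) norm_0)
 moreover have "touched_above mcf_condition u" by (rule touched_above_mono[OF u(3)]) (rule sub_condition_mcf)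
 hence "mcf_subsolution u" unfolding mcf_subsolution_iff using usc_lsc_continuous(1)[OF cont] by blast
 moreover have "touched_above mcf_condition (\<lambda>z. - u z)" by (rule touched_above_mono[OF u(4)]) (rule super_condition_mcf)
 hence "mcf_supersolution u"
  unfolding mcf_supersolution_iff mcf_subsolution_iff usc_on_minus_iff using usc_lsc_continuous(2)[OF cont] by blast
 ultimately have "mcf_level_set_solution E u" unfolding mcf_level_set_solution_def using u(2)[of 0] by simp
 thus ?thesis by blast
qed

lemma game_limit:
 assumes n: "CARD('m) - 1 \<le> CARD('n::finite)"
 obtains u where "(\<lambda>T. game_K TYPE('n) T E / sqrt (real T)) \<longlonglongrightarrow> u (0, - 1)" "continuous_on UNIV u"
  "!!S. \<exists>c. \<forall>x. \<forall>t\<in>{- S..0}. \<bar>u (x, t)\<bar> \<le> c * (1 + norm x)" "!!x. u (x, 0) = body_norm E x"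
  "!!x t. body_norm E x \<le> u (x, t)" "touched_above (gradient_free_condition (1 / 2)) u" "touched_above (regular_condition (1 / 2)) (\<lambda>z. - u z)"
proof -
 have r': "0 < 1 / r" using r by simp
 obtain R' where "game_scheme (short_column_matrices :: (real^'n^'m) set) (body_norm E) (1 / r) R'"
  using short_column_matrices_scheme[OF norm_lipschitz r' norm_scale] .
 then interpret G: game_scheme "short_column_matrices :: (real^'n^'m) set" "body_norm E" "1 / r" R' .
 have low: "(1 / R) * norm x \<le> body_norm E x" for x using norm_lower[of x] by simp
 obtain u where u: "!!z. (\<lambda>n. G.V n z) \<longlonglongrightarrow> u z"
  "!!x t y s. \<bar>u (x, t) - u (y, s)\<bar> \<le> (1 / r) * norm (x - y) + (1 / r) * R' * sqrt \<bar>t - s\<bar>"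
  "!!x t. 0 \<le> t ==> u (x, t) = body_norm E x" "touched_above (sub_condition (short_column_matrices :: (real^'n^'m) set)) u"
  "touched_above (super_condition (short_column_matrices :: (real^'n^'m) set)) (\<lambda>z. - u z)"
  using G.scheme_converges[OF _ low] R(1) by (metis divide_pos_pos zero_less_one)
 show thesis
 proof (rule that[of u])
  \<comment> \<open>At time \<open>- 1\<close> there are \<open>Suc k\<close> rounds left and the
    origin is fixed by the rescaling, so \<open>V\<close> is the normalized game value.\<close>
  have "G.V k (0, - 1) = game_K TYPE('n) (Suc k) E / sqrt (real (Suc k))" for k
   by (simp add: G.V_def game_K_def game_value_eq_steps del: of_nat_Suc funpow.simps game_value.simps)
  hence "(\<lambda>k. game_K TYPE('n) (Suc k) E / sqrt (real (Suc k))) \<longlonglongrightarrow> u (0, - 1)" using u(1)[of "(0, - 1)"] by simp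
  thus "(\<lambda>T. game_K TYPE('n) T E / sqrt (real T)) \<longlonglongrightarrow> u (0, - 1)" by (rule LIMSEQ_imp_Suc)
  show "continuous_on UNIV u" by (rule modulus_continuous[OF u(2)])
  show "\<exists>c. \<forall>x. \<forall>t\<in>{- S..0}. \<bar>u (x, t)\<bar> \<le> c * (1 + norm x)" for S
   using r' G.R_pos by (intro modulus_growth[OF u(2)]) (auto simp: u(3) norm_0)
  show "u (x, 0) = body_norm E x" for x by (simp add: u(3))
  have z: "(0 :: real^'n^'m) \<in> short_column_matrices"
   by (simp add: short_column_matrices_def column_def vec_eq_iff norm_eq_zero zero_vec_def[symmetric])
  have "body_norm E x \<le> G.V n (x, t)" for n x t
  proof -
   have s: "0 < sqrt (real (Suc n))" by simp
   have "sqrt (real (Suc n)) * body_norm E x = body_norm E (sqrt (real (Suc n)) *\<^sub>R x)" by (simp add: norm_scale)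
   also have "\<dots> \<le> (game_step (short_column_matrices :: (real^'n^'m) set) ^^ nat \<lfloor>- t * real (Suc n)\<rfloor>) (body_norm E) (sqrt (real (Suc n)) *\<^sub>R x)"
    by (rule G.steps_ge_payoff[OF z])
   finally show ?thesis unfolding G.V_def prod.case using s by (simp only: pos_le_divide_eq mult.commute)
  qed
  thus "body_norm E x \<le> u (x, t)" for x t by (intro LIMSEQ_le_const[OF u(1)]) auto
  show "touched_above (gradient_free_condition (1 / 2)) u" by (rule touched_above_mono[OF u(4)]) (rule sub_condition_gradient_free)
  show "touched_above (regular_condition (1 / 2)) (\<lambda>z. - u z)" by (rule touched_above_mono[OF u(5)]) (rule super_condition_regular[OF _ _ n])
 qed
qed

end

section \<open>The bounds\<close>

lemma gaussian_integral:
 fixes h :: "real^'m => real"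
 assumes "std_gaussian_vector M G" "h \<in> borel_measurable borel"
 shows "(\<integral>\<omega>. h (G \<omega>) \<partial>M) = (\<integral>v. h v * gauss v \<partial>lborel)"
proof -
 have "distributed M lborel G (\<lambda>x. ennreal (gauss x))" using assms(1) by (simp add: std_gaussian_vector_def gauss_def)
 from distributed_integral[OF this, of h] assms(2) show ?thesis
  by (simp add: mult.commute order_less_imp_le[OF gauss_pos])
qed

text \<open>A bound for the flow must hold at every \<open>x\<close>, but the largest coordinate
  alone gives little where all coordinates are very negative. The bounds for both values of
  \<open>sg\<close> are added, and convexity compares the points \<open>x\<close> and
  \<open>- x\<close> with the origin.\<close>

lemma heat_reflection_bound:
 fixes x :: "real^'m"
 assumes "t \<le> 0" "0 < th"
 shows "2 * (sqrt (- (2 * th * t)) * homogeneous_lipschitz.avg (coord_max 1) (0 :: real^'m))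
  \<le> homogeneous_lipschitz.heat (coord_max 1) th (x, t) + homogeneous_lipschitz.heat (coord_max (- 1)) th (x, t)"
proof -
 interpret P: largest_coordinate 1 "TYPE('m)" by unfold_locales simp
 interpret N: largest_coordinate "- 1" "TYPE('m)" by unfold_locales simp
 define s where "s = sqrt (- (2 * th * t))"
 have "2 * P.heat th (0, t) = (\<integral>v. 2 * (coord_max 1 (0 + s *\<^sub>R (v :: real^'m)) * gauss v) \<partial>lborel)"
  unfolding P.heat_def prod.case s_def by simp
 also have "\<dots> \<le> (\<integral>v. coord_max 1 (x + s *\<^sub>R v) * gauss v + coord_max 1 (- x + s *\<^sub>R v) * gauss v \<partial>lborel)"
 proof (rule integral_mono)
  fix v :: "real^'m"
  have "(1 - 1 / 2) *\<^sub>R (x + s *\<^sub>R v) + (1 / 2) *\<^sub>R (- x + s *\<^sub>R v) = s *\<^sub>R v" by (simp add: vec_eq_iff field_simps)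
  hence "coord_max 1 (s *\<^sub>R v) \<le> (1 - 1 / 2) * coord_max 1 (x + s *\<^sub>R v) + (1 / 2) * coord_max 1 (- x + s *\<^sub>R v)"
   using convex_onD[OF coord_max_convex[of 1], of "1 / 2" "x + s *\<^sub>R v" "- x + s *\<^sub>R v"] by simp
  hence "2 * coord_max 1 (s *\<^sub>R v) \<le> coord_max 1 (x + s *\<^sub>R v) + coord_max 1 (- x + s *\<^sub>R v)" by simp
  from mult_right_mono[OF this order_less_imp_le[OF gauss_pos[of v]]]
  show "2 * (coord_max 1 (0 + s *\<^sub>R v) * gauss v) \<le> coord_max 1 (x + s *\<^sub>R v) * gauss v + coord_max 1 (- x + s *\<^sub>R v) * gauss v"
   by (simp add: distrib_right)
 qed (intro Bochner_Integration.integrable_add integrable_mult_right P.affine_integrable)+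
 also have "\<dots> = P.heat th (x, t) + (\<integral>v. coord_max 1 (- x + s *\<^sub>R v) * gauss v \<partial>lborel)"
  unfolding P.heat_def prod.case s_def[symmetric] by (rule Bochner_Integration.integral_add) (rule P.affine_integrable)+
 also have "(\<integral>v. coord_max 1 (- x + s *\<^sub>R v) * gauss v \<partial>lborel) = N.heat th (x, t)"
  unfolding N.heat_def prod.case s_def[symmetric] using P.reflect[of "- x" s] by simp
 finally show ?thesis unfolding P.heat_center[OF assms(2,1)] .
qed

context convex_body begin

sublocale homogeneous_lipschitz "body_norm E" "1 / r"
 by unfold_locales (use norm_lipschitz norm_scale r in auto)

lemma coordinate_bound: "body_C E * \<bar>x $ i\<bar> \<le> body_norm E x"
 using C_coordinate_le[of x i] C_coordinate_le[of "- x" i] by (cases "0 \<le> x $ i") (auto simp: norm_minus abs_if)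

text \<open>Both bounds hold for an arbitrary level set solution, hence for the one that
  \<open>SOME\<close> selects. The second is uniform in \<open>x\<close>, as emptiness of the flow
  demands.\<close>

theorem level_set_bounds:
 assumes u: "mcf_level_set_solution E u" and t: "t \<le> 0"
 shows "u (x, t) \<le> heat 1 (x, t)"
  "body_C E * (sqrt (- t) * homogeneous_lipschitz.avg (coord_max 1) (0 :: real^'m)) \<le> u (x, t)"
proof -
 have sub: "mcf_subsolution u" and super: "mcf_supersolution u" and init: "!!x. u (x, 0) = body_norm E x"
  and growth: "!!S. \<exists>c. \<forall>x. \<forall>t\<in>{-S..0}. \<bar>u (x, t)\<bar> \<le> c * (1 + norm x)"
  using u unfolding mcf_level_set_solution_def by auto
 show "u (x, t) \<le> heat 1 (x, t)"
 proof (rule heat_upper_bound[OF norm_convex])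
  show "\<exists>c. \<forall>x. \<forall>t\<in>{- S..0}. u (x, t) \<le> c * (1 + norm x)" for S using growth[of S] by (meson abs_le_D1)
  show "touched_above (gradient_free_condition 1) u"
   by (rule touched_above_mono[OF conjunct2[OF sub[unfolded mcf_subsolution_iff]]]) (rule mcf_condition_gradient_free)
 qed (use init sub t in \<open>auto simp: mcf_subsolution_iff\<close>)
 have usc: "usc_on (UNIV \<times> {..0}) (\<lambda>z. - u z)" and "touched_above mcf_condition (\<lambda>z. - u z)"
  using super unfolding mcf_supersolution_iff mcf_subsolution_iff by auto
 from this(2) have reg: "touched_above (regular_condition 1) (\<lambda>z. - u z)" by (rule touched_above_mono) (rule mcf_condition_regular)
 \<comment> \<open>Linear functions of slope \<open>body_C E\<close> along a coordinate axis lie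
   below the norm, and \<open>mcf_supersolution_linear_bound\<close> keeps them below
   \<open>u\<close> at all earlier times.\<close>
 have coercive: "body_C E * \<bar>y $ i\<bar> \<le> u (y, s)" if "s \<le> 0" for y s i
 proof -
  have "(sg * body_C E) *\<^sub>R axis i 1 \<bullet> y \<le> u (y, s)" if "sg \<in> {-1, 1}" for sg
  proof (rule mcf_supersolution_linear_bound[OF super growth _ \<open>s \<le> 0\<close>])
   fix z :: "real^'m"
   have "sg * body_C E * z $ i \<le> body_C E * \<bar>z $ i\<bar>" using that C_pos by (auto simp: mult_left_mono mult_le_cancel_left)
   thus "(sg * body_C E) *\<^sub>R axis i 1 \<bullet> z \<le> u (z, 0)"
    using coordinate_bound[of z i] by (simp add: init inner_axis')
  qed
  from this[of 1] this[of "- 1"] show ?thesis by (cases "0 \<le> y $ i") (auto simp: inner_axis' abs_if)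
 qed
 interpret P: largest_coordinate 1 "TYPE('m)" by unfold_locales simp
 interpret N: largest_coordinate "- 1" "TYPE('m)" by unfold_locales simp
 have "body_C E * P.heat (1 / 2) (x, t) \<le> u (x, t)" "body_C E * N.heat (1 / 2) (x, t) \<le> u (x, t)"
  using P.heat_lower_bound[OF C_pos _ usc coercive reg t]
   N.heat_lower_bound[OF C_pos _ usc coercive reg t] by auto
 moreover have "body_C E * (2 * (sqrt (- (2 * (1 / 2) * t)) * P.avg 0)) \<le> body_C E * (P.heat (1 / 2) (x, t) + N.heat (1 / 2) (x, t))"
  using C_pos by (intro mult_left_mono heat_reflection_bound t) auto
 ultimately show "body_C E * (sqrt (- t) * P.avg 0) \<le> u (x, t)" by (simp add: distrib_left)
qed

text \<open>An existing solution lies between its two bounds, and the lower one is positive at the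
  origin.\<close>

lemma avg_pos: "0 < avg 0" if "2 \<le> CARD('m)"
proof -
 interpret P: largest_coordinate 1 "TYPE('m)" by unfold_locales simp
 obtain u where u: "mcf_level_set_solution E u" using level_set_solution_exists by blast
 have "0 < body_C E * (sqrt (- (- 1)) * P.avg 0)" using C_pos P.avg_0_pos[OF that] by simp
 also have "\<dots> \<le> heat 1 (0, - 1)" using level_set_bounds[OF u, of "- 1" 0] by simp
 finally show ?thesis by (simp add: heat_center zero_less_mult_iff)
qed

theorem extinction_time_bounds:
 assumes "2 \<le> CARD('m)"
 defines "MM \<equiv> homogeneous_lipschitz.avg (coord_max 1) (0 :: real^'m)"
 shows "1 / (avg 0)^2 \<le> 2 * extinction_time E" "2 * extinction_time E \<le> 2 / ((body_C E)^2 * MM^2)"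
proof -
 interpret P: largest_coordinate 1 "TYPE('m)" by unfold_locales simp
 have MM: "MM > 0" unfolding MM_def by (rule P.avg_0_pos[OF assms(1)])
 define u where "u = mcf_level_set_function E"
 have u: "mcf_level_set_solution E u" unfolding u_def mcf_level_set_function_def by (rule someI_ex[OF level_set_solution_exists])
 define X where "X = {t. 0 < t \<and> interior (mcf_flow E t) \<noteq> {}}"
 define l where "l = avg 0"
 have l: "l > 0" unfolding l_def by (rule avg_pos[OF assms(1)])
 \<comment> \<open>Before this time \<open>heat 1 (0, - t) = sqrt (2 * t) * l\<close> is below one,
   so a neighborhood of the origin belongs to the flow.\<close>
 have low: "t \<in> X" if t: "0 < t" "t < 1 / (2 * l^2)" for t
 proof -
  have "heat 1 (0, - t) = sqrt (2 * t) * l" using t by (simp add: heat_center l_def)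
  also have "\<dots> < 1"
  proof -
   have "(sqrt (2 * t) * l)^2 < 1^2" using t l by (simp add: power_mult_distrib field_simps)
   thus ?thesis by (rule power2_less_imp_less) simp
  qed
  finally have h: "heat 1 (0, - t) < 1" .
  have "open {x. heat 1 (x, - t) < 1}"
   by (intro open_Collect_less continuous_on_compose2[OF heat_continuous] continuous_intros) auto
  moreover have "{x. heat 1 (x, - t) < 1} \<subseteq> mcf_flow E t"
   using level_set_bounds(1)[OF u, of "- t"] t unfolding mcf_flow_def u_def[symmetric] by (auto intro: order_trans less_imp_le)
  ultimately have "{x. heat 1 (x, - t) < 1} \<subseteq> interior (mcf_flow E t)" by (rule interior_maximal[rotated])
  thus ?thesis using h t unfolding X_def by blast
 qed
 have up: "t \<le> 1 / ((body_C E)^2 * MM^2)" if "t \<in> X" for t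
 proof (rule ccontr)
  assume "\<not> ?thesis"
  hence big: "1 < t * ((body_C E)^2 * MM^2)" using C_pos MM by (simp add: divide_less_eq not_le)
  have t: "0 < t" using that by (simp add: X_def)
  have "1^2 < (body_C E * (sqrt t * MM))^2" using big t by (simp add: power_mult_distrib mult_ac)
  hence "1 < body_C E * (sqrt t * MM)" using C_pos MM t by (intro power2_less_imp_less[of 1]) auto
  hence "1 < u (x, - t)" for x using level_set_bounds(2)[OF u, of "- t" x] t by (simp add: MM_def)
  hence "mcf_flow E t = {}" unfolding mcf_flow_def u_def[symmetric] by (auto simp: not_le)
  thus False using that by (simp add: X_def)
 qed
 have bdd: "bdd_above X" using up by (rule bdd_aboveI)
 \<comment> \<open>Half of the guaranteed lifetime: a witness that the supremum is taken over a
   nonempty set.\<close>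
 have ne: "1 / (4 * l^2) \<in> X" using l by (intro low) (auto simp: field_simps)
 have ext: "extinction_time E = Sup X" by (simp add: extinction_time_def X_def)
 have "extinction_time E \<le> 1 / ((body_C E)^2 * MM^2)" unfolding ext using ne up by (intro cSup_least) auto
 thus "2 * extinction_time E \<le> 2 / ((body_C E)^2 * MM^2)" by simp
 have "1 / (2 * l^2) \<le> extinction_time E"
 proof (rule dense_le_bounded[of 0])
  fix t assume "0 < t" "t < 1 / (2 * l^2)"
  thus "t \<le> extinction_time E" unfolding ext using low by (intro cSup_upper bdd) auto
 qed (use l in simp)
 thus "1 / (avg 0)^2 \<le> 2 * extinction_time E" unfolding l_def by simp
qed

text \<open>The game has rate \<open>1 / 2\<close>. The upper barrier therefore has unit variance at
  time \<open>- 1\<close>, which gives \<open>avg 0\<close>; the lower one, with rate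
  \<open>1 / 4\<close>, has variance \<open>1 / 2\<close>, which gives the factor
  \<open>1 / sqrt 2\<close>.\<close>

theorem game_bounds:
 assumes n: "CARD('m) - 1 \<le> CARD('n::finite)"
 obtains L where "(\<lambda>T. game_K TYPE('n) T E / sqrt (real T)) \<longlonglongrightarrow> L"
  "1 / sqrt 2 * body_C E * homogeneous_lipschitz.avg (coord_max 1) (0 :: real^'m) \<le> L" "L \<le> avg 0"
proof -
 obtain u where u: "(\<lambda>T. game_K TYPE('n) T E / sqrt (real T)) \<longlonglongrightarrow> u (0, - 1)" "continuous_on UNIV u"
  "!!S. \<exists>c. \<forall>x. \<forall>t\<in>{- S..0}. \<bar>u (x, t)\<bar> \<le> c * (1 + norm x)" "!!x. u (x, 0) = body_norm E x"
  "!!x t. body_norm E x \<le> u (x, t)" "touched_above (gradient_free_condition (1 / 2)) u" "touched_above (regular_condition (1 / 2)) (\<lambda>z. - u z)"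
  by (rule game_limit[OF n]) blast
 interpret P: largest_coordinate 1 "TYPE('m)" by unfold_locales simp
 show thesis
 proof (rule that[OF u(1)])
  have "u (0, - 1) \<le> heat (1 / 2) (0, - 1)"
  proof (rule heat_upper_bound[OF norm_convex _ usc_lsc_continuous(1)[OF u(2)] _ _ u(6)])
   show "\<exists>c. \<forall>x. \<forall>t\<in>{- S..0}. u (x, t) \<le> c * (1 + norm x)" for S using u(3)[of S] by (meson abs_le_D1)
  qed (auto simp: u(4))
  thus "u (0, - 1) \<le> avg 0" by (simp add: heat_center)
  have "body_C E * P.heat (1 / 2 / 2) (0, - 1) \<le> u (0, - 1)"
   by (rule P.heat_lower_bound[OF C_pos _ usc_lsc_continuous(2)[OF u(2), folded usc_on_minus_iff] order_trans[OF coordinate_bound u(5)] u(7)]) auto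
  thus "1 / sqrt 2 * body_C E * P.avg 0 \<le> u (0, - 1)" by (simp add: P.heat_center real_sqrt_divide mult_ac)
 qed
qed

end

theorem theorem2p2:
  fixes E :: "(real ^ 'm) set"
    and M :: "'a measure" and G :: "'a \<Rightarrow> real ^ 'm"
  assumes "CARD('m) \<ge> 2"
    and "CARD('n::finite) \<ge> CARD('m) - 1"
    and "symmetric_convex_body E"
    and "std_gaussian_vector M G"
  shows "1 / (gaussian_ell M G E)\<^sup>2 \<le> 2 * extinction_time E \<and>
         2 * extinction_time E \<le> 2 / ((body_C E)\<^sup>2 * (gaussian_max M G)\<^sup>2) \<and>
         (\<exists>L. (\<lambda>T. game_K TYPE('n) T E / sqrt (real T)) \<longlonglongrightarrow> L \<and>
              1 / sqrt 2 * body_C E * gaussian_max M G \<le> L \<and>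
              L \<le> gaussian_ell M G E)"
proof -
 obtain r R where "convex_body E r R" using convex_body_exists[OF assms(3)] .
 then interpret convex_body E r R .
 interpret P: largest_coordinate 1 "TYPE('m)" by unfold_locales simp
 have l: "gaussian_ell M G E = avg 0"
  unfolding gaussian_ell_def avg_def gaussian_integral[OF assms(4) f_measurable] by simp
 have "gaussian_max M G = (\<integral>\<omega>. coord_max 1 (G \<omega>) \<partial>M)" by (simp add: gaussian_max_def coord_max_def)
 hence m: "gaussian_max M G = P.avg 0"
  unfolding P.avg_def gaussian_integral[OF assms(4) P.f_measurable] by simp
 obtain L where "(\<lambda>T. game_K TYPE('n) T E / sqrt (real T)) \<longlonglongrightarrow> L"
  "1 / sqrt 2 * body_C E * P.avg 0 \<le> L" "L \<le> avg 0" using game_bounds[OF assms(2)] .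
 thus ?thesis unfolding l m using extinction_time_bounds[OF assms(1)] by blast
qed

end
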